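(* Let $p\ge2$ and $0<a<b<\beta_p$. For every $\varepsilon>0$ there exists a constant $K>0$ such that for all $\beta\in[a,b]$ and all $N\ge1$, $$\mathbb E\big\langle 1\{|R_{1,2}|\ge\varepsilon\}\big\rangle_\beta\le K\exp(-N/K).$$
   Context: $\Sigma_N=\{-1,1\}^N$, $(g_{i_1,\dots,i_p})$ i.i.d. standard Gaussians, $H_N(\sigma)=N^{-(p-1)/2}\sum_{1\le i_1,\dots,i_p\le N}g_{i_1,\dots,i_p}\sigma_{i_1}\cdots\sigma_{i_p}$, $F_N(\beta)=\frac1N\log\sum_{\sigma}2^{-N}\exp(\tfrac{\beta}{\sqrt2}H_N(\sigma))$, which converges a.s. to a nonrandom $F(\beta)\le\beta^2/4$. $\mathcal R=\{\beta>0:F(\beta)=\beta^2/4\}$, $\beta_p=\max\mathcal R$. The Gibbs measure is $G_{N,\beta}(\sigma)\propto\exp(\tfrac{\beta}{\sqrt2}H_N(\sigma))$ on $\Sigma_N$; $\langle\cdot\rangle_\beta$ is the average with respect to $G_{N,\beta}^{\otimes2}$ over two independent samples $\sigma^1,\sigma^2$, and $R_{1,2}=\frac1N\sum_{i=1}^N\sigma^1_i\sigma^2_i$ is their overlap. $\mathbb E$ is expectation over the disorder $g$. *)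

theory Defs
  imports "HOL-Probability.Probability"
begin

definition gauss :: "real measure" where
  "gauss = density lborel (\<lambda>x. ennreal (std_normal_density x))"

text \<open>Disorder: one i.i.d. standard Gaussian g xs for every finite index list xs
  (all N are coupled on a common probability space; H_N uses the entries
  g [i_1,...,i_p] with i_k < N).\<close>
definition disorder :: "(nat list \<Rightarrow> real) measure" where
  "disorder = (\<Pi>\<^sub>M xs\<in>(UNIV :: nat list set). gauss)"

definition Sigma :: "nat \<Rightarrow> (nat \<Rightarrow> real) set" where
  "Sigma N = PiE {..<N} (\<lambda>_. {-1, 1})"

definition idx :: "nat \<Rightarrow> nat \<Rightarrow> nat list set" where
  "idx p N = {xs. length xs = p \<and> set xs \<subseteq> {..<N}}"

definition H :: "nat \<Rightarrow> nat \<Rightarrow> (nat list \<Rightarrow> real) \<Rightarrow> (nat \<Rightarrow> real) \<Rightarrow> real" where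
  "H p N g \<sigma> = real N powr (- (real p - 1) / 2) *
      (\<Sum>xs\<in>idx p N. g xs * prod_list (map \<sigma> xs))"

definition weight :: "nat \<Rightarrow> nat \<Rightarrow> real \<Rightarrow> (nat list \<Rightarrow> real) \<Rightarrow> (nat \<Rightarrow> real) \<Rightarrow> real" where
  "weight p N \<beta> g \<sigma> = exp (\<beta> / sqrt 2 * H p N g \<sigma>)"

definition FN :: "nat \<Rightarrow> nat \<Rightarrow> (nat list \<Rightarrow> real) \<Rightarrow> real \<Rightarrow> real" where
  "FN p N g \<beta> = ln (\<Sum>\<sigma>\<in>Sigma N. 2 powr (- real N) * weight p N \<beta> g \<sigma>) / real N"

definition F :: "nat \<Rightarrow> real \<Rightarrow> real" where
  "F p \<beta> = (THE c. AE g in disorder. (\<lambda>N. FN p N g \<beta>) \<longlonglongrightarrow> c)"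

definition replica_sym :: "nat \<Rightarrow> real set" where
  "replica_sym p = {\<beta>. \<beta> > 0 \<and> F p \<beta> = \<beta>\<^sup>2 / 4}"

definition beta_c :: "nat \<Rightarrow> real" where
  "beta_c p = Sup (replica_sym p)"

definition gibbs :: "nat \<Rightarrow> nat \<Rightarrow> real \<Rightarrow> (nat list \<Rightarrow> real) \<Rightarrow> (nat \<Rightarrow> real) \<Rightarrow> real" where
  "gibbs p N \<beta> g \<sigma> = weight p N \<beta> g \<sigma> / (\<Sum>\<tau>\<in>Sigma N. weight p N \<beta> g \<tau>)"

definition overlap :: "nat \<Rightarrow> (nat \<Rightarrow> real) \<Rightarrow> (nat \<Rightarrow> real) \<Rightarrow> real" where
  "overlap N \<sigma>1 \<sigma>2 = (\<Sum>i<N. \<sigma>1 i * \<sigma>2 i) / real N"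

definition overlap_tail :: "nat \<Rightarrow> nat \<Rightarrow> real \<Rightarrow> real \<Rightarrow> (nat list \<Rightarrow> real) \<Rightarrow> real" where
  "overlap_tail p N \<beta> \<epsilon> g = (\<Sum>\<sigma>1\<in>Sigma N. \<Sum>\<sigma>2\<in>Sigma N.
      gibbs p N \<beta> g \<sigma>1 * gibbs p N \<beta> g \<sigma>2 *
      (if \<bar>overlap N \<sigma>1 \<sigma>2\<bar> \<ge> \<epsilon> then 1 else 0))"

end

theory Submission
  imports Defs "HOL-Real_Asymp.Real_Asymp"
begin

text \<open>
  Let \<open>W\<close> be the partition function divided by its expectation. Weighting the disorder by \<open>W\<close> and
  sampling a configuration from the Gibbs measure amounts to planting a uniform configuration, that
  is, to shifting the Gaussian couplings in its direction; by symmetry the planted configuration may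
  be taken constant. For \<open>\<beta>\<close> below a point \<open>b'\<close> of the replica symmetric phase \<open>ln W = o(N)\<close>, and
  concentration carries this over to the planted disorder: planting does not raise the free energy
  to leading order, uniformly in \<open>\<beta> \<le> b'\<close>.

  Suppose now that the configurations \<open>\<sigma>\<close> with \<open>R\<^sup>p \<ge> t\<close> relative to the planted one carry more than
  an exponentially small part of the partition function, while pairs of samples with
  \<open>R\<^sub>1\<^sub>2\<^sup>p \<ge> 3t/2\<close> are exponentially rare. Raising \<open>\<beta>\<close> by \<open>\<kappa>\<close> changes the restricted planted free
  energy per spin by at least \<open>\<kappa> \<beta> (t - E\<langle>R\<^sub>1\<^sub>2\<^sup>p\<rangle> / 2) - O(\<kappa>\<^sup>2)\<close>, which is positive because
  \<open>E\<langle>R\<^sub>1\<^sub>2\<^sup>p\<rangle> \<le> 3t/2 + o(1)\<close>; this contradicts the previous paragraph. So the exponential bound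
  descends from threshold \<open>3t/2\<close> to \<open>t\<close>, starting from the trivial thresholds above \<open>1\<close>. Pairs with
  \<open>R\<^sub>1\<^sub>2\<^sup>p \<le> 0\<close> are controlled by their annealed weight.

  Since \<open>F\<close> is defined as the almost sure limit, its existence has to be established as well, also for
  odd \<open>p\<close>. The expected free energy is almost superadditive by interpolation between one system and
  independent blocks. The sign of the error is right as soon as overlaps are almost nonnegative, which
  is enforced by small \<open>s\<close>-spin perturbations: they yield the Ghirlanda--Guerra identities, hence
  Talagrand's positivity principle.
\<close>

section \<open>Real analysis\<close>

lemma diff_le_of_quadratic_increments:
  fixes f :: "real \<Rightarrow> real"
  assumes xy: "x \<le> y"
    and increment: "\<And>u v. x \<le> u \<Longrightarrow> u \<le> v \<Longrightarrow> v \<le> y \<Longrightarrow> f v - f u \<le> B * (v - u) + C * (v - u)\<^sup>2"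
  shows "f y - f x \<le> B * (y - x)"
proof (rule LIMSEQ_le_const)
  have "f y - f x \<le> B * (y - x) + C * (y - x)\<^sup>2 / real n" if n: "n \<ge> 1" for n
  proof -
    define t where "t k = x + (y - x) * (real k / real n)" for k
    have width: "t (Suc k) - t k = (y - x) / real n" for k
      by (simp add: t_def algebra_simps add_divide_distrib diff_divide_distrib)
    have "0 \<le> (y - x) / real n" using xy by simp
    then have t_Suc: "t k \<le> t (Suc k)" for k using width[of k] by linarith
    have t_range: "x \<le> t k" "t k \<le> y" if "k \<le> n" for k
      using xy n that mult_left_mono[of "real k / real n" 1 "y - x"] by (simp_all add: t_def)
    have "f y - f x = (\<Sum>k<n. f (t (Suc k)) - f (t k))"
      using n by (simp only: sum_lessThan_telescope[of "\<lambda>k. f (t k)" n]) (simp add: t_def)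
    also have "\<dots> \<le> (\<Sum>k<n. B * ((y - x) / real n) + C * ((y - x) / real n)\<^sup>2)"
      using increment t_range t_Suc width by (intro sum_mono) (metis Suc_leI lessThan_iff less_imp_le)
    also have "\<dots> = B * (y - x) + C * (y - x)\<^sup>2 / real n"
      using n by (simp add: power2_eq_square field_simps)
    finally show ?thesis .
  qed
  then show "\<exists>n0. \<forall>n\<ge>n0. f y - f x \<le> B * (y - x) + C * (y - x)\<^sup>2 / real n" by blast
  show "(\<lambda>n. B * (y - x) + C * (y - x)\<^sup>2 / real n) \<longlonglongrightarrow> B * (y - x)"
    by real_asymp
qed

lemma eventually_exp_minus_le:
  assumes "k > 0" "q > 0"
  shows "\<forall>\<^sub>F n in sequentially. exp (- k * real n) \<le> q"
proof -
  have "(\<lambda>n. exp (- k * real n)) \<longlonglongrightarrow> 0"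
    using assms(1) by real_asymp
  from order_tendstoD(2)[OF this assms(2)] show ?thesis
    by (rule eventually_mono) simp
qed

lemma obtain_pos_mult_le:
  fixes c \<delta> :: real
  assumes "0 \<le> c" "0 < \<delta>"
  obtains \<epsilon> where "0 < \<epsilon>" "c * \<epsilon> \<le> \<delta>"
proof
  show "0 < \<delta> / (c + 1)" using assms by simp
  have "c * (\<delta> / (c + 1)) = \<delta> * (c / (c + 1))" by simp
  also have "\<dots> \<le> \<delta> * 1" using assms by (intro mult_left_mono) auto
  finally show "c * (\<delta> / (c + 1)) \<le> \<delta>" by simp
qed

lemma abs_power_le_1: "\<bar>x\<bar> \<le> 1 \<Longrightarrow> \<bar>x ^ n\<bar> \<le> 1" for x :: real
  by (simp add: power_abs power_le_one)

lemma cosh_le_exp: "cosh x \<le> exp (x\<^sup>2 / 2)" for x :: real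
proof -
  have nonneg: "cosh x \<le> exp (x\<^sup>2 / 2)" if "x \<ge> 0" for x :: real
  proof -
    have half: "1 + (exp (2 * x) - 1) / 2 = (1 + exp (2 * x)) / 2" by (simp add: field_simps)
    have "ln ((1 + exp (2 * x)) / 2) \<le> x\<^sup>2 / 2 + x"
      using Hoeffdings_lemma_aux[of "2 * x" "1 / 2"] that by (simp add: half power2_eq_square)
    then have "exp (ln ((1 + exp (2 * x)) / 2)) \<le> exp (x\<^sup>2 / 2 + x)" by simp
    then have "(1 + exp (2 * x)) / 2 \<le> exp (x\<^sup>2 / 2) * exp x"
      by (simp add: exp_add add_pos_pos)
    then have "exp (- x) * ((1 + exp (2 * x)) / 2) \<le> exp (- x) * (exp (x\<^sup>2 / 2) * exp x)"
      by (rule mult_left_mono) simp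
    moreover have "exp (- x) * exp (2 * x) = exp x" by (simp flip: exp_add)
    then have "exp (- x) * ((1 + exp (2 * x)) / 2) = cosh x" by (simp add: cosh_field_def distrib_left)
    moreover have "exp (- x) * (exp (x\<^sup>2 / 2) * exp x) = exp (x\<^sup>2 / 2)" by (simp flip: exp_add)
    ultimately show ?thesis by (simp only:)
  qed
  then show ?thesis using nonneg[of "- x"] by (cases "x \<ge> 0") auto
qed

lemma power_lower_bound_of_recurrence:
  fixes E :: "nat \<Rightarrow> real"
  assumes q: "0 \<le> q" "q \<le> 1" and err: "0 \<le> err" and E1: "1 \<le> E 1"
    and step: "\<And>n. 1 \<le> n \<Longrightarrow> n < m \<Longrightarrow> E n * q - err \<le> E (Suc n)" and n: "1 \<le> n" "n \<le> m"
  shows "q ^ (n - 1) - real n * err \<le> E n"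
  using n
proof (induction n rule: nat_induct_at_least)
  case base
  then show ?case using E1 err by simp
next
  case (Suc n)
  have "q ^ n - real n * err \<le> q ^ n - real n * err * q"
    using mult_left_mono[OF q(2), of "real n * err"] err by simp
  also have "\<dots> = (q ^ (n - 1) - real n * err) * q"
    using Suc.hyps by (cases n) (auto simp: algebra_simps)
  also have "\<dots> \<le> E n * q" using Suc q by (intro mult_right_mono) auto
  also have "\<dots> \<le> E (Suc n) + err" using step[of n] Suc by simp
  finally show ?case by (simp add: algebra_simps)
qed

lemma uniform_exponential_bound:
  fixes f :: "'a \<Rightarrow> nat \<Rightarrow> real"
  assumes f: "\<And>x n. f x n \<le> 1" and c: "c > 0"
    and decay: "\<forall>\<^sub>F n in sequentially. \<forall>x\<in>A. f x n \<le> C * exp (- c * real n)"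
  shows "\<exists>K>0. \<forall>x\<in>A. \<forall>n. f x n \<le> K * exp (- real n / K)"
proof -
  obtain m where m: "\<And>n x. n \<ge> m \<Longrightarrow> x \<in> A \<Longrightarrow> f x n \<le> C * exp (- c * real n)"
    using decay unfolding eventually_sequentially by blast
  define K where "K = max (max 3 C) (max (1 / c) (real m))"
  have K: "K \<ge> 3" "C \<le> K" "1 / c \<le> K" "real m \<le> K" by (auto simp: K_def)
  have "f x n \<le> K * exp (- real n / K)" if x: "x \<in> A" for x n
  proof (cases "n \<ge> m")
    case True
    have "1 / K \<le> c" using K c by (simp add: field_simps)
    then have "1 / K * real n \<le> c * real n" by (intro mult_right_mono) auto
    then have "C * exp (- c * real n) \<le> K * exp (- real n / K)" using K by (intro mult_mono) auto
    then show ?thesis using m[OF True x] by linarith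
  next
    case False
    then have "exp (- 1) \<le> exp (- real n / K)" using K by (simp add: divide_le_eq)
    then have "K * exp (- 1) \<le> K * exp (- real n / K)" using K by (intro mult_left_mono) auto
    moreover have "exp 1 \<le> K" using exp_le K(1) by linarith
    then have "1 \<le> K * exp (- 1)" by (simp add: exp_minus field_simps)
    ultimately show ?thesis using f[of x n] by linarith
  qed
  then show ?thesis using K(1) by (intro exI[of _ K]) auto
qed

lemma sum_central_differences:
  fixes f :: "nat \<Rightarrow> real"
  assumes "m \<ge> 1"
  shows "(\<Sum>y\<in>{m<..2 * m}. f (y + 1) - f (y - 1)) = f (2 * m + 1) + f (2 * m) - f (m + 1) - f m"
proof -
  have "(\<Sum>y\<in>{m<..m + k}. f (y + 1) - f (y - 1)) = f (m + k + 1) + f (m + k) - f (m + 1) - f m" for k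
  proof (induction k)
    case (Suc k)
    have "{m<..m + Suc k} = insert (m + Suc k) {m<..m + k}" by auto
    then show ?case using Suc by simp
  qed simp
  from this[of m] show ?thesis by (simp add: mult_2)
qed

lemma sum_PiE_resample:
  fixes f :: "('a \<Rightarrow> 'b) \<Rightarrow> real"
  assumes a: "a \<in> A"
  shows "(\<Sum>x\<in>A \<rightarrow>\<^sub>E B. \<Sum>y\<in>B. f (x(a := y))) = real (card B) * (\<Sum>x\<in>A \<rightarrow>\<^sub>E B. f x)"
proof -
  let ?P = "A \<rightarrow>\<^sub>E B"
  have bij: "bij_betw (\<lambda>(x, y). (x(a := y), x a)) (?P \<times> B) (?P \<times> B)"
    by (rule bij_betw_byWitness[where f' = "\<lambda>(x, y). (x(a := y), x a)"])
       (use a in \<open>auto simp: PiE_def Pi_def extensional_def\<close>)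
  have "(\<Sum>x\<in>?P. \<Sum>y\<in>B. f (x(a := y))) = (\<Sum>z\<in>?P \<times> B. (\<lambda>(x, y). f x) ((\<lambda>(x, y). (x(a := y), x a)) z))"
    by (simp add: sum.cartesian_product split_beta')
  also have "\<dots> = (\<Sum>z\<in>?P \<times> B. (\<lambda>(x, y). f x) z)"
    by (rule sum.reindex_bij_betw[OF bij])
  also have "\<dots> = (\<Sum>x\<in>?P. \<Sum>y\<in>B. f x)" by (rule sum.cartesian_product[symmetric])
  finally show ?thesis by (simp add: sum_distrib_left)
qed

subsection \<open>Uniform polynomial approximation\<close>

lemma polynomial_approximation:
  fixes h :: "real \<Rightarrow> real"
  assumes "continuous_on {-1..1} h" "\<delta> > 0"
  shows "\<exists>k m. \<forall>y. \<bar>y\<bar> \<le> 1 \<longrightarrow> \<bar>h y - (\<Sum>s\<le>m. k s * y ^ s)\<bar> \<le> \<delta>"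
proof -
  obtain f where f: "real_polynomial_function f" "\<And>y. y \<in> {-1..1} \<Longrightarrow> \<bar>h y - f y\<bar> < \<delta>"
    using Stone_Weierstrass_real_polynomial_function[of "{-1..1}" h \<delta>] assms by (metis compact_Icc)
  obtain k m where k: "f = (\<lambda>x. \<Sum>i\<le>m. k i * x ^ i)"
    using real_polynomial_function_imp_sum[OF f(1)] by blast
  have "\<bar>h y - (\<Sum>s\<le>m. k s * y ^ s)\<bar> \<le> \<delta>" if "\<bar>y\<bar> \<le> 1" for y
  proof -
    have "y \<in> {-1..1}" using that by auto
    from less_imp_le[OF f(2)[OF this]] show ?thesis unfolding k .
  qed
  then show ?thesis by blast
qed

lemma simultaneous_polynomial_approximation:
  fixes h :: "nat \<Rightarrow> real \<Rightarrow> real"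
  assumes "\<And>n. continuous_on {-1..1} (h n)" "\<delta> > 0"
  shows "\<exists>S K. K \<ge> 0 \<and> (\<forall>n<m. \<exists>k. (\<forall>s. \<bar>k s\<bar> \<le> K) \<and> (\<forall>y. \<bar>y\<bar> \<le> 1 \<longrightarrow> \<bar>h n y - (\<Sum>s\<le>S. k s * y ^ s)\<bar> \<le> \<delta>))"
proof -
  obtain a d where approx: "\<And>n y. \<bar>y\<bar> \<le> 1 \<Longrightarrow> \<bar>h n y - (\<Sum>s\<le>d n. a n s * y ^ s)\<bar> \<le> \<delta>"
    using polynomial_approximation[OF assms] by metis
  define S where "S = (\<Sum>n<m. d n)"
  define K where "K = (\<Sum>n<m. \<Sum>s\<le>d n. \<bar>a n s\<bar>)"
  have K: "K \<ge> 0" unfolding K_def by (intro sum_nonneg) auto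
  have "\<exists>k. (\<forall>s. \<bar>k s\<bar> \<le> K) \<and> (\<forall>y. \<bar>y\<bar> \<le> 1 \<longrightarrow> \<bar>h n y - (\<Sum>s\<le>S. k s * y ^ s)\<bar> \<le> \<delta>)"
    if n: "n < m" for n
  proof (intro exI[of _ "\<lambda>s. if s \<le> d n then a n s else 0"] conjI allI impI)
    show "\<bar>if s \<le> d n then a n s else 0\<bar> \<le> K" for s
    proof (cases "s \<le> d n")
      case True
      then have "\<bar>a n s\<bar> \<le> (\<Sum>s\<le>d n. \<bar>a n s\<bar>)" by (intro member_le_sum) auto
      also have "\<dots> \<le> K"
        unfolding K_def by (rule member_le_sum[where f = "\<lambda>n. \<Sum>s\<le>d n. \<bar>a n s\<bar>"]) (use n in \<open>auto intro: sum_nonneg\<close>)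
      finally show ?thesis using True by simp
    qed (use K in simp)
  next
    fix y :: real assume y: "\<bar>y\<bar> \<le> 1"
    have "d n \<le> S" unfolding S_def by (rule member_le_sum) (use n in auto)
    then have "(\<Sum>s\<le>S. (if s \<le> d n then a n s else 0) * y ^ s) = (\<Sum>s\<le>d n. a n s * y ^ s)"
      by (intro sum.mono_neutral_cong_right) auto
    then show "\<bar>h n y - (\<Sum>s\<le>S. (if s \<le> d n then a n s else 0) * y ^ s)\<bar> \<le> \<delta>"
      using approx[OF y, of n] by simp
  qed
  then show ?thesis using K by blast
qed

subsection \<open>Powers of weighted means\<close>

lemma power_weighted_sum_le:
  fixes y w :: "'a \<Rightarrow> real"
  assumes I: "finite I" and y: "\<And>i. i \<in> I \<Longrightarrow> 0 \<le> y i" and w: "\<And>i. i \<in> I \<Longrightarrow> 0 \<le> w i" "sum w I \<le> 1" and p: "p \<ge> 1"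
  shows "(\<Sum>i\<in>I. w i * y i) ^ p \<le> (\<Sum>i\<in>I. w i * y i ^ p)"
proof -
  have convex: "convex_on {0::real..} (\<lambda>x. x ^ p)"
  proof (cases "even p")
    case True
    then show ?thesis using convex_on_subset[OF convex_power_even[of p]] by blast
  next
    case False
    then show ?thesis by (rule convex_power_odd)
  qed
  define v where "v = case_option (1 - sum w I) w"
  define z where "z = case_option 0 y"
  have split: "(\<Sum>k\<in>insert None (Some ` I). h k) = h None + (\<Sum>i\<in>I. h (Some i))" for h :: "'a option \<Rightarrow> real"
    using I by (subst sum.insert) (auto simp: sum.reindex)
  have "(\<Sum>k\<in>insert None (Some ` I). v k *\<^sub>R z k) ^ p \<le> (\<Sum>k\<in>insert None (Some ` I). v k * z k ^ p)"
    by (rule convex_on_sum[OF _ _ convex]) (use I y w in \<open>auto simp: v_def z_def sum.reindex\<close>)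
  then show ?thesis using p by (simp add: split) (simp add: v_def z_def power_0_left)
qed

lemma sum_weighted_negative_part_le:
  fixes q w :: "'a \<Rightarrow> real"
  assumes q: "\<And>i. i \<in> I \<Longrightarrow> - 1 \<le> q i" and w: "\<And>i. i \<in> I \<Longrightarrow> 0 \<le> w i" "sum w I \<le> 1" and \<epsilon>: "\<epsilon> \<ge> 0"
  shows "(\<Sum>i\<in>I. w i * max 0 (- q i)) \<le> \<epsilon> + (\<Sum>i\<in>I. w i * of_bool (q i \<le> - \<epsilon>))"
proof -
  have "max 0 (- q i) \<le> \<epsilon> + of_bool (q i \<le> - \<epsilon>)" if "i \<in> I" for i
    using q[OF that] \<epsilon> by (auto simp: max_def)
  then have "(\<Sum>i\<in>I. w i * max 0 (- q i)) \<le> (\<Sum>i\<in>I. w i * (\<epsilon> + of_bool (q i \<le> - \<epsilon>)))"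
    using w by (intro sum_mono mult_left_mono) auto
  also have "\<dots> = sum w I * \<epsilon> + (\<Sum>i\<in>I. w i * of_bool (q i \<le> - \<epsilon>))"
    by (simp only: distrib_left sum.distrib sum_distrib_right)
  also have "sum w I * \<epsilon> \<le> 1 * \<epsilon>" using w \<epsilon> by (intro mult_right_mono)
  finally show ?thesis by simp
qed

lemma power_le_power_add_negative_part:
  fixes x :: real
  assumes "\<bar>x\<bar> \<le> 1" "p \<ge> 1"
  shows "max 0 x ^ p \<le> x ^ p + max 0 (- x)"
proof (cases "x \<ge> 0")
  case False
  have "\<bar>x ^ p\<bar> \<le> \<bar>x\<bar> ^ 1"
    unfolding power_abs using assms by (intro power_decreasing) auto
  then show ?thesis using False assms by (auto simp: max_def abs_le_iff power_0_left)
qed (simp add: max_def)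

text \<open>Convexity, up to the error coming from substantially negative \<open>q i\<close>; for odd \<open>p\<close> the power is not convex there.\<close>
lemma power_mean_le_mean_power:
  fixes q w :: "'a \<Rightarrow> real"
  assumes I: "finite I" and q: "\<And>i. i \<in> I \<Longrightarrow> \<bar>q i\<bar> \<le> 1" and w: "\<And>i. i \<in> I \<Longrightarrow> 0 \<le> w i" "sum w I + t = 1"
    and t: "0 \<le> t" and p: "p \<ge> 1" and \<epsilon>: "\<epsilon> \<ge> 0"
  shows "((\<Sum>i\<in>I. w i * q i) + t) ^ p \<le> (\<Sum>i\<in>I. w i * q i ^ p) +
     (real p + 1) * (\<epsilon> + (\<Sum>i\<in>I. w i * of_bool (q i \<le> - \<epsilon>))) + real p * t"
proof -
  define b where "b = (\<Sum>i\<in>I. w i * max 0 (q i))"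
  define n where "n = (\<Sum>i\<in>I. w i * max 0 (- q i))"
  have w_sum: "sum w I \<le> 1" using w t by simp
  have mean: "(\<Sum>i\<in>I. w i * q i) = b - n"
    unfolding b_def n_def sum_subtractf[symmetric] by (intro sum.cong refl) (auto simp: max_def algebra_simps)
  have "\<bar>\<Sum>i\<in>I. w i * q i\<bar> \<le> (\<Sum>i\<in>I. w i * 1)"
    using w q by (intro order_trans[OF sum_abs] sum_mono) (auto simp: abs_mult intro: mult_left_le)
  then have mean_le: "\<bar>(\<Sum>i\<in>I. w i * q i) + t\<bar> \<le> 1" using w t by (simp add: abs_le_iff)
  have "b \<le> (\<Sum>i\<in>I. w i * 1)"
    unfolding b_def using w q by (intro sum_mono mult_left_mono) (auto simp: abs_le_iff)
  then have b: "0 \<le> b" "b \<le> 1"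
    using w w_sum by (auto simp: b_def intro!: sum_nonneg)
  have n: "0 \<le> n" unfolding n_def using w by (intro sum_nonneg) auto
  have "((\<Sum>i\<in>I. w i * q i) + t) ^ p - b ^ p \<le> real p * \<bar>(\<Sum>i\<in>I. w i * q i) + t - b\<bar>"
    using norm_power_diff[of "(\<Sum>i\<in>I. w i * q i) + t" b p] mean_le b by simp
  also have "\<dots> \<le> real p * (n + t)" unfolding mean using n t by (intro mult_left_mono) auto
  finally have "((\<Sum>i\<in>I. w i * q i) + t) ^ p \<le> b ^ p + real p * (n + t)" by simp
  also have "b ^ p \<le> (\<Sum>i\<in>I. w i * max 0 (q i) ^ p)"
    unfolding b_def by (rule power_weighted_sum_le) (use I w w_sum p in auto)
  also have "\<dots> \<le> (\<Sum>i\<in>I. w i * (q i ^ p + max 0 (- q i)))"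
    using w q p by (intro sum_mono mult_left_mono power_le_power_add_negative_part) auto
  also have "\<dots> = (\<Sum>i\<in>I. w i * q i ^ p) + n" by (simp add: n_def distrib_left sum.distrib)
  finally have "((\<Sum>i\<in>I. w i * q i) + t) ^ p \<le> (\<Sum>i\<in>I. w i * q i ^ p) + (real p + 1) * n + real p * t"
    by (simp add: algebra_simps)
  moreover have "n \<le> \<epsilon> + (\<Sum>i\<in>I. w i * of_bool (q i \<le> - \<epsilon>))"
    unfolding n_def using q w w_sum \<epsilon> by (intro sum_weighted_negative_part_le) (auto simp: abs_le_iff)
  then have "(real p + 1) * n \<le> (real p + 1) * (\<epsilon> + (\<Sum>i\<in>I. w i * of_bool (q i \<le> - \<epsilon>)))"
    by (rule mult_left_mono) simp
  ultimately show ?thesis by linarith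
qed

subsection \<open>Almost superadditive sequences\<close>

lemma convergent_if_almost_increasing:
  fixes f :: "nat \<Rightarrow> real"
  assumes bounds: "\<forall>\<^sub>F n in sequentially. l \<le> f n" "\<forall>\<^sub>F n in sequentially. f n \<le> u"
    and increasing: "\<And>\<delta>. \<delta> > 0 \<Longrightarrow> \<forall>\<^sub>F m in sequentially. \<forall>\<^sub>F n in sequentially. f m - \<delta> \<le> f n"
  shows "convergent f"
proof -
  define A where "A = {y. \<forall>\<^sub>F n in sequentially. y \<le> f n}"
  have A: "l \<in> A" using bounds(1) by (simp add: A_def)
  have "y \<le> u" if "y \<in> A" for y
  proof -
    have "\<forall>\<^sub>F n in sequentially. y \<le> u"
      using that[unfolded A_def mem_Collect_eq] bounds(2) by eventually_elim simp
    then show ?thesis by simp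
  qed
  then have bdd: "bdd_above A" by (rule bdd_aboveI)
  have "f \<longlonglongrightarrow> Sup A"
  proof (rule tendstoI)
    fix e :: real assume e: "e > 0"
    obtain y where y: "y \<in> A" "Sup A - e < y"
      using less_cSupE[of "Sup A - e" A] A e by auto
    show "\<forall>\<^sub>F n in sequentially. dist (f n) (Sup A) < e"
      using increasing[OF half_gt_zero[OF e]] y(1)[unfolded A_def mem_Collect_eq]
    proof eventually_elim
      case (elim n)
      then have "f n - e / 2 \<le> Sup A" by (intro cSup_upper bdd) (simp add: A_def)
      then show ?case using elim(2) y(2) e by (simp add: dist_real_def abs_less_iff)
    qed
  qed
  then show ?thesis by (rule convergentI)
qed

lemma superadditive_remainder_le:
  fixes x :: real
  assumes M: "M \<ge> 1" and x: "x \<le> C" and C: "C \<ge> 0" and D: "D \<ge> 0"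
    and super: "real (N div M) * (real M * x) - \<delta> * real N - D * real (N mod M) \<le> y"
  shows "real N * x - (C + D) * real M - \<delta> * real N \<le> y"
proof -
  have "N mod M \<le> M" using M by (simp add: less_imp_le)
  then have "real (N mod M) \<le> real M" by simp
  then have "real (N mod M) * x \<le> real M * C" "D * real (N mod M) \<le> D * real M"
    using x C D by (auto intro!: mult_left_mono intro: order_trans[OF mult_left_mono mult_right_mono])
  moreover have "real N = real (N div M) * real M + real (N mod M)"
    by (metis div_mult_mod_eq of_nat_add of_nat_mult)
  then have "real N * x = real (N div M) * (real M * x) + real (N mod M) * x"
    by (simp add: algebra_simps)
  ultimately show ?thesis using super by (simp add: algebra_simps)
qed

lemma convergent_if_almost_superadditive:
  fixes a :: "nat \<Rightarrow> real"
  assumes bounds: "\<And>N. N \<ge> 1 \<Longrightarrow> 0 \<le> a N" "\<And>N. N \<ge> 1 \<Longrightarrow> a N \<le> C * real N" and D: "D \<ge> 0"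
    and super: "\<And>\<delta>. \<delta> > 0 \<Longrightarrow> \<forall>\<^sub>F M in sequentially. \<forall>m\<ge>1. \<forall>r.
      real m * a M - \<delta> * real (m * M + r) - D * real r \<le> a (m * M + r)"
  shows "convergent (\<lambda>N. a N / real N)"
proof (rule convergent_if_almost_increasing)
  have C: "C \<ge> 0" using bounds[of 1] by simp
  show "\<forall>\<^sub>F N in sequentially. 0 \<le> a N / real N"
    using eventually_ge_at_top[of 1] by eventually_elim (simp add: bounds)
  show "\<forall>\<^sub>F N in sequentially. a N / real N \<le> C"
    using eventually_ge_at_top[of 1] by eventually_elim (simp add: bounds divide_le_eq)
  fix \<delta> :: real assume \<delta>: "\<delta> > 0"
  show "\<forall>\<^sub>F M in sequentially. \<forall>\<^sub>F N in sequentially. a M / real M - \<delta> \<le> a N / real N"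
    using super[OF half_gt_zero[OF \<delta>]] eventually_ge_at_top[of 1]
  proof eventually_elim
    case (elim M)
    have "(\<lambda>N. (C + D) * real M / real N) \<longlonglongrightarrow> 0" by (rule lim_const_over_n)
    from order_tendstoD(2)[OF this half_gt_zero[OF \<delta>]] eventually_ge_at_top[of M]
    show ?case
    proof eventually_elim
      case N: (elim N)
      have pos: "real N > 0" using N(2) elim(2) by simp
      have "N div M \<ge> 1" using N(2) elim(2) by (simp add: Suc_le_eq div_greater_zero_iff)
      from elim(1)[rule_format, OF this, of "N mod M"]
      have "real (N div M) * (real M * (a M / real M)) - \<delta> / 2 * real N - D * real (N mod M) \<le> a N"
        using elim(2) by simp
      then have "real N * (a M / real M) - (C + D) * real M - \<delta> / 2 * real N \<le> a N"
        using elim(2) bounds(2)[of M] by (intro superadditive_remainder_le[OF _ _ C D]) (auto simp: divide_le_eq)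
      moreover have "(C + D) * real M \<le> \<delta> / 2 * real N"
        using N(1) pos by (simp add: divide_less_eq mult.commute)
      ultimately have "(a M / real M - \<delta>) * real N \<le> a N" by (simp add: algebra_simps)
      then show ?case using pos by (simp add: pos_le_divide_eq)
    qed
  qed
qed

section \<open>Integrals of bounded functions and tail bounds\<close>

lemma integral_of_bool: "(\<integral>x. of_bool (P x) \<partial>M) = measure M {x\<in>space M. P x}"
proof -
  have "(\<lambda>x. of_bool (P x) :: real) = indicator {x. P x}" by (auto simp: indicator_def)
  then show ?thesis by (simp add: Int_def conj_commute)
qed

lemma (in finite_measure) integrable_of_bool:
  assumes [measurable]: "Measurable.pred M P"
  shows "integrable M (\<lambda>x. of_bool (P x) :: real)"
  by (rule integrable_const_bound[where B = 1]) auto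

lemma integrable_mult_bounded:
  fixes f h :: "'a \<Rightarrow> real"
  assumes int: "integrable M f" and [measurable]: "h \<in> borel_measurable M"
    and bound: "\<And>x. \<bar>h x\<bar> \<le> B"
  shows "integrable M (\<lambda>x. h x * f x)"
proof (rule Bochner_Integration.integrable_bound)
  show "integrable M (\<lambda>x. B * f x)" using int by simp
  have [measurable]: "f \<in> borel_measurable M" using int by simp
  show "(\<lambda>x. h x * f x) \<in> borel_measurable M" by measurable
  have "norm (h x * f x) \<le> norm (B * f x)" for x
    using mult_right_mono[OF order_trans[OF bound abs_ge_self], of "\<bar>f x\<bar>"] by (simp add: abs_mult)
  then show "AE x in M. norm (h x * f x) \<le> norm (B * f x)" by simp
qed

lemma (in prob_space) paley_zygmund:
  fixes X :: "'a \<Rightarrow> real"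
  assumes X: "integrable M X" "integrable M (\<lambda>x. (X x)\<^sup>2)" and t: "0 \<le> t" "t < expectation X"
  shows "(expectation X - t)\<^sup>2 \<le> expectation (\<lambda>x. (X x)\<^sup>2) * prob {x\<in>space M. t \<le> X x}"
proof -
  have [measurable]: "X \<in> borel_measurable M" using X by simp
  define d s P where "d = expectation X - t" and "s = expectation (\<lambda>x. (X x)\<^sup>2)" and "P = prob {x\<in>space M. t \<le> X x}"
  have d: "d > 0" using t by (simp add: d_def)
  have "(expectation X)\<^sup>2 \<le> s"
    using variance_eq[OF X] variance_positive[of X] by (simp add: s_def)
  moreover have "0 < (expectation X)\<^sup>2" using t by simp
  ultimately have s: "s > 0" by linarith
  define k where "k = s / (2 * d)"
  have k: "k > 0" using s d by (simp add: k_def)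
  have "X x \<le> t + (X x)\<^sup>2 / (4 * k) + k * of_bool (t \<le> X x)" for x
  proof (cases "t \<le> X x")
    case True
    have "0 \<le> (X x - 2 * k)\<^sup>2 / (4 * k)" using k by simp
    also have "\<dots> = (X x)\<^sup>2 / (4 * k) - X x + k" using k by (simp add: power2_eq_square field_simps)
    finally show ?thesis using True t by simp
  next
    case False
    have "0 \<le> (X x)\<^sup>2 / (4 * k)" using k by simp
    then show ?thesis using False by simp
  qed
  then have "expectation X \<le> (\<integral>x. t + (X x)\<^sup>2 / (4 * k) + k * of_bool (t \<le> X x) \<partial>M)"
    using X by (intro integral_mono Bochner_Integration.integrable_add integrable_mult_right integrable_of_bool) auto
  also have "\<dots> = t + s / (4 * k) + k * P"
    using X by (simp add: integral_of_bool integrable_of_bool prob_space s_def P_def)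
  finally have "d \<le> s / (4 * k) + k * P" by (simp add: d_def)
  also have "\<dots> = d / 2 + s * P / (2 * d)" using s d by (simp add: k_def field_simps)
  finally have "d * d \<le> s * P" using d by (simp add: field_simps)
  then show ?thesis by (simp add: power2_eq_square d_def s_def P_def)
qed

lemma (in prob_space) AE_tendsto_0_if_summable_tails:
  fixes X :: "nat \<Rightarrow> 'a \<Rightarrow> real"
  assumes [measurable]: "\<And>n. X n \<in> borel_measurable M"
    and summable: "\<And>e. e > 0 \<Longrightarrow> summable (\<lambda>n. prob {x\<in>space M. e \<le> \<bar>X n x\<bar>})"
  shows "AE x in M. (\<lambda>n. X n x) \<longlonglongrightarrow> 0"
proof -
  have "AE x in M. \<forall>\<^sub>F n in sequentially. \<bar>X n x\<bar> < 1 / real (Suc m)" for m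
  proof -
    have "AE x in M. \<forall>\<^sub>F n in sequentially. x \<in> space M - {x\<in>space M. 1 / real (Suc m) \<le> \<bar>X n x\<bar>}"
      using summable[of "1 / real (Suc m)"] by (intro borel_cantelli_AE1) (auto simp: emeasure_eq_measure)
    then show ?thesis
    proof (rule AE_mp, intro AE_I2 impI)
      fix x assume "\<forall>\<^sub>F n in sequentially. x \<in> space M - {x\<in>space M. 1 / real (Suc m) \<le> \<bar>X n x\<bar>}"
      then show "\<forall>\<^sub>F n in sequentially. \<bar>X n x\<bar> < 1 / real (Suc m)" by eventually_elim auto
    qed
  qed
  then have "AE x in M. \<forall>m. \<forall>\<^sub>F n in sequentially. \<bar>X n x\<bar> < 1 / real (Suc m)"
    unfolding AE_all_countable by blast
  then show ?thesis
  proof (rule AE_mp, intro AE_I2 impI)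
    fix x assume eventually: "\<forall>m. \<forall>\<^sub>F n in sequentially. \<bar>X n x\<bar> < 1 / real (Suc m)"
    show "(\<lambda>n. X n x) \<longlonglongrightarrow> 0"
    proof (rule tendstoI)
      fix e :: real assume "e > 0"
      then obtain m where m: "1 / real (Suc m) < e" using nat_approx_posE by blast
      show "\<forall>\<^sub>F n in sequentially. dist (X n x) 0 < e"
        using eventually[rule_format, of m] by (rule eventually_mono) (use m in auto)
    qed
  qed
qed

section \<open>Subgaussian random variables\<close>

text \<open>In terms of the usual variance proxy, \<^term>\<open>subgaussian M f V\<close> has proxy \<open>2 V\<close>.\<close>
definition subgaussian :: "'a measure \<Rightarrow> ('a \<Rightarrow> real) \<Rightarrow> real \<Rightarrow> bool" where
  "subgaussian M f V \<longleftrightarrow> integrable M f \<and>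
     (\<forall>l. (\<integral>\<^sup>+x. ennreal (exp (l * (f x - (\<integral>y. f y \<partial>M)))) \<partial>M) \<le> ennreal (exp (l\<^sup>2 * V)))"

lemma subgaussian_imp_integrable: "subgaussian M f V \<Longrightarrow> integrable M f"
  by (simp add: subgaussian_def)

lemma subgaussianD:
  assumes "subgaussian M f V"
  shows "(\<integral>\<^sup>+x. ennreal (exp (l * (f x - (\<integral>y. f y \<partial>M)))) \<partial>M) \<le> ennreal (exp (l\<^sup>2 * V))"
  using assms by (simp add: subgaussian_def)

lemma subgaussian_mono:
  assumes "subgaussian M f V" "V \<le> V'"
  shows "subgaussian M f V'"
  unfolding subgaussian_def
proof (intro conjI allI)
  show "integrable M f" using assms(1) by (rule subgaussian_imp_integrable)
  fix l
  note subgaussianD[OF assms(1), of l]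
  also have "ennreal (exp (l\<^sup>2 * V)) \<le> ennreal (exp (l\<^sup>2 * V'))"
    using assms(2) by (auto intro!: ennreal_leI mult_left_mono)
  finally show "(\<integral>\<^sup>+x. ennreal (exp (l * (f x - (\<integral>y. f y \<partial>M)))) \<partial>M) \<le> ennreal (exp (l\<^sup>2 * V'))" .
qed

lemma subgaussian_uminus:
  assumes "subgaussian M f V"
  shows "subgaussian M (\<lambda>x. - f x) V"
  unfolding subgaussian_def
proof (intro conjI allI)
  show "integrable M (\<lambda>x. - f x)" using subgaussian_imp_integrable[OF assms] by simp
  show "(\<integral>\<^sup>+x. ennreal (exp (l * (- f x - (\<integral>y. - f y \<partial>M)))) \<partial>M) \<le> ennreal (exp (l\<^sup>2 * V))" for l
    using subgaussianD[OF assms, of "- l"] by (simp add: algebra_simps)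
qed

context prob_space
begin

lemma subgaussian_upper_tail:
  assumes f: "subgaussian M f V" and V: "V > 0" and t: "t > 0"
  shows "prob {x\<in>space M. expectation f + t \<le> f x} \<le> exp (- t\<^sup>2 / (4 * V))"
proof -
  have [measurable]: "f \<in> borel_measurable M" using subgaussian_imp_integrable[OF f] by simp
  define l where "l = t / (2 * V)"
  have l: "l > 0" using V t by (simp add: l_def)
  have exponent: "l\<^sup>2 * V - l * t = - (t\<^sup>2 / (4 * V))"
    using V by (simp add: l_def power2_eq_square field_simps)
  have "emeasure M {x\<in>space M. expectation f + t \<le> f x} = emeasure M {x\<in>space M. t \<le> f x - expectation f}"
    by (simp add: algebra_simps)
  also have "\<dots> \<le> ennreal (exp (- l * t)) *
      (\<integral>\<^sup>+x. ennreal (exp (l * (f x - expectation f))) * indicator (space M) x \<partial>M)"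
    by (rule Chernoff_ineq_nn_integral_ge[OF l]) measurable
  also have "\<dots> = ennreal (exp (- l * t)) * (\<integral>\<^sup>+x. ennreal (exp (l * (f x - expectation f))) \<partial>M)"
    by (intro arg_cong2[where f = "(*)"] nn_integral_cong) auto
  also have "\<dots> \<le> ennreal (exp (- l * t)) * ennreal (exp (l\<^sup>2 * V))"
    by (intro mult_left_mono subgaussianD f) auto
  also have "\<dots> = ennreal (exp (- t\<^sup>2 / (4 * V)))"
    using exponent by (simp flip: ennreal_mult exp_add)
  finally show ?thesis by (simp add: emeasure_eq_measure)
qed

lemma subgaussian_lower_tail:
  assumes "subgaussian M f V" "V > 0" "t > 0"
  shows "prob {x\<in>space M. f x \<le> expectation f - t} \<le> exp (- t\<^sup>2 / (4 * V))"
proof -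
  have "{x\<in>space M. f x \<le> expectation f - t} = {x\<in>space M. expectation (\<lambda>x. - f x) + t \<le> - f x}"
    by auto
  then show ?thesis
    using subgaussian_upper_tail[OF subgaussian_uminus[OF assms(1)] assms(2,3)] by simp
qed

lemma subgaussian_linear_tails:
  assumes f: "subgaussian M f (b\<^sup>2 / 2 * n)" and pos: "b > 0" "n > 0" "x > 0"
  shows "prob {y\<in>space M. expectation f + x * n \<le> f y} \<le> exp (- (x\<^sup>2 / (2 * b\<^sup>2)) * n)"
    and "prob {y\<in>space M. f y \<le> expectation f - x * n} \<le> exp (- (x\<^sup>2 / (2 * b\<^sup>2)) * n)"
proof -
  have "- (x * n)\<^sup>2 / (4 * (b\<^sup>2 / 2 * n)) = - (x\<^sup>2 / (2 * b\<^sup>2)) * n"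
    using pos by (simp add: power2_eq_square field_simps)
  then show "prob {y\<in>space M. expectation f + x * n \<le> f y} \<le> exp (- (x\<^sup>2 / (2 * b\<^sup>2)) * n)"
    and "prob {y\<in>space M. f y \<le> expectation f - x * n} \<le> exp (- (x\<^sup>2 / (2 * b\<^sup>2)) * n)"
    using subgaussian_upper_tail[OF f, of "x * n"] subgaussian_lower_tail[OF f, of "x * n"] pos by simp_all
qed

lemma subgaussian_mean_abs_deviation_le:
  assumes f: "subgaussian M f V" and V: "V > 0"
  shows "expectation (\<lambda>x. \<bar>f x - expectation f\<bar>) \<le> 6 * sqrt V"
proof -
  let ?d = "\<lambda>x. f x - expectation f"
  have int: "integrable M f" using f by (rule subgaussian_imp_integrable)
  then have [measurable]: "f \<in> borel_measurable M" by simp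
  define l where "l = 1 / sqrt V"
  have l: "l\<^sup>2 * V = 1" using V by (simp add: l_def power_divide)
  have abs_le: "\<bar>?d x\<bar> \<le> sqrt V * (exp (l * ?d x) + exp (- l * ?d x))" for x
  proof -
    have "l * \<bar>?d x\<bar> \<le> exp (l * \<bar>?d x\<bar>)"
      using exp_ge_add_one_self[of "l * \<bar>?d x\<bar>"] by linarith
    also have "\<dots> \<le> exp (l * ?d x) + exp (- l * ?d x)"
      by (cases "f x \<ge> expectation f") (auto simp: algebra_simps)
    finally show ?thesis using V by (simp add: l_def field_simps)
  qed
  have "ennreal (expectation (\<lambda>x. \<bar>?d x\<bar>)) = (\<integral>\<^sup>+x. ennreal \<bar>?d x\<bar> \<partial>M)"
    using int by (intro nn_integral_eq_integral[symmetric]) auto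
  also have "\<dots> \<le> (\<integral>\<^sup>+x. ennreal (sqrt V) * (ennreal (exp (l * ?d x)) + ennreal (exp (- l * ?d x))) \<partial>M)"
    using V abs_le by (intro nn_integral_mono) (simp flip: ennreal_mult ennreal_plus)
  also have "\<dots> = ennreal (sqrt V) *
      ((\<integral>\<^sup>+x. ennreal (exp (l * ?d x)) \<partial>M) + (\<integral>\<^sup>+x. ennreal (exp (- l * ?d x)) \<partial>M))"
    by (simp add: nn_integral_cmult nn_integral_add)
  also have "\<dots> \<le> ennreal (sqrt V) * (ennreal (exp (l\<^sup>2 * V)) + ennreal (exp ((- l)\<^sup>2 * V)))"
    by (intro mult_left_mono add_mono subgaussianD f) auto
  also have "\<dots> = ennreal (sqrt V * (2 * exp 1))"
    using l V by (simp flip: ennreal_mult ennreal_plus)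
  also have "\<dots> \<le> ennreal (6 * sqrt V)"
    using V exp_le by (intro ennreal_leI) auto
  finally show ?thesis using V by simp
qed

lemma exp_expectation_le_nn_integral:
  assumes int: "integrable M f"
  shows "ennreal (exp (expectation f)) \<le> (\<integral>\<^sup>+x. ennreal (exp (f x)) \<partial>M)"
proof (cases "integrable M (\<lambda>x. exp (f x))")
  case True
  have "exp (expectation f) \<le> expectation (\<lambda>x. exp (f x))"
    by (rule jensens_inequality[where I = UNIV]) (use int True convex_on_exp[of 1] in auto)
  then show ?thesis using True by (subst nn_integral_eq_integral) auto
next
  case False
  have [measurable]: "f \<in> borel_measurable M" using int by simp
  have "integrable M (\<lambda>x. exp (f x))" if "(\<integral>\<^sup>+x. ennreal (exp (f x)) \<partial>M) < \<infinity>"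
    by (rule integrableI_nonneg[OF _ _ that]) auto
  then have "(\<integral>\<^sup>+x. ennreal (exp (f x)) \<partial>M) = \<infinity>"
    using False by (metis infinity_ennreal_def less_top)
  then show ?thesis by simp
qed

lemma nn_integral_exp_diff_eq_cosh:
  assumes [measurable]: "f \<in> borel_measurable M"
  shows "(\<integral>\<^sup>+x. \<integral>\<^sup>+y. ennreal (exp (f x - f y)) \<partial>M \<partial>M) = (\<integral>\<^sup>+x. \<integral>\<^sup>+y. ennreal (cosh (f x - f y)) \<partial>M \<partial>M)"
proof -
  interpret pair: pair_prob_space M M ..
  let ?I = "\<integral>\<^sup>+x. \<integral>\<^sup>+y. ennreal (exp (f x - f y)) \<partial>M \<partial>M"
  have swap: "(\<integral>\<^sup>+x. \<integral>\<^sup>+y. ennreal (exp (f y - f x)) \<partial>M \<partial>M) = ?I"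
    by (subst pair.Fubini') auto
  define c :: ennreal where "c = ennreal (1 / 2)"
  have half: "c * ennreal y = ennreal (y / 2)" for y
    unfolding c_def by (subst ennreal_mult'[symmetric]) auto
  have halves: "c + c = 1"
    unfolding c_def by (subst ennreal_plus[symmetric]) auto
  have "(\<integral>\<^sup>+x. \<integral>\<^sup>+y. ennreal (cosh (f x - f y)) \<partial>M \<partial>M) =
      (\<integral>\<^sup>+x. \<integral>\<^sup>+y. c * ennreal (exp (f x - f y)) + c * ennreal (exp (f y - f x)) \<partial>M \<partial>M)"
    by (intro nn_integral_cong) (simp add: half cosh_field_def add_divide_distrib flip: ennreal_plus)
  also have "\<dots> = c * ?I + c * (\<integral>\<^sup>+x. \<integral>\<^sup>+y. ennreal (exp (f y - f x)) \<partial>M \<partial>M)"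
    by (simp add: nn_integral_add nn_integral_cmult)
  also have "\<dots> = ?I"
    unfolding swap by (simp add: halves flip: distrib_right)
  finally show ?thesis ..
qed

lemma nn_integral_exp_centered_le_cosh:
  assumes int: "integrable M f"
  shows "(\<integral>\<^sup>+x. ennreal (exp (f x - expectation f)) \<partial>M) \<le> (\<integral>\<^sup>+x. \<integral>\<^sup>+y. ennreal (cosh (f x - f y)) \<partial>M \<partial>M)"
proof -
  have "ennreal (exp (f x - expectation f)) \<le> (\<integral>\<^sup>+y. ennreal (exp (f x - f y)) \<partial>M)" for x
    using exp_expectation_le_nn_integral[of "\<lambda>y. f x - f y"] int by (simp add: prob_space)
  then have "(\<integral>\<^sup>+x. ennreal (exp (f x - expectation f)) \<partial>M) \<le> (\<integral>\<^sup>+x. \<integral>\<^sup>+y. ennreal (exp (f x - f y)) \<partial>M \<partial>M)"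
    by (intro nn_integral_mono)
  also have "\<dots> = (\<integral>\<^sup>+x. \<integral>\<^sup>+y. ennreal (cosh (f x - f y)) \<partial>M \<partial>M)"
    using int by (intro nn_integral_exp_diff_eq_cosh) simp
  finally show ?thesis .
qed

end

section \<open>The standard Gaussian measure\<close>

interpretation gauss: prob_space gauss
  unfolding gauss_def by (rule prob_space_normal_density) simp

lemma sets_gauss [simp, measurable_cong]: "sets gauss = sets borel"
  by (simp add: gauss_def)

lemma space_gauss [simp]: "space gauss = UNIV"
  by (simp add: gauss_def)

lemma measurable_from_gauss [simp]: "measurable gauss M = measurable borel M"
  by (rule measurable_cong_sets) auto

lemma measurable_into_gauss [simp]: "measurable M gauss = measurable M borel"
  by (rule measurable_cong_sets) auto

lemmas gauss_prob_UNIV [simp] = gauss.prob_space[simplified]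

lemmas gauss_emeasure_UNIV [simp] = gauss.emeasure_space_1[simplified]

lemma nn_integral_gauss:
  assumes [measurable]: "f \<in> borel_measurable borel"
  shows "(\<integral>\<^sup>+x. f x \<partial>gauss) = (\<integral>\<^sup>+x. ennreal (std_normal_density x) * f x \<partial>lborel)"
  unfolding gauss_def by (subst nn_integral_density) auto

lemma integral_gauss:
  fixes f :: "real \<Rightarrow> real"
  assumes [measurable]: "f \<in> borel_measurable borel"
  shows "(\<integral>x. f x \<partial>gauss) = (\<integral>x. std_normal_density x * f x \<partial>lborel)"
  unfolding gauss_def by (subst integral_density) auto

lemma integrable_gauss_iff:
  fixes f :: "real \<Rightarrow> real"
  assumes [measurable]: "f \<in> borel_measurable borel"
  shows "integrable gauss f \<longleftrightarrow> integrable lborel (\<lambda>x. std_normal_density x * f x)"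
  unfolding gauss_def by (subst integrable_density) auto

lemma integrable_gauss_abs: "integrable gauss (\<lambda>x. \<bar>x\<bar>)"
  using integrable_std_normal_moment_abs[of 1] by (subst integrable_gauss_iff) auto

lemma nn_integral_gauss_shift:
  assumes [measurable]: "f \<in> borel_measurable borel"
  shows "(\<integral>\<^sup>+x. f (x + b) \<partial>gauss) = (\<integral>\<^sup>+x. ennreal (exp (b * x - b\<^sup>2 / 2)) * f x \<partial>gauss)"
proof -
  have shifted_density: "std_normal_density (x - b) = std_normal_density x * exp (b * x - b\<^sup>2 / 2)" for x
    by (simp add: std_normal_density_def exp_add[symmetric] power2_eq_square field_simps)
  have "(\<integral>\<^sup>+x. f (x + b) \<partial>gauss) = (\<integral>\<^sup>+x. ennreal (std_normal_density x) * f (x + b) \<partial>lborel)"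
    by (subst nn_integral_gauss) auto
  also have "\<dots> = (\<integral>\<^sup>+x. ennreal (std_normal_density (x - b)) * f x \<partial>lborel)"
    using nn_integral_real_affine[of "\<lambda>x. ennreal (std_normal_density (x - b)) * f x" 1 b]
    by (simp add: add.commute)
  also have "\<dots> = (\<integral>\<^sup>+x. ennreal (exp (b * x - b\<^sup>2 / 2)) * f x \<partial>gauss)"
    by (subst nn_integral_gauss) (auto simp: shifted_density ennreal_mult mult.assoc)
  finally show ?thesis .
qed

lemma nn_integral_gauss_uminus:
  assumes [measurable]: "f \<in> borel_measurable borel"
  shows "(\<integral>\<^sup>+x. f (- x) \<partial>gauss) = (\<integral>\<^sup>+x. f x \<partial>gauss)"
proof -
  have "(\<integral>\<^sup>+x. f (- x) \<partial>gauss) = (\<integral>\<^sup>+x. ennreal (std_normal_density x) * f (- x) \<partial>lborel)"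
    by (subst nn_integral_gauss) auto
  also have "\<dots> = (\<integral>\<^sup>+x. ennreal (std_normal_density x) * f x \<partial>lborel)"
    using nn_integral_real_affine[of "\<lambda>x. ennreal (std_normal_density x) * f x" "-1" 0]
    by (simp add: std_normal_density_def)
  also have "\<dots> = (\<integral>\<^sup>+x. f x \<partial>gauss)"
    by (subst nn_integral_gauss) auto
  finally show ?thesis .
qed

lemma nn_integral_gauss_exp: "(\<integral>\<^sup>+x. ennreal (exp (k * x)) \<partial>gauss) = ennreal (exp (k\<^sup>2 / 2))"
proof -
  have "(\<integral>\<^sup>+x. ennreal (exp (k * x)) \<partial>gauss) =
     (\<integral>\<^sup>+x. ennreal (exp (k\<^sup>2 / 2)) * (ennreal (exp (k * x - k\<^sup>2 / 2)) * 1) \<partial>gauss)"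
    by (intro nn_integral_cong) (simp flip: ennreal_mult exp_add)
  also have "\<dots> = ennreal (exp (k\<^sup>2 / 2)) * (\<integral>\<^sup>+x. ennreal (exp (k * x - k\<^sup>2 / 2)) * 1 \<partial>gauss)"
    by (subst nn_integral_cmult) auto
  also have "\<dots> = ennreal (exp (k\<^sup>2 / 2))"
    by (subst nn_integral_gauss_shift[symmetric]) auto
  finally show ?thesis .
qed

lemma integrable_gauss_lipschitz:
  fixes f :: "real \<Rightarrow> real"
  assumes "c-lipschitz_on UNIV f"
  shows "integrable gauss f"
proof (rule Bochner_Integration.integrable_bound)
  show "integrable gauss (\<lambda>x. \<bar>f 0\<bar> + c * \<bar>x\<bar>)"
    using integrable_gauss_abs by auto
  show "f \<in> borel_measurable gauss"
    using lipschitz_on_continuous_on[OF assms] by (simp add: borel_measurable_continuous_onI)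
  have "\<bar>f x\<bar> \<le> \<bar>f 0\<bar> + c * \<bar>x\<bar>" for x
    using lipschitz_onD[OF assms, of x 0] by (simp add: dist_real_def)
  then show "AE x in gauss. norm (f x) \<le> norm (\<bar>f 0\<bar> + c * \<bar>x\<bar>)"
    by (auto intro: order_trans[OF _ abs_ge_self])
qed

text \<open>Symmetrisation turns the exponential into a hyperbolic cosine, which is monotone in the absolute
  value of its argument; this compares \<^term>\<open>f\<close> with the linear function of slope \<^term>\<open>c\<close>.\<close>
lemma subgaussian_gauss_lipschitz:
  fixes f :: "real \<Rightarrow> real"
  assumes lip: "c-lipschitz_on UNIV f"
  shows "subgaussian gauss f (c\<^sup>2)"
  unfolding subgaussian_def
proof (intro conjI allI)
  show int: "integrable gauss f" by (rule integrable_gauss_lipschitz[OF lip])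
  fix l :: real
  have "(\<integral>\<^sup>+x. ennreal (exp (l * (f x - (\<integral>y. f y \<partial>gauss)))) \<partial>gauss) \<le>
      (\<integral>\<^sup>+x. \<integral>\<^sup>+y. ennreal (cosh (l * f x - l * f y)) \<partial>gauss \<partial>gauss)"
    using gauss.nn_integral_exp_centered_le_cosh[of "\<lambda>x. l * f x"] int by (simp add: right_diff_distrib)
  also have "\<dots> \<le> (\<integral>\<^sup>+x. \<integral>\<^sup>+y. ennreal (cosh (l * c * x - l * c * y)) \<partial>gauss \<partial>gauss)"
  proof (intro nn_integral_mono ennreal_leI)
    fix x y
    have "\<bar>l * (f x - f y)\<bar> \<le> \<bar>l * c * (x - y)\<bar>"
      using lipschitz_onD[OF lip, of x y] lipschitz_on_nonneg[OF lip]
      by (simp add: dist_real_def abs_mult mult.assoc mult_left_mono)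
    then show "cosh (l * f x - l * f y) \<le> cosh (l * c * x - l * c * y)"
      by (metis abs_ge_zero cosh_real_abs cosh_real_nonneg_le_iff right_diff_distrib)
  qed
  also have "\<dots> = (\<integral>\<^sup>+x. \<integral>\<^sup>+y. ennreal (exp (l * c * x - l * c * y)) \<partial>gauss \<partial>gauss)"
    by (rule gauss.nn_integral_exp_diff_eq_cosh[symmetric]) simp
  also have "\<dots> = (\<integral>\<^sup>+x. \<integral>\<^sup>+y. ennreal (exp (l * c * x)) * ennreal (exp (- (l * c) * y)) \<partial>gauss \<partial>gauss)"
    by (intro nn_integral_cong) (simp flip: ennreal_mult exp_add)
  also have "\<dots> = ennreal (exp ((l * c)\<^sup>2 / 2)) * ennreal (exp ((- (l * c))\<^sup>2 / 2))"
    using nn_integral_gauss_exp[of "l * c"] nn_integral_gauss_exp[of "- (l * c)"]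
    by (simp add: nn_integral_cmult nn_integral_multc)
  also have "\<dots> = ennreal (exp (l\<^sup>2 * c\<^sup>2))"
    by (simp add: power_mult_distrib flip: ennreal_mult exp_add)
  finally show "(\<integral>\<^sup>+x. ennreal (exp (l * (f x - (\<integral>y. f y \<partial>gauss)))) \<partial>gauss) \<le> ennreal (exp (l\<^sup>2 * c\<^sup>2))" .
qed

lemma tendsto_std_normal_density:
  "(std_normal_density \<longlongrightarrow> 0) at_top" "(std_normal_density \<longlongrightarrow> 0) at_bot"
  unfolding std_normal_density_def by real_asymp+

lemma gauss_integration_by_parts:
  fixes f f' :: "real \<Rightarrow> real"
  assumes deriv: "\<And>x. (f has_real_derivative f' x) (at x)" and cont: "\<And>x. isCont f' x"
    and bound: "\<And>x. \<bar>f x\<bar> \<le> B" "\<And>x. \<bar>f' x\<bar> \<le> B"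
  shows "(\<integral>x. x * f x \<partial>gauss) = (\<integral>x. f' x \<partial>gauss)"
proof -
  let ?\<phi> = std_normal_density
  have cont_f: "isCont f x" for x using deriv by (rule DERIV_isCont)
  have [measurable]: "f \<in> borel_measurable borel" "f' \<in> borel_measurable borel"
    using cont cont_f by (auto intro!: borel_measurable_continuous_onI simp: continuous_on_eq_continuous_at)
  have deriv_\<phi>: "(?\<phi> has_real_derivative (- x * ?\<phi> x)) (at x)" for x
    unfolding std_normal_density_def by (auto intro!: derivative_eq_intros simp: field_simps)
  have "integrable gauss f'"
    by (rule gauss.integrable_const_bound[of _ B]) (use bound in auto)
  moreover have "integrable gauss (\<lambda>x. x)"
    using integrable_gauss_abs by (subst (asm) integrable_abs_iff) auto
  then have "integrable gauss (\<lambda>x. f x * x)"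
    by (rule integrable_mult_bounded[OF _ _ bound(1)]) measurable
  then have "integrable gauss (\<lambda>x. x * f x)" by (simp add: mult.commute)
  ultimately have int: "integrable lborel (\<lambda>x. ?\<phi> x * f' x)" "integrable lborel (\<lambda>x. ?\<phi> x * (x * f x))"
    by (simp_all add: integrable_gauss_iff)
  have vanish: "((\<lambda>x. ?\<phi> x * f x) \<longlongrightarrow> 0) F" if "(?\<phi> \<longlongrightarrow> 0) F" for F
  proof (rule Lim_null_comparison)
    show "\<forall>\<^sub>F x in F. norm (?\<phi> x * f x) \<le> norm (?\<phi> x) * B"
      by (intro always_eventually allI) (simp add: abs_mult mult_left_mono bound(1))
    show "((\<lambda>x. norm (?\<phi> x) * B) \<longlongrightarrow> 0) F"
      using tendsto_mult_left_zero[OF tendsto_norm_zero[OF that]] by simp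
  qed
  have "(LBINT x=-\<infinity>..\<infinity>. ?\<phi> x * f' x - ?\<phi> x * (x * f x)) = 0 - 0"
  proof (rule interval_integral_FTC_integrable[where F = "\<lambda>x. ?\<phi> x * f x"])
    show "((\<lambda>x. ?\<phi> x * f x) has_vector_derivative ?\<phi> x * f' x - ?\<phi> x * (x * f x)) (at x)" for x
      unfolding has_real_derivative_iff_has_vector_derivative[symmetric]
      by (auto intro!: derivative_eq_intros deriv deriv_\<phi> simp: algebra_simps)
    show "isCont (\<lambda>x. ?\<phi> x * f' x - ?\<phi> x * (x * f x)) x" for x
      using deriv_\<phi> by (intro continuous_intros cont cont_f DERIV_isCont)
    show "set_integrable lborel (einterval (- \<infinity>) \<infinity>) (\<lambda>x. ?\<phi> x * f' x - ?\<phi> x * (x * f x))"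
      using int by (simp add: set_integrable_def)
    show "(((\<lambda>x. ?\<phi> x * f x) \<circ> real_of_ereal) \<longlongrightarrow> 0) (at_right (- \<infinity>))"
      "(((\<lambda>x. ?\<phi> x * f x) \<circ> real_of_ereal) \<longlongrightarrow> 0) (at_left \<infinity>)"
      using vanish tendsto_std_normal_density by (auto simp: ereal_tendsto_simps)
  qed simp
  then have "(\<integral>x. ?\<phi> x * f' x - ?\<phi> x * (x * f x) \<partial>lborel) = 0"
    by (simp add: interval_lebesgue_integral_def set_lebesgue_integral_def)
  then show ?thesis
    using int by (simp add: integral_gauss)
qed

section \<open>Families of independent standard Gaussians\<close>

definition iid_gauss :: "('i \<Rightarrow> real) measure" where
  "iid_gauss = (\<Pi>\<^sub>M i\<in>UNIV. gauss)"

interpretation iid_gauss: prob_space iid_gauss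
  unfolding iid_gauss_def by (intro prob_space_PiM gauss.prob_space_axioms)

lemma space_iid_gauss [simp]: "space iid_gauss = UNIV"
  by (simp add: iid_gauss_def space_PiM)

lemmas iid_gauss_prob_UNIV [simp] = iid_gauss.prob_space[simplified]

lemmas iid_gauss_emeasure_UNIV [simp] = iid_gauss.emeasure_space_1[simplified]

lemma sets_iid_gauss_Collect [measurable (raw)]:
  "Measurable.pred iid_gauss P \<Longrightarrow> {g. P g} \<in> sets iid_gauss"
  by (drule predE) simp

lemma measurable_coordinate [measurable]: "(\<lambda>g. g i) \<in> borel_measurable iid_gauss"
  using measurable_component_singleton[of i UNIV "\<lambda>_. gauss"] by (simp add: iid_gauss_def)

lemma measurable_into_iid_gauss:
  assumes "\<And>i. (\<lambda>x. f x i) \<in> borel_measurable M"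
  shows "f \<in> measurable M iid_gauss"
  unfolding iid_gauss_def by (rule measurable_PiM_single') (use assms in auto)

lemma measurable_fun_upd_iid_gauss [measurable (raw)]:
  assumes [measurable]: "\<phi> \<in> measurable M iid_gauss" "h \<in> borel_measurable M"
  shows "(\<lambda>x. (\<phi> x)(i := h x)) \<in> measurable M iid_gauss"
proof (rule measurable_into_iid_gauss)
  show "(\<lambda>x. ((\<phi> x)(i := h x)) j) \<in> borel_measurable M" for j
    by (cases "j = i") (auto intro: measurable_compose[OF assms(1) measurable_coordinate])
qed

lemma measurable_resample_coordinate [measurable]: "(\<lambda>x. g(i := x)) \<in> measurable borel iid_gauss"
  by (rule measurable_fun_upd_iid_gauss) auto

lemma distr_coordinate: "distr iid_gauss gauss (\<lambda>g. g i) = gauss"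
  unfolding iid_gauss_def by (rule distr_PiM_component) (auto intro: gauss.prob_space_axioms)

lemma integrable_coordinate_abs: "integrable iid_gauss (\<lambda>g. \<bar>g i\<bar>)"
proof -
  have "integrable (distr iid_gauss gauss (\<lambda>g. g i)) (\<lambda>x. \<bar>x\<bar>)"
    by (simp add: distr_coordinate integrable_gauss_abs)
  then show ?thesis
    by (subst (asm) integrable_distr_eq) auto
qed

lemma integrable_coordinate: "integrable iid_gauss (\<lambda>g. g i)"
  using integrable_coordinate_abs by (rule Bochner_Integration.integrable_bound) auto

lemma integrable_linear: "integrable iid_gauss (\<lambda>g. \<Sum>i\<in>J. b i * g i)"
  by (intro Bochner_Integration.integrable_sum integrable_mult_right integrable_coordinate)

subsection \<open>Resampling, reindexing and merging\<close>

interpretation gauss_iid_gauss: pair_prob_space gauss iid_gauss ..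

interpretation iid_gauss_pair: pair_prob_space iid_gauss iid_gauss ..

lemma distr_resample:
  "distr (gauss \<Otimes>\<^sub>M iid_gauss) iid_gauss (\<lambda>(x, g). g(i := x)) = iid_gauss"
  using distr_pair_PiM_eq_PiM[of UNIV "\<lambda>_. gauss" i] gauss.prob_space_axioms
  by (simp add: iid_gauss_def)

lemma nn_integral_resample:
  assumes [measurable]: "f \<in> borel_measurable iid_gauss"
  shows "(\<integral>\<^sup>+g. f g \<partial>iid_gauss) = (\<integral>\<^sup>+g. \<integral>\<^sup>+x. f (g(i := x)) \<partial>gauss \<partial>iid_gauss)"
proof -
  have "(\<integral>\<^sup>+g. f g \<partial>iid_gauss) = (\<integral>\<^sup>+z. f ((snd z)(i := fst z)) \<partial>(gauss \<Otimes>\<^sub>M iid_gauss))"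
    by (subst distr_resample[of i, symmetric], subst nn_integral_distr) (auto simp: split_beta)
  also have "\<dots> = (\<integral>\<^sup>+g. \<integral>\<^sup>+x. f (g(i := x)) \<partial>gauss \<partial>iid_gauss)"
    by (subst gauss_iid_gauss.nn_integral_snd[symmetric]) (auto simp: split_beta)
  finally show ?thesis .
qed

lemma integral_resample:
  fixes f :: "('i \<Rightarrow> real) \<Rightarrow> real"
  assumes f: "integrable iid_gauss f"
  shows "(\<integral>g. f g \<partial>iid_gauss) = (\<integral>g. (\<integral>x. f (g(i := x)) \<partial>gauss) \<partial>iid_gauss)"
proof -
  have [measurable]: "f \<in> borel_measurable iid_gauss" using f by simp
  have "integrable (distr (gauss \<Otimes>\<^sub>M iid_gauss) iid_gauss (\<lambda>(x, g). g(i := x))) f"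
    using f by (simp add: distr_resample)
  then have int: "integrable (gauss \<Otimes>\<^sub>M iid_gauss) (case_prod (\<lambda>x g. f (g(i := x))))"
    by (subst (asm) integrable_distr_eq) (auto simp: split_beta')
  have "(\<integral>g. f g \<partial>iid_gauss) = (\<integral>z. f ((snd z)(i := fst z)) \<partial>(gauss \<Otimes>\<^sub>M iid_gauss))"
    by (subst distr_resample[of i, symmetric], subst integral_distr) (auto simp: split_beta)
  also have "\<dots> = (\<integral>g. (\<integral>x. f (g(i := x)) \<partial>gauss) \<partial>iid_gauss)"
    by (subst gauss_iid_gauss.integral_snd[OF int]) (simp add: split_beta')
  finally show ?thesis .
qed

lemma measurable_reindex: "(\<lambda>g i. g (f i)) \<in> measurable iid_gauss iid_gauss"
  by (rule measurable_into_iid_gauss) measurable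

lemma distr_reindex:
  assumes "inj f"
  shows "distr iid_gauss iid_gauss (\<lambda>g i. g (f i)) = iid_gauss"
  using distr_PiM_reindex[of UNIV "\<lambda>_. gauss" f UNIV] assms gauss.prob_space_axioms
  by (simp add: iid_gauss_def restrict_UNIV)

lemma integral_reindex:
  fixes \<phi> :: "('i \<Rightarrow> real) \<Rightarrow> real"
  assumes "inj f" "\<phi> \<in> borel_measurable iid_gauss"
  shows "(\<integral>g. \<phi> (\<lambda>i. g (f i)) \<partial>iid_gauss) = (\<integral>g. \<phi> g \<partial>iid_gauss)"
  using integral_distr[OF measurable_reindex assms(2), of f] by (simp add: distr_reindex[OF assms(1)])

lemma integrable_reindex:
  fixes \<phi> :: "('i \<Rightarrow> real) \<Rightarrow> real"
  assumes "inj f" "integrable iid_gauss \<phi>"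
  shows "integrable iid_gauss (\<lambda>g. \<phi> (\<lambda>i. g (f i)))"
  using integrable_distr_eq[OF measurable_reindex borel_measurable_integrable[OF assms(2)], of f] assms(2)
  by (simp add: distr_reindex[OF assms(1)])

lemma measurable_merge [measurable]:
  "(\<lambda>(g', g) i. if i \<in> K then g' i else g i) \<in> measurable (iid_gauss \<Otimes>\<^sub>M iid_gauss) iid_gauss"
proof (rule measurable_into_iid_gauss)
  show "(\<lambda>z. (case z of (g', g) \<Rightarrow> \<lambda>i. if i \<in> K then g' i else g i) i)
      \<in> borel_measurable (iid_gauss \<Otimes>\<^sub>M iid_gauss)" for i
    by (cases "i \<in> K") (auto simp: split_beta' intro: measurable_compose[OF _ measurable_coordinate])
qed

lemma emeasure_iid_gauss_cylinder:
  assumes "finite J" "\<And>i. i \<in> J \<Longrightarrow> A i \<in> sets borel"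
  shows "emeasure iid_gauss {g. \<forall>i\<in>J. g i \<in> A i} = (\<Prod>i\<in>J. emeasure gauss (A i))"
proof -
  have "prod_emb UNIV (\<lambda>_. gauss) J (Pi\<^sub>E J A) = {g. \<forall>i\<in>J. g i \<in> A i}"
    by (auto simp: prod_emb_def PiE_iff)
  then show ?thesis
    using emeasure_PiM_emb[where I = UNIV and M = "\<lambda>_. gauss" and J = J and A = A] assms gauss.prob_space_axioms
    by (simp add: iid_gauss_def)
qed

lemma distr_merge:
  fixes K :: "'i set"
  shows "distr (iid_gauss \<Otimes>\<^sub>M iid_gauss) iid_gauss (\<lambda>(g', g) i. if i \<in> K then g' i else g i) = iid_gauss"
  (is "distr _ _ ?merge = _")
  unfolding iid_gauss_def
proof (rule measure_eqI_PiM_infinite[symmetric, OF refl])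
  show "sets (distr (Pi\<^sub>M UNIV (\<lambda>_. gauss) \<Otimes>\<^sub>M Pi\<^sub>M UNIV (\<lambda>_. gauss)) (Pi\<^sub>M UNIV (\<lambda>_. gauss)) ?merge) =
      sets (Pi\<^sub>M UNIV (\<lambda>_. gauss))" by simp
  show "finite_measure (Pi\<^sub>M UNIV (\<lambda>_. gauss))"
    unfolding iid_gauss_def[symmetric] by (rule iid_gauss.finite_measure_axioms)
  fix A :: "'i \<Rightarrow> real set" and J assume J: "finite J" "J \<subseteq> UNIV" and A: "\<And>i. i \<in> J \<Longrightarrow> A i \<in> sets gauss"
  have emb: "prod_emb UNIV (\<lambda>_. gauss) J (Pi\<^sub>E J A) = {g. \<forall>i\<in>J. g i \<in> A i}"
    by (auto simp: prod_emb_def PiE_iff)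
  have [measurable]: "{g. \<forall>i\<in>J'. g i \<in> A i} \<in> sets iid_gauss" if "J' \<subseteq> J" for J'
  proof -
    have "countable J'" "\<And>i. i \<in> J' \<Longrightarrow> A i \<in> sets borel"
      using that J A finite_subset[of J' J] by (auto intro: countable_finite)
    then show ?thesis by measurable
  qed
  have "emeasure (distr (iid_gauss \<Otimes>\<^sub>M iid_gauss) iid_gauss ?merge) {g. \<forall>i\<in>J. g i \<in> A i} =
      emeasure (iid_gauss \<Otimes>\<^sub>M iid_gauss) ({g. \<forall>i\<in>J \<inter> K. g i \<in> A i} \<times> {g. \<forall>i\<in>J - K. g i \<in> A i})"
    by (subst emeasure_distr)
       (auto simp: space_pair_measure intro!: arg_cong2[where f = emeasure] split: if_splits)
  also have "\<dots> = emeasure iid_gauss {g. \<forall>i\<in>J \<inter> K. g i \<in> A i} * emeasure iid_gauss {g. \<forall>i\<in>J - K. g i \<in> A i}"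
    by (rule iid_gauss.emeasure_pair_measure_Times) auto
  also have "\<dots> = emeasure iid_gauss {g. \<forall>i\<in>J. g i \<in> A i}"
    using J A emeasure_iid_gauss_cylinder[of "J \<inter> K" A] emeasure_iid_gauss_cylinder[of "J - K" A]
      emeasure_iid_gauss_cylinder[of J A] by (simp add: prod.Int_Diff[of J _ K])
  finally show "emeasure (Pi\<^sub>M UNIV (\<lambda>_. gauss)) (prod_emb UNIV (\<lambda>_. gauss) J (Pi\<^sub>E J A)) =
      emeasure (distr (Pi\<^sub>M UNIV (\<lambda>_. gauss) \<Otimes>\<^sub>M Pi\<^sub>M UNIV (\<lambda>_. gauss)) (Pi\<^sub>M UNIV (\<lambda>_. gauss)) ?merge)
        (prod_emb UNIV (\<lambda>_. gauss) J (Pi\<^sub>E J A))"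
    by (simp add: emb iid_gauss_def)
qed

lemma
  fixes f :: "('i \<Rightarrow> real) \<Rightarrow> real"
  assumes f: "integrable iid_gauss f"
  shows integrable_merge: "integrable iid_gauss (\<lambda>g. \<integral>g'. f (\<lambda>i. if i \<in> K then g' i else g i) \<partial>iid_gauss)"
    and integral_merge:
      "(\<integral>g. f g \<partial>iid_gauss) = (\<integral>g. (\<integral>g'. f (\<lambda>i. if i \<in> K then g' i else g i) \<partial>iid_gauss) \<partial>iid_gauss)"
proof -
  let ?merge = "\<lambda>(g', g) i. if i \<in> K then g' i else g i"
  have [measurable]: "f \<in> borel_measurable iid_gauss" using f by simp
  have "integrable (distr (iid_gauss \<Otimes>\<^sub>M iid_gauss) iid_gauss ?merge) f"
    using f by (simp add: distr_merge)
  then have int: "integrable (iid_gauss \<Otimes>\<^sub>M iid_gauss) (case_prod (\<lambda>g' g. f (\<lambda>i. if i \<in> K then g' i else g i)))"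
    using integrable_distr_eq[OF measurable_merge, of f K] by (simp add: split_beta' cong: if_cong)
  show "integrable iid_gauss (\<lambda>g. \<integral>g'. f (\<lambda>i. if i \<in> K then g' i else g i) \<partial>iid_gauss)"
    by (rule iid_gauss_pair.integrable_snd[OF int])
  have "(\<integral>g. f g \<partial>iid_gauss) = (\<integral>z. f (?merge z) \<partial>(iid_gauss \<Otimes>\<^sub>M iid_gauss))"
    using integral_distr[OF measurable_merge, of f K] by (simp add: distr_merge)
  also have "\<dots> = (\<integral>g. (\<integral>g'. f (\<lambda>i. if i \<in> K then g' i else g i) \<partial>iid_gauss) \<partial>iid_gauss)"
    using iid_gauss_pair.integral_snd[OF int] by (simp add: split_beta' cong: if_cong)
  finally show "(\<integral>g. f g \<partial>iid_gauss) = (\<integral>g. (\<integral>g'. f (\<lambda>i. if i \<in> K then g' i else g i) \<partial>iid_gauss) \<partial>iid_gauss)" .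
qed

subsection \<open>Changes of variables\<close>

lemma nn_integral_coordinatewise_transform:
  assumes "finite J" "f \<in> borel_measurable iid_gauss"
    and "\<And>i. i \<in> J \<Longrightarrow> T i \<in> borel_measurable borel"
    and "\<And>i. i \<in> J \<Longrightarrow> D i \<in> borel_measurable borel"
    and "\<And>i u. i \<in> J \<Longrightarrow> u \<in> borel_measurable borel \<Longrightarrow>
      (\<integral>\<^sup>+x. u (T i x) \<partial>gauss) = (\<integral>\<^sup>+x. D i x * u x \<partial>gauss)"
  shows "(\<integral>\<^sup>+g. f (\<lambda>i. if i \<in> J then T i (g i) else g i) \<partial>iid_gauss) =
    (\<integral>\<^sup>+g. (\<Prod>i\<in>J. D i (g i)) * f g \<partial>iid_gauss)"
  using assms
proof (induction J arbitrary: f rule: finite_induct)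
  case empty
  then show ?case by simp
next
  case (insert i J)
  have [measurable]: "f \<in> borel_measurable iid_gauss" "T i \<in> borel_measurable borel" "D i \<in> borel_measurable borel"
    using insert.prems by auto
  have [measurable]: "D j \<in> borel_measurable borel" if "j \<in> J" for j
    using insert.prems(3) that by auto
  have D_upd: "(\<Prod>j\<in>J. D j ((g(i := x)) j)) = (\<Prod>j\<in>J. D j (g j))" for g x
    using insert.hyps by (intro prod.cong) auto
  have split: "(\<lambda>j. if j \<in> insert i J then T j (g j) else g j) =
      (\<lambda>j. if j \<in> J then T j (g j) else g j)(i := T i (g i))" for g
    by auto
  have "(\<integral>\<^sup>+g. f (\<lambda>j. if j \<in> insert i J then T j (g j) else g j) \<partial>iid_gauss) =
     (\<integral>\<^sup>+g. (\<lambda>g. f (g(i := T i (g i)))) (\<lambda>j. if j \<in> J then T j (g j) else g j) \<partial>iid_gauss)"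
    using insert.hyps by (simp only: split if_False)
  also have "\<dots> = (\<integral>\<^sup>+g. (\<Prod>j\<in>J. D j (g j)) * f (g(i := T i (g i))) \<partial>iid_gauss)"
    using insert.prems by (intro insert.IH) (auto simp del: fun_upd_apply)
  also have "\<dots> = (\<integral>\<^sup>+g. (\<Prod>j\<in>J. D j (g j)) * (\<integral>\<^sup>+x. f (g(i := T i x)) \<partial>gauss) \<partial>iid_gauss)"
    by (subst nn_integral_resample[where i = i]) (auto simp: D_upd nn_integral_cmult fun_upd_same simp del: fun_upd_apply)
  also have "\<dots> = (\<integral>\<^sup>+g. (\<Prod>j\<in>J. D j (g j)) * (\<integral>\<^sup>+x. D i x * f (g(i := x)) \<partial>gauss) \<partial>iid_gauss)"
    using insert.prems(4)[of i "\<lambda>x. f (_(i := x))"] by simp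
  also have "\<dots> = (\<integral>\<^sup>+g. \<integral>\<^sup>+x. (\<Prod>j\<in>insert i J. D j ((g(i := x)) j)) * f (g(i := x)) \<partial>gauss \<partial>iid_gauss)"
    using insert.hyps by (simp add: D_upd fun_upd_same mult_ac flip: nn_integral_cmult del: fun_upd_apply)
  also have "\<dots> = (\<integral>\<^sup>+g. (\<Prod>j\<in>insert i J. D j (g j)) * f g \<partial>iid_gauss)"
    using insert.hyps by (intro nn_integral_resample[symmetric]) simp
  finally show ?case .
qed

lemma nn_integral_sign_flip:
  assumes "finite J" "f \<in> borel_measurable iid_gauss" "\<And>i. i \<in> J \<Longrightarrow> s i = 1 \<or> s i = (-1::real)"
  shows "(\<integral>\<^sup>+g. f (\<lambda>i. if i \<in> J then s i * g i else g i) \<partial>iid_gauss) = (\<integral>\<^sup>+g. f g \<partial>iid_gauss)"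
proof -
  have "(\<integral>\<^sup>+x. u (s i * x) \<partial>gauss) = (\<integral>\<^sup>+x. 1 * u x \<partial>gauss)"
    if "i \<in> J" "u \<in> borel_measurable borel" for i and u :: "real \<Rightarrow> ennreal"
    using assms(3)[OF that(1)] nn_integral_gauss_uminus[OF that(2)] by auto
  then show ?thesis
    using nn_integral_coordinatewise_transform[where T = "\<lambda>i x. s i * x" and D = "\<lambda>_ _. 1", OF assms(1,2)] by simp
qed

lemma cameron_martin:
  assumes "finite J" "f \<in> borel_measurable iid_gauss"
  shows "(\<integral>\<^sup>+g. f (\<lambda>i. g i + (if i \<in> J then b i else 0)) \<partial>iid_gauss) =
     (\<integral>\<^sup>+g. ennreal (exp ((\<Sum>i\<in>J. b i * g i) - (\<Sum>i\<in>J. (b i)\<^sup>2) / 2)) * f g \<partial>iid_gauss)"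
proof -
  have density: "(\<Prod>i\<in>J. ennreal (exp (b i * g i - (b i)\<^sup>2 / 2))) =
      ennreal (exp ((\<Sum>i\<in>J. b i * g i) - (\<Sum>i\<in>J. (b i)\<^sup>2) / 2))" for g
    using assms(1) by (simp add: prod_ennreal exp_sum[symmetric] sum_subtractf sum_divide_distrib)
  have "(\<lambda>i. g i + (if i \<in> J then b i else 0)) = (\<lambda>i. if i \<in> J then g i + b i else g i)" for g
    by auto
  then show ?thesis
    using nn_integral_coordinatewise_transform[where T = "\<lambda>i x. x + b i"
        and D = "\<lambda>i x. ennreal (exp (b i * x - (b i)\<^sup>2 / 2))", OF assms]
    by (simp add: nn_integral_gauss_shift density)
qed

lemma nn_integral_exp_linear:
  assumes "finite J"
  shows "(\<integral>\<^sup>+g. ennreal (exp (\<Sum>i\<in>J. b i * g i)) \<partial>iid_gauss) = ennreal (exp ((\<Sum>i\<in>J. (b i)\<^sup>2) / 2))"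
proof -
  let ?v = "(\<Sum>i\<in>J. (b i)\<^sup>2) / 2"
  have "(\<integral>\<^sup>+g. ennreal (exp (\<Sum>i\<in>J. b i * g i)) \<partial>iid_gauss) =
      (\<integral>\<^sup>+g. ennreal (exp ?v) * (ennreal (exp ((\<Sum>i\<in>J. b i * g i) - ?v)) * 1) \<partial>iid_gauss)"
    by (intro nn_integral_cong) (simp flip: ennreal_mult exp_add)
  also have "\<dots> = ennreal (exp ?v) * (\<integral>\<^sup>+g. ennreal (exp ((\<Sum>i\<in>J. b i * g i) - ?v)) * 1 \<partial>iid_gauss)"
    by (subst nn_integral_cmult) auto
  also have "\<dots> = ennreal (exp ?v)"
    by (subst cameron_martin[OF assms, symmetric]) auto
  finally show ?thesis .
qed

subsection \<open>Integration by parts and concentration\<close>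

lemma iid_gauss_integration_by_parts:
  fixes \<phi> \<phi>' :: "('i \<Rightarrow> real) \<Rightarrow> real"
  assumes [measurable]: "\<phi> \<in> borel_measurable iid_gauss" "\<phi>' \<in> borel_measurable iid_gauss"
    and deriv: "\<And>g x. ((\<lambda>x. \<phi> (g(i := x))) has_real_derivative \<phi>' (g(i := x))) (at x)"
    and cont: "\<And>g x. isCont (\<lambda>x. \<phi>' (g(i := x))) x"
    and bound: "\<And>g. \<bar>\<phi> g\<bar> \<le> B" "\<And>g. \<bar>\<phi>' g\<bar> \<le> B"
  shows "(\<integral>g. g i * \<phi> g \<partial>iid_gauss) = (\<integral>g. \<phi>' g \<partial>iid_gauss)"
proof -
  have "integrable iid_gauss (\<lambda>g. \<phi> g * g i)"
    by (rule integrable_mult_bounded[OF integrable_coordinate _ bound(1)]) measurable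
  then have "(\<integral>g. g i * \<phi> g \<partial>iid_gauss) = (\<integral>g. (\<integral>x. x * \<phi> (g(i := x)) \<partial>gauss) \<partial>iid_gauss)"
    by (subst integral_resample[where i = i]) (simp_all add: mult.commute)
  also have "\<dots> = (\<integral>g. (\<integral>x. \<phi>' (g(i := x)) \<partial>gauss) \<partial>iid_gauss)"
    by (subst gauss_integration_by_parts[OF deriv cont bound]) (rule refl)
  also have "\<dots> = (\<integral>g. \<phi>' g \<partial>iid_gauss)"
    by (rule integral_resample[symmetric], rule iid_gauss.integrable_const_bound[of _ B]) (use bound in auto)
  finally show ?thesis .
qed

definition coord_lipschitz :: "'i set \<Rightarrow> ('i \<Rightarrow> real) \<Rightarrow> (('i \<Rightarrow> real) \<Rightarrow> real) \<Rightarrow> bool" where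
  "coord_lipschitz J c f \<longleftrightarrow> (\<forall>g g'. \<bar>f g - f g'\<bar> \<le> (\<Sum>i\<in>J. c i * \<bar>g i - g' i\<bar>))"

lemma coord_lipschitzD:
  "coord_lipschitz J c f \<Longrightarrow> \<bar>f g - f g'\<bar> \<le> (\<Sum>i\<in>J. c i * \<bar>g i - g' i\<bar>)"
  by (simp add: coord_lipschitz_def)

lemma integrable_coord_lipschitz:
  assumes f: "coord_lipschitz J c f" "f \<in> borel_measurable iid_gauss"
  shows "integrable iid_gauss f"
proof (rule Bochner_Integration.integrable_bound)
  show "integrable iid_gauss (\<lambda>g. \<bar>f (\<lambda>_. 0)\<bar> + (\<Sum>i\<in>J. c i * \<bar>g i\<bar>))"
    by (intro Bochner_Integration.integrable_add Bochner_Integration.integrable_sum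
        integrable_mult_right integrable_coordinate_abs) simp
  have "norm (f g) \<le> norm (\<bar>f (\<lambda>_. 0)\<bar> + (\<Sum>i\<in>J. c i * \<bar>g i\<bar>))" for g
    using coord_lipschitzD[OF f(1), of g "\<lambda>_. 0"] by simp
  then show "AE g in iid_gauss. norm (f g) \<le> norm (\<bar>f (\<lambda>_. 0)\<bar> + (\<Sum>i\<in>J. c i * \<bar>g i\<bar>))" by simp
qed (rule f)

lemma coord_lipschitz_coordinate:
  assumes "finite J" "i \<in> J" and f: "coord_lipschitz J c f"
  shows "(c i)-lipschitz_on UNIV (\<lambda>x. f (g(i := x)))"
proof (rule lipschitz_onI)
  have sum_eq: "(\<Sum>j\<in>J. c j * \<bar>(g(i := x)) j - (g(i := y)) j\<bar>) = c i * \<bar>x - y\<bar>" for x y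
    using assms(1,2) by (simp add: sum.remove[of J i])
  show le: "dist (f (g(i := x))) (f (g(i := y))) \<le> c i * dist x y" for x y
    using coord_lipschitzD[OF f, of "g(i := x)" "g(i := y)"] unfolding sum_eq dist_real_def .
  show "0 \<le> c i" using order_trans[OF zero_le_dist le[of 1 0]] by simp
qed

lemma coord_lipschitz_integrate_out:
  assumes "finite J" "i \<notin> J" and f: "coord_lipschitz (insert i J) c f"
  shows "coord_lipschitz J c (\<lambda>g. \<integral>x. f (g(i := x)) \<partial>gauss)"
  unfolding coord_lipschitz_def
proof (intro allI)
  fix g g'
  have int: "integrable gauss (\<lambda>x. f (h(i := x)))" for h
    by (rule integrable_gauss_lipschitz[OF coord_lipschitz_coordinate[OF _ _ f]]) (use assms in auto)
  have "(\<Sum>j\<in>J. c j * \<bar>(g(i := x)) j - (g'(i := x)) j\<bar>) = (\<Sum>j\<in>J. c j * \<bar>g j - g' j\<bar>)" for x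
    using assms by (intro sum.cong) auto
  then have le: "\<bar>f (g(i := x)) - f (g'(i := x))\<bar> \<le> (\<Sum>j\<in>J. c j * \<bar>g j - g' j\<bar>)" for x
    using coord_lipschitzD[OF f, of "g(i := x)" "g'(i := x)"] assms by simp
  have "\<bar>(\<integral>x. f (g(i := x)) \<partial>gauss) - (\<integral>x. f (g'(i := x)) \<partial>gauss)\<bar> \<le>
      (\<integral>x. \<bar>f (g(i := x)) - f (g'(i := x))\<bar> \<partial>gauss)"
    using int by (simp flip: Bochner_Integration.integral_diff)
  also have "\<dots> \<le> (\<integral>x. (\<Sum>j\<in>J. c j * \<bar>g j - g' j\<bar>) \<partial>gauss)"
    using int le by (intro integral_mono) auto
  finally show "\<bar>(\<integral>x. f (g(i := x)) \<partial>gauss) - (\<integral>x. f (g'(i := x)) \<partial>gauss)\<bar> \<le> (\<Sum>j\<in>J. c j * \<bar>g j - g' j\<bar>)"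
    by simp
qed

lemma subgaussian_resample:
  assumes f: "integrable iid_gauss f"
    and coordinate: "\<And>g. subgaussian gauss (\<lambda>x. f (g(i := x))) V"
    and rest: "subgaussian iid_gauss (\<lambda>g. \<integral>x. f (g(i := x)) \<partial>gauss) V'"
  shows "subgaussian iid_gauss f (V + V')"
  unfolding subgaussian_def
proof (intro conjI allI)
  have [measurable]: "f \<in> borel_measurable iid_gauss" using f by simp
  have resample: "(\<lambda>x. f (g(i := x))) \<in> borel_measurable borel" for g
    by (rule measurable_compose[OF measurable_resample_coordinate]) measurable
  fix l
  define h where "h g = (\<integral>x. f (g(i := x)) \<partial>gauss)" for g
  have [measurable]: "h \<in> borel_measurable iid_gauss"
    using subgaussian_imp_integrable[OF rest] unfolding h_def by simp
  let ?m = "\<integral>g. f g \<partial>iid_gauss"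
  have mean: "?m = (\<integral>g. h g \<partial>iid_gauss)"
    unfolding h_def by (rule integral_resample[OF f])
  have conditional: "(\<integral>\<^sup>+x. ennreal (exp (l * (f (g(i := x)) - ?m))) \<partial>gauss) \<le>
      ennreal (exp (l\<^sup>2 * V)) * ennreal (exp (l * (h g - ?m)))" for g
  proof -
    have "(\<integral>\<^sup>+x. ennreal (exp (l * (f (g(i := x)) - ?m))) \<partial>gauss) =
        (\<integral>\<^sup>+x. ennreal (exp (l * (f (g(i := x)) - h g))) * ennreal (exp (l * (h g - ?m))) \<partial>gauss)"
      by (intro nn_integral_cong) (simp flip: ennreal_mult exp_add add: algebra_simps)
    also have "\<dots> = (\<integral>\<^sup>+x. ennreal (exp (l * (f (g(i := x)) - h g))) \<partial>gauss) * ennreal (exp (l * (h g - ?m)))"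
      using resample[of g] by (intro nn_integral_multc) simp
    also have "\<dots> \<le> ennreal (exp (l\<^sup>2 * V)) * ennreal (exp (l * (h g - ?m)))"
      unfolding h_def by (intro mult_right_mono subgaussianD coordinate) simp
    finally show ?thesis .
  qed
  have "(\<integral>\<^sup>+g. ennreal (exp (l * (f g - ?m))) \<partial>iid_gauss) =
      (\<integral>\<^sup>+g. \<integral>\<^sup>+x. ennreal (exp (l * (f (g(i := x)) - ?m))) \<partial>gauss \<partial>iid_gauss)"
    by (rule nn_integral_resample) measurable
  also have "\<dots> \<le> (\<integral>\<^sup>+g. ennreal (exp (l\<^sup>2 * V)) * ennreal (exp (l * (h g - ?m))) \<partial>iid_gauss)"
    by (intro nn_integral_mono conditional)
  also have "\<dots> = ennreal (exp (l\<^sup>2 * V)) * (\<integral>\<^sup>+g. ennreal (exp (l * (h g - ?m))) \<partial>iid_gauss)"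
    by (subst nn_integral_cmult) auto
  also have "\<dots> \<le> ennreal (exp (l\<^sup>2 * V)) * ennreal (exp (l\<^sup>2 * V'))"
    using subgaussianD[OF rest, of l] unfolding mean h_def by (intro mult_left_mono) auto
  also have "\<dots> = ennreal (exp (l\<^sup>2 * (V + V')))"
    by (simp add: distrib_left flip: ennreal_mult exp_add)
  finally show "(\<integral>\<^sup>+g. ennreal (exp (l * (f g - ?m))) \<partial>iid_gauss) \<le> ennreal (exp (l\<^sup>2 * (V + V')))" .
qed (rule f)

theorem subgaussian_coord_lipschitz:
  assumes "finite J" "coord_lipschitz J c f" "f \<in> borel_measurable iid_gauss"
  shows "subgaussian iid_gauss f (\<Sum>i\<in>J. (c i)\<^sup>2)"
  using assms
proof (induction J arbitrary: f rule: finite_induct)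
  case empty
  then have "\<bar>f g - f (\<lambda>_. 0)\<bar> \<le> 0" for g by (simp add: coord_lipschitz_def)
  then have "f = (\<lambda>_. f (\<lambda>_. 0))" by auto
  then obtain k where "f = (\<lambda>_. k)" by blast
  then show ?case by (simp add: subgaussian_def)
next
  case (insert i J)
  have [measurable]: "f \<in> borel_measurable iid_gauss" by fact
  have "(\<lambda>g. \<integral>x. f (g(i := x)) \<partial>gauss) \<in> borel_measurable iid_gauss"
    by (rule gauss.borel_measurable_lebesgue_integral) (simp add: split_beta')
  then have "subgaussian iid_gauss (\<lambda>g. \<integral>x. f (g(i := x)) \<partial>gauss) (\<Sum>i\<in>J. (c i)\<^sup>2)"
    using insert.hyps insert.prems by (intro insert.IH coord_lipschitz_integrate_out)
  moreover have "subgaussian gauss (\<lambda>x. f (g(i := x))) ((c i)\<^sup>2)" for g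
    by (rule subgaussian_gauss_lipschitz[OF coord_lipschitz_coordinate[OF _ _ insert.prems(1)]])
       (use insert.hyps in auto)
  ultimately have "subgaussian iid_gauss f ((c i)\<^sup>2 + (\<Sum>i\<in>J. (c i)\<^sup>2))"
    using integrable_coord_lipschitz[OF insert.prems] by (intro subgaussian_resample)
  then show ?case using insert.hyps by simp
qed

section \<open>Finite Gibbs measures\<close>

definition log_sum_exp :: "'o set \<Rightarrow> ('o \<Rightarrow> real) \<Rightarrow> real" where
  "log_sum_exp \<Omega> X = ln (\<Sum>\<omega>\<in>\<Omega>. exp (X \<omega>))"

definition softmax :: "'o set \<Rightarrow> ('o \<Rightarrow> real) \<Rightarrow> 'o \<Rightarrow> real" where
  "softmax \<Omega> X \<omega> = exp (X \<omega> - log_sum_exp \<Omega> X)"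

definition gibbs_avg :: "'o set \<Rightarrow> ('o \<Rightarrow> real) \<Rightarrow> ('o \<Rightarrow> real) \<Rightarrow> real" where
  "gibbs_avg \<Omega> X f = (\<Sum>\<omega>\<in>\<Omega>. softmax \<Omega> X \<omega> * f \<omega>)"

abbreviation pair_avg :: "'o set \<Rightarrow> ('o \<Rightarrow> real) \<Rightarrow> ('o \<Rightarrow> 'o \<Rightarrow> real) \<Rightarrow> real" where
  "pair_avg \<Omega> X f \<equiv> gibbs_avg \<Omega> X (\<lambda>\<omega>. gibbs_avg \<Omega> X (f \<omega>))"

text \<open>The product of \<open>n\<close> copies of a Gibbs measure is the Gibbs measure of the summed energy.\<close>
abbreviation replica_avg :: "'o set \<Rightarrow> ('o \<Rightarrow> real) \<Rightarrow> nat \<Rightarrow> ((nat \<Rightarrow> 'o) \<Rightarrow> real) \<Rightarrow> real" where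
  "replica_avg \<Omega> X n \<equiv> gibbs_avg ({..<n} \<rightarrow>\<^sub>E \<Omega>) (\<lambda>\<tau>. \<Sum>l<n. X (\<tau> l))"

lemma borel_measurable_log_sum_exp [measurable (raw)]:
  assumes [measurable]: "\<And>\<omega>. \<omega> \<in> \<Omega> \<Longrightarrow> (\<lambda>x. X x \<omega>) \<in> borel_measurable M"
  shows "(\<lambda>x. log_sum_exp \<Omega> (X x)) \<in> borel_measurable M"
  unfolding log_sum_exp_def by measurable

lemma borel_measurable_softmax [measurable (raw)]:
  assumes [measurable]: "\<And>\<omega>. (\<lambda>x. X x \<omega>) \<in> borel_measurable M"
  shows "(\<lambda>x. softmax \<Omega> (X x) \<omega>) \<in> borel_measurable M"
  unfolding softmax_def by measurable

lemma borel_measurable_gibbs_avg [measurable (raw)]: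
  assumes [measurable]: "\<And>\<omega>. \<omega> \<in> \<Omega> \<Longrightarrow> (\<lambda>x. X x \<omega>) \<in> borel_measurable M"
    "\<And>\<omega>. \<omega> \<in> \<Omega> \<Longrightarrow> (\<lambda>x. f x \<omega>) \<in> borel_measurable M"
  shows "(\<lambda>x. gibbs_avg \<Omega> (X x) (f x)) \<in> borel_measurable M"
  unfolding gibbs_avg_def softmax_def by measurable

subsection \<open>The log-partition function\<close>

lemma sum_exp_pos:
  fixes X :: "'o \<Rightarrow> real"
  assumes "finite \<Omega>" "\<Omega> \<noteq> {}"
  shows "(\<Sum>\<omega>\<in>\<Omega>. exp (X \<omega>)) > 0"
  by (rule sum_pos) (use assms in auto)

lemma exp_log_sum_exp:
  assumes "finite \<Omega>" "\<Omega> \<noteq> {}"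
  shows "exp (log_sum_exp \<Omega> X) = (\<Sum>\<omega>\<in>\<Omega>. exp (X \<omega>))"
  using sum_exp_pos[OF assms, of X] by (simp add: log_sum_exp_def)

lemma log_sum_exp_ge:
  assumes "finite \<Omega>" "\<omega> \<in> \<Omega>"
  shows "X \<omega> \<le> log_sum_exp \<Omega> X"
proof -
  have "exp (X \<omega>) \<le> (\<Sum>\<omega>\<in>\<Omega>. exp (X \<omega>))"
    using assms by (intro member_le_sum) auto
  also have "\<dots> = exp (log_sum_exp \<Omega> X)"
    using assms by (intro exp_log_sum_exp[symmetric]) auto
  finally show ?thesis by simp
qed

lemma log_sum_exp_add_const:
  assumes "finite \<Omega>" "\<Omega> \<noteq> {}"
  shows "log_sum_exp \<Omega> (\<lambda>\<omega>. X \<omega> + k) = log_sum_exp \<Omega> X + k"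
  using sum_exp_pos[OF assms, of X]
  by (simp add: log_sum_exp_def exp_add ln_mult flip: sum_distrib_right)

lemma log_sum_exp_mono:
  assumes "finite \<Omega>" "\<Omega> \<noteq> {}" "\<And>\<omega>. \<omega> \<in> \<Omega> \<Longrightarrow> X \<omega> \<le> Y \<omega>"
  shows "log_sum_exp \<Omega> X \<le> log_sum_exp \<Omega> Y"
  unfolding log_sum_exp_def
  using sum_exp_pos[OF assms(1,2), of X] assms(3) by (auto intro!: ln_mono sum_mono)

lemma log_sum_exp_mono_set:
  assumes "finite \<Omega>" "\<Omega>' \<noteq> {}" "\<Omega>' \<subseteq> \<Omega>"
  shows "log_sum_exp \<Omega>' X \<le> log_sum_exp \<Omega> X"
  unfolding log_sum_exp_def
  using sum_exp_pos[of \<Omega>' X] assms finite_subset by (auto intro!: ln_mono sum_mono2)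

lemma abs_log_sum_exp_diff_le:
  assumes fin: "finite \<Omega>" "\<Omega> \<noteq> {}" and diff: "\<And>\<omega>. \<omega> \<in> \<Omega> \<Longrightarrow> \<bar>X \<omega> - Y \<omega>\<bar> \<le> B"
  shows "\<bar>log_sum_exp \<Omega> X - log_sum_exp \<Omega> Y\<bar> \<le> B"
proof -
  have "X \<omega> \<le> Y \<omega> + B" "Y \<omega> \<le> X \<omega> + B" if "\<omega> \<in> \<Omega>" for \<omega>
    using diff[OF that] by (simp_all add: abs_le_iff)
  then have "log_sum_exp \<Omega> X \<le> log_sum_exp \<Omega> (\<lambda>\<omega>. Y \<omega> + B)" "log_sum_exp \<Omega> Y \<le> log_sum_exp \<Omega> (\<lambda>\<omega>. X \<omega> + B)"
    by (auto intro!: log_sum_exp_mono fin)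
  then show ?thesis unfolding log_sum_exp_add_const[OF fin] by linarith
qed

lemma log_sum_exp_reindex:
  assumes "inj_on h \<Omega>"
  shows "log_sum_exp (h ` \<Omega>) X = log_sum_exp \<Omega> (\<lambda>\<omega>. X (h \<omega>))"
  by (simp add: log_sum_exp_def sum.reindex[OF assms])

lemma log_sum_exp_PiE:
  assumes I: "finite I" and A: "\<And>i. i \<in> I \<Longrightarrow> finite (A i)" "\<And>i. i \<in> I \<Longrightarrow> A i \<noteq> {}"
  shows "log_sum_exp (Pi\<^sub>E I A) (\<lambda>\<tau>. \<Sum>i\<in>I. X i (\<tau> i)) = (\<Sum>i\<in>I. log_sum_exp (A i) (X i))"
proof -
  have "(\<Sum>\<tau>\<in>Pi\<^sub>E I A. exp (\<Sum>i\<in>I. X i (\<tau> i))) = (\<Prod>i\<in>I. \<Sum>\<omega>\<in>A i. exp (X i \<omega>))"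
    using I A by (simp add: exp_sum prod_sum_PiE)
  moreover have "(\<Sum>\<omega>\<in>A i. exp (X i \<omega>)) \<noteq> 0" if "i \<in> I" for i
    using sum_exp_pos[OF A(1)[OF that] A(2)[OF that], of "X i"] by simp
  ultimately show ?thesis
    unfolding log_sum_exp_def by (simp only:) (intro ln_prod I)
qed

subsection \<open>Gibbs averages\<close>

lemma softmax_eq_divide:
  assumes "finite \<Omega>" "\<Omega> \<noteq> {}"
  shows "softmax \<Omega> X \<omega> = exp (X \<omega>) / (\<Sum>\<omega>'\<in>\<Omega>. exp (X \<omega>'))"
  by (simp add: softmax_def exp_diff exp_log_sum_exp[OF assms])

lemma softmax_nonneg: "softmax \<Omega> X \<omega> \<ge> 0"
  by (simp add: softmax_def)

lemma softmax_le_1: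
  assumes "finite \<Omega>" "\<omega> \<in> \<Omega>"
  shows "softmax \<Omega> X \<omega> \<le> 1"
  using log_sum_exp_ge[OF assms] by (simp add: softmax_def)

lemma abs_softmax_le_1:
  assumes "finite \<Omega>" "\<omega> \<in> \<Omega>"
  shows "\<bar>softmax \<Omega> X \<omega>\<bar> \<le> 1"
  using softmax_le_1[OF assms, of X] softmax_nonneg[of \<Omega> X \<omega>] by simp

lemma sum_softmax:
  assumes "finite \<Omega>" "\<Omega> \<noteq> {}"
  shows "(\<Sum>\<omega>\<in>\<Omega>. softmax \<Omega> X \<omega>) = 1"
  using sum_exp_pos[OF assms, of X] by (simp add: softmax_eq_divide[OF assms] flip: sum_divide_distrib)

lemma gibbs_avg_cong:
  assumes "\<And>\<omega>. \<omega> \<in> \<Omega> \<Longrightarrow> f \<omega> = h \<omega>"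
  shows "gibbs_avg \<Omega> X f = gibbs_avg \<Omega> X h"
  unfolding gibbs_avg_def using assms by (intro sum.cong) auto

lemma gibbs_avg_const:
  assumes "finite \<Omega>" "\<Omega> \<noteq> {}"
  shows "gibbs_avg \<Omega> X (\<lambda>_. k) = k"
  using sum_softmax[OF assms, of X] by (simp add: gibbs_avg_def flip: sum_distrib_right)

lemma gibbs_avg_mono:
  assumes "\<And>\<omega>. \<omega> \<in> \<Omega> \<Longrightarrow> f \<omega> \<le> h \<omega>"
  shows "gibbs_avg \<Omega> X f \<le> gibbs_avg \<Omega> X h"
  unfolding gibbs_avg_def by (intro sum_mono mult_left_mono assms softmax_nonneg)

lemma gibbs_avg_nonneg:
  assumes "\<And>\<omega>. \<omega> \<in> \<Omega> \<Longrightarrow> f \<omega> \<ge> 0"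
  shows "gibbs_avg \<Omega> X f \<ge> 0"
  unfolding gibbs_avg_def by (intro sum_nonneg mult_nonneg_nonneg assms softmax_nonneg)

lemma gibbs_avg_le:
  assumes "finite \<Omega>" "\<Omega> \<noteq> {}" "\<And>\<omega>. \<omega> \<in> \<Omega> \<Longrightarrow> f \<omega> \<le> B"
  shows "gibbs_avg \<Omega> X f \<le> B"
  using gibbs_avg_mono[of \<Omega> f "\<lambda>_. B" X] assms by (simp add: gibbs_avg_const)

lemma gibbs_avg_ge:
  assumes "finite \<Omega>" "\<Omega> \<noteq> {}" "\<And>\<omega>. \<omega> \<in> \<Omega> \<Longrightarrow> B \<le> f \<omega>"
  shows "B \<le> gibbs_avg \<Omega> X f"
  using gibbs_avg_mono[of \<Omega> "\<lambda>_. B" f X] assms by (simp add: gibbs_avg_const)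

lemma gibbs_avg_add: "gibbs_avg \<Omega> X (\<lambda>\<omega>. f \<omega> + h \<omega>) = gibbs_avg \<Omega> X f + gibbs_avg \<Omega> X h"
  by (simp add: gibbs_avg_def distrib_left sum.distrib)

lemma gibbs_avg_diff: "gibbs_avg \<Omega> X (\<lambda>\<omega>. f \<omega> - h \<omega>) = gibbs_avg \<Omega> X f - gibbs_avg \<Omega> X h"
  by (simp add: gibbs_avg_def right_diff_distrib sum_subtractf)

lemma gibbs_avg_cmult: "gibbs_avg \<Omega> X (\<lambda>\<omega>. k * f \<omega>) = k * gibbs_avg \<Omega> X f"
  by (simp add: gibbs_avg_def sum_distrib_left mult_ac)

lemma gibbs_avg_sum: "gibbs_avg \<Omega> X (\<lambda>\<omega>. \<Sum>i\<in>I. f i \<omega>) = (\<Sum>i\<in>I. gibbs_avg \<Omega> X (f i))"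
  unfolding gibbs_avg_def sum_distrib_left by (rule sum.swap)

lemma abs_gibbs_avg_le: "\<bar>gibbs_avg \<Omega> X f\<bar> \<le> gibbs_avg \<Omega> X (\<lambda>\<omega>. \<bar>f \<omega>\<bar>)"
  unfolding gibbs_avg_def by (rule order_trans[OF sum_abs]) (simp add: abs_mult softmax_nonneg)

lemma abs_gibbs_avg_le_bound:
  assumes "finite \<Omega>" "\<Omega> \<noteq> {}" "\<And>\<omega>. \<omega> \<in> \<Omega> \<Longrightarrow> \<bar>f \<omega>\<bar> \<le> B"
  shows "\<bar>gibbs_avg \<Omega> X f\<bar> \<le> B"
  using order_trans[OF abs_gibbs_avg_le gibbs_avg_le] assms by blast

lemma gibbs_avg_reindex:
  assumes h: "bij_betw h \<Omega> \<Omega>'"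
  shows "gibbs_avg \<Omega>' X f = gibbs_avg \<Omega> (\<lambda>\<omega>. X (h \<omega>)) (\<lambda>\<omega>. f (h \<omega>))"
proof -
  have "log_sum_exp \<Omega>' X = log_sum_exp \<Omega> (\<lambda>\<omega>. X (h \<omega>))"
    unfolding log_sum_exp_def by (simp add: sum.reindex_bij_betw[OF h, of "\<lambda>\<omega>. exp (X \<omega>)"])
  then show ?thesis
    unfolding gibbs_avg_def softmax_def
    using sum.reindex_bij_betw[OF h, of "\<lambda>\<omega>. exp (X \<omega> - log_sum_exp \<Omega>' X) * f \<omega>"] by simp
qed

lemma gibbs_avg_of_bool:
  assumes "finite \<Omega>" "{\<omega>\<in>\<Omega>. P \<omega>} \<noteq> {}"
  shows "gibbs_avg \<Omega> X (\<lambda>\<omega>. of_bool (P \<omega>)) = exp (log_sum_exp {\<omega>\<in>\<Omega>. P \<omega>} X - log_sum_exp \<Omega> X)"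
proof -
  have "gibbs_avg \<Omega> X (\<lambda>\<omega>. of_bool (P \<omega>)) = (\<Sum>\<omega>\<in>{\<omega>\<in>\<Omega>. P \<omega>}. exp (X \<omega> - log_sum_exp \<Omega> X))"
    by (simp add: assms(1) gibbs_avg_def softmax_def sum.inter_filter of_bool_def if_distrib cong: if_cong)
  then show ?thesis
    using assms by (simp add: exp_diff exp_log_sum_exp[of "{\<omega>\<in>\<Omega>. P \<omega>}"] flip: sum_divide_distrib)
qed

lemma exp_log_sum_exp_diff:
  assumes "finite \<Omega>" "\<Omega> \<noteq> {}"
  shows "exp (log_sum_exp \<Omega> Y - log_sum_exp \<Omega> X) = gibbs_avg \<Omega> X (\<lambda>\<omega>. exp (Y \<omega> - X \<omega>))"
  by (simp add: exp_diff exp_log_sum_exp[OF assms] gibbs_avg_def softmax_eq_divide[OF assms] sum_divide_distrib)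

lemma exp_gibbs_avg_le:
  assumes "finite \<Omega>" "\<Omega> \<noteq> {}"
  shows "exp (gibbs_avg \<Omega> X f) \<le> gibbs_avg \<Omega> X (\<lambda>\<omega>. exp (f \<omega>))"
proof -
  have "exp (\<Sum>\<omega>\<in>\<Omega>. softmax \<Omega> X \<omega> *\<^sub>R f \<omega>) \<le> (\<Sum>\<omega>\<in>\<Omega>. softmax \<Omega> X \<omega> * exp (f \<omega>))"
    by (rule convex_on_sum[OF assms convex_on_exp[of 1, simplified]])
       (use sum_softmax[OF assms] softmax_nonneg in auto)
  then show ?thesis by (simp add: gibbs_avg_def)
qed

lemma gibbs_avg_diff_le_log_sum_exp_diff:
  assumes "finite \<Omega>" "\<Omega> \<noteq> {}"
  shows "gibbs_avg \<Omega> X (\<lambda>\<omega>. Y \<omega> - X \<omega>) \<le> log_sum_exp \<Omega> Y - log_sum_exp \<Omega> X"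
  using exp_gibbs_avg_le[OF assms, of X "\<lambda>\<omega>. Y \<omega> - X \<omega>"] by (simp flip: exp_log_sum_exp_diff[OF assms])

text \<open>Jensen's inequality for \<^term>\<open>exp \<bar>h \<omega> - m\<bar> \<le> exp (h \<omega> - m) + exp (m - h \<omega>)\<close>.\<close>
lemma gibbs_avg_abs_deviation_le:
  assumes fin: "finite \<Omega>" "\<Omega> \<noteq> {}"
  shows "gibbs_avg \<Omega> X (\<lambda>\<omega>. \<bar>h \<omega> - m\<bar>) \<le> ln 2 +
    max (log_sum_exp \<Omega> (\<lambda>\<omega>. X \<omega> + h \<omega>) - log_sum_exp \<Omega> X - m) (log_sum_exp \<Omega> (\<lambda>\<omega>. X \<omega> - h \<omega>) - log_sum_exp \<Omega> X + m)"
    (is "_ \<le> ln 2 + max ?u ?v")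
proof -
  have "exp (gibbs_avg \<Omega> X (\<lambda>\<omega>. \<bar>h \<omega> - m\<bar>)) \<le> gibbs_avg \<Omega> X (\<lambda>\<omega>. exp \<bar>h \<omega> - m\<bar>)"
    by (rule exp_gibbs_avg_le[OF fin])
  also have "\<dots> \<le> gibbs_avg \<Omega> X (\<lambda>\<omega>. exp (- m) * exp (h \<omega>) + exp m * exp (- h \<omega>))"
  proof (rule gibbs_avg_mono)
    show "exp \<bar>h \<omega> - m\<bar> \<le> exp (- m) * exp (h \<omega>) + exp m * exp (- h \<omega>)" for \<omega>
      by (cases "h \<omega> \<ge> m") (auto simp: algebra_simps simp flip: exp_add)
  qed
  also have "\<dots> = exp (- m) * exp (log_sum_exp \<Omega> (\<lambda>\<omega>. X \<omega> + h \<omega>) - log_sum_exp \<Omega> X) +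
      exp m * exp (log_sum_exp \<Omega> (\<lambda>\<omega>. X \<omega> - h \<omega>) - log_sum_exp \<Omega> X)"
    by (simp add: gibbs_avg_add gibbs_avg_cmult exp_log_sum_exp_diff[OF fin])
  also have "\<dots> = exp ?u + exp ?v"
    by (simp add: algebra_simps flip: exp_add)
  also have "\<dots> \<le> exp (max ?u ?v) + exp (max ?u ?v)"
    by (intro add_mono) auto
  also have "\<dots> = exp (ln 2 + max ?u ?v)" by (simp add: exp_add)
  finally show ?thesis by simp
qed

lemma gibbs_avg_subset_le:
  assumes "finite \<Omega>" "\<Omega>' \<subseteq> \<Omega>" "\<And>\<omega>. f \<omega> \<ge> 0"
  shows "gibbs_avg \<Omega>' X f \<le> exp (log_sum_exp \<Omega> X - log_sum_exp \<Omega>' X) * gibbs_avg \<Omega> X f"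
proof -
  have "gibbs_avg \<Omega>' X f = (\<Sum>\<omega>\<in>\<Omega>'. exp (log_sum_exp \<Omega> X - log_sum_exp \<Omega>' X) * (softmax \<Omega> X \<omega> * f \<omega>))"
    unfolding gibbs_avg_def softmax_def mult.assoc[symmetric] exp_add[symmetric]
    by (simp add: algebra_simps)
  also have "\<dots> \<le> (\<Sum>\<omega>\<in>\<Omega>. exp (log_sum_exp \<Omega> X - log_sum_exp \<Omega>' X) * (softmax \<Omega> X \<omega> * f \<omega>))"
    using assms softmax_nonneg by (intro sum_mono2 mult_nonneg_nonneg) auto
  finally show ?thesis by (simp add: gibbs_avg_def sum_distrib_left)
qed

lemma pair_avg_subset_le:
  assumes "finite \<Omega>" "\<Omega>' \<subseteq> \<Omega>" "\<And>\<omega> \<omega>'. f \<omega> \<omega>' \<ge> 0"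
  shows "pair_avg \<Omega>' X f \<le> exp (2 * (log_sum_exp \<Omega> X - log_sum_exp \<Omega>' X)) * pair_avg \<Omega> X f"
proof -
  let ?e = "exp (log_sum_exp \<Omega> X - log_sum_exp \<Omega>' X)"
  have "pair_avg \<Omega>' X f \<le> gibbs_avg \<Omega>' X (\<lambda>\<omega>. ?e * gibbs_avg \<Omega> X (f \<omega>))"
    by (intro gibbs_avg_mono gibbs_avg_subset_le assms)
  also have "\<dots> \<le> ?e * (?e * pair_avg \<Omega> X f)"
    unfolding gibbs_avg_cmult by (intro mult_left_mono gibbs_avg_subset_le gibbs_avg_nonneg assms) auto
  also have "?e * (?e * pair_avg \<Omega> X f) = exp (2 * (log_sum_exp \<Omega> X - log_sum_exp \<Omega>' X)) * pair_avg \<Omega> X f"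
    by (simp only: mult.assoc[symmetric] mult_2 exp_add)
  finally show ?thesis .
qed

subsection \<open>Product systems and replicas\<close>

lemma gibbs_avg_PiE_marginal:
  assumes I: "finite I" "l \<in> I" and A: "\<And>i. i \<in> I \<Longrightarrow> finite (A i)" "\<And>i. i \<in> I \<Longrightarrow> A i \<noteq> {}"
  shows "gibbs_avg (Pi\<^sub>E I A) (\<lambda>\<tau>. \<Sum>i\<in>I. X i (\<tau> i)) (\<lambda>\<tau>. u (\<tau> l)) = gibbs_avg (A l) (X l) u"
proof -
  let ?u = "\<lambda>i \<omega>. softmax (A i) (X i) \<omega> * (if i = l then u \<omega> else 1)"
  have "softmax (Pi\<^sub>E I A) (\<lambda>\<tau>. \<Sum>i\<in>I. X i (\<tau> i)) \<tau> = (\<Prod>i\<in>I. softmax (A i) (X i) (\<tau> i))" for \<tau>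
    using log_sum_exp_PiE[where X = X, OF I(1) A] I(1)
    by (simp add: softmax_def exp_sum[symmetric] sum_subtractf)
  then have "gibbs_avg (Pi\<^sub>E I A) (\<lambda>\<tau>. \<Sum>i\<in>I. X i (\<tau> i)) (\<lambda>\<tau>. u (\<tau> l)) =
      (\<Sum>\<tau>\<in>Pi\<^sub>E I A. \<Prod>i\<in>I. ?u i (\<tau> i))"
    unfolding gibbs_avg_def using I by (simp add: prod.distrib prod.delta)
  also have "\<dots> = (\<Prod>i\<in>I. \<Sum>\<omega>\<in>A i. ?u i \<omega>)"
    using I A by (simp add: prod_sum_PiE)
  also have "\<dots> = (\<Prod>i\<in>I. if i = l then gibbs_avg (A l) (X l) u else 1)"
    using A by (intro prod.cong refl) (auto simp: gibbs_avg_def sum_softmax)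
  finally show ?thesis using I by (simp add: prod.delta)
qed

lemma finite_replicas: "finite \<Omega> \<Longrightarrow> finite ({..<n::nat} \<rightarrow>\<^sub>E \<Omega>)"
  by (simp add: finite_PiE)

lemma replicas_nonempty: "\<Omega> \<noteq> {} \<Longrightarrow> ({..<n::nat} \<rightarrow>\<^sub>E \<Omega>) \<noteq> {}"
  by (simp add: PiE_eq_empty_iff)

lemma replica_avg_marginal:
  assumes "finite \<Omega>" "\<Omega> \<noteq> {}" "l < n"
  shows "replica_avg \<Omega> X n (\<lambda>\<tau>. u (\<tau> l)) = gibbs_avg \<Omega> X u"
  using gibbs_avg_PiE_marginal[of "{..<n}" l "\<lambda>_. \<Omega>" "\<lambda>_. X" u] assms by simp

lemma replica_avg_Suc:
  assumes "finite \<Omega>" "\<Omega> \<noteq> {}"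
  shows "replica_avg \<Omega> X (Suc n) f = replica_avg \<Omega> X n (\<lambda>\<tau>. gibbs_avg \<Omega> X (\<lambda>\<omega>. f (\<tau>(n := \<omega>))))"
proof -
  let ?T = "{..<n} \<rightarrow>\<^sub>E \<Omega>"
  have lse: "log_sum_exp ({..<m} \<rightarrow>\<^sub>E \<Omega>) (\<lambda>\<tau>. \<Sum>l<m. X (\<tau> l)) = real m * log_sum_exp \<Omega> X" for m
    using log_sum_exp_PiE[of "{..<m}" "\<lambda>_. \<Omega>" "\<lambda>_. X"] assms by simp
  have softmax: "softmax ({..<Suc n} \<rightarrow>\<^sub>E \<Omega>) (\<lambda>\<tau>. \<Sum>l<Suc n. X (\<tau> l)) (\<tau>(n := \<omega>)) =
      softmax ?T (\<lambda>\<tau>. \<Sum>l<n. X (\<tau> l)) \<tau> * softmax \<Omega> X \<omega>" for \<tau> \<omega>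
    unfolding softmax_def lse by (simp add: algebra_simps flip: exp_add)
  have inj: "inj_on (\<lambda>(\<omega>, \<tau>). \<tau>(n := \<omega>)) (\<Omega> \<times> ?T)"
  proof (rule inj_onI, clarify)
    fix \<omega> \<tau> \<omega>' \<tau>' assume \<tau>: "\<tau> \<in> ?T" "\<tau>' \<in> ?T" and eq: "\<tau>(n := \<omega>) = \<tau>'(n := \<omega>')"
    have "\<tau> k = \<tau>' k" for k
      using fun_cong[OF eq, of k] \<tau> by (cases "k = n") (auto simp: PiE_def extensional_def)
    then show "\<omega> = \<omega>' \<and> \<tau> = \<tau>'" using fun_cong[OF eq, of n] by auto
  qed
  have "replica_avg \<Omega> X (Suc n) f =
      (\<Sum>(\<omega>, \<tau>)\<in>\<Omega> \<times> ?T. softmax ?T (\<lambda>\<tau>. \<Sum>l<n. X (\<tau> l)) \<tau> * softmax \<Omega> X \<omega> * f (\<tau>(n := \<omega>)))"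
    unfolding gibbs_avg_def softmax[symmetric]
    by (subst (1) lessThan_Suc, subst PiE_insert_eq, subst sum.reindex[OF inj]) (simp add: split_beta' o_def)
  also have "\<dots> = (\<Sum>\<tau>\<in>?T. \<Sum>\<omega>\<in>\<Omega>. softmax ?T (\<lambda>\<tau>. \<Sum>l<n. X (\<tau> l)) \<tau> * softmax \<Omega> X \<omega> * f (\<tau>(n := \<omega>)))"
    unfolding sum.cartesian_product[symmetric] by (rule sum.swap)
  finally show ?thesis by (simp add: gibbs_avg_def sum_distrib_left mult.assoc)
qed

subsection \<open>Random Hamiltonians\<close>

lemma integrable_gibbs_avg:
  assumes fin: "finite \<Omega>" and [measurable]: "\<And>\<omega>. (\<lambda>x. X x \<omega>) \<in> borel_measurable M"
    and int: "\<And>\<omega>. \<omega> \<in> \<Omega> \<Longrightarrow> integrable M (\<lambda>x. f x \<omega>)"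
  shows "integrable M (\<lambda>x. gibbs_avg \<Omega> (X x) (f x))"
  unfolding gibbs_avg_def
proof (rule Bochner_Integration.integrable_sum)
  fix \<omega> assume "\<omega> \<in> \<Omega>"
  then show "integrable M (\<lambda>x. softmax \<Omega> (X x) \<omega> * f x \<omega>)"
    by (intro integrable_mult_bounded[OF int]) (auto intro: abs_softmax_le_1[OF fin])
qed

lemma (in finite_measure) integrable_pair_avg:
  assumes "finite \<Omega>" "\<And>\<omega>. (\<lambda>x. X x \<omega>) \<in> borel_measurable M"
  shows "integrable M (\<lambda>x. pair_avg \<Omega> (X x) f)"
  using assms by (intro integrable_gibbs_avg) auto

lemma has_real_derivative_log_sum_exp:
  assumes fin: "finite \<Omega>" "\<Omega> \<noteq> {}"
    and deriv: "\<And>\<omega>. \<omega> \<in> \<Omega> \<Longrightarrow> ((\<lambda>x. X x \<omega>) has_real_derivative X' \<omega>) (at x)"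
  shows "((\<lambda>x. log_sum_exp \<Omega> (X x)) has_real_derivative gibbs_avg \<Omega> (X x) X') (at x)"
proof -
  have "((\<lambda>x. \<Sum>\<omega>\<in>\<Omega>. exp (X x \<omega>)) has_real_derivative (\<Sum>\<omega>\<in>\<Omega>. exp (X x \<omega>) * X' \<omega>)) (at x)"
    by (auto intro!: derivative_eq_intros deriv simp: fin)
  then have "((\<lambda>x. ln (\<Sum>\<omega>\<in>\<Omega>. exp (X x \<omega>))) has_real_derivative
      (1 / (\<Sum>\<omega>\<in>\<Omega>. exp (X x \<omega>))) * (\<Sum>\<omega>\<in>\<Omega>. exp (X x \<omega>) * X' \<omega>)) (at x)"
    by (rule DERIV_chain2[where f = ln, rotated]) (rule DERIV_ln_divide[OF sum_exp_pos[OF fin]])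
  then show ?thesis
    by (simp add: log_sum_exp_def gibbs_avg_def softmax_eq_divide[OF fin] sum_divide_distrib)
qed

definition affine_energy ::
    "'i set \<Rightarrow> ('i \<Rightarrow> 'o \<Rightarrow> real) \<Rightarrow> ('o \<Rightarrow> real) \<Rightarrow> ('i \<Rightarrow> real) \<Rightarrow> 'o \<Rightarrow> real" where
  "affine_energy J a c g \<omega> = (\<Sum>i\<in>J. a i \<omega> * g i) + c \<omega>"

lemma measurable_affine_energy [measurable]: "(\<lambda>g. affine_energy J a c g \<omega>) \<in> borel_measurable iid_gauss"
  unfolding affine_energy_def by measurable

lemma integrable_affine_energy: "integrable iid_gauss (\<lambda>g. affine_energy J a c g \<omega>)"
  unfolding affine_energy_def by (intro Bochner_Integration.integrable_add integrable_linear) simp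

lemma affine_energy_upd:
  assumes "finite J" "i \<in> J"
  shows "affine_energy J a c (g(i := x)) \<omega> = affine_energy J a c g \<omega> + a i \<omega> * (x - g i)"
  using assms by (simp add: affine_energy_def sum.remove[of J i] algebra_simps)

lemma subgaussian_log_sum_exp_affine_energy:
  assumes fin: "finite \<Omega>" "\<Omega> \<noteq> {}" "finite J"
    and A: "\<And>i \<omega>. i \<in> J \<Longrightarrow> \<omega> \<in> \<Omega> \<Longrightarrow> \<bar>a i \<omega>\<bar> \<le> A i" and V: "(\<Sum>i\<in>J. (A i)\<^sup>2) \<le> V"
  shows "subgaussian iid_gauss (\<lambda>g. log_sum_exp \<Omega> (affine_energy J a c g)) V"
proof -
  have "coord_lipschitz J A (\<lambda>g. log_sum_exp \<Omega> (affine_energy J a c g))"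
    unfolding coord_lipschitz_def
  proof (intro allI abs_log_sum_exp_diff_le fin)
    fix g g' \<omega> assume \<omega>: "\<omega> \<in> \<Omega>"
    have "\<bar>affine_energy J a c g \<omega> - affine_energy J a c g' \<omega>\<bar> = \<bar>\<Sum>i\<in>J. a i \<omega> * (g i - g' i)\<bar>"
      by (simp add: affine_energy_def right_diff_distrib sum_subtractf)
    also have "\<dots> \<le> (\<Sum>i\<in>J. A i * \<bar>g i - g' i\<bar>)"
      using A \<omega> by (intro order_trans[OF sum_abs] sum_mono) (auto simp: abs_mult intro: mult_right_mono)
    finally show "\<bar>affine_energy J a c g \<omega> - affine_energy J a c g' \<omega>\<bar> \<le> (\<Sum>i\<in>J. A i * \<bar>g i - g' i\<bar>)" .
  qed
  then show ?thesis
    using fin V by (intro subgaussian_mono[OF subgaussian_coord_lipschitz]) auto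
qed

lemma integrable_log_sum_exp_affine_energy:
  assumes "finite \<Omega>" "\<Omega> \<noteq> {}" "finite J"
  shows "integrable iid_gauss (\<lambda>g. log_sum_exp \<Omega> (affine_energy J a c g))"
  by (rule subgaussian_imp_integrable,
      rule subgaussian_log_sum_exp_affine_energy[OF assms, where A = "\<lambda>i. \<Sum>\<omega>\<in>\<Omega>. \<bar>a i \<omega>\<bar>"])
     (use assms in \<open>auto intro: member_le_sum\<close>)

lemma softmax_integration_by_parts:
  assumes fin: "finite \<Omega>" "finite J" and \<omega>: "\<omega> \<in> \<Omega>" and i: "i \<in> J"
  shows "(\<integral>g. g i * softmax \<Omega> (affine_energy J a c g) \<omega> \<partial>iid_gauss) =
    (\<integral>g. softmax \<Omega> (affine_energy J a c g) \<omega> * (a i \<omega> - gibbs_avg \<Omega> (affine_energy J a c g) (a i)) \<partial>iid_gauss)"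
proof -
  let ?E = "affine_energy J a c"
  let ?s = "\<lambda>g. softmax \<Omega> (?E g) \<omega>"
  let ?s' = "\<lambda>g. ?s g * (a i \<omega> - gibbs_avg \<Omega> (?E g) (a i))"
  let ?A = "\<Sum>\<omega>\<in>\<Omega>. \<bar>a i \<omega>\<bar>"
  have ne: "\<Omega> \<noteq> {}" using \<omega> by auto
  have abs_a: "\<bar>a i \<omega>'\<bar> \<le> ?A" if "\<omega>' \<in> \<Omega>" for \<omega>'
    using fin that by (intro member_le_sum) auto
  have shift: "?E (g(i := x)) = (\<lambda>\<omega>. ?E g \<omega> + a i \<omega> * (x - g i))" for g x
    by (rule ext) (rule affine_energy_upd[OF fin(2) i])
  have deriv_E: "((\<lambda>x. ?E (g(i := x)) \<omega>') has_real_derivative a i \<omega>') (at x)" for g x \<omega>'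
    unfolding shift by (auto intro!: derivative_eq_intros)
  have deriv: "((\<lambda>x. ?s (g(i := x))) has_real_derivative ?s' (g(i := x))) (at x)" for g x
    unfolding softmax_def
    by (rule DERIV_fun_exp[OF DERIV_diff[OF deriv_E has_real_derivative_log_sum_exp[OF fin(1) ne deriv_E]]])
  have cont_E: "isCont (\<lambda>x. ?E (g(i := x)) \<omega>') x" for g x \<omega>'
    using deriv_E by (rule DERIV_isCont)
  have cont: "isCont (\<lambda>x. ?s' (g(i := x))) x" for g x
  proof -
    have "isCont (\<lambda>x. softmax \<Omega> (?E (g(i := x))) \<omega>') x" for \<omega>'
      unfolding softmax_def
      by (intro continuous_intros cont_E DERIV_isCont[OF has_real_derivative_log_sum_exp[OF fin(1) ne deriv_E]])
    then show ?thesis unfolding gibbs_avg_def by (intro continuous_intros)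
  qed
  have bound_s: "\<bar>?s g\<bar> \<le> 1 + 2 * ?A" for g
    using abs_softmax_le_1[OF fin(1) \<omega>, of "?E g"] abs_a[OF \<omega>] by simp
  have bound_s': "\<bar>?s' g\<bar> \<le> 1 + 2 * ?A" for g
  proof -
    have "\<bar>a i \<omega> - gibbs_avg \<Omega> (?E g) (a i)\<bar> \<le> 2 * ?A"
      using abs_gibbs_avg_le_bound[where f = "a i" and X = "?E g", OF fin(1) ne abs_a] abs_a[OF \<omega>] by linarith
    then have "\<bar>?s' g\<bar> \<le> 1 * (2 * ?A)"
      unfolding abs_mult using abs_softmax_le_1[OF fin(1) \<omega>, of "?E g"] by (intro mult_mono) auto
    then show ?thesis by simp
  qed
  show ?thesis
    by (rule iid_gauss_integration_by_parts[OF _ _ deriv cont bound_s bound_s']) measurable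
qed

lemma gibbs_avg_integration_by_parts:
  assumes fin: "finite \<Omega>" "finite J" and K: "K \<subseteq> J"
  shows "(\<integral>g. gibbs_avg \<Omega> (affine_energy J a c g) (\<lambda>\<omega>. \<Sum>i\<in>K. b i \<omega> * g i) \<partial>iid_gauss) =
    (\<integral>g. gibbs_avg \<Omega> (affine_energy J a c g) (\<lambda>\<omega>. \<Sum>i\<in>K. b i \<omega> * a i \<omega>) \<partial>iid_gauss) -
    (\<integral>g. pair_avg \<Omega> (affine_energy J a c g) (\<lambda>\<omega> \<omega>'. \<Sum>i\<in>K. b i \<omega> * a i \<omega>') \<partial>iid_gauss)"
proof -
  let ?E = "affine_energy J a c"
  let ?s = "\<lambda>g. softmax \<Omega> (?E g)" and ?avg = "\<lambda>g. gibbs_avg \<Omega> (?E g)"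
  have int_coord: "integrable iid_gauss (\<lambda>g. g i * ?s g \<omega>)" if "\<omega> \<in> \<Omega>" for i \<omega>
    using integrable_mult_bounded[OF integrable_coordinate, of "\<lambda>g. ?s g \<omega>" 1 i] abs_softmax_le_1[OF fin(1) that]
    by (simp add: mult.commute)
  have int_avg: "integrable iid_gauss (\<lambda>g. ?s g \<omega> * (a i \<omega> - ?avg g (a i)))" if "\<omega> \<in> \<Omega>" for i \<omega>
    using that by (intro integrable_mult_bounded[of _ _ _ 1] Bochner_Integration.integrable_diff
        integrable_gibbs_avg fin abs_softmax_le_1) auto
  have "(\<integral>g. ?avg g (\<lambda>\<omega>. \<Sum>i\<in>K. b i \<omega> * g i) \<partial>iid_gauss) =
      (\<integral>g. (\<Sum>\<omega>\<in>\<Omega>. \<Sum>i\<in>K. b i \<omega> * (g i * ?s g \<omega>)) \<partial>iid_gauss)"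
    by (simp add: gibbs_avg_def sum_distrib_left mult_ac)
  also have "\<dots> = (\<Sum>\<omega>\<in>\<Omega>. \<Sum>i\<in>K. b i \<omega> * (\<integral>g. g i * ?s g \<omega> \<partial>iid_gauss))"
    using int_coord by (simp add: Bochner_Integration.integral_sum)
  also have "\<dots> = (\<Sum>\<omega>\<in>\<Omega>. \<Sum>i\<in>K. b i \<omega> * (\<integral>g. ?s g \<omega> * (a i \<omega> - ?avg g (a i)) \<partial>iid_gauss))"
    using fin K by (intro sum.cong refl arg_cong2[where f = "(*)"] softmax_integration_by_parts) auto
  also have "\<dots> = (\<integral>g. (\<Sum>\<omega>\<in>\<Omega>. \<Sum>i\<in>K. b i \<omega> * (?s g \<omega> * (a i \<omega> - ?avg g (a i)))) \<partial>iid_gauss)"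
    using int_avg by (simp add: Bochner_Integration.integral_sum)
  also have "\<dots> = (\<integral>g. ?avg g (\<lambda>\<omega>. \<Sum>i\<in>K. b i \<omega> * a i \<omega>) - pair_avg \<Omega> (?E g) (\<lambda>\<omega> \<omega>'. \<Sum>i\<in>K. b i \<omega> * a i \<omega>') \<partial>iid_gauss)"
  proof (rule Bochner_Integration.integral_cong[OF refl])
    fix g
    have "(\<Sum>\<omega>\<in>\<Omega>. \<Sum>i\<in>K. b i \<omega> * (?s g \<omega> * (a i \<omega> - ?avg g (a i)))) =
        ?avg g (\<lambda>\<omega>. \<Sum>i\<in>K. b i \<omega> * (a i \<omega> - ?avg g (a i)))"
      by (simp add: gibbs_avg_def sum_distrib_left mult.left_commute)
    then show "(\<Sum>\<omega>\<in>\<Omega>. \<Sum>i\<in>K. b i \<omega> * (?s g \<omega> * (a i \<omega> - ?avg g (a i)))) =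
        ?avg g (\<lambda>\<omega>. \<Sum>i\<in>K. b i \<omega> * a i \<omega>) - pair_avg \<Omega> (?E g) (\<lambda>\<omega> \<omega>'. \<Sum>i\<in>K. b i \<omega> * a i \<omega>')"
      by (simp add: right_diff_distrib sum_subtractf gibbs_avg_diff gibbs_avg_sum gibbs_avg_cmult)
  qed
  also have "\<dots> = (\<integral>g. ?avg g (\<lambda>\<omega>. \<Sum>i\<in>K. b i \<omega> * a i \<omega>) \<partial>iid_gauss) -
      (\<integral>g. pair_avg \<Omega> (?E g) (\<lambda>\<omega> \<omega>'. \<Sum>i\<in>K. b i \<omega> * a i \<omega>') \<partial>iid_gauss)"
    using fin by (intro Bochner_Integration.integral_diff integrable_gibbs_avg) auto
  finally show ?thesis .
qed

text \<open>A system of \<^term>\<open>n\<close> replicas is again affine in the couplings.\<close>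
lemma replica_avg_integration_by_parts:
  assumes fin: "finite \<Omega>" "\<Omega> \<noteq> {}" "finite J" and K: "K \<subseteq> J"
    and C: "\<And>\<omega> \<omega>'. C \<omega> \<omega>' = (\<Sum>i\<in>K. b i \<omega> * a i \<omega>')"
  shows "(\<integral>g. replica_avg \<Omega> (affine_energy J a c g) n (\<lambda>\<tau>. f \<tau> * (\<Sum>i\<in>K. b i (\<tau> l) * g i)) \<partial>iid_gauss) =
    (\<integral>g. replica_avg \<Omega> (affine_energy J a c g) n
       (\<lambda>\<tau>. f \<tau> * ((\<Sum>l'<n. C (\<tau> l) (\<tau> l')) - real n * gibbs_avg \<Omega> (affine_energy J a c g) (C (\<tau> l)))) \<partial>iid_gauss)"
proof -
  let ?T = "{..<n} \<rightarrow>\<^sub>E \<Omega>" and ?a = "\<lambda>i \<tau>. \<Sum>l'<n. a i (\<tau> l')"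
  let ?E = "affine_energy J ?a (\<lambda>\<tau>. \<Sum>l'<n. c (\<tau> l'))"
  have energy: "(\<lambda>\<tau>. \<Sum>l'<n. affine_energy J a c g (\<tau> l')) = ?E g" for g
    by (simp add: affine_energy_def sum.distrib sum_distrib_right sum.swap[of _ J] fun_eq_iff)
  have cov: "(\<Sum>i\<in>K. f \<tau> * b i (\<tau> l) * ?a i \<tau>') = f \<tau> * (\<Sum>l'<n. C (\<tau> l) (\<tau>' l'))" for \<tau> \<tau>'
    unfolding C by (subst sum.swap) (simp add: sum_distrib_left mult_ac)
  have marginal: "gibbs_avg ?T (?E g) (\<lambda>\<tau>'. \<Sum>l'<n. C \<omega> (\<tau>' l')) =
      real n * gibbs_avg \<Omega> (affine_energy J a c g) (C \<omega>)" for g \<omega>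
    using replica_avg_marginal[OF fin(1,2)] by (simp add: gibbs_avg_sum flip: energy)
  have "(\<integral>g. gibbs_avg ?T (?E g) (\<lambda>\<tau>. f \<tau> * (\<Sum>i\<in>K. b i (\<tau> l) * g i)) \<partial>iid_gauss) =
      (\<integral>g. gibbs_avg ?T (?E g) (\<lambda>\<tau>. \<Sum>i\<in>K. f \<tau> * b i (\<tau> l) * g i) \<partial>iid_gauss)"
    by (simp add: sum_distrib_left mult.assoc)
  also have "\<dots> = (\<integral>g. gibbs_avg ?T (?E g) (\<lambda>\<tau>. f \<tau> * (\<Sum>l'<n. C (\<tau> l) (\<tau> l'))) \<partial>iid_gauss) -
      (\<integral>g. pair_avg ?T (?E g) (\<lambda>\<tau> \<tau>'. f \<tau> * (\<Sum>l'<n. C (\<tau> l) (\<tau>' l'))) \<partial>iid_gauss)"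
    using fin K by (subst gibbs_avg_integration_by_parts) (simp_all add: cov finite_replicas)
  also have "\<dots> = (\<integral>g. gibbs_avg ?T (?E g) (\<lambda>\<tau>. f \<tau> * (\<Sum>l'<n. C (\<tau> l) (\<tau> l'))) -
      pair_avg ?T (?E g) (\<lambda>\<tau> \<tau>'. f \<tau> * (\<Sum>l'<n. C (\<tau> l) (\<tau>' l'))) \<partial>iid_gauss)"
    using fin by (intro Bochner_Integration.integral_diff[symmetric] integrable_gibbs_avg)
      (auto simp: finite_replicas)
  finally show ?thesis
    by (simp add: energy gibbs_avg_cmult marginal right_diff_distrib flip: gibbs_avg_diff)
qed

text \<open>Convexity of the log-partition function, with the slope computed by Gaussian integration by parts.\<close>
lemma expected_log_sum_exp_increment:
  fixes J :: "'i set"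
  assumes fin: "finite \<Omega>" "\<Omega> \<noteq> {}" "finite J"
    and C: "\<And>\<omega> \<omega>'. C \<omega> \<omega>' = (\<Sum>i\<in>J. (a' i \<omega> - a i \<omega>) * a i \<omega>')"
    and diag: "\<And>\<omega>. \<omega> \<in> \<Omega> \<Longrightarrow> v \<le> C \<omega> \<omega> + (c' \<omega> - c \<omega>)"
  shows "(\<integral>g. log_sum_exp \<Omega> (affine_energy J a c g) \<partial>iid_gauss) +
      (v - (\<integral>g. pair_avg \<Omega> (affine_energy J a c g) C \<partial>iid_gauss))
    \<le> (\<integral>g. log_sum_exp \<Omega> (affine_energy J a' c' g) \<partial>iid_gauss)"
proof -
  let ?E = "affine_energy J a c" and ?E' = "affine_energy J a' c'"
  let ?avg = "\<lambda>g. gibbs_avg \<Omega> (?E g)"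
  let ?h = "\<lambda>g \<omega>. \<Sum>i\<in>J. (a' i \<omega> - a i \<omega>) * g i"
  have int_diag: "integrable iid_gauss (\<lambda>g. ?avg g (\<lambda>\<omega>. C \<omega> \<omega>))"
    and int_c: "integrable iid_gauss (\<lambda>g. ?avg g (\<lambda>\<omega>. c' \<omega> - c \<omega>))"
    and int_h: "integrable iid_gauss (\<lambda>g. ?avg g (?h g))"
    using fin integrable_linear by (auto intro!: integrable_gibbs_avg)
  have int_lse: "integrable iid_gauss (\<lambda>g. log_sum_exp \<Omega> (?E g))" "integrable iid_gauss (\<lambda>g. log_sum_exp \<Omega> (?E' g))"
    by (rule integrable_log_sum_exp_affine_energy[OF fin])+
  have "v = (\<integral>g. v \<partial>(iid_gauss :: ('i \<Rightarrow> real) measure))" by simp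
  also have "\<dots> \<le> (\<integral>g. ?avg g (\<lambda>\<omega>. C \<omega> \<omega>) + ?avg g (\<lambda>\<omega>. c' \<omega> - c \<omega>) \<partial>iid_gauss)"
    using int_diag int_c fin diag
    by (intro integral_mono Bochner_Integration.integrable_add) (auto simp flip: gibbs_avg_add intro: gibbs_avg_ge)
  also have "\<dots> = (\<integral>g. ?avg g (\<lambda>\<omega>. C \<omega> \<omega>) \<partial>iid_gauss) + (\<integral>g. ?avg g (\<lambda>\<omega>. c' \<omega> - c \<omega>) \<partial>iid_gauss)"
    by (rule Bochner_Integration.integral_add[OF int_diag int_c])
  also have "(\<integral>g. ?avg g (\<lambda>\<omega>. C \<omega> \<omega>) \<partial>iid_gauss) =
      (\<integral>g. ?avg g (?h g) \<partial>iid_gauss) + (\<integral>g. pair_avg \<Omega> (?E g) C \<partial>iid_gauss)"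
    unfolding C using fin by (subst gibbs_avg_integration_by_parts) auto
  finally have "v - (\<integral>g. pair_avg \<Omega> (?E g) C \<partial>iid_gauss) \<le>
      (\<integral>g. ?avg g (?h g) \<partial>iid_gauss) + (\<integral>g. ?avg g (\<lambda>\<omega>. c' \<omega> - c \<omega>) \<partial>iid_gauss)" by simp
  also have "\<dots> = (\<integral>g. ?avg g (\<lambda>\<omega>. ?E' g \<omega> - ?E g \<omega>) \<partial>iid_gauss)"
  proof -
    have "?E' g \<omega> - ?E g \<omega> = ?h g \<omega> + (c' \<omega> - c \<omega>)" for g \<omega>
      by (simp add: affine_energy_def left_diff_distrib sum_subtractf)
    then show ?thesis using int_h int_c by (simp add: gibbs_avg_add)
  qed
  also have "\<dots> \<le> (\<integral>g. log_sum_exp \<Omega> (?E' g) - log_sum_exp \<Omega> (?E g) \<partial>iid_gauss)"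
    using int_lse fin
    by (intro integral_mono gibbs_avg_diff_le_log_sum_exp_diff integrable_gibbs_avg
        Bochner_Integration.integrable_diff integrable_affine_energy) auto
  finally show ?thesis using int_lse by simp
qed

section \<open>Spin configurations and the energy\<close>

lemma idx_0: "idx 0 N = {[]}"
  by (auto simp: idx_def)

lemma idx_Suc: "idx (Suc p) N = (\<lambda>(i, xs). i # xs) ` ({..<N} \<times> idx p N)"
  by (auto simp: idx_def length_Suc_conv image_iff)

lemma finite_idx [simp]: "finite (idx p N)"
  by (induction p) (auto simp: idx_0 idx_Suc)

lemma length_idx: "xs \<in> idx p N \<Longrightarrow> length xs = p"
  by (simp add: idx_def)

lemma sum_idx_prod_list:
  fixes f :: "nat \<Rightarrow> real"
  shows "(\<Sum>xs\<in>idx p N. prod_list (map f xs)) = (\<Sum>i<N. f i) ^ p"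
proof (induction p)
  case 0
  then show ?case by (simp add: idx_0)
next
  case (Suc p)
  have "inj_on (\<lambda>(i, xs). i # xs) ({..<N} \<times> idx p N)" by (auto simp: inj_on_def)
  then have "(\<Sum>xs\<in>idx (Suc p) N. prod_list (map f xs)) =
      (\<Sum>(i, xs)\<in>{..<N} \<times> idx p N. f i * prod_list (map f xs))"
    by (simp add: idx_Suc sum.reindex split_beta' o_def)
  also have "\<dots> = (\<Sum>i<N. f i) * (\<Sum>xs\<in>idx p N. prod_list (map f xs))"
    by (simp add: sum.cartesian_product[symmetric] sum_product)
  finally show ?case by (simp add: Suc.IH)
qed

lemma prod_list_map_mult:
  fixes f h :: "'b \<Rightarrow> real"
  shows "prod_list (map f xs) * prod_list (map h xs) = prod_list (map (\<lambda>i. f i * h i) xs)"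
  by (induction xs) (auto simp: mult_ac)

lemma card_idx: "real (card (idx p N)) = real N ^ p"
  using sum_idx_prod_list[of "\<lambda>_. 1" p N] by (simp add: map_replicate_const)

lemma finite_Sigma [simp]: "finite (Sigma N)"
  unfolding Sigma_def by (intro finite_PiE) auto

lemma card_Sigma: "card (Sigma N) = 2 ^ N"
  unfolding Sigma_def by (subst card_PiE) (auto simp: numeral_2_eq_2)

lemma Sigma_nonempty [simp]: "Sigma N \<noteq> {}"
  using card_Sigma[of N] by (metis card.empty power_not_zero zero_neq_numeral)

lemma Sigma_cases:
  assumes "\<sigma> \<in> Sigma N" "i < N"
  obtains "\<sigma> i = 1" | "\<sigma> i = -1"
  using assms unfolding Sigma_def by (auto simp: PiE_def Pi_def)

lemma Sigma_square: "\<sigma> \<in> Sigma N \<Longrightarrow> i < N \<Longrightarrow> \<sigma> i * \<sigma> i = 1"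
  by (erule (1) Sigma_cases) auto

lemma Sigma_restrict: "\<sigma> \<in> Sigma N \<Longrightarrow> (\<lambda>i\<in>{..<N}. \<sigma> i) = \<sigma>"
  unfolding Sigma_def by (metis PiE_restrict restrict_ext)

lemma prod_list_Sigma:
  assumes "\<sigma> \<in> Sigma N" "set xs \<subseteq> {..<N}"
  shows "prod_list (map \<sigma> xs) = 1 \<or> prod_list (map \<sigma> xs) = -1"
  using assms(2)
proof (induction xs)
  case (Cons i xs)
  then show ?case by (cases rule: Sigma_cases[OF assms(1), of i]) auto
qed simp

lemma overlap_self: "N \<ge> 1 \<Longrightarrow> \<sigma> \<in> Sigma N \<Longrightarrow> overlap N \<sigma> \<sigma> = 1"
  by (simp add: overlap_def Sigma_square)

lemma overlap_commute: "overlap N \<sigma> \<tau> = overlap N \<tau> \<sigma>"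
  by (simp add: overlap_def mult.commute)

lemma abs_overlap_le_1:
  assumes "\<sigma> \<in> Sigma N" "\<tau> \<in> Sigma N"
  shows "\<bar>overlap N \<sigma> \<tau>\<bar> \<le> 1"
proof -
  have "\<bar>\<sigma> i * \<tau> i\<bar> = 1" if "i < N" for i
    using Sigma_cases[OF assms(1) that] Sigma_cases[OF assms(2) that] by (metis abs_1 abs_minus mult_1 mult_minus1)
  then have "\<bar>\<Sum>i<N. \<sigma> i * \<tau> i\<bar> \<le> real N"
    using sum_abs[of "\<lambda>i. \<sigma> i * \<tau> i" "{..<N}"] by simp
  then show ?thesis by (cases "N = 0") (auto simp: overlap_def abs_divide)
qed

lemma abs_overlap_power_le_1:
  assumes "\<sigma> \<in> Sigma N" "\<tau> \<in> Sigma N"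
  shows "\<bar>overlap N \<sigma> \<tau> ^ p\<bar> \<le> 1"
  by (intro abs_power_le_1 abs_overlap_le_1 assms)

subsection \<open>The \<open>p\<close>-spin Hamiltonian\<close>

definition coupling_coeff :: "nat \<Rightarrow> nat \<Rightarrow> nat list \<Rightarrow> (nat \<Rightarrow> real) \<Rightarrow> real" where
  "coupling_coeff p N xs \<sigma> = real N powr (- (real p - 1) / 2) * prod_list (map \<sigma> xs)"

lemma H_eq_sum_coupling_coeff: "H p N g \<sigma> = (\<Sum>xs\<in>idx p N. coupling_coeff p N xs \<sigma> * g xs)"
  by (simp add: H_def coupling_coeff_def sum_distrib_left mult_ac)

lemma coupling_scale_square:
  assumes "N \<ge> 1" "p \<ge> 1"
  shows "(real N powr (- (real p - 1) / 2))\<^sup>2 * real N ^ p = real N"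
proof -
  have "(real N powr (- (real p - 1) / 2))\<^sup>2 = real N powr (1 - real p)"
    by (simp add: power2_eq_square powr_add[symmetric])
  moreover have "real N ^ p = real N powr real p"
    using assms by (simp add: powr_realpow)
  ultimately show ?thesis using assms by (simp add: powr_add[symmetric])
qed

lemma abs_coupling_coeff:
  assumes "xs \<in> idx p N" "\<sigma> \<in> Sigma N"
  shows "\<bar>coupling_coeff p N xs \<sigma>\<bar> = real N powr (- (real p - 1) / 2)"
  using prod_list_Sigma[OF assms(2), of xs] assms(1) by (auto simp: coupling_coeff_def idx_def abs_mult)

lemma sum_coupling_scale_square:
  assumes "N \<ge> 1" "p \<ge> 1"
  shows "(\<Sum>xs\<in>idx p N. (k * real N powr (- (real p - 1) / 2))\<^sup>2) = k\<^sup>2 * real N"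
  using coupling_scale_square[OF assms] by (simp add: card_idx power_mult_distrib mult_ac)

lemma sum_coupling_coeff_mult:
  assumes "N \<ge> 1" "p \<ge> 1"
  shows "(\<Sum>xs\<in>idx p N. coupling_coeff p N xs \<sigma> * coupling_coeff p N xs \<tau>) = real N * overlap N \<sigma> \<tau> ^ p"
proof -
  let ?k = "real N powr (- (real p - 1) / 2)"
  have "(\<Sum>xs\<in>idx p N. coupling_coeff p N xs \<sigma> * coupling_coeff p N xs \<tau>) =
     (\<Sum>xs\<in>idx p N. ?k\<^sup>2 * prod_list (map (\<lambda>i. \<sigma> i * \<tau> i) xs))"
    by (simp add: coupling_coeff_def power2_eq_square prod_list_map_mult[symmetric] mult_ac)
  also have "\<dots> = ?k\<^sup>2 * (\<Sum>i<N. \<sigma> i * \<tau> i) ^ p"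
    by (simp add: sum_distrib_left[symmetric] sum_idx_prod_list)
  also have "\<dots> = (?k\<^sup>2 * real N ^ p) * overlap N \<sigma> \<tau> ^ p"
    using assms by (simp add: overlap_def power_divide)
  finally show ?thesis using coupling_scale_square[OF assms] by simp
qed

lemma borel_measurable_H [measurable]: "(\<lambda>g. H p N g \<sigma>) \<in> borel_measurable iid_gauss"
  unfolding H_def by measurable

lemma integrable_H: "integrable iid_gauss (\<lambda>g. H p N g \<sigma>)"
  unfolding H_eq_sum_coupling_coeff by (rule integrable_linear)

lemma affine_energy_coupling_coeff:
  "affine_energy (idx p N) (\<lambda>xs \<sigma>. k * coupling_coeff p N xs \<sigma>) c g = (\<lambda>\<sigma>. k * H p N g \<sigma> + c \<sigma>)"
  by (rule ext) (simp add: affine_energy_def H_eq_sum_coupling_coeff sum_distrib_left mult_ac)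

lemma subgaussian_log_sum_exp_H:
  assumes "N \<ge> 1" "p \<ge> 1" "A \<subseteq> Sigma N" "A \<noteq> {}"
  shows "subgaussian iid_gauss (\<lambda>g. log_sum_exp A (\<lambda>\<sigma>. k * H p N g \<sigma> + c \<sigma>)) (k\<^sup>2 * real N)"
  unfolding affine_energy_coupling_coeff[symmetric]
proof (rule subgaussian_log_sum_exp_affine_energy[where A = "\<lambda>_. \<bar>k\<bar> * real N powr (- (real p - 1) / 2)"])
  show "finite A" by (rule finite_subset[OF assms(3)]) simp
  show "(\<Sum>xs\<in>idx p N. (\<bar>k\<bar> * real N powr (- (real p - 1) / 2))\<^sup>2) \<le> k\<^sup>2 * real N"
    using sum_coupling_scale_square[OF assms(1,2), of "\<bar>k\<bar>"] by simp
  show "\<bar>k * coupling_coeff p N xs \<sigma>\<bar> \<le> \<bar>k\<bar> * real N powr (- (real p - 1) / 2)"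
    if "xs \<in> idx p N" "\<sigma> \<in> A" for xs \<sigma>
    using abs_coupling_coeff[OF that(1), of \<sigma>] that assms(3) by (auto simp: abs_mult)
qed (use assms in auto)

lemma expected_log_sum_exp_H_increment:
  fixes k k' :: real and c c' :: "(nat \<Rightarrow> real) \<Rightarrow> real"
  assumes N: "N \<ge> 1" "p \<ge> 1" and A: "A \<subseteq> Sigma N" "A \<noteq> {}" and d: "\<And>\<sigma>. \<sigma> \<in> A \<Longrightarrow> d \<le> c' \<sigma> - c \<sigma>"
  defines "r \<equiv> (\<integral>g. pair_avg A (\<lambda>\<sigma>. k * H p N g \<sigma> + c \<sigma>) (\<lambda>\<sigma> \<tau>. overlap N \<sigma> \<tau> ^ p) \<partial>iid_gauss)"
  shows "(\<integral>g. log_sum_exp A (\<lambda>\<sigma>. k * H p N g \<sigma> + c \<sigma>) \<partial>iid_gauss) + ((k' - k) * k * real N * (1 - r) + d)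
    \<le> (\<integral>g. log_sum_exp A (\<lambda>\<sigma>. k' * H p N g \<sigma> + c' \<sigma>) \<partial>iid_gauss)"
proof -
  let ?C = "\<lambda>\<sigma> \<tau>. (k' - k) * k * real N * overlap N \<sigma> \<tau> ^ p"
  have C: "?C \<sigma> \<tau> = (\<Sum>xs\<in>idx p N. (k' * coupling_coeff p N xs \<sigma> - k * coupling_coeff p N xs \<sigma>) *
      (k * coupling_coeff p N xs \<tau>))" for \<sigma> \<tau>
    unfolding left_diff_distrib[symmetric] mult.assoc sum_coupling_coeff_mult[OF N, symmetric] sum_distrib_left
    by (intro sum.cong refl) (simp add: mult_ac)
  have "(\<integral>g. pair_avg A (\<lambda>\<sigma>. k * H p N g \<sigma> + c \<sigma>) ?C \<partial>iid_gauss) = (k' - k) * k * real N * r"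
    unfolding r_def gibbs_avg_cmult by simp
  moreover have "(k' - k) * k * real N + d \<le> ?C \<sigma> \<sigma> + (c' \<sigma> - c \<sigma>)" if "\<sigma> \<in> A" for \<sigma>
    using that d A N overlap_self[of N \<sigma>] by (simp add: subset_iff)
  moreover have "finite A" by (rule finite_subset[OF A(1)]) simp
  ultimately have "(\<integral>g. log_sum_exp A (\<lambda>\<sigma>. k * H p N g \<sigma> + c \<sigma>) \<partial>iid_gauss) +
      ((k' - k) * k * real N + d - (k' - k) * k * real N * r)
    \<le> (\<integral>g. log_sum_exp A (\<lambda>\<sigma>. k' * H p N g \<sigma> + c' \<sigma>) \<partial>iid_gauss)"
    using expected_log_sum_exp_increment[where \<Omega> = A and J = "idx p N" and C = ?C and c = c and c' = c'
        and v = "(k' - k) * k * real N + d" and a = "\<lambda>xs \<sigma>. k * coupling_coeff p N xs \<sigma>"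
        and a' = "\<lambda>xs \<sigma>. k' * coupling_coeff p N xs \<sigma>"] C A(2)
    by (simp only: affine_energy_coupling_coeff finite_idx simp_thms)
  then show ?thesis by (simp add: right_diff_distrib)
qed

lemma pair_avg_overlap_power_nonneg:
  assumes "N \<ge> 1" "p \<ge> 1"
  shows "pair_avg A X (\<lambda>\<sigma> \<tau>. overlap N \<sigma> \<tau> ^ p) \<ge> 0"
proof -
  have "real N * pair_avg A X (\<lambda>\<sigma> \<tau>. overlap N \<sigma> \<tau> ^ p) =
     pair_avg A X (\<lambda>\<sigma> \<tau>. \<Sum>xs\<in>idx p N. coupling_coeff p N xs \<sigma> * coupling_coeff p N xs \<tau>)"
    unfolding sum_coupling_coeff_mult[OF assms] gibbs_avg_cmult ..
  also have "\<dots> = (\<Sum>xs\<in>idx p N. gibbs_avg A X (\<lambda>\<sigma>. gibbs_avg A X (coupling_coeff p N xs) * coupling_coeff p N xs \<sigma>))"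
    by (simp add: gibbs_avg_sum gibbs_avg_cmult mult.commute)
  also have "\<dots> = (\<Sum>xs\<in>idx p N. (gibbs_avg A X (coupling_coeff p N xs))\<^sup>2)"
    by (simp add: gibbs_avg_cmult power2_eq_square)
  also have "\<dots> \<ge> 0" by (intro sum_nonneg) auto
  finally show ?thesis using assms by (simp add: zero_le_mult_iff)
qed

section \<open>The planted disorder\<close>

definition ones :: "nat \<Rightarrow> nat \<Rightarrow> real" where
  "ones N = (\<lambda>i\<in>{..<N}. 1)"

definition spin_mult :: "nat \<Rightarrow> (nat \<Rightarrow> real) \<Rightarrow> (nat \<Rightarrow> real) \<Rightarrow> nat \<Rightarrow> real" where
  "spin_mult N s \<sigma> = (\<lambda>i\<in>{..<N}. s i * \<sigma> i)"

definition gauge :: "nat \<Rightarrow> nat \<Rightarrow> (nat \<Rightarrow> real) \<Rightarrow> (nat list \<Rightarrow> real) \<Rightarrow> nat list \<Rightarrow> real" where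
  "gauge p N s g = (\<lambda>xs. if xs \<in> idx p N then prod_list (map s xs) * g xs else g xs)"

definition planted :: "nat \<Rightarrow> nat \<Rightarrow> real \<Rightarrow> (nat list \<Rightarrow> real) \<Rightarrow> nat list \<Rightarrow> real" where
  "planted p N \<beta> g = (\<lambda>xs. g xs + (if xs \<in> idx p N then \<beta> / sqrt 2 * coupling_coeff p N xs (ones N) else 0))"

text \<open>The shift gives every configuration the expected weight \<open>E (exp (normalized_energy p N \<beta> g \<sigma>)) = 2 powr (- N)\<close>.\<close>
definition normalized_energy :: "nat \<Rightarrow> nat \<Rightarrow> real \<Rightarrow> (nat list \<Rightarrow> real) \<Rightarrow> (nat \<Rightarrow> real) \<Rightarrow> real" where
  "normalized_energy p N \<beta> g \<sigma> = \<beta> / sqrt 2 * H p N g \<sigma> + - ((\<beta>\<^sup>2 / 4 + ln 2) * real N)"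

text \<open>\<open>ln W\<close>, where \<open>W\<close> is the partition function divided by its expectation.\<close>
definition log_ratio :: "nat \<Rightarrow> nat \<Rightarrow> real \<Rightarrow> (nat list \<Rightarrow> real) \<Rightarrow> real" where
  "log_ratio p N \<beta> g = log_sum_exp (Sigma N) (normalized_energy p N \<beta> g)"

definition mean_log_ratio :: "nat \<Rightarrow> nat \<Rightarrow> real \<Rightarrow> real" where
  "mean_log_ratio p N \<beta> = (\<integral>g. log_ratio p N \<beta> g \<partial>iid_gauss)"

definition planted_mean_log_ratio :: "nat \<Rightarrow> nat \<Rightarrow> real \<Rightarrow> real" where
  "planted_mean_log_ratio p N \<beta> = (\<integral>g. log_ratio p N \<beta> (planted p N \<beta> g) \<partial>iid_gauss)"

subsection \<open>Gauge invariance\<close>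

lemma ones_in_Sigma [simp]: "ones N \<in> Sigma N"
  by (auto simp: ones_def Sigma_def)

lemma spin_mult_in_Sigma: "s \<in> Sigma N \<Longrightarrow> \<sigma> \<in> Sigma N \<Longrightarrow> spin_mult N s \<sigma> \<in> Sigma N"
  by (fastforce simp: spin_mult_def Sigma_def PiE_def Pi_def)

lemma spin_mult_spin_mult:
  assumes "s \<in> Sigma N" "\<sigma> \<in> Sigma N"
  shows "spin_mult N s (spin_mult N s \<sigma>) = \<sigma>"
proof -
  have "spin_mult N s (spin_mult N s \<sigma>) = (\<lambda>i\<in>{..<N}. (s i * s i) * \<sigma> i)"
    by (auto simp: spin_mult_def mult.assoc)
  also have "\<dots> = (\<lambda>i\<in>{..<N}. \<sigma> i)" using assms(1) by (auto simp: Sigma_square)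
  finally show ?thesis using Sigma_restrict[OF assms(2)] by simp
qed

lemma spin_mult_self: "s \<in> Sigma N \<Longrightarrow> spin_mult N s s = ones N"
  by (auto simp: spin_mult_def ones_def Sigma_square)

lemma bij_betw_spin_mult: "s \<in> Sigma N \<Longrightarrow> bij_betw (spin_mult N s) (Sigma N) (Sigma N)"
  by (rule bij_betw_byWitness[where f' = "spin_mult N s"]) (auto simp: spin_mult_spin_mult spin_mult_in_Sigma)

lemma overlap_spin_mult:
  assumes s: "s \<in> Sigma N"
  shows "overlap N (spin_mult N s \<sigma>) (spin_mult N s \<tau>) = overlap N \<sigma> \<tau>"
proof -
  have "spin_mult N s \<sigma> i * spin_mult N s \<tau> i = \<sigma> i * \<tau> i" if "i < N" for i
  proof -
    have "spin_mult N s \<sigma> i * spin_mult N s \<tau> i = (s i * s i) * (\<sigma> i * \<tau> i)"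
      using that by (simp add: spin_mult_def)
    then show ?thesis using Sigma_square[OF s that] by simp
  qed
  then show ?thesis by (simp add: overlap_def)
qed

lemma prod_list_spin_mult:
  assumes "set xs \<subseteq> {..<N}"
  shows "prod_list (map (spin_mult N s \<sigma>) xs) = prod_list (map s xs) * prod_list (map \<sigma> xs)"
proof -
  have "map (spin_mult N s \<sigma>) xs = map (\<lambda>i. s i * \<sigma> i) xs"
    using assms by (intro map_cong) (auto simp: spin_mult_def)
  then show ?thesis by (simp only: prod_list_map_mult)
qed

lemma H_gauge: "H p N (gauge p N s g) \<sigma> = H p N g (spin_mult N s \<sigma>)"
proof -
  have "(\<Sum>xs\<in>idx p N. gauge p N s g xs * prod_list (map \<sigma> xs)) =
     (\<Sum>xs\<in>idx p N. g xs * prod_list (map (spin_mult N s \<sigma>) xs))"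
    by (intro sum.cong refl) (auto simp: gauge_def idx_def prod_list_spin_mult)
  then show ?thesis by (simp add: H_def)
qed

lemma normalized_energy_gauge:
  "normalized_energy p N \<beta> (gauge p N s g) = (\<lambda>\<sigma>. normalized_energy p N \<beta> g (spin_mult N s \<sigma>))"
  by (rule ext) (simp add: normalized_energy_def H_gauge)

lemma log_ratio_gauge:
  assumes "s \<in> Sigma N"
  shows "log_ratio p N \<beta> (gauge p N s g) = log_ratio p N \<beta> g"
  using log_sum_exp_reindex[of "spin_mult N s" "Sigma N" "normalized_energy p N \<beta> g"] bij_betw_spin_mult[OF assms]
  by (simp add: log_ratio_def normalized_energy_gauge bij_betw_def)

lemma gibbs_avg_gauge:
  assumes s: "s \<in> Sigma N"
  shows "gibbs_avg (Sigma N) (normalized_energy p N \<beta> (gauge p N s g)) f =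
    gibbs_avg (Sigma N) (normalized_energy p N \<beta> g) (\<lambda>\<sigma>. f (spin_mult N s \<sigma>))"
proof -
  have "gibbs_avg (Sigma N) (normalized_energy p N \<beta> g) (\<lambda>\<sigma>. f (spin_mult N s \<sigma>)) =
      gibbs_avg (Sigma N) (\<lambda>\<sigma>. normalized_energy p N \<beta> g (spin_mult N s \<sigma>))
        (\<lambda>\<sigma>. f (spin_mult N s (spin_mult N s \<sigma>)))"
    by (rule gibbs_avg_reindex[OF bij_betw_spin_mult[OF s]])
  also have "\<dots> = gibbs_avg (Sigma N) (normalized_energy p N \<beta> (gauge p N s g)) f"
    unfolding normalized_energy_gauge using spin_mult_spin_mult[OF s] by (intro gibbs_avg_cong) simp
  finally show ?thesis ..
qed

subsection \<open>Planting as a change of measure\<close>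

lemma H_planted:
  assumes "N \<ge> 1" "p \<ge> 1"
  shows "H p N (planted p N \<beta> g) \<sigma> = H p N g \<sigma> + \<beta> / sqrt 2 * (real N * overlap N (ones N) \<sigma> ^ p)"
proof -
  have "H p N (planted p N \<beta> g) \<sigma> = (\<Sum>xs\<in>idx p N. coupling_coeff p N xs \<sigma> * g xs +
      \<beta> / sqrt 2 * (coupling_coeff p N xs \<sigma> * coupling_coeff p N xs (ones N)))"
    unfolding H_eq_sum_coupling_coeff by (intro sum.cong refl) (auto simp: planted_def algebra_simps)
  then show ?thesis
    using sum_coupling_coeff_mult[OF assms, of \<sigma> "ones N"]
    by (simp only: sum.distrib sum_distrib_left[symmetric] H_eq_sum_coupling_coeff overlap_commute[of N \<sigma>])
qed

lemma normalized_energy_planted: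
  assumes "N \<ge> 1" "p \<ge> 1"
  shows "normalized_energy p N \<beta> (planted p N \<beta> g) =
    (\<lambda>\<sigma>. \<beta> / sqrt 2 * H p N g \<sigma> + (\<beta>\<^sup>2 / 2 * real N * overlap N (ones N) \<sigma> ^ p - (\<beta>\<^sup>2 / 4 + ln 2) * real N))"
  by (rule ext) (simp add: normalized_energy_def H_planted[OF assms] power2_eq_square field_simps)

lemma borel_measurable_normalized_energy [measurable]:
  "(\<lambda>g. normalized_energy p N \<beta> g \<sigma>) \<in> borel_measurable iid_gauss"
  unfolding normalized_energy_def by measurable

lemma borel_measurable_log_ratio [measurable]: "log_ratio p N \<beta> \<in> borel_measurable iid_gauss"
  unfolding log_ratio_def[abs_def] by measurable

lemma measurable_planted [measurable]: "planted p N \<beta> \<in> measurable iid_gauss iid_gauss"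
  unfolding planted_def[abs_def] by (rule measurable_into_iid_gauss) measurable

lemma nn_integral_gauge:
  assumes "s \<in> Sigma N" "\<Phi> \<in> borel_measurable iid_gauss"
  shows "(\<integral>\<^sup>+g. \<Phi> (gauge p N s g) \<partial>iid_gauss) = (\<integral>\<^sup>+g. \<Phi> g \<partial>iid_gauss)"
  unfolding gauge_def
proof (rule nn_integral_sign_flip[OF finite_idx assms(2)])
  show "prod_list (map s xs) = 1 \<or> prod_list (map s xs) = - 1" if "xs \<in> idx p N" for xs
    using prod_list_Sigma[OF assms(1)] that by (simp add: idx_def)
qed

lemma nn_integral_exp_normalized_energy_ones:
  assumes N: "N \<ge> 1" "p \<ge> 1" and \<Phi>: "\<Phi> \<in> borel_measurable iid_gauss"
  shows "(\<integral>\<^sup>+g. ennreal (exp (normalized_energy p N \<beta> g (ones N))) * \<Phi> g \<partial>iid_gauss) =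
    ennreal (1 / 2 ^ N) * (\<integral>\<^sup>+g. \<Phi> (planted p N \<beta> g) \<partial>iid_gauss)"
proof -
  let ?b = "\<lambda>xs. \<beta> / sqrt 2 * coupling_coeff p N xs (ones N)"
  let ?density = "\<lambda>g. exp ((\<Sum>xs\<in>idx p N. ?b xs * g xs) - (\<Sum>xs\<in>idx p N. (?b xs)\<^sup>2) / 2)"
  have "(\<Sum>xs\<in>idx p N. (?b xs)\<^sup>2) =
      \<beta>\<^sup>2 / 2 * (\<Sum>xs\<in>idx p N. coupling_coeff p N xs (ones N) * coupling_coeff p N xs (ones N))"
    unfolding sum_distrib_left
    by (intro sum.cong refl) (simp add: power_mult_distrib power_divide power2_eq_square)
  then have variance: "(\<Sum>xs\<in>idx p N. (?b xs)\<^sup>2) = \<beta>\<^sup>2 / 2 * real N"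
    by (simp add: sum_coupling_coeff_mult[OF N] overlap_self[OF N(1)])
  have "normalized_energy p N \<beta> g (ones N) =
      (\<Sum>xs\<in>idx p N. ?b xs * g xs) - (\<Sum>xs\<in>idx p N. (?b xs)\<^sup>2) / 2 - real N * ln 2" for g
    unfolding variance
    by (simp add: normalized_energy_def H_eq_sum_coupling_coeff sum_distrib_left mult.assoc algebra_simps)
  then have weight: "exp (normalized_energy p N \<beta> g (ones N)) = 1 / 2 ^ N * ?density g" for g
    by (simp add: exp_diff exp_of_nat_mult)
  have "(\<integral>\<^sup>+g. ennreal (exp (normalized_energy p N \<beta> g (ones N))) * \<Phi> g \<partial>iid_gauss) =
      (\<integral>\<^sup>+g. ennreal (1 / 2 ^ N) * (ennreal (?density g) * \<Phi> g) \<partial>iid_gauss)"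
    unfolding weight by (subst ennreal_mult) (simp_all add: mult.assoc)
  also have "\<dots> = ennreal (1 / 2 ^ N) * (\<integral>\<^sup>+g. ennreal (?density g) * \<Phi> g \<partial>iid_gauss)"
    using \<Phi> by (intro nn_integral_cmult) measurable
  also have "(\<integral>\<^sup>+g. ennreal (?density g) * \<Phi> g \<partial>iid_gauss) = (\<integral>\<^sup>+g. \<Phi> (planted p N \<beta> g) \<partial>iid_gauss)"
    unfolding planted_def by (rule cameron_martin[symmetric, OF finite_idx \<Phi>])
  finally show ?thesis .
qed

lemma nn_integral_planted:
  assumes N: "N \<ge> 1" "p \<ge> 1" and [measurable]: "\<And>s. \<Psi> s \<in> borel_measurable iid_gauss"
    and invariant: "\<And>s g. s \<in> Sigma N \<Longrightarrow> \<Psi> s (gauge p N s g) = \<Psi> (ones N) g"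
  shows "(\<integral>\<^sup>+g. (\<Sum>s\<in>Sigma N. ennreal (exp (normalized_energy p N \<beta> g s)) * \<Psi> s g) \<partial>iid_gauss) =
    (\<integral>\<^sup>+g. \<Psi> (ones N) (planted p N \<beta> g) \<partial>iid_gauss)"
proof -
  let ?I = "\<integral>\<^sup>+g. \<Psi> (ones N) (planted p N \<beta> g) \<partial>iid_gauss"
  have summand: "(\<integral>\<^sup>+g. ennreal (exp (normalized_energy p N \<beta> g s)) * \<Psi> s g \<partial>iid_gauss) = ennreal (1 / 2 ^ N) * ?I"
    if s: "s \<in> Sigma N" for s
  proof -
    have "(\<integral>\<^sup>+g. ennreal (exp (normalized_energy p N \<beta> g s)) * \<Psi> s g \<partial>iid_gauss) =
        (\<integral>\<^sup>+g. ennreal (exp (normalized_energy p N \<beta> (gauge p N s g) s)) * \<Psi> s (gauge p N s g) \<partial>iid_gauss)"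
      by (rule nn_integral_gauge[OF s, symmetric]) measurable
    also have "\<dots> = (\<integral>\<^sup>+g. ennreal (exp (normalized_energy p N \<beta> g (ones N))) * \<Psi> (ones N) g \<partial>iid_gauss)"
      by (simp add: normalized_energy_gauge spin_mult_self[OF s] invariant[OF s])
    also have "\<dots> = ennreal (1 / 2 ^ N) * ?I"
      by (rule nn_integral_exp_normalized_energy_ones[OF N]) measurable
    finally show ?thesis .
  qed
  have "(\<integral>\<^sup>+g. (\<Sum>s\<in>Sigma N. ennreal (exp (normalized_energy p N \<beta> g s)) * \<Psi> s g) \<partial>iid_gauss) =
      (\<Sum>s\<in>Sigma N. ennreal (1 / 2 ^ N) * ?I)"
    by (subst nn_integral_sum) (auto simp: summand)
  also have "\<dots> = (ennreal (2 ^ N) * ennreal (1 / 2 ^ N)) * ?I"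
    by (simp add: card_Sigma mult.assoc flip: ennreal_power)
  also have "ennreal (2 ^ N) * ennreal (1 / 2 ^ N) = 1"
    by (subst ennreal_mult[symmetric]) auto
  finally show ?thesis by simp
qed

lemma
  fixes \<Psi> :: "(nat \<Rightarrow> real) \<Rightarrow> (nat list \<Rightarrow> real) \<Rightarrow> real"
  assumes N: "N \<ge> 1" "p \<ge> 1" and [measurable]: "\<And>s. \<Psi> s \<in> borel_measurable iid_gauss"
    and invariant: "\<And>s g. s \<in> Sigma N \<Longrightarrow> \<Psi> s (gauge p N s g) = \<Psi> (ones N) g"
    and bound: "\<And>s g. 0 \<le> \<Psi> s g" "\<And>s g. \<Psi> s g \<le> B"
  shows integrable_exp_normalized_energy_mult:
      "integrable iid_gauss (\<lambda>g. \<Sum>s\<in>Sigma N. exp (normalized_energy p N \<beta> g s) * \<Psi> s g)" (is "integrable _ ?L")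
    and integral_planted:
      "(\<integral>g. (\<Sum>s\<in>Sigma N. exp (normalized_energy p N \<beta> g s) * \<Psi> s g) \<partial>iid_gauss) =
        (\<integral>g. \<Psi> (ones N) (planted p N \<beta> g) \<partial>iid_gauss)"
proof -
  have [measurable]: "(\<lambda>g. \<Psi> (ones N) (planted p N \<beta> g)) \<in> borel_measurable iid_gauss"
    by measurable
  have int: "integrable iid_gauss (\<lambda>g. \<Psi> (ones N) (planted p N \<beta> g))"
    by (rule iid_gauss.integrable_const_bound[where B = B]) (use bound in \<open>auto simp: abs_of_nonneg\<close>)
  have "(\<integral>\<^sup>+g. ennreal (?L g) \<partial>iid_gauss) =
      (\<integral>\<^sup>+g. (\<Sum>s\<in>Sigma N. ennreal (exp (normalized_energy p N \<beta> g s)) * ennreal (\<Psi> s g)) \<partial>iid_gauss)"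
    using bound by (intro nn_integral_cong) (simp add: ennreal_mult sum_ennreal[symmetric])
  also have "\<dots> = (\<integral>\<^sup>+g. ennreal (\<Psi> (ones N) (planted p N \<beta> g)) \<partial>iid_gauss)"
    by (rule nn_integral_planted[OF N]) (use invariant in auto)
  also have "\<dots> = ennreal (\<integral>g. \<Psi> (ones N) (planted p N \<beta> g) \<partial>iid_gauss)"
    by (rule nn_integral_eq_integral[OF int]) (use bound in auto)
  finally have eq: "(\<integral>\<^sup>+g. ennreal (?L g) \<partial>iid_gauss) = ennreal (\<integral>g. \<Psi> (ones N) (planted p N \<beta> g) \<partial>iid_gauss)" .
  have nonneg: "?L g \<ge> 0" for g using bound by (auto intro!: sum_nonneg)
  show int_L: "integrable iid_gauss ?L"
    by (rule integrableI_nonneg) (use nonneg eq in auto)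
  show "(\<integral>g. ?L g \<partial>iid_gauss) = (\<integral>g. \<Psi> (ones N) (planted p N \<beta> g) \<partial>iid_gauss)"
    using eq nn_integral_eq_integral[OF int_L] nonneg bound by (simp add: integral_nonneg_AE)
qed

lemma exp_log_ratio: "exp (log_ratio p N \<beta> g) = (\<Sum>s\<in>Sigma N. exp (normalized_energy p N \<beta> g s))"
  unfolding log_ratio_def by (rule exp_log_sum_exp) auto

lemma
  assumes "N \<ge> 1" "p \<ge> 1" "\<Psi> \<in> borel_measurable iid_gauss"
    and "\<And>s g. s \<in> Sigma N \<Longrightarrow> \<Psi> (gauge p N s g) = \<Psi> g"
    and "\<And>g. 0 \<le> \<Psi> g" "\<And>g. \<Psi> g \<le> B"
  shows integrable_exp_log_ratio_mult: "integrable iid_gauss (\<lambda>g. exp (log_ratio p N \<beta> g) * \<Psi> g)"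
    and integral_exp_log_ratio_mult:
      "(\<integral>g. exp (log_ratio p N \<beta> g) * \<Psi> g \<partial>iid_gauss) = (\<integral>g. \<Psi> (planted p N \<beta> g) \<partial>iid_gauss)"
  using integrable_exp_normalized_energy_mult[of N p "\<lambda>_. \<Psi>" B \<beta>] integral_planted[of N p "\<lambda>_. \<Psi>" B \<beta>] assms
  by (auto simp: exp_log_ratio sum_distrib_right)

lemma
  assumes "N \<ge> 1" "p \<ge> 1"
  shows integrable_exp_log_ratio: "integrable iid_gauss (\<lambda>g. exp (log_ratio p N \<beta> g))"
    and integral_exp_log_ratio: "(\<integral>g. exp (log_ratio p N \<beta> g) \<partial>iid_gauss) = 1"
  using integrable_exp_log_ratio_mult[OF assms, of "\<lambda>_. 1" 1 \<beta>]
    integral_exp_log_ratio_mult[OF assms, of "\<lambda>_. 1" 1 \<beta>] by auto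

subsection \<open>The free energy of the planted system\<close>

lemma prob_log_ratio_ge_le:
  assumes N: "N \<ge> 1" "p \<ge> 1"
  shows "iid_gauss.prob {g. x \<le> log_ratio p N \<beta> g} \<le> exp (- x)"
proof -
  have "iid_gauss.prob {g. x \<le> log_ratio p N \<beta> g} = iid_gauss.prob {g\<in>space iid_gauss. exp x \<le> exp (log_ratio p N \<beta> g)}"
    by simp
  also have "\<dots> \<le> (\<integral>g. exp (log_ratio p N \<beta> g) \<partial>iid_gauss) / exp x"
    by (rule integral_Markov_inequality_measure[where A = "{}"]) (use integrable_exp_log_ratio[OF N] in auto)
  finally show ?thesis using integral_exp_log_ratio[OF N] by (simp add: exp_minus divide_inverse)
qed

lemma
  assumes "N \<ge> 1" "p \<ge> 1" "A \<subseteq> Sigma N" "A \<noteq> {}" "0 \<le> \<beta>" "\<beta> \<le> b"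
  shows subgaussian_log_sum_exp_normalized_energy:
      "subgaussian iid_gauss (\<lambda>g. log_sum_exp A (normalized_energy p N \<beta> g)) (b\<^sup>2 / 2 * real N)"
    and subgaussian_log_sum_exp_planted:
      "subgaussian iid_gauss (\<lambda>g. log_sum_exp A (normalized_energy p N \<beta> (planted p N \<beta> g))) (b\<^sup>2 / 2 * real N)"
proof -
  have "\<beta>\<^sup>2 \<le> b\<^sup>2" using assms by (intro power_mono) auto
  then have V: "(\<beta> / sqrt 2)\<^sup>2 * real N \<le> b\<^sup>2 / 2 * real N"
    by (intro mult_right_mono) (auto simp: power_divide)
  show "subgaussian iid_gauss (\<lambda>g. log_sum_exp A (normalized_energy p N \<beta> g)) (b\<^sup>2 / 2 * real N)"
    unfolding normalized_energy_def[abs_def]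
    by (rule subgaussian_mono[OF subgaussian_log_sum_exp_H[OF assms(1-4)] V])
  show "subgaussian iid_gauss (\<lambda>g. log_sum_exp A (normalized_energy p N \<beta> (planted p N \<beta> g))) (b\<^sup>2 / 2 * real N)"
    unfolding normalized_energy_planted[OF assms(1,2)]
    by (rule subgaussian_mono[OF subgaussian_log_sum_exp_H[OF assms(1-4)] V])
qed

lemma
  assumes "N \<ge> 1" "p \<ge> 1" "0 \<le> \<beta>" "\<beta> \<le> b"
  shows subgaussian_log_ratio: "subgaussian iid_gauss (log_ratio p N \<beta>) (b\<^sup>2 / 2 * real N)"
    and subgaussian_log_ratio_planted:
      "subgaussian iid_gauss (\<lambda>g. log_ratio p N \<beta> (planted p N \<beta> g)) (b\<^sup>2 / 2 * real N)"
  using subgaussian_log_sum_exp_normalized_energy[of N p "Sigma N" \<beta> b]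
    subgaussian_log_sum_exp_planted[of N p "Sigma N" \<beta> b] assms
  by (simp_all add: log_ratio_def[abs_def])

text \<open>Expanding at the larger inverse temperature gives the bound in the right direction, because
  \<^term>\<open>pair_avg A X (\<lambda>\<sigma> \<tau>. overlap N \<sigma> \<tau> ^ p)\<close> is nonnegative.\<close>
lemma mean_log_ratio_antimono:
  assumes N: "N \<ge> 1" "p \<ge> 1" and \<beta>: "0 \<le> \<beta>1" "\<beta>1 \<le> \<beta>2"
  shows "mean_log_ratio p N \<beta>2 \<le> mean_log_ratio p N \<beta>1"
proof -
  have "mean_log_ratio p N v - mean_log_ratio p N u \<le> 0 * (v - u) + real N / 4 * (v - u)\<^sup>2"
    if uv: "\<beta>1 \<le> u" "u \<le> v" "v \<le> \<beta>2" for u v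
  proof -
    define r where "r = (\<integral>g. pair_avg (Sigma N) (normalized_energy p N v g) (\<lambda>\<sigma> \<tau>. overlap N \<sigma> \<tau> ^ p) \<partial>iid_gauss)"
    have "mean_log_ratio p N v + ((u / sqrt 2 - v / sqrt 2) * (v / sqrt 2) * real N * (1 - r) + (v\<^sup>2 - u\<^sup>2) / 4 * real N)
        \<le> mean_log_ratio p N u"
      unfolding mean_log_ratio_def log_ratio_def r_def normalized_energy_def
      by (rule expected_log_sum_exp_H_increment[OF N order_refl Sigma_nonempty]) (simp add: field_simps)
    moreover have "(u / sqrt 2 - v / sqrt 2) * (v / sqrt 2) * real N * (1 - r) = - ((v - u) * v / 2 * real N * (1 - r))"
      by (simp add: field_simps)
    moreover have "(v - u) * v / 2 * real N * (1 - r) \<le> (v - u) * v / 2 * real N * 1"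
    proof (intro mult_left_mono)
      have "0 \<le> r" unfolding r_def
        by (intro Bochner_Integration.integral_nonneg pair_avg_overlap_power_nonneg N)
      then show "1 - r \<le> 1" by simp
    qed (use \<beta> uv in simp)
    moreover have "(v - u) * v / 2 * real N * 1 - (v\<^sup>2 - u\<^sup>2) / 4 * real N = real N / 4 * (v - u)\<^sup>2"
      by (simp add: power2_eq_square field_simps)
    ultimately show ?thesis by linarith
  qed
  from diff_le_of_quadratic_increments[OF \<beta>(2) this] show ?thesis by simp
qed

lemma size_biased_prob_ge:
  assumes N: "N \<ge> 1" "p \<ge> 1"
  shows "exp (- y) * (1 - iid_gauss.prob {g. log_ratio p N \<beta> g \<le> - y} - iid_gauss.prob {g. z \<le> log_ratio p N \<beta> g})
    \<le> iid_gauss.prob {g. log_ratio p N \<beta> (planted p N \<beta> g) \<le> z}"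
proof -
  let ?W = "log_ratio p N \<beta>"
  have "exp (- y) * (1 - iid_gauss.prob {g. ?W g \<le> - y} - iid_gauss.prob {g. z \<le> ?W g}) =
      (\<integral>g. exp (- y) * (1 - of_bool (?W g \<le> - y) - of_bool (z \<le> ?W g)) \<partial>iid_gauss)"
    by (simp add: integral_of_bool iid_gauss.integrable_of_bool)
  also have "\<dots> \<le> (\<integral>g. exp (?W g) * of_bool (?W g \<le> z) \<partial>iid_gauss)"
  proof (rule integral_mono)
    show "integrable iid_gauss (\<lambda>g. exp (- y) * (1 - of_bool (?W g \<le> - y) - of_bool (z \<le> ?W g)))"
      by (intro integrable_mult_right Bochner_Integration.integrable_diff iid_gauss.integrable_of_bool) auto
    show "integrable iid_gauss (\<lambda>g. exp (?W g) * of_bool (?W g \<le> z))"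
      by (rule integrable_exp_log_ratio_mult[OF N, where B = 1]) (auto simp: log_ratio_gauge)
    show "exp (- y) * (1 - of_bool (?W g \<le> - y) - of_bool (z \<le> ?W g)) \<le> exp (?W g) * of_bool (?W g \<le> z)" for g
      by (auto intro: order_trans[of _ 0])
  qed
  also have "\<dots> = (\<integral>g. of_bool (?W (planted p N \<beta> g) \<le> z) \<partial>iid_gauss)"
    by (rule integral_exp_log_ratio_mult[OF N, where B = 1]) (auto simp: log_ratio_gauge)
  finally show ?thesis by (simp add: integral_of_bool)
qed

lemma planted_prob_ge:
  assumes N: "N \<ge> 1" "p \<ge> 1"
    and typical: "iid_gauss.prob {g. log_ratio p N \<beta> g \<le> - y} \<le> 1 / 4" "iid_gauss.prob {g. z \<le> log_ratio p N \<beta> g} \<le> 1 / 4"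
  shows "exp (- y) / 2 \<le> iid_gauss.prob {g. log_ratio p N \<beta> (planted p N \<beta> g) \<le> z}"
proof -
  have "exp (- y) * (1 / 2) \<le> exp (- y) *
      (1 - iid_gauss.prob {g. log_ratio p N \<beta> g \<le> - y} - iid_gauss.prob {g. z \<le> log_ratio p N \<beta> g})"
  proof (rule mult_left_mono)
    show "1 / 2 \<le> 1 - iid_gauss.prob {g. log_ratio p N \<beta> g \<le> - y} - iid_gauss.prob {g. z \<le> log_ratio p N \<beta> g}"
      using typical by linarith
  qed simp
  also note size_biased_prob_ge[OF N]
  finally show ?thesis by simp
qed

locale replica_symmetric_at =
  fixes p :: nat and b :: real
  assumes p: "p \<ge> 1" and b: "b > 0"
    and mean_log_ratio_ge: "\<And>\<eta>. \<eta> > 0 \<Longrightarrow> \<forall>\<^sub>F N in sequentially. - \<eta> * real N \<le> mean_log_ratio p N b"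
begin

lemma log_ratio_lower_tail:
  assumes "\<eta> > 0"
  shows "\<forall>\<^sub>F N in sequentially. \<forall>\<beta>\<in>{0<..b}.
    iid_gauss.prob {g. log_ratio p N \<beta> g \<le> - \<eta> * real N} \<le> exp (- (\<eta>\<^sup>2 / (8 * b\<^sup>2)) * real N)"
  using mean_log_ratio_ge[OF half_gt_zero[OF assms]] eventually_ge_at_top[of 1]
proof eventually_elim
  case (elim N)
  show ?case
  proof
    fix \<beta> assume \<beta>: "\<beta> \<in> {0<..b}"
    have "- (\<eta> / 2) * real N \<le> mean_log_ratio p N \<beta>"
      using mean_log_ratio_antimono[of N p \<beta> b] \<beta> elim p by auto
    then have "iid_gauss.prob {g. log_ratio p N \<beta> g \<le> - \<eta> * real N} \<le>
      iid_gauss.prob {g. log_ratio p N \<beta> g \<le> (\<integral>g. log_ratio p N \<beta> g \<partial>iid_gauss) - \<eta> / 2 * real N}"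
      unfolding mean_log_ratio_def by (intro iid_gauss.finite_measure_mono) auto
    also have "\<dots> \<le> exp (- ((\<eta> / 2)\<^sup>2 / (2 * b\<^sup>2)) * real N)"
      using iid_gauss.subgaussian_linear_tails(2)[OF subgaussian_log_ratio[of N p \<beta> b], of "\<eta> / 2"] \<beta> elim p b assms
      by simp
    finally show "iid_gauss.prob {g. log_ratio p N \<beta> g \<le> - \<eta> * real N} \<le> exp (- (\<eta>\<^sup>2 / (8 * b\<^sup>2)) * real N)"
      by (simp add: power_divide)
  qed
qed

text \<open>Otherwise the event \<^term>\<open>log_ratio p N \<beta> g \<le> \<delta> / 2 * real N\<close>, which carries most of the size-biased
  mass up to a factor \<^term>\<open>exp (- \<eta> * real N)\<close>, would be exponentially rare under the planted law.\<close>
lemma planted_mean_log_ratio_le: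
  assumes \<delta>: "\<delta> > 0"
  shows "\<forall>\<^sub>F N in sequentially. \<forall>\<beta>\<in>{0<..b}. planted_mean_log_ratio p N \<beta> \<le> \<delta> * real N"
proof -
  define \<eta> where "\<eta> = (\<delta> / 2)\<^sup>2 / (2 * b\<^sup>2) / 2"
  have \<eta>: "\<eta> > 0" using \<delta> b by (simp add: \<eta>_def)
  have lower: "\<forall>\<^sub>F N in sequentially. exp (- (\<eta>\<^sup>2 / (8 * b\<^sup>2)) * real N) \<le> 1 / 4"
    and upper: "\<forall>\<^sub>F N in sequentially. exp (- (\<delta> / 2) * real N) \<le> 1 / 4"
    and gap: "\<forall>\<^sub>F N in sequentially. exp (- \<eta> * real N) \<le> 1 / 4"
    by (rule eventually_exp_minus_le; use \<delta> b \<eta> in simp)+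
  show ?thesis
    using log_ratio_lower_tail[OF \<eta>] lower upper gap eventually_ge_at_top[of 1]
  proof eventually_elim
    case (elim N)
    show ?case
    proof (rule ballI, rule ccontr)
      fix \<beta> assume \<beta>: "\<beta> \<in> {0<..b}" and large: "\<not> planted_mean_log_ratio p N \<beta> \<le> \<delta> * real N"
      let ?W = "log_ratio p N \<beta>"
      have "exp (- (\<eta> * real N)) / 2 \<le> iid_gauss.prob {g. ?W (planted p N \<beta> g) \<le> \<delta> / 2 * real N}"
      proof (rule planted_prob_ge[OF elim(5) p])
        show "iid_gauss.prob {g. ?W g \<le> - (\<eta> * real N)} \<le> 1 / 4"
          using bspec[OF elim(1) \<beta>] elim(2) by simp
        show "iid_gauss.prob {g. \<delta> / 2 * real N \<le> ?W g} \<le> 1 / 4"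
          using prob_log_ratio_ge_le[OF elim(5) p, of "\<delta> / 2 * real N" \<beta>] elim(3) by simp
      qed
      also have "\<dots> \<le> iid_gauss.prob {g. ?W (planted p N \<beta> g) \<le>
          (\<integral>g. ?W (planted p N \<beta> g) \<partial>iid_gauss) - \<delta> / 2 * real N}"
        using large by (intro iid_gauss.finite_measure_mono) (auto simp: planted_mean_log_ratio_def)
      also have "\<dots> \<le> exp (- ((\<delta> / 2)\<^sup>2 / (2 * b\<^sup>2)) * real N)"
        using iid_gauss.subgaussian_linear_tails(2)[OF subgaussian_log_ratio_planted[of N p \<beta> b], of "\<delta> / 2"]
          \<beta> elim(5) p b \<delta> by simp
      also have "\<dots> = exp (- (\<eta> * real N)) * exp (- (\<eta> * real N))"
        by (simp add: \<eta>_def flip: exp_add)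
      finally have "1 / 2 \<le> exp (- (\<eta> * real N))" by simp
      then show False using elim(4) by simp
    qed
  qed
qed

end

section \<open>Descent of the overlap threshold\<close>

definition shell :: "nat \<Rightarrow> nat \<Rightarrow> real \<Rightarrow> (nat \<Rightarrow> real) set" where
  "shell p N t = {\<sigma>\<in>Sigma N. t \<le> overlap N (ones N) \<sigma> ^ p}"

definition overlap_mass :: "nat \<Rightarrow> nat \<Rightarrow> real \<Rightarrow> real \<Rightarrow> (nat \<Rightarrow> real) \<Rightarrow> (nat list \<Rightarrow> real) \<Rightarrow> real" where
  "overlap_mass p N \<beta> t s g =
     gibbs_avg (Sigma N) (normalized_energy p N \<beta> g) (\<lambda>\<tau>. of_bool (t \<le> overlap N s \<tau> ^ p))"

definition pair_overlap_mass :: "nat \<Rightarrow> nat \<Rightarrow> real \<Rightarrow> real \<Rightarrow> (nat list \<Rightarrow> real) \<Rightarrow> real" where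
  "pair_overlap_mass p N \<beta> t g =
     pair_avg (Sigma N) (normalized_energy p N \<beta> g) (\<lambda>\<sigma> \<tau>. of_bool (t \<le> overlap N \<sigma> \<tau> ^ p))"

definition mean_pair_overlap_mass :: "nat \<Rightarrow> nat \<Rightarrow> real \<Rightarrow> real \<Rightarrow> real" where
  "mean_pair_overlap_mass p N \<beta> t = (\<integral>g. pair_overlap_mass p N \<beta> t g \<partial>iid_gauss)"

definition planted_free_energy :: "nat \<Rightarrow> nat \<Rightarrow> real \<Rightarrow> (nat \<Rightarrow> real) set \<Rightarrow> real" where
  "planted_free_energy p N \<beta> A = (\<integral>g. log_sum_exp A (normalized_energy p N \<beta> (planted p N \<beta> g)) \<partial>iid_gauss)"

lemma shell_subset: "shell p N t \<subseteq> Sigma N"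
  by (auto simp: shell_def)

lemma shell_nonempty: "N \<ge> 1 \<Longrightarrow> t \<le> 1 \<Longrightarrow> shell p N t \<noteq> {}"
  using overlap_self[OF _ ones_in_Sigma, of N] by (auto simp: shell_def intro!: exI[of _ "ones N"])

lemma overlap_mass_nonneg: "0 \<le> overlap_mass p N \<beta> t s g"
  unfolding overlap_mass_def by (rule gibbs_avg_nonneg) simp

lemma overlap_mass_le_1: "overlap_mass p N \<beta> t s g \<le> 1"
  unfolding overlap_mass_def by (rule gibbs_avg_le) auto

lemma pair_overlap_mass_nonneg: "0 \<le> pair_overlap_mass p N \<beta> t g"
  unfolding pair_overlap_mass_def by (intro gibbs_avg_nonneg) simp

lemma pair_overlap_mass_le_1: "pair_overlap_mass p N \<beta> t g \<le> 1"
  unfolding pair_overlap_mass_def by (intro gibbs_avg_le) auto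

lemma borel_measurable_overlap_mass [measurable]: "overlap_mass p N \<beta> t s \<in> borel_measurable iid_gauss"
  unfolding overlap_mass_def[abs_def] by measurable

lemma borel_measurable_pair_overlap_mass [measurable]: "pair_overlap_mass p N \<beta> t \<in> borel_measurable iid_gauss"
  unfolding pair_overlap_mass_def[abs_def] by measurable

lemma integrable_pair_overlap_mass: "integrable iid_gauss (pair_overlap_mass p N \<beta> t)"
  unfolding pair_overlap_mass_def[abs_def] by (rule iid_gauss.integrable_pair_avg) auto

lemma overlap_mass_gauge:
  assumes s: "s \<in> Sigma N"
  shows "overlap_mass p N \<beta> t s (gauge p N s g) = overlap_mass p N \<beta> t (ones N) g"
  unfolding overlap_mass_def gibbs_avg_gauge[OF s]
proof (rule gibbs_avg_cong)
  fix \<sigma> assume \<sigma>: "\<sigma> \<in> Sigma N"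
  have "overlap N s (spin_mult N s \<sigma>) = overlap N (ones N) \<sigma>"
    using overlap_spin_mult[OF s, of s "spin_mult N s \<sigma>"] spin_mult_self[OF s] spin_mult_spin_mult[OF s \<sigma>] by simp
  then show "of_bool (t \<le> overlap N s (spin_mult N s \<sigma>) ^ p) = (of_bool (t \<le> overlap N (ones N) \<sigma> ^ p) :: real)"
    by simp
qed

lemma pair_overlap_mass_gauge:
  assumes s: "s \<in> Sigma N"
  shows "pair_overlap_mass p N \<beta> t (gauge p N s g) = pair_overlap_mass p N \<beta> t g"
  unfolding pair_overlap_mass_def gibbs_avg_gauge[OF s] overlap_spin_mult[OF s] ..

lemma overlap_mass_ones:
  assumes "N \<ge> 1" "t \<le> 1"
  shows "overlap_mass p N \<beta> t (ones N) g =
    exp (log_sum_exp (shell p N t) (normalized_energy p N \<beta> g) - log_ratio p N \<beta> g)"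
  unfolding overlap_mass_def log_ratio_def shell_def
  by (rule gibbs_avg_of_bool) (use shell_nonempty[OF assms, of p] in \<open>auto simp: shell_def\<close>)

lemma mean_pair_overlap_mass_eq_0:
  assumes "t > 1"
  shows "mean_pair_overlap_mass p N \<beta> t = 0"
proof -
  have "of_bool (t \<le> overlap N \<sigma> \<tau> ^ p) = (0 :: real)" if "\<sigma> \<in> Sigma N" "\<tau> \<in> Sigma N" for \<sigma> \<tau>
    using abs_overlap_power_le_1[OF that, of p] assms by auto
  then have "pair_overlap_mass p N \<beta> t g = pair_avg (Sigma N) (normalized_energy p N \<beta> g) (\<lambda>\<sigma> \<tau>. 0)" for g
    unfolding pair_overlap_mass_def by (intro gibbs_avg_cong)
  then show ?thesis by (simp add: mean_pair_overlap_mass_def gibbs_avg_const)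
qed

subsection \<open>Comparison with the planted system\<close>

text \<open>A pair sampled from the Gibbs measure is, up to the density \<^term>\<open>exp (log_ratio p N \<beta> g)\<close>,
  a planted configuration together with a sample.\<close>
lemma pair_overlap_mass_le:
  "pair_overlap_mass p N \<beta> t g \<le> of_bool (log_ratio p N \<beta> g \<le> - y) +
     exp y * (\<Sum>s\<in>Sigma N. exp (normalized_energy p N \<beta> g s) *
       (overlap_mass p N \<beta> t s g * of_bool (- y < log_ratio p N \<beta> g)))"
proof (cases "log_ratio p N \<beta> g \<le> - y")
  case True
  then show ?thesis using pair_overlap_mass_le_1[of p N \<beta> t g] by simp
next
  case False
  have "pair_overlap_mass p N \<beta> t g =
      (\<Sum>s\<in>Sigma N. exp (- log_ratio p N \<beta> g) * (exp (normalized_energy p N \<beta> g s) * overlap_mass p N \<beta> t s g))"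
    unfolding pair_overlap_mass_def overlap_mass_def log_ratio_def
    by (subst gibbs_avg_def) (simp add: softmax_def exp_diff exp_minus field_simps)
  also have "\<dots> \<le> (\<Sum>s\<in>Sigma N. exp y * (exp (normalized_energy p N \<beta> g s) * overlap_mass p N \<beta> t s g))"
    using False by (intro sum_mono mult_right_mono mult_nonneg_nonneg overlap_mass_nonneg) auto
  finally show ?thesis using False by (simp add: sum_distrib_left)
qed

lemma mean_pair_overlap_mass_le:
  assumes N: "N \<ge> 1" "p \<ge> 1" and t: "t \<le> 1"
  shows "mean_pair_overlap_mass p N \<beta> t \<le> iid_gauss.prob {g. log_ratio p N \<beta> g \<le> - y} +
     exp y * (iid_gauss.prob {g. - z \<le> log_sum_exp (shell p N t) (normalized_energy p N \<beta> (planted p N \<beta> g))} +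
       exp (y - z))"
proof -
  let ?\<Psi> = "\<lambda>s g. overlap_mass p N \<beta> t s g * of_bool (- y < log_ratio p N \<beta> g)"
  let ?L = "\<lambda>g. \<Sum>s\<in>Sigma N. exp (normalized_energy p N \<beta> g s) * ?\<Psi> s g"
  let ?F = "\<lambda>g. log_sum_exp (shell p N t) (normalized_energy p N \<beta> (planted p N \<beta> g))"
  have \<Psi>: "0 \<le> ?\<Psi> s g" "?\<Psi> s g \<le> 1" for s g
    by (auto simp: overlap_mass_nonneg overlap_mass_le_1)
  have invariant: "?\<Psi> s (gauge p N s g) = ?\<Psi> (ones N) g" if "s \<in> Sigma N" for s g
    using that by (simp add: overlap_mass_gauge log_ratio_gauge)
  note int_L = integrable_exp_normalized_energy_mult[of N p ?\<Psi> 1 \<beta>, OF N _ invariant \<Psi>]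
  note integral_L = integral_planted[of N p ?\<Psi> 1 \<beta>, OF N _ invariant \<Psi>]
  have "mean_pair_overlap_mass p N \<beta> t \<le> (\<integral>g. of_bool (log_ratio p N \<beta> g \<le> - y) + exp y * ?L g \<partial>iid_gauss)"
    unfolding mean_pair_overlap_mass_def
    by (intro integral_mono integrable_pair_overlap_mass pair_overlap_mass_le Bochner_Integration.integrable_add
        iid_gauss.integrable_of_bool integrable_mult_right int_L) auto
  also have "\<dots> = iid_gauss.prob {g. log_ratio p N \<beta> g \<le> - y} + exp y * (\<integral>g. ?\<Psi> (ones N) (planted p N \<beta> g) \<partial>iid_gauss)"
    using int_L integral_L
    by (subst Bochner_Integration.integral_add) (auto simp: iid_gauss.integrable_of_bool integral_of_bool)
  also have "(\<integral>g. ?\<Psi> (ones N) (planted p N \<beta> g) \<partial>iid_gauss) \<le> (\<integral>g. of_bool (- z \<le> ?F g) + exp (y - z) \<partial>iid_gauss)"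
  proof (rule integral_mono)
    show "integrable iid_gauss (\<lambda>g. ?\<Psi> (ones N) (planted p N \<beta> g))"
      by (rule iid_gauss.integrable_const_bound[where B = 1])
         (use \<Psi> in \<open>auto simp: abs_of_nonneg intro: measurable_compose[OF measurable_planted]\<close>)
    show "integrable iid_gauss (\<lambda>g. of_bool (- z \<le> ?F g) + exp (y - z))"
      by (intro Bochner_Integration.integrable_add iid_gauss.integrable_of_bool) auto
    show "?\<Psi> (ones N) (planted p N \<beta> g) \<le> of_bool (- z \<le> ?F g) + exp (y - z)" for g
    proof (cases "- z \<le> ?F g")
      case True
      then show ?thesis using \<Psi>(2)[of "ones N" "planted p N \<beta> g"] by (simp add: add_increasing2)
    next
      case False
      then show ?thesis by (simp add: overlap_mass_ones[OF N(1) t])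
    qed
  qed
  also have "\<dots> = iid_gauss.prob {g. - z \<le> ?F g} + exp (y - z)"
    by (subst Bochner_Integration.integral_add) (auto simp: iid_gauss.integrable_of_bool integral_of_bool)
  finally show ?thesis by (simp add: mult_left_mono)
qed

lemma integral_planted_pair_overlap_mass_le:
  fixes \<beta> u z :: real
  assumes N: "N \<ge> 1" "p \<ge> 1"
  defines "\<Psi> \<equiv> \<lambda>g. pair_overlap_mass p N \<beta> u g * of_bool (log_ratio p N \<beta> g < z)"
  shows "(\<integral>g. \<Psi> (planted p N \<beta> g) \<partial>iid_gauss) \<le> exp z * mean_pair_overlap_mass p N \<beta> u"
proof -
  have [measurable]: "\<Psi> \<in> borel_measurable iid_gauss"
    unfolding \<Psi>_def by measurable
  have invariant: "\<Psi> (gauge p N s g) = \<Psi> g" if "s \<in> Sigma N" for s g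
    using that by (simp add: \<Psi>_def pair_overlap_mass_gauge log_ratio_gauge)
  have \<Psi>: "0 \<le> \<Psi> g" "\<Psi> g \<le> 1" for g
    by (auto simp: \<Psi>_def pair_overlap_mass_nonneg pair_overlap_mass_le_1)
  have "(\<integral>g. \<Psi> (planted p N \<beta> g) \<partial>iid_gauss) = (\<integral>g. exp (log_ratio p N \<beta> g) * \<Psi> g \<partial>iid_gauss)"
    by (rule integral_exp_log_ratio_mult[symmetric, OF N _ invariant \<Psi>]) measurable
  also have "\<dots> \<le> (\<integral>g. exp z * pair_overlap_mass p N \<beta> u g \<partial>iid_gauss)"
  proof (rule integral_mono)
    show "integrable iid_gauss (\<lambda>g. exp (log_ratio p N \<beta> g) * \<Psi> g)"
      by (rule integrable_exp_log_ratio_mult[OF N _ invariant \<Psi>]) measurable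
    show "integrable iid_gauss (\<lambda>g. exp z * pair_overlap_mass p N \<beta> u g)"
      using integrable_pair_overlap_mass by simp
    show "exp (log_ratio p N \<beta> g) * \<Psi> g \<le> exp z * pair_overlap_mass p N \<beta> u g" for g
      by (cases "log_ratio p N \<beta> g < z") (auto simp: \<Psi>_def pair_overlap_mass_nonneg intro!: mult_right_mono)
  qed
  finally show ?thesis by (simp add: mean_pair_overlap_mass_def)
qed

lemma restricted_pair_mass_le:
  fixes p N and \<beta> :: real and A
  assumes A: "A \<subseteq> Sigma N" "A \<noteq> {}"
  defines "L \<equiv> \<lambda>g. log_sum_exp A (normalized_energy p N \<beta> g)"
  shows "pair_avg A (normalized_energy p N \<beta> g) (\<lambda>\<sigma> \<tau>. of_bool (u \<le> overlap N \<sigma> \<tau> ^ p)) \<le>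
    of_bool (L g \<le> - y) + of_bool (z \<le> log_ratio p N \<beta> g) +
    exp (2 * y + 2 * z) * (pair_overlap_mass p N \<beta> u g * of_bool (log_ratio p N \<beta> g < z))"
    (is "?P \<le> _ + _ + _ * (_ * ?b)")
proof (cases "L g \<le> - y \<or> z \<le> log_ratio p N \<beta> g")
  case True
  have "?P \<le> 1" by (intro gibbs_avg_le finite_subset[OF A(1)] A(2)) auto
  moreover have "0 \<le> exp (2 * y + 2 * z) * (pair_overlap_mass p N \<beta> u g * ?b)"
    by (simp add: pair_overlap_mass_nonneg)
  ultimately show ?thesis using True by auto
next
  case False
  have "?P \<le> exp (2 * (log_ratio p N \<beta> g - L g)) * pair_overlap_mass p N \<beta> u g"
    unfolding pair_overlap_mass_def log_ratio_def L_def by (rule pair_avg_subset_le) (use A in auto)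
  also have "\<dots> \<le> exp (2 * y + 2 * z) * pair_overlap_mass p N \<beta> u g"
    using False by (intro mult_right_mono pair_overlap_mass_nonneg) simp
  finally show ?thesis using False by simp
qed

lemma planted_restricted_pair_mass_le:
  fixes \<beta> u y z :: real
  assumes N: "N \<ge> 1" "p \<ge> 1" and A: "A \<subseteq> Sigma N" "A \<noteq> {}"
  defines "X \<equiv> \<lambda>g. normalized_energy p N \<beta> (planted p N \<beta> g)"
  shows "(\<integral>g. pair_avg A (X g) (\<lambda>\<sigma> \<tau>. of_bool (u \<le> overlap N \<sigma> \<tau> ^ p)) \<partial>iid_gauss) \<le>
     iid_gauss.prob {g. log_sum_exp A (X g) \<le> - y} + iid_gauss.prob {g. z \<le> log_ratio p N \<beta> (planted p N \<beta> g)} +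
     exp (2 * y + 3 * z) * mean_pair_overlap_mass p N \<beta> u"
proof -
  let ?W = "\<lambda>g. log_ratio p N \<beta> (planted p N \<beta> g)" and ?F = "\<lambda>g. log_sum_exp A (X g)"
  let ?P = "\<lambda>g. pair_avg A (X g) (\<lambda>\<sigma> \<tau>. of_bool (u \<le> overlap N \<sigma> \<tau> ^ p))"
  let ?\<Psi> = "\<lambda>g. pair_overlap_mass p N \<beta> u (planted p N \<beta> g) * of_bool (?W g < z)"
  have finA: "finite A" using A(1) by (rule finite_subset) simp
  have [measurable]: "(\<lambda>g. X g \<sigma>) \<in> borel_measurable iid_gauss" for \<sigma>
    unfolding X_def by measurable
  have [measurable]: "?W \<in> borel_measurable iid_gauss"
    by measurable
  have int_\<Psi>: "integrable iid_gauss ?\<Psi>"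
    by (rule iid_gauss.integrable_const_bound[where B = 1])
       (auto simp: pair_overlap_mass_nonneg pair_overlap_mass_le_1 abs_mult
        intro: measurable_compose[OF measurable_planted])
  have "(\<integral>g. ?P g \<partial>iid_gauss) \<le>
      (\<integral>g. of_bool (?F g \<le> - y) + of_bool (z \<le> ?W g) + exp (2 * y + 2 * z) * ?\<Psi> g \<partial>iid_gauss)"
    unfolding X_def
    by (intro integral_mono restricted_pair_mass_le A iid_gauss.integrable_pair_avg finA
        Bochner_Integration.integrable_add iid_gauss.integrable_of_bool integrable_mult_right int_\<Psi>) auto
  also have "\<dots> = iid_gauss.prob {g. ?F g \<le> - y} + iid_gauss.prob {g. z \<le> ?W g} +
      exp (2 * y + 2 * z) * (\<integral>g. ?\<Psi> g \<partial>iid_gauss)"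
    using int_\<Psi> by (simp add: integral_of_bool iid_gauss.integrable_of_bool)
  also have "\<dots> \<le> iid_gauss.prob {g. ?F g \<le> - y} + iid_gauss.prob {g. z \<le> ?W g} +
      exp (2 * y + 2 * z) * (exp z * mean_pair_overlap_mass p N \<beta> u)"
    by (intro add_left_mono mult_left_mono integral_planted_pair_overlap_mass_le N) auto
  also have "exp (2 * y + 2 * z) * (exp z * mean_pair_overlap_mass p N \<beta> u) =
      exp (2 * y + 3 * z) * mean_pair_overlap_mass p N \<beta> u"
    by (simp add: mult.assoc[symmetric] flip: exp_add)
  finally show ?thesis .
qed

lemma planted_free_energy_increment:
  assumes N: "N \<ge> 1" "p \<ge> 1" and A: "A \<subseteq> Sigma N" "A \<noteq> {}" and \<kappa>: "0 \<le> \<beta>" "0 \<le> \<kappa>"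
    and t: "\<And>\<sigma>. \<sigma> \<in> A \<Longrightarrow> t \<le> overlap N (ones N) \<sigma> ^ p"
  defines "r \<equiv> (\<integral>g. pair_avg A (normalized_energy p N \<beta> (planted p N \<beta> g)) (\<lambda>\<sigma> \<tau>. overlap N \<sigma> \<tau> ^ p) \<partial>iid_gauss)"
  shows "planted_free_energy p N \<beta> A +
      real N * (\<kappa> * \<beta> / 2 * (1 - r) + (2 * \<kappa> * \<beta> + \<kappa>\<^sup>2) / 2 * t - (2 * \<kappa> * \<beta> + \<kappa>\<^sup>2) / 4)
    \<le> planted_free_energy p N (\<beta> + \<kappa>) A"
proof -
  let ?c = "\<lambda>\<beta> \<sigma>. \<beta>\<^sup>2 / 2 * real N * overlap N (ones N) \<sigma> ^ p - (\<beta>\<^sup>2 / 4 + ln 2) * real N"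
  let ?d = "(2 * \<kappa> * \<beta> + \<kappa>\<^sup>2) / 2 * real N * t - (2 * \<kappa> * \<beta> + \<kappa>\<^sup>2) / 4 * real N"
  have "?d \<le> ?c (\<beta> + \<kappa>) \<sigma> - ?c \<beta> \<sigma>" if "\<sigma> \<in> A" for \<sigma>
  proof -
    have "(2 * \<kappa> * \<beta> + \<kappa>\<^sup>2) / 2 * real N * t \<le> (2 * \<kappa> * \<beta> + \<kappa>\<^sup>2) / 2 * real N * overlap N (ones N) \<sigma> ^ p"
      using t[OF that] \<kappa> by (intro mult_left_mono) auto
    then show ?thesis by (simp add: power2_eq_square field_simps)
  qed
  moreover have gain: "((\<beta> + \<kappa>) / sqrt 2 - \<beta> / sqrt 2) * (\<beta> / sqrt 2) = \<kappa> * \<beta> / 2"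
    by (simp add: field_simps)
  ultimately have "planted_free_energy p N \<beta> A +
      (((\<beta> + \<kappa>) / sqrt 2 - \<beta> / sqrt 2) * (\<beta> / sqrt 2) * real N * (1 - r) + ?d)
    \<le> planted_free_energy p N (\<beta> + \<kappa>) A"
    unfolding planted_free_energy_def r_def normalized_energy_planted[OF N]
    by (intro expected_log_sum_exp_H_increment[OF N A])
  then show ?thesis unfolding gain by (simp add: algebra_simps)
qed

lemma planted_free_energy_le:
  assumes "N \<ge> 1" "p \<ge> 1" "A \<subseteq> Sigma N" "A \<noteq> {}" "0 \<le> \<beta>"
  shows "planted_free_energy p N \<beta> A \<le> planted_mean_log_ratio p N \<beta>"
  unfolding planted_free_energy_def planted_mean_log_ratio_def log_ratio_def
  using assms
  by (intro integral_mono log_sum_exp_mono_set subgaussian_imp_integrable[OF subgaussian_log_sum_exp_planted]) auto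

subsection \<open>One step of the descent\<close>

lemma expected_overlap_power_le:
  assumes A: "A \<subseteq> Sigma N" "A \<noteq> {}" and [measurable]: "\<And>\<sigma>. (\<lambda>g. X g \<sigma>) \<in> borel_measurable iid_gauss"
    and u: "u \<ge> 0"
  shows "(\<integral>g. pair_avg A (X g) (\<lambda>\<sigma> \<tau>. overlap N \<sigma> \<tau> ^ p) \<partial>iid_gauss) \<le>
    u + (\<integral>g. pair_avg A (X g) (\<lambda>\<sigma> \<tau>. of_bool (u \<le> overlap N \<sigma> \<tau> ^ p)) \<partial>iid_gauss)"
proof -
  have finA: "finite A" using A(1) by (rule finite_subset) simp
  have "overlap N \<sigma> \<tau> ^ p \<le> u + of_bool (u \<le> overlap N \<sigma> \<tau> ^ p)" if "\<sigma> \<in> A" "\<tau> \<in> A" for \<sigma> \<tau>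
    using abs_overlap_power_le_1[of \<sigma> N \<tau> p] A that u by (auto simp: abs_le_iff subset_iff)
  then have "pair_avg A (X g) (\<lambda>\<sigma> \<tau>. overlap N \<sigma> \<tau> ^ p) \<le>
      pair_avg A (X g) (\<lambda>\<sigma> \<tau>. u + of_bool (u \<le> overlap N \<sigma> \<tau> ^ p))" for g
    by (intro gibbs_avg_mono)
  then have "(\<integral>g. pair_avg A (X g) (\<lambda>\<sigma> \<tau>. overlap N \<sigma> \<tau> ^ p) \<partial>iid_gauss) \<le>
      (\<integral>g. u + pair_avg A (X g) (\<lambda>\<sigma> \<tau>. of_bool (u \<le> overlap N \<sigma> \<tau> ^ p)) \<partial>iid_gauss)"
    unfolding gibbs_avg_add gibbs_avg_const[OF finA A(2)]
    by (intro integral_mono Bochner_Integration.integrable_add iid_gauss.integrable_pair_avg finA) auto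
  also have "\<dots> = u + (\<integral>g. pair_avg A (X g) (\<lambda>\<sigma> \<tau>. of_bool (u \<le> overlap N \<sigma> \<tau> ^ p)) \<partial>iid_gauss)"
    by (subst Bochner_Integration.integral_add) (auto intro!: iid_gauss.integrable_pair_avg finA)
  finally show ?thesis .
qed

lemma planted_energy_gain:
  fixes \<kappa> \<beta> r t \<eta> :: real
  assumes pos: "0 < \<kappa>" "0 < \<beta>" "0 < t" and \<kappa>: "\<kappa> \<le> \<beta> * t / 2" and r: "r \<le> 13 / 8 * t"
    and \<eta>: "128 * \<eta> \<le> \<kappa> * \<beta> * t"
  shows "4 * \<eta> \<le> \<kappa> * \<beta> / 2 * (1 - r) + (2 * \<kappa> * \<beta> + \<kappa>\<^sup>2) / 2 * t - (2 * \<kappa> * \<beta> + \<kappa>\<^sup>2) / 4"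
proof -
  have "\<kappa> * \<beta> * r \<le> \<kappa> * \<beta> * (13 / 8 * t)" using pos r by (intro mult_left_mono) auto
  moreover have "\<kappa> * \<kappa> \<le> \<kappa> * (\<beta> * t / 2)" using pos \<kappa> by (intro mult_left_mono) auto
  then have "\<kappa>\<^sup>2 \<le> \<kappa> * \<beta> * t / 2" by (simp add: power2_eq_square mult_ac)
  moreover have "0 \<le> \<kappa>\<^sup>2 * t" "0 < \<kappa> * \<beta> * t" using pos by simp_all
  moreover have "\<kappa> * \<beta> / 2 * (1 - r) + (2 * \<kappa> * \<beta> + \<kappa>\<^sup>2) / 2 * t - (2 * \<kappa> * \<beta> + \<kappa>\<^sup>2) / 4 =
      - (\<kappa> * \<beta> * r) / 2 + \<kappa> * \<beta> * t + \<kappa>\<^sup>2 * t / 2 - \<kappa>\<^sup>2 / 4"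
    by (simp add: field_simps)
  moreover have "\<kappa> * \<beta> * (13 / 8 * t) = 13 / 8 * (\<kappa> * \<beta> * t)" by simp
  ultimately show ?thesis using \<eta> by linarith
qed

context replica_symmetric_at
begin

lemma planted_tails:
  assumes "N \<ge> 1" "A \<subseteq> Sigma N" "A \<noteq> {}" "\<beta> \<in> {0<..b}" "\<eta> > 0"
  shows "planted_free_energy p N \<beta> A + \<eta> * real N \<le> x \<Longrightarrow>
      iid_gauss.prob {g. x \<le> log_sum_exp A (normalized_energy p N \<beta> (planted p N \<beta> g))} \<le> exp (- (\<eta>\<^sup>2 / (2 * b\<^sup>2)) * real N)"
    and "x \<le> planted_free_energy p N \<beta> A - \<eta> * real N \<Longrightarrow>
      iid_gauss.prob {g. log_sum_exp A (normalized_energy p N \<beta> (planted p N \<beta> g)) \<le> x} \<le> exp (- (\<eta>\<^sup>2 / (2 * b\<^sup>2)) * real N)"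
proof -
  let ?F = "\<lambda>g. log_sum_exp A (normalized_energy p N \<beta> (planted p N \<beta> g))"
  have F: "subgaussian iid_gauss ?F (b\<^sup>2 / 2 * real N)"
    using assms p by (intro subgaussian_log_sum_exp_planted) auto
  note tails = iid_gauss.subgaussian_linear_tails[OF F, of \<eta>, simplified, folded planted_free_energy_def]
  show "iid_gauss.prob {g. x \<le> ?F g} \<le> exp (- (\<eta>\<^sup>2 / (2 * b\<^sup>2)) * real N)"
    if "planted_free_energy p N \<beta> A + \<eta> * real N \<le> x"
  proof -
    have "iid_gauss.prob {g. x \<le> ?F g} \<le> iid_gauss.prob {g. planted_free_energy p N \<beta> A + \<eta> * real N \<le> ?F g}"
      using that by (intro iid_gauss.finite_measure_mono) auto
    then show ?thesis using tails(1) assms b by simp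
  qed
  show "iid_gauss.prob {g. ?F g \<le> x} \<le> exp (- (\<eta>\<^sup>2 / (2 * b\<^sup>2)) * real N)"
    if "x \<le> planted_free_energy p N \<beta> A - \<eta> * real N"
  proof -
    have "iid_gauss.prob {g. ?F g \<le> x} \<le> iid_gauss.prob {g. ?F g \<le> planted_free_energy p N \<beta> A - \<eta> * real N}"
      using that by (intro iid_gauss.finite_measure_mono) auto
    then show ?thesis using tails(2) assms b by simp
  qed
qed

lemma planted_overlap_le:
  assumes N: "N \<ge> 1" and t: "0 < t" "t \<le> 1" and \<beta>: "\<beta> \<in> {0<..b}" and \<eta>: "0 < \<eta>" "28 * \<eta> \<le> \<gamma>"
    and rare: "mean_pair_overlap_mass p N \<beta> (3 / 2 * t) \<le> exp (- \<gamma> * real N)"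
    and planted: "planted_mean_log_ratio p N \<beta> \<le> \<eta> * real N"
    and large: "- 3 * \<eta> * real N < planted_free_energy p N \<beta> (shell p N t)"
    and N_large: "exp (- (\<eta>\<^sup>2 / (2 * b\<^sup>2)) * real N) \<le> t / 24" "exp (- (\<gamma> / 2) * real N) \<le> t / 24"
  shows "(\<integral>g. pair_avg (shell p N t) (normalized_energy p N \<beta> (planted p N \<beta> g)) (\<lambda>\<sigma> \<tau>. overlap N \<sigma> \<tau> ^ p) \<partial>iid_gauss)
    \<le> 13 / 8 * t"
proof -
  let ?A = "shell p N t" and ?X = "\<lambda>g. normalized_energy p N \<beta> (planted p N \<beta> g)"
  have A: "?A \<subseteq> Sigma N" "?A \<noteq> {}"
    using shell_subset shell_nonempty[OF N t(2)] by auto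
  have "(\<integral>g. pair_avg ?A (?X g) (\<lambda>\<sigma> \<tau>. overlap N \<sigma> \<tau> ^ p) \<partial>iid_gauss) \<le>
      3 / 2 * t + (\<integral>g. pair_avg ?A (?X g) (\<lambda>\<sigma> \<tau>. of_bool (3 / 2 * t \<le> overlap N \<sigma> \<tau> ^ p)) \<partial>iid_gauss)"
    by (rule expected_overlap_power_le[OF A]) (use t in auto)
  also have "(\<integral>g. pair_avg ?A (?X g) (\<lambda>\<sigma> \<tau>. of_bool (3 / 2 * t \<le> overlap N \<sigma> \<tau> ^ p)) \<partial>iid_gauss) \<le>
      iid_gauss.prob {g. log_sum_exp ?A (?X g) \<le> - (4 * \<eta> * real N)} +
      iid_gauss.prob {g. 2 * \<eta> * real N \<le> log_ratio p N \<beta> (planted p N \<beta> g)} +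
      exp (2 * (4 * \<eta> * real N) + 3 * (2 * \<eta> * real N)) * mean_pair_overlap_mass p N \<beta> (3 / 2 * t)"
    by (rule planted_restricted_pair_mass_le[OF N p A])
  also have "\<dots> \<le> t / 24 + t / 24 + t / 24"
  proof (intro add_mono)
    show "iid_gauss.prob {g. log_sum_exp ?A (?X g) \<le> - (4 * \<eta> * real N)} \<le> t / 24"
      by (rule order_trans[OF planted_tails(2)[OF N A \<beta> \<eta>(1)] N_large(1)]) (use large in simp)
    have "planted_free_energy p N \<beta> (Sigma N) = planted_mean_log_ratio p N \<beta>"
      by (simp add: planted_free_energy_def planted_mean_log_ratio_def log_ratio_def)
    then show "iid_gauss.prob {g. 2 * \<eta> * real N \<le> log_ratio p N \<beta> (planted p N \<beta> g)} \<le> t / 24"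
      unfolding log_ratio_def
      by (intro order_trans[OF planted_tails(1)[OF N order_refl Sigma_nonempty \<beta> \<eta>(1)] N_large(1)])
         (use planted in simp)
    have "exp (2 * (4 * \<eta> * real N) + 3 * (2 * \<eta> * real N)) * mean_pair_overlap_mass p N \<beta> (3 / 2 * t) \<le>
        exp (14 * \<eta> * real N) * exp (- \<gamma> * real N)"
      using rare by (simp add: algebra_simps)
    also have "\<dots> = exp ((14 * \<eta> - \<gamma>) * real N)" by (simp add: left_diff_distrib flip: exp_add)
    also have "\<dots> \<le> exp (- (\<gamma> / 2) * real N)"
      using mult_right_mono[of "14 * \<eta> - \<gamma>" "- (\<gamma> / 2)" "real N"] \<eta>(2) by simp
    finally show "exp (2 * (4 * \<eta> * real N) + 3 * (2 * \<eta> * real N)) * mean_pair_overlap_mass p N \<beta> (3 / 2 * t) \<le> t / 24"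
      using N_large(2) by linarith
  qed
  finally show ?thesis by simp
qed

text \<open>If the shell carried more than an exponentially small part of the planted partition function, raising
  \<^term>\<open>\<beta>\<close> by \<^term>\<open>\<kappa>\<close> would push the planted free energy above \<^term>\<open>\<eta> * real N\<close>.\<close>
lemma planted_free_energy_shell_le:
  assumes N: "N \<ge> 1" and t: "0 < t" "t \<le> 1" and \<beta>: "0 < \<beta>" "\<beta> + \<kappa> \<le> b" and \<kappa>: "0 < \<kappa>" "\<kappa> \<le> \<beta> * t / 2"
    and \<eta>: "0 < \<eta>" "28 * \<eta> \<le> \<gamma>" "128 * \<eta> \<le> \<kappa> * \<beta> * t"
    and rare: "mean_pair_overlap_mass p N \<beta> (3 / 2 * t) \<le> exp (- \<gamma> * real N)"
    and planted: "\<And>\<beta>. \<beta> \<in> {0<..b} \<Longrightarrow> planted_mean_log_ratio p N \<beta> \<le> \<eta> * real N"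
    and N_large: "exp (- (\<eta>\<^sup>2 / (2 * b\<^sup>2)) * real N) \<le> t / 24" "exp (- (\<gamma> / 2) * real N) \<le> t / 24"
  shows "planted_free_energy p N \<beta> (shell p N t) \<le> - 3 * \<eta> * real N"
proof (rule ccontr)
  assume "\<not> planted_free_energy p N \<beta> (shell p N t) \<le> - 3 * \<eta> * real N"
  then have large: "- 3 * \<eta> * real N < planted_free_energy p N \<beta> (shell p N t)" by simp
  let ?A = "shell p N t"
  have A: "?A \<subseteq> Sigma N" "?A \<noteq> {}"
    using shell_subset shell_nonempty[OF N t(2)] by auto
  define r where "r = (\<integral>g. pair_avg ?A (normalized_energy p N \<beta> (planted p N \<beta> g)) (\<lambda>\<sigma> \<tau>. overlap N \<sigma> \<tau> ^ p) \<partial>iid_gauss)"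
  have "r \<le> 13 / 8 * t"
    unfolding r_def by (rule planted_overlap_le[OF N t _ \<eta>(1,2) rare _ large N_large]) (use \<beta> \<kappa> planted in auto)
  then have "4 * \<eta> \<le> \<kappa> * \<beta> / 2 * (1 - r) + (2 * \<kappa> * \<beta> + \<kappa>\<^sup>2) / 2 * t - (2 * \<kappa> * \<beta> + \<kappa>\<^sup>2) / 4"
    by (rule planted_energy_gain[OF \<kappa>(1) \<beta>(1) t(1) \<kappa>(2) _ \<eta>(3)])
  then have "real N * (4 * \<eta>) \<le>
      real N * (\<kappa> * \<beta> / 2 * (1 - r) + (2 * \<kappa> * \<beta> + \<kappa>\<^sup>2) / 2 * t - (2 * \<kappa> * \<beta> + \<kappa>\<^sup>2) / 4)"
    by (rule mult_left_mono) simp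
  also have "planted_free_energy p N \<beta> ?A + \<dots> \<le> planted_free_energy p N (\<beta> + \<kappa>) ?A"
    unfolding r_def
    by (rule planted_free_energy_increment[OF N p A]) (use \<beta> \<kappa> in \<open>auto simp: shell_def\<close>)
  also have "planted_free_energy p N (\<beta> + \<kappa>) ?A \<le> planted_mean_log_ratio p N (\<beta> + \<kappa>)"
    by (rule planted_free_energy_le[OF N p A]) (use \<beta> \<kappa> in auto)
  also have "planted_mean_log_ratio p N (\<beta> + \<kappa>) \<le> \<eta> * real N"
    using planted[of "\<beta> + \<kappa>"] \<beta> \<kappa> by simp
  finally show False using large by (simp add: algebra_simps)
qed

lemma mean_pair_overlap_mass_le_exp:
  assumes N: "N \<ge> 1" and t: "0 < t" "t \<le> 1" and \<beta>: "\<beta> \<in> {0<..b}" and \<eta>: "\<eta> > 0"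
    and shell: "planted_free_energy p N \<beta> (shell p N t) \<le> - 3 * \<eta> * real N"
    and lower: "iid_gauss.prob {g. log_ratio p N \<beta> g \<le> - y * real N} \<le> exp (- k * real N)"
    and \<delta>: "2 * \<delta> \<le> k" "2 * \<delta> \<le> \<eta>\<^sup>2 / (2 * b\<^sup>2) - y" "2 * \<delta> \<le> 2 * \<eta> - 2 * y"
    and N_large: "exp (- \<delta> * real N) \<le> 1 / 3"
  shows "mean_pair_overlap_mass p N \<beta> t \<le> exp (- \<delta> * real N)"
proof -
  have third: "exp (- x * real N) \<le> exp (- \<delta> * real N) * (1 / 3)" if "2 * \<delta> \<le> x" for x
  proof -
    have "exp (- x * real N) \<le> exp (- \<delta> * real N) * exp (- \<delta> * real N)"
      using mult_right_mono[OF that, of "real N"] by (simp flip: exp_add)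
    also have "\<dots> \<le> exp (- \<delta> * real N) * (1 / 3)" using N_large by (intro mult_left_mono) auto
    finally show ?thesis .
  qed
  have A: "shell p N t \<subseteq> Sigma N" "shell p N t \<noteq> {}"
    using shell_subset shell_nonempty[OF N t(2)] by auto
  have "mean_pair_overlap_mass p N \<beta> t \<le> iid_gauss.prob {g. log_ratio p N \<beta> g \<le> - (y * real N)} +
      exp (y * real N) * (iid_gauss.prob {g. - (2 * \<eta> * real N) \<le>
        log_sum_exp (shell p N t) (normalized_energy p N \<beta> (planted p N \<beta> g))} + exp (y * real N - 2 * \<eta> * real N))"
    by (rule mean_pair_overlap_mass_le[OF N p t(2)])
  also have "\<dots> \<le> exp (- k * real N) + exp (y * real N) *
      (exp (- (\<eta>\<^sup>2 / (2 * b\<^sup>2)) * real N) + exp (y * real N - 2 * \<eta> * real N))"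
    using lower shell by (intro add_mono mult_left_mono planted_tails(1)[OF N A \<beta> \<eta>]) auto
  also have "\<dots> = exp (- k * real N) + (exp (- (\<eta>\<^sup>2 / (2 * b\<^sup>2) - y) * real N) + exp (- (2 * \<eta> - 2 * y) * real N))"
    by (simp add: distrib_left algebra_simps flip: exp_add)
  also have "\<dots> \<le> exp (- \<delta> * real N) * (1 / 3) + (exp (- \<delta> * real N) * (1 / 3) + exp (- \<delta> * real N) * (1 / 3))"
    by (intro add_mono third \<delta>)
  finally show ?thesis by simp
qed

lemma overlap_threshold_step:
  assumes range: "0 < a" "a \<le> b'" "b' < b" and t: "0 < t" "t \<le> 1" and \<gamma>: "\<gamma> > 0"
    and rare: "\<forall>\<^sub>F N in sequentially. \<forall>\<beta>\<in>{a..b'}. mean_pair_overlap_mass p N \<beta> (3 / 2 * t) \<le> exp (- \<gamma> * real N)"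
  shows "\<exists>\<delta>>0. \<forall>\<^sub>F N in sequentially. \<forall>\<beta>\<in>{a..b'}. mean_pair_overlap_mass p N \<beta> t \<le> exp (- \<delta> * real N)"
proof -
  define \<kappa> where "\<kappa> = min (a * t / 2) (b - b')"
  have \<kappa>: "\<kappa> > 0" "\<kappa> \<le> a * t / 2" "\<kappa> \<le> b - b'"
    using range t by (auto simp: \<kappa>_def min_def)
  define \<eta> where "\<eta> = min (\<kappa> * a * t / 128) (\<gamma> / 28)"
  have \<eta>: "\<eta> > 0" "128 * \<eta> \<le> \<kappa> * a * t" "28 * \<eta> \<le> \<gamma>"
    using \<kappa>(1) range t \<gamma> by (auto simp: \<eta>_def min_def)
  define k where "k = \<eta>\<^sup>2 / (2 * b\<^sup>2)"
  have k: "k > 0" using \<eta> b by (simp add: k_def)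
  define y where "y = min (k / 2) (\<eta> / 2)"
  have y: "y > 0" "y \<le> k / 2" "y \<le> \<eta> / 2"
    using k \<eta> by (auto simp: y_def)
  define \<delta> where "\<delta> = min (y\<^sup>2 / (8 * b\<^sup>2)) (min (k / 2) \<eta>) / 2"
  have \<delta>: "\<delta> > 0" "2 * \<delta> \<le> y\<^sup>2 / (8 * b\<^sup>2)" "2 * \<delta> \<le> k / 2" "2 * \<delta> \<le> \<eta>"
    using k y \<eta> b by (auto simp: \<delta>_def)
  have large: "\<forall>\<^sub>F N in sequentially. exp (- k * real N) \<le> t / 24"
      "\<forall>\<^sub>F N in sequentially. exp (- (\<gamma> / 2) * real N) \<le> t / 24"
      "\<forall>\<^sub>F N in sequentially. exp (- \<delta> * real N) \<le> 1 / 3"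
    by (rule eventually_exp_minus_le; use k \<gamma> t \<delta> in simp)+
  have "\<forall>\<^sub>F N in sequentially. \<forall>\<beta>\<in>{a..b'}. mean_pair_overlap_mass p N \<beta> t \<le> exp (- \<delta> * real N)"
    using log_ratio_lower_tail[OF y(1)] planted_mean_log_ratio_le[OF \<eta>(1)] rare large eventually_ge_at_top[of 1]
  proof eventually_elim
    case (elim N)
    show ?case
    proof
      fix \<beta> assume \<beta>: "\<beta> \<in> {a..b'}"
      have "a * t \<le> \<beta> * t" "\<kappa> * a * t \<le> \<kappa> * \<beta> * t"
        using \<beta> t \<kappa> by (auto intro!: mult_right_mono mult_left_mono)
      then have "128 * \<eta> \<le> \<kappa> * \<beta> * t" "\<kappa> \<le> \<beta> * t / 2"
        using \<kappa> \<eta> by linarith+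
      then have "planted_free_energy p N \<beta> (shell p N t) \<le> - 3 * \<eta> * real N"
        using elim(2,3) \<beta> range \<kappa> \<eta>
        by (intro planted_free_energy_shell_le[OF elim(7) t, where \<kappa> = \<kappa> and \<gamma> = \<gamma>] elim(4)[unfolded k_def] elim(5)) auto
      then show "mean_pair_overlap_mass p N \<beta> t \<le> exp (- \<delta> * real N)"
        using elim(1) \<beta> range y \<delta> \<eta> k_def
        by (intro mean_pair_overlap_mass_le_exp[OF elim(7) t, where y = y and k = "y\<^sup>2 / (8 * b\<^sup>2)" and \<eta> = \<eta>] elim(6)) auto
    qed
  qed
  then show ?thesis using \<delta>(1) by blast
qed

theorem mean_pair_overlap_mass_exponentially_small:
  assumes range: "0 < a" "a \<le> b'" "b' < b" and t: "t > 0"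
  shows "\<exists>\<gamma>>0. \<forall>\<^sub>F N in sequentially. \<forall>\<beta>\<in>{a..b'}. mean_pair_overlap_mass p N \<beta> t \<le> exp (- \<gamma> * real N)"
proof -
  have above_1: "\<exists>\<gamma>>0. \<forall>\<^sub>F N in sequentially. \<forall>\<beta>\<in>{a..b'}. mean_pair_overlap_mass p N \<beta> t \<le> exp (- \<gamma> * real N)"
    if "t > 1" for t
    using that by (intro exI[of _ 1]) (auto simp: mean_pair_overlap_mass_eq_0)
  have "t > 0 \<Longrightarrow> t > (2 / 3) ^ n \<Longrightarrow>
     \<exists>\<gamma>>0. \<forall>\<^sub>F N in sequentially. \<forall>\<beta>\<in>{a..b'}. mean_pair_overlap_mass p N \<beta> t \<le> exp (- \<gamma> * real N)" for n
  proof (induction n arbitrary: t)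
    case 0
    then show ?case using above_1 by simp
  next
    case (Suc n)
    show ?case
    proof (cases "t > 1")
      case False
      have "3 / 2 * t > 0" "3 / 2 * t > (2 / 3) ^ n" using Suc.prems by auto
      from Suc.IH[OF this] obtain \<gamma> where "\<gamma> > 0"
        "\<forall>\<^sub>F N in sequentially. \<forall>\<beta>\<in>{a..b'}. mean_pair_overlap_mass p N \<beta> (3 / 2 * t) \<le> exp (- \<gamma> * real N)" by blast
      then show ?thesis using overlap_threshold_step[OF range Suc.prems(1)] False by auto
    qed (rule above_1)
  qed
  moreover obtain n where "(2 / 3) ^ n < t"
    using real_arch_pow_inv[OF t, of "2 / 3"] by auto
  ultimately show ?thesis using t by blast
qed

end

section \<open>Positivity of the overlap\<close>

text \<open>A deterministic weight \<^term>\<open>exp (c \<omega>)\<close>, perturbed by small independent \<open>s\<close>-spin Hamiltonians of the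
  configuration \<open>spins \<omega>\<close>, \<open>s = 1, \<dots>, S\<close>, at strengths \<open>\<eta> * x s\<close>.\<close>
locale perturbed =
  fixes \<Omega> :: "'o set" and c :: "'o \<Rightarrow> real" and spins :: "'o \<Rightarrow> nat \<Rightarrow> real" and M S :: nat and \<eta> :: real
  assumes finite_\<Omega>: "finite \<Omega>" and \<Omega>_nonempty: "\<Omega> \<noteq> {}"
    and spins_in_Sigma: "\<And>\<omega>. \<omega> \<in> \<Omega> \<Longrightarrow> spins \<omega> \<in> Sigma M"
    and M: "M \<ge> 1" and \<eta>: "\<eta> > 0"
begin

definition ovl :: "'o \<Rightarrow> 'o \<Rightarrow> real" where
  "ovl \<omega> \<omega>' = overlap M (spins \<omega>) (spins \<omega>')"

definition spin_indices :: "nat list set" where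
  "spin_indices = (\<Union>s\<in>{1..S}. idx s M)"

definition coeff :: "(nat \<Rightarrow> nat) \<Rightarrow> nat list \<Rightarrow> 'o \<Rightarrow> real" where
  "coeff x i \<omega> = \<eta> * real (x (length i)) * coupling_coeff (length i) M i (spins \<omega>)"

definition perturbed_energy :: "(nat \<Rightarrow> nat) \<Rightarrow> (nat list \<Rightarrow> real) \<Rightarrow> 'o \<Rightarrow> real" where
  "perturbed_energy x = affine_energy spin_indices (coeff x) c"

definition spin_energy :: "nat \<Rightarrow> (nat list \<Rightarrow> real) \<Rightarrow> 'o \<Rightarrow> real" where
  "spin_energy s g \<omega> = \<eta> * H s M g (spins \<omega>)"

abbreviation avg :: "(nat \<Rightarrow> nat) \<Rightarrow> (nat list \<Rightarrow> real) \<Rightarrow> ('o \<Rightarrow> real) \<Rightarrow> real" where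
  "avg x g \<equiv> gibbs_avg \<Omega> (perturbed_energy x g)"

abbreviation multi_avg :: "(nat \<Rightarrow> nat) \<Rightarrow> (nat list \<Rightarrow> real) \<Rightarrow> nat \<Rightarrow> ((nat \<Rightarrow> 'o) \<Rightarrow> real) \<Rightarrow> real" where
  "multi_avg x g n \<equiv> replica_avg \<Omega> (perturbed_energy x g) n"

abbreviation log_partition :: "(nat \<Rightarrow> nat) \<Rightarrow> (nat list \<Rightarrow> real) \<Rightarrow> real" where
  "log_partition x g \<equiv> log_sum_exp \<Omega> (perturbed_energy x g)"

definition mean_log_partition :: "(nat \<Rightarrow> nat) \<Rightarrow> real" where
  "mean_log_partition x = (\<integral>g. log_partition x g \<partial>iid_gauss)"

definition mean_spin_energy :: "nat \<Rightarrow> (nat \<Rightarrow> nat) \<Rightarrow> real" where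
  "mean_spin_energy s x = (\<integral>g. avg x g (spin_energy s g) \<partial>iid_gauss)"

definition spin_energy_deviation :: "nat \<Rightarrow> (nat \<Rightarrow> nat) \<Rightarrow> real" where
  "spin_energy_deviation s x = (\<integral>g. avg x g (\<lambda>\<omega>. \<bar>spin_energy s g \<omega> - mean_spin_energy s x\<bar>) \<partial>iid_gauss)"

definition mean_overlap_avg :: "(real \<Rightarrow> real) \<Rightarrow> (nat \<Rightarrow> nat) \<Rightarrow> real" where
  "mean_overlap_avg f x = (\<integral>g. avg x g (\<lambda>\<omega>. avg x g (\<lambda>\<omega>'. f (ovl \<omega> \<omega>'))) \<partial>iid_gauss)"

lemma finite_spin_indices: "finite spin_indices"
  by (simp add: spin_indices_def)

lemma sum_spin_indices: "(\<Sum>i\<in>spin_indices. f i) = (\<Sum>s=1..S. \<Sum>i\<in>idx s M. f i)" for f :: "nat list \<Rightarrow> real"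
  unfolding spin_indices_def by (rule sum.UNION_disjoint) (auto dest: length_idx)

lemma idx_subset_spin_indices: "s \<in> {1..S} \<Longrightarrow> idx s M \<subseteq> spin_indices"
  by (auto simp: spin_indices_def)

lemma abs_ovl_le_1: "\<omega> \<in> \<Omega> \<Longrightarrow> \<omega>' \<in> \<Omega> \<Longrightarrow> \<bar>ovl \<omega> \<omega>'\<bar> \<le> 1"
  unfolding ovl_def by (intro abs_overlap_le_1 spins_in_Sigma)

lemma ovl_self: "\<omega> \<in> \<Omega> \<Longrightarrow> ovl \<omega> \<omega> = 1"
  unfolding ovl_def by (intro overlap_self M spins_in_Sigma)

lemma ovl_commute: "ovl \<omega> \<omega>' = ovl \<omega>' \<omega>"
  unfolding ovl_def by (rule overlap_commute)

lemma measurable_perturbed_energy [measurable]: "(\<lambda>g. perturbed_energy x g \<omega>) \<in> borel_measurable iid_gauss"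
  unfolding perturbed_energy_def by measurable

lemma integrable_spin_energy: "integrable iid_gauss (\<lambda>g. spin_energy s g \<omega>)"
  unfolding spin_energy_def using integrable_H by simp

lemma integrable_avg:
  "(\<And>\<omega>. \<omega> \<in> \<Omega> \<Longrightarrow> integrable iid_gauss (\<lambda>g. f g \<omega>)) \<Longrightarrow> integrable iid_gauss (\<lambda>g. avg x g (f g))"
  by (intro integrable_gibbs_avg finite_\<Omega> measurable_perturbed_energy)

lemma integrable_multi_avg:
  "(\<And>\<tau>. integrable iid_gauss (\<lambda>g. f g \<tau>)) \<Longrightarrow> integrable iid_gauss (\<lambda>g. multi_avg x g n (f g))"
  by (intro integrable_gibbs_avg finite_replicas finite_\<Omega>) measurable

lemma integrable_avg_spin_energy_deviation:
  "integrable iid_gauss (\<lambda>g. avg x g (\<lambda>\<omega>. \<bar>spin_energy s g \<omega> - m\<bar>))"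
  by (intro integrable_avg Bochner_Integration.integrable_abs Bochner_Integration.integrable_diff
      integrable_spin_energy) simp

lemma spin_energy_deviation_nonneg: "0 \<le> spin_energy_deviation s x"
  unfolding spin_energy_deviation_def by (intro Bochner_Integration.integral_nonneg gibbs_avg_nonneg) simp

lemma integrable_log_partition: "integrable iid_gauss (log_partition x)"
  unfolding perturbed_energy_def
  by (rule integrable_log_sum_exp_affine_energy[OF finite_\<Omega> \<Omega>_nonempty finite_spin_indices])

lemma perturbed_energy_eq_sum:
  "perturbed_energy x g \<omega> = (\<Sum>s=1..S. real (x s) * spin_energy s g \<omega>) + c \<omega>"
proof -
  have "(\<Sum>i\<in>idx s M. coeff x i \<omega> * g i) = real (x s) * spin_energy s g \<omega>" for s
    unfolding spin_energy_def H_eq_sum_coupling_coeff sum_distrib_left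
    by (intro sum.cong refl) (simp add: coeff_def length_idx)
  then show ?thesis by (simp add: perturbed_energy_def affine_energy_def sum_spin_indices)
qed

lemma perturbed_energy_upd:
  assumes "s \<in> {1..S}"
  shows "perturbed_energy (x(s := x s + 1)) g \<omega> = perturbed_energy x g \<omega> + spin_energy s g \<omega>"
proof -
  have "(\<Sum>s'=1..S. real ((x(s := x s + 1)) s') * spin_energy s' g \<omega>) =
     (\<Sum>s'=1..S. real (x s') * spin_energy s' g \<omega> + (if s' = s then spin_energy s g \<omega> else 0))"
    by (intro sum.cong refl) (auto simp: algebra_simps)
  then show ?thesis using assms by (simp add: perturbed_energy_eq_sum sum.distrib sum.delta)
qed

lemma subgaussian_log_partition:
  assumes "\<And>s. s \<in> {1..S} \<Longrightarrow> x s \<le> B"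
  shows "subgaussian iid_gauss (log_partition x) (real S * ((real B)\<^sup>2 * \<eta>\<^sup>2 * real M))"
  unfolding perturbed_energy_def
proof (rule subgaussian_log_sum_exp_affine_energy[OF finite_\<Omega> \<Omega>_nonempty finite_spin_indices])
  let ?A = "\<lambda>i. \<eta> * real (x (length i)) * real M powr (- (real (length i) - 1) / 2)"
  show "\<bar>coeff x i \<omega>\<bar> \<le> ?A i" if "i \<in> spin_indices" "\<omega> \<in> \<Omega>" for i \<omega>
  proof -
    have "i \<in> idx (length i) M" using that(1) by (auto simp: spin_indices_def dest: length_idx)
    from abs_coupling_coeff[OF this spins_in_Sigma[OF that(2)]] show ?thesis
      using \<eta> by (simp add: coeff_def abs_mult)
  qed
  have "(\<Sum>i\<in>idx s M. (?A i)\<^sup>2) \<le> (real B)\<^sup>2 * \<eta>\<^sup>2 * real M" if s: "s \<in> {1..S}" for s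
  proof -
    have "(\<Sum>i\<in>idx s M. (?A i)\<^sup>2) = (\<Sum>i\<in>idx s M. (\<eta> * real (x s) * real M powr (- (real s - 1) / 2))\<^sup>2)"
      by (intro sum.cong refl) (simp add: length_idx)
    also have "\<dots> = (real (x s))\<^sup>2 * (\<eta>\<^sup>2 * real M)"
      using M s by (subst sum_coupling_scale_square) (auto simp: power_mult_distrib)
    also have "\<dots> \<le> (real B)\<^sup>2 * (\<eta>\<^sup>2 * real M)"
      using assms[OF s] by (intro mult_right_mono power_mono) auto
    finally show ?thesis by simp
  qed
  then have "(\<Sum>s=1..S. \<Sum>i\<in>idx s M. (?A i)\<^sup>2) \<le> (\<Sum>s=1..S. (real B)\<^sup>2 * \<eta>\<^sup>2 * real M)"
    by (rule sum_mono)
  then show "(\<Sum>i\<in>spin_indices. (?A i)\<^sup>2) \<le> real S * ((real B)\<^sup>2 * \<eta>\<^sup>2 * real M)"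
    by (simp add: sum_spin_indices)
qed

lemma spin_energy_eq_sum: "spin_energy s g \<omega> = (\<Sum>i\<in>idx s M. (\<eta> * coupling_coeff s M i (spins \<omega>)) * g i)"
  by (simp add: spin_energy_def H_eq_sum_coupling_coeff sum_distrib_left mult_ac)

lemma spin_energy_covariance:
  assumes "s \<in> {1..S}"
  shows "(\<Sum>i\<in>idx s M. (\<eta> * coupling_coeff s M i (spins \<omega>)) * coeff x i \<omega>') = \<eta>\<^sup>2 * real (x s) * real M * ovl \<omega> \<omega>' ^ s"
proof -
  have "(\<Sum>i\<in>idx s M. (\<eta> * coupling_coeff s M i (spins \<omega>)) * coeff x i \<omega>') =
     (\<Sum>i\<in>idx s M. (\<eta>\<^sup>2 * real (x s)) * (coupling_coeff s M i (spins \<omega>) * coupling_coeff s M i (spins \<omega>')))"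
    by (intro sum.cong refl) (simp add: coeff_def length_idx power2_eq_square)
  also have "\<dots> = (\<eta>\<^sup>2 * real (x s)) * (real M * overlap M (spins \<omega>) (spins \<omega>') ^ s)"
    unfolding sum_distrib_left[symmetric] using assms M by (subst sum_coupling_coeff_mult) auto
  finally show ?thesis by (simp add: ovl_def)
qed

subsection \<open>The mean of the perturbation energy\<close>

lemma integrable_overlap_avg: "integrable iid_gauss (\<lambda>g. avg x g (\<lambda>\<omega>. avg x g (\<lambda>\<omega>'. f (ovl \<omega> \<omega>'))))"
  by (intro integrable_avg) simp

lemma abs_mean_overlap_avg_le:
  assumes "\<And>y. \<bar>y\<bar> \<le> 1 \<Longrightarrow> \<bar>f y\<bar> \<le> B"
  shows "\<bar>mean_overlap_avg f x\<bar> \<le> B"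
proof -
  have bound: "\<bar>avg x g (\<lambda>\<omega>. avg x g (\<lambda>\<omega>'. f (ovl \<omega> \<omega>')))\<bar> \<le> B" for g
    by (intro abs_gibbs_avg_le_bound finite_\<Omega> \<Omega>_nonempty assms abs_ovl_le_1)
  have "\<bar>mean_overlap_avg f x\<bar> \<le> (\<integral>g. \<bar>avg x g (\<lambda>\<omega>. avg x g (\<lambda>\<omega>'. f (ovl \<omega> \<omega>')))\<bar> \<partial>iid_gauss)"
    unfolding mean_overlap_avg_def by (rule integral_abs_bound)
  also have "\<dots> \<le> (\<integral>g. B \<partial>(iid_gauss :: (nat list \<Rightarrow> real) measure))"
    using bound integrable_overlap_avg by (intro integral_mono) auto
  finally show ?thesis by simp
qed

lemma mean_spin_energy_eq:
  assumes s: "s \<in> {1..S}"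
  shows "mean_spin_energy s x = \<eta>\<^sup>2 * real (x s) * real M * (1 - mean_overlap_avg (\<lambda>y. y ^ s) x)"
proof -
  let ?k = "\<eta>\<^sup>2 * real (x s) * real M"
  have diag: "avg x g (\<lambda>\<omega>. ?k * ovl \<omega> \<omega> ^ s) = ?k" for g
  proof -
    have "avg x g (\<lambda>\<omega>. ?k * ovl \<omega> \<omega> ^ s) = avg x g (\<lambda>\<omega>. ?k)"
      by (rule gibbs_avg_cong) (simp add: ovl_self)
    then show ?thesis by (simp add: gibbs_avg_const finite_\<Omega> \<Omega>_nonempty)
  qed
  have "mean_spin_energy s x = (\<integral>g. avg x g (\<lambda>\<omega>. ?k * ovl \<omega> \<omega> ^ s) \<partial>iid_gauss) -
      (\<integral>g. avg x g (\<lambda>\<omega>. avg x g (\<lambda>\<omega>'. ?k * ovl \<omega> \<omega>' ^ s)) \<partial>iid_gauss)"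
    unfolding mean_spin_energy_def spin_energy_eq_sum[abs_def] spin_energy_covariance[OF s, symmetric] perturbed_energy_def
    by (rule gibbs_avg_integration_by_parts[OF finite_\<Omega> finite_spin_indices idx_subset_spin_indices[OF s]])
  also have "\<dots> = ?k - ?k * mean_overlap_avg (\<lambda>y. y ^ s) x"
    unfolding diag by (simp add: gibbs_avg_cmult mean_overlap_avg_def)
  finally show ?thesis by (simp add: right_diff_distrib)
qed

lemma mean_spin_energy_bounds:
  assumes "s \<in> {1..S}"
  shows "0 \<le> mean_spin_energy s x" and "mean_spin_energy s x \<le> 2 * \<eta>\<^sup>2 * real (x s) * real M"
proof -
  have "\<bar>mean_overlap_avg (\<lambda>y. y ^ s) x\<bar> \<le> 1"
    by (rule abs_mean_overlap_avg_le) (rule abs_power_le_1)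
  then have range: "0 \<le> 1 - mean_overlap_avg (\<lambda>y. y ^ s) x" "1 - mean_overlap_avg (\<lambda>y. y ^ s) x \<le> 2"
    by auto
  have k: "0 \<le> \<eta>\<^sup>2 * real (x s) * real M" by simp
  show "0 \<le> mean_spin_energy s x"
    unfolding mean_spin_energy_eq[OF assms] by (rule mult_nonneg_nonneg[OF k range(1)])
  show "mean_spin_energy s x \<le> 2 * \<eta>\<^sup>2 * real (x s) * real M"
    unfolding mean_spin_energy_eq[OF assms] using mult_left_mono[OF range(2) k] by simp
qed

lemma mean_log_partition_increment:
  fixes x :: "nat \<Rightarrow> nat"
  assumes s: "s \<in> {1..S}"
  defines "y \<equiv> x(s := x s + 1)"
  shows "mean_spin_energy s x \<le> mean_log_partition y - mean_log_partition x"
    and "mean_log_partition y - mean_log_partition x \<le> mean_spin_energy s y"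
proof -
  have energy: "perturbed_energy y g \<omega> = perturbed_energy x g \<omega> + spin_energy s g \<omega>" for g \<omega>
    unfolding y_def by (rule perturbed_energy_upd[OF s])
  have lower: "avg x g (spin_energy s g) \<le> log_partition y g - log_partition x g" for g
    using gibbs_avg_diff_le_log_sum_exp_diff[OF finite_\<Omega> \<Omega>_nonempty, of "perturbed_energy x g" "perturbed_energy y g"]
    by (simp add: energy)
  have upper: "log_partition y g - log_partition x g \<le> avg y g (spin_energy s g)" for g
    using gibbs_avg_diff_le_log_sum_exp_diff[OF finite_\<Omega> \<Omega>_nonempty, of "perturbed_energy y g" "perturbed_energy x g"]
      gibbs_avg_cmult[of \<Omega> "perturbed_energy y g" "-1" "spin_energy s g"]
    by (simp add: energy)
  have difference: "(\<integral>g. log_partition y g - log_partition x g \<partial>iid_gauss) = mean_log_partition y - mean_log_partition x"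
    unfolding mean_log_partition_def using integrable_log_partition by (intro Bochner_Integration.integral_diff)
  note integrable = Bochner_Integration.integrable_diff[OF integrable_log_partition integrable_log_partition]
    integrable_avg[OF integrable_spin_energy]
  show "mean_spin_energy s x \<le> mean_log_partition y - mean_log_partition x"
    unfolding mean_spin_energy_def difference[symmetric] by (intro integral_mono integrable lower)
  show "mean_log_partition y - mean_log_partition x \<le> mean_spin_energy s y"
    unfolding mean_spin_energy_def difference[symmetric] by (intro integral_mono integrable upper)
qed

text \<open>The Gibbs average of the absolute deviation is controlled by increments of the free energy, which concentrate.\<close>
lemma avg_spin_energy_deviation_le:
  fixes x :: "nat \<Rightarrow> nat"
  assumes s: "s \<in> {1..S}" and x: "x s \<ge> 1"
  defines "y \<equiv> x(s := x s + 1)" and "z \<equiv> x(s := x s - 1)" and "d \<equiv> \<lambda>x g. \<bar>log_partition x g - mean_log_partition x\<bar>"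
  shows "avg x g (\<lambda>\<omega>. \<bar>spin_energy s g \<omega> - mean_spin_energy s x\<bar>) \<le>
    ln 2 + (mean_spin_energy s y - mean_spin_energy s z) + (d y g + 2 * d x g + d z g)"
proof -
  let ?m = "mean_spin_energy s x" and ?D = "mean_spin_energy s y - mean_spin_energy s z"
  let ?u = "log_partition y g - log_partition x g - ?m" and ?v = "log_partition z g - log_partition x g + ?m"
  have zx: "z(s := z s + 1) = x" using x by (auto simp: z_def)
  have "perturbed_energy y g = (\<lambda>\<omega>. perturbed_energy x g \<omega> + spin_energy s g \<omega>)"
      "perturbed_energy z g = (\<lambda>\<omega>. perturbed_energy x g \<omega> - spin_energy s g \<omega>)"
    using perturbed_energy_upd[OF s, of x g] perturbed_energy_upd[OF s, of z g] unfolding zx y_def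
    by (simp_all add: fun_eq_iff)
  then have "avg x g (\<lambda>\<omega>. \<bar>spin_energy s g \<omega> - ?m\<bar>) \<le> ln 2 + max ?u ?v"
    using gibbs_avg_abs_deviation_le[OF finite_\<Omega> \<Omega>_nonempty] by simp
  moreover have "?u \<le> ?D + d y g + d x g" "?v \<le> ?D + d z g + d x g"
    using mean_log_partition_increment[OF s, of x] mean_log_partition_increment[OF s, of z]
    unfolding zx y_def[symmetric] d_def by linarith+
  moreover have "0 \<le> d x g" "0 \<le> d y g" "0 \<le> d z g" by (simp_all add: d_def)
  ultimately show ?thesis by linarith
qed

lemma spin_energy_deviation_le:
  assumes s: "s \<in> {1..S}" and x: "x s \<ge> 1" and B: "\<And>s. s \<in> {1..S} \<Longrightarrow> x s + 1 \<le> B"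
  shows "spin_energy_deviation s x \<le>
    ln 2 + (mean_spin_energy s (x(s := x s + 1)) - mean_spin_energy s (x(s := x s - 1))) +
    24 * sqrt (real S * ((real B)\<^sup>2 * \<eta>\<^sup>2 * real M))"
proof -
  define V where "V = real S * ((real B)\<^sup>2 * \<eta>\<^sup>2 * real M)"
  have V: "V > 0" unfolding V_def using B[OF s] s M \<eta> by auto
  let ?y = "x(s := x s + 1)" and ?z = "x(s := x s - 1)"
  let ?D = "mean_spin_energy s ?y - mean_spin_energy s ?z"
  let ?d = "\<lambda>w g. \<bar>log_partition w g - mean_log_partition w\<bar>"
  have int_d: "integrable iid_gauss (?d w)" for w
    using integrable_log_partition by simp
  have concentration: "(\<integral>g. ?d w g \<partial>iid_gauss) \<le> 6 * sqrt V" if "w \<in> {x, ?y, ?z}" for w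
    unfolding V_def mean_log_partition_def
  proof (rule iid_gauss.subgaussian_mean_abs_deviation_le[OF subgaussian_log_partition V[unfolded V_def]])
    fix s' assume s': "s' \<in> {1..S}"
    have "w s' \<le> x s' + 1" using that by auto
    then show "w s' \<le> B" using B[OF s'] by linarith
  qed
  have "spin_energy_deviation s x \<le> (\<integral>g. ln 2 + ?D + (?d ?y g + 2 * ?d x g + ?d ?z g) \<partial>iid_gauss)"
    unfolding spin_energy_deviation_def using int_d
    by (intro integral_mono avg_spin_energy_deviation_le s x integrable_avg_spin_energy_deviation
        Bochner_Integration.integrable_add integrable_mult_right) auto
  also have "\<dots> = ln 2 + ?D + ((\<integral>g. ?d ?y g \<partial>iid_gauss) + 2 * (\<integral>g. ?d x g \<partial>iid_gauss) + (\<integral>g. ?d ?z g \<partial>iid_gauss))"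
    using int_d[of x] int_d[of ?y] int_d[of ?z] by simp
  also have "\<dots> \<le> ln 2 + ?D + (6 * sqrt V + 2 * (6 * sqrt V) + 6 * sqrt V)"
    by (intro add_mono mult_left_mono order_refl concentration) auto
  finally show ?thesis by (simp add: V_def)
qed

subsection \<open>The Ghirlanda--Guerra identities\<close>

definition overlap_excess ::
    "(nat \<Rightarrow> nat) \<Rightarrow> (nat list \<Rightarrow> real) \<Rightarrow> nat \<Rightarrow> nat \<Rightarrow> (real \<Rightarrow> real) \<Rightarrow> (nat \<Rightarrow> 'o) \<Rightarrow> real" where
  "overlap_excess x g n l \<psi> \<tau> = (\<Sum>l'<n. \<psi> (ovl (\<tau> l) (\<tau> l'))) - real n * avg x g (\<lambda>\<omega>. \<psi> (ovl (\<tau> l) \<omega>))"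

definition gg_defect :: "(nat \<Rightarrow> nat) \<Rightarrow> nat \<Rightarrow> ((nat \<Rightarrow> 'o) \<Rightarrow> real) \<Rightarrow> nat \<Rightarrow> (real \<Rightarrow> real) \<Rightarrow> real" where
  "gg_defect x n f l \<psi> = (\<integral>g. multi_avg x g n (\<lambda>\<tau>. f \<tau> * overlap_excess x g n l \<psi> \<tau>) \<partial>iid_gauss) -
     (\<integral>g. multi_avg x g n f \<partial>iid_gauss) * (\<psi> 1 - mean_overlap_avg \<psi> x)"

definition gg_error :: "(nat \<Rightarrow> nat) \<Rightarrow> real" where
  "gg_error x = (\<Sum>s=1..S. spin_energy_deviation s x / (\<eta>\<^sup>2 * real (x s) * real M))"

lemma gg_error_nonneg: "0 \<le> gg_error x"
  unfolding gg_error_def by (intro sum_nonneg divide_nonneg_nonneg spin_energy_deviation_nonneg) auto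

lemma integrable_overlap_excess: "integrable iid_gauss (\<lambda>g. multi_avg x g n (\<lambda>\<tau>. f \<tau> * overlap_excess x g n l \<psi> \<tau>))"
  unfolding overlap_excess_def
  by (intro integrable_multi_avg integrable_mult_right Bochner_Integration.integrable_diff integrable_avg) auto

lemma abs_expected_multi_avg_le:
  assumes f: "\<And>g \<tau>. \<tau> \<in> {..<n} \<rightarrow>\<^sub>E \<Omega> \<Longrightarrow> \<bar>f g \<tau>\<bar> \<le> B" and int: "\<And>\<tau>. integrable iid_gauss (\<lambda>g. f g \<tau>)"
  shows "\<bar>\<integral>g. multi_avg x g n (f g) \<partial>iid_gauss\<bar> \<le> B"
proof -
  have "\<bar>\<integral>g. multi_avg x g n (f g) \<partial>iid_gauss\<bar> \<le> (\<integral>g. \<bar>multi_avg x g n (f g)\<bar> \<partial>iid_gauss)"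
    by (rule integral_abs_bound)
  also have "\<dots> \<le> (\<integral>g. B \<partial>(iid_gauss :: (nat list \<Rightarrow> real) measure))"
    using f int
    by (intro integral_mono Bochner_Integration.integrable_abs integrable_multi_avg abs_gibbs_avg_le_bound
        finite_replicas replicas_nonempty finite_\<Omega> \<Omega>_nonempty) auto
  finally show ?thesis by simp
qed

lemma expected_spin_energy_overlap_excess:
  assumes s: "s \<in> {1..S}"
  shows "(\<integral>g. multi_avg x g n (\<lambda>\<tau>. f \<tau> * spin_energy s g (\<tau> l)) \<partial>iid_gauss) =
    \<eta>\<^sup>2 * real (x s) * real M * (\<integral>g. multi_avg x g n (\<lambda>\<tau>. f \<tau> * overlap_excess x g n l (\<lambda>y. y ^ s) \<tau>) \<partial>iid_gauss)"
proof -
  let ?k = "\<eta>\<^sup>2 * real (x s) * real M"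
  let ?b = "\<lambda>i \<omega>. \<eta> * coupling_coeff s M i (spins \<omega>)"
  have "(\<integral>g. multi_avg x g n (\<lambda>\<tau>. f \<tau> * spin_energy s g (\<tau> l)) \<partial>iid_gauss) =
      (\<integral>g. multi_avg x g n (\<lambda>\<tau>. f \<tau> * ((\<Sum>l'<n. ?k * ovl (\<tau> l) (\<tau> l') ^ s) -
        real n * avg x g (\<lambda>\<omega>. ?k * ovl (\<tau> l) \<omega> ^ s))) \<partial>iid_gauss)"
    unfolding spin_energy_eq_sum[abs_def] perturbed_energy_def
    by (rule replica_avg_integration_by_parts[OF finite_\<Omega> \<Omega>_nonempty finite_spin_indices
          idx_subset_spin_indices[OF s], where b = ?b and C = "\<lambda>\<omega> \<omega>'. ?k * ovl \<omega> \<omega>' ^ s"])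
       (rule spin_energy_covariance[OF s, symmetric])
  also have "\<dots> = (\<integral>g. multi_avg x g n (\<lambda>\<tau>. ?k * (f \<tau> * overlap_excess x g n l (\<lambda>y. y ^ s) \<tau>)) \<partial>iid_gauss)"
    by (intro Bochner_Integration.integral_cong refl gibbs_avg_cong)
       (simp add: overlap_excess_def gibbs_avg_cmult right_diff_distrib mult_ac flip: sum_distrib_left)
  finally show ?thesis by (simp add: gibbs_avg_cmult)
qed

lemma abs_expected_spin_energy_deviation_le:
  assumes l: "l < n" and f: "\<And>\<tau>. \<bar>f \<tau>\<bar> \<le> 1"
  shows "\<bar>\<integral>g. multi_avg x g n (\<lambda>\<tau>. f \<tau> * (spin_energy s g (\<tau> l) - mean_spin_energy s x)) \<partial>iid_gauss\<bar>
    \<le> spin_energy_deviation s x"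
proof -
  let ?d = "\<lambda>g \<omega>. spin_energy s g \<omega> - mean_spin_energy s x"
  have int: "integrable iid_gauss (\<lambda>g. multi_avg x g n (\<lambda>\<tau>. f \<tau> * ?d g (\<tau> l)))"
    by (intro integrable_multi_avg integrable_mult_right Bochner_Integration.integrable_diff integrable_spin_energy) simp
  have "\<bar>\<integral>g. multi_avg x g n (\<lambda>\<tau>. f \<tau> * ?d g (\<tau> l)) \<partial>iid_gauss\<bar> \<le>
      (\<integral>g. \<bar>multi_avg x g n (\<lambda>\<tau>. f \<tau> * ?d g (\<tau> l))\<bar> \<partial>iid_gauss)"
    by (rule integral_abs_bound)
  also have "\<dots> \<le> (\<integral>g. avg x g (\<lambda>\<omega>. \<bar>?d g \<omega>\<bar>) \<partial>iid_gauss)"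
  proof (rule integral_mono)
    show "\<bar>multi_avg x g n (\<lambda>\<tau>. f \<tau> * ?d g (\<tau> l))\<bar> \<le> avg x g (\<lambda>\<omega>. \<bar>?d g \<omega>\<bar>)" for g
    proof -
      have "\<bar>multi_avg x g n (\<lambda>\<tau>. f \<tau> * ?d g (\<tau> l))\<bar> \<le> multi_avg x g n (\<lambda>\<tau>. \<bar>f \<tau> * ?d g (\<tau> l)\<bar>)"
        by (rule abs_gibbs_avg_le)
      also have "\<dots> \<le> multi_avg x g n (\<lambda>\<tau>. \<bar>?d g (\<tau> l)\<bar>)"
        using mult_right_mono[OF f abs_ge_zero] by (intro gibbs_avg_mono) (simp add: abs_mult)
      also have "\<dots> = avg x g (\<lambda>\<omega>. \<bar>?d g \<omega>\<bar>)"
        by (rule replica_avg_marginal[OF finite_\<Omega> \<Omega>_nonempty l, of _ "\<lambda>\<omega>. \<bar>?d g \<omega>\<bar>"])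
      finally show ?thesis .
    qed
  qed (use int integrable_avg_spin_energy_deviation in auto)
  finally show ?thesis by (simp add: spin_energy_deviation_def)
qed

lemma abs_gg_defect_power_le:
  assumes s: "s \<in> {1..S}" and l: "l < n" and x: "x s \<ge> 1" and f: "\<And>\<tau>. \<bar>f \<tau>\<bar> \<le> 1"
  shows "\<bar>gg_defect x n f l (\<lambda>y. y ^ s)\<bar> \<le> spin_energy_deviation s x / (\<eta>\<^sup>2 * real (x s) * real M)"
proof -
  let ?k = "\<eta>\<^sup>2 * real (x s) * real M" and ?m = "mean_spin_energy s x"
  have k: "?k > 0" using x M \<eta> by simp
  have "?k * gg_defect x n f l (\<lambda>y. y ^ s) =
      (\<integral>g. multi_avg x g n (\<lambda>\<tau>. f \<tau> * spin_energy s g (\<tau> l)) \<partial>iid_gauss) - ?m * (\<integral>g. multi_avg x g n f \<partial>iid_gauss)"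
    unfolding gg_defect_def mean_spin_energy_eq[OF s] expected_spin_energy_overlap_excess[OF s]
    by (simp add: algebra_simps)
  also have "\<dots> = (\<integral>g. multi_avg x g n (\<lambda>\<tau>. f \<tau> * spin_energy s g (\<tau> l)) - ?m * multi_avg x g n f \<partial>iid_gauss)"
    by (subst Bochner_Integration.integral_diff)
       (auto intro!: integrable_multi_avg integrable_mult_right integrable_spin_energy)
  also have "\<dots> = (\<integral>g. multi_avg x g n (\<lambda>\<tau>. f \<tau> * (spin_energy s g (\<tau> l) - ?m)) \<partial>iid_gauss)"
    unfolding gibbs_avg_cmult[symmetric] gibbs_avg_diff[symmetric] by (simp add: algebra_simps)
  finally have "?k * \<bar>gg_defect x n f l (\<lambda>y. y ^ s)\<bar> \<le> spin_energy_deviation s x"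
    using abs_expected_spin_energy_deviation_le[where f = f and x = x and s = s, OF l f] k by (simp add: abs_mult)
  then show ?thesis using k by (simp add: le_divide_eq mult.commute)
qed

lemma abs_gg_defect_le:
  assumes l: "l < n" and f: "\<And>\<tau>. \<bar>f \<tau>\<bar> \<le> 1" and \<psi>: "\<And>y. \<bar>y\<bar> \<le> 1 \<Longrightarrow> \<bar>\<psi> y\<bar> \<le> \<delta>"
  shows "\<bar>gg_defect x n f l \<psi>\<bar> \<le> 4 * real n * \<delta>"
proof -
  have \<delta>: "\<delta> \<ge> 0" using \<psi>[of 0] by (auto intro: order_trans[OF abs_ge_zero])
  have excess: "\<bar>f \<tau> * overlap_excess x g n l \<psi> \<tau>\<bar> \<le> 2 * real n * \<delta>" if \<tau>: "\<tau> \<in> {..<n} \<rightarrow>\<^sub>E \<Omega>" for g \<tau>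
  proof -
    have mem: "\<tau> l' \<in> \<Omega>" if "l' < n" for l' using \<tau> that by auto
    have "\<bar>\<Sum>l'<n. \<psi> (ovl (\<tau> l) (\<tau> l'))\<bar> \<le> (\<Sum>l'<n. \<delta>)"
      using mem l by (intro order_trans[OF sum_abs] sum_mono \<psi> abs_ovl_le_1) auto
    moreover have "real n * \<bar>avg x g (\<lambda>\<omega>. \<psi> (ovl (\<tau> l) \<omega>))\<bar> \<le> real n * \<delta>"
      using mem[OF l] by (intro mult_left_mono abs_gibbs_avg_le_bound finite_\<Omega> \<Omega>_nonempty \<psi> abs_ovl_le_1) auto
    ultimately have "\<bar>overlap_excess x g n l \<psi> \<tau>\<bar> \<le> 2 * real n * \<delta>"
      unfolding overlap_excess_def
      using abs_triangle_ineq4[of "\<Sum>l'<n. \<psi> (ovl (\<tau> l) (\<tau> l'))" "real n * avg x g (\<lambda>\<omega>. \<psi> (ovl (\<tau> l) \<omega>))"]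
      by (simp add: abs_mult)
    then have "\<bar>f \<tau>\<bar> * \<bar>overlap_excess x g n l \<psi> \<tau>\<bar> \<le> 1 * (2 * real n * \<delta>)"
      by (intro mult_mono f) auto
    then show ?thesis by (simp add: abs_mult)
  qed
  have "\<bar>\<integral>g. multi_avg x g n (\<lambda>\<tau>. f \<tau> * overlap_excess x g n l \<psi> \<tau>) \<partial>iid_gauss\<bar> \<le> 2 * real n * \<delta>"
    using excess unfolding overlap_excess_def
    by (intro abs_expected_multi_avg_le) (auto intro!: integrable_mult_right integrable_avg)
  moreover have "\<bar>(\<integral>g. multi_avg x g n f \<partial>iid_gauss) * (\<psi> 1 - mean_overlap_avg \<psi> x)\<bar> \<le> 1 * (2 * \<delta>)"
  proof -
    have "\<bar>\<psi> 1 - mean_overlap_avg \<psi> x\<bar> \<le> 2 * \<delta>"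
      using \<psi>[of 1] abs_mean_overlap_avg_le[of \<psi> \<delta> x, OF \<psi>] by simp
    moreover have "\<bar>\<integral>g. multi_avg x g n f \<partial>iid_gauss\<bar> \<le> 1"
      using f by (intro abs_expected_multi_avg_le) auto
    ultimately show ?thesis unfolding abs_mult by (intro mult_mono) auto
  qed
  moreover have "1 * \<delta> \<le> real n * \<delta>" using l \<delta> by (intro mult_right_mono) auto
  ultimately show ?thesis unfolding gg_defect_def by linarith
qed

lemma gg_defect_add:
  "gg_defect x n f l (\<lambda>y. \<phi> y + \<psi> y) = gg_defect x n f l \<phi> + gg_defect x n f l \<psi>"
proof -
  have "overlap_excess x g n l (\<lambda>y. \<phi> y + \<psi> y) \<tau> = overlap_excess x g n l \<phi> \<tau> + overlap_excess x g n l \<psi> \<tau>" for g \<tau>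
    by (simp add: overlap_excess_def sum.distrib gibbs_avg_add algebra_simps)
  moreover have "mean_overlap_avg (\<lambda>y. \<phi> y + \<psi> y) x = mean_overlap_avg \<phi> x + mean_overlap_avg \<psi> x"
    unfolding mean_overlap_avg_def gibbs_avg_add
    by (intro Bochner_Integration.integral_add integrable_overlap_avg)
  ultimately show ?thesis
    by (simp add: gg_defect_def distrib_left gibbs_avg_add Bochner_Integration.integral_add integrable_overlap_excess)
       (simp add: algebra_simps)
qed

lemma gg_defect_cmult: "gg_defect x n f l (\<lambda>y. k * \<psi> y) = k * gg_defect x n f l \<psi>"
proof -
  have "overlap_excess x g n l (\<lambda>y. k * \<psi> y) \<tau> = k * overlap_excess x g n l \<psi> \<tau>" for g \<tau>
    by (simp add: overlap_excess_def gibbs_avg_cmult right_diff_distrib sum_distrib_left mult_ac)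
  moreover have "mean_overlap_avg (\<lambda>y. k * \<psi> y) x = k * mean_overlap_avg \<psi> x"
    unfolding mean_overlap_avg_def gibbs_avg_cmult by simp
  ultimately show ?thesis
    by (simp add: gg_defect_def mult.left_commute[of _ k] gibbs_avg_cmult right_diff_distrib)
qed

lemma gg_defect_const: "gg_defect x n f l (\<lambda>_. k) = 0"
  by (simp add: gg_defect_def overlap_excess_def mean_overlap_avg_def gibbs_avg_const finite_\<Omega> \<Omega>_nonempty
      finite_replicas replicas_nonempty)

lemma abs_gg_defect_polynomial_le:
  assumes l: "l < n" and f: "\<And>\<tau>. \<bar>f \<tau>\<bar> \<le> 1" and x: "\<And>s. s \<in> {1..S} \<Longrightarrow> x s \<ge> 1" and k: "\<And>s. \<bar>k s\<bar> \<le> K"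
  shows "\<bar>gg_defect x n f l (\<lambda>y. \<Sum>s\<le>S. k s * y ^ s)\<bar> \<le> K * gg_error x"
proof -
  have "gg_defect x n f l (\<lambda>y. \<Sum>s\<le>m. k s * y ^ s) = (\<Sum>s=1..m. k s * gg_defect x n f l (\<lambda>y. y ^ s))" for m
    by (induction m) (simp_all add: gg_defect_const gg_defect_add gg_defect_cmult)
  moreover have "\<bar>\<Sum>s=1..S. k s * gg_defect x n f l (\<lambda>y. y ^ s)\<bar> \<le>
      (\<Sum>s=1..S. K * (spin_energy_deviation s x / (\<eta>\<^sup>2 * real (x s) * real M)))"
  proof (intro order_trans[OF sum_abs] sum_mono)
    fix s assume s: "s \<in> {1..S}"
    show "\<bar>k s * gg_defect x n f l (\<lambda>y. y ^ s)\<bar> \<le> K * (spin_energy_deviation s x / (\<eta>\<^sup>2 * real (x s) * real M))"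
      unfolding abs_mult using k
      by (intro mult_mono abs_gg_defect_power_le s l x f) (auto intro: order_trans[OF abs_ge_zero k])
  qed
  ultimately show ?thesis by (simp add: gg_error_def sum_distrib_left)
qed

lemma abs_gg_defect_approx_le:
  assumes l: "l < n" and f: "\<And>\<tau>. \<bar>f \<tau>\<bar> \<le> 1" and x: "\<And>s. s \<in> {1..S} \<Longrightarrow> x s \<ge> 1" and k: "\<And>s. \<bar>k s\<bar> \<le> K"
    and \<delta>: "\<And>y. \<bar>y\<bar> \<le> 1 \<Longrightarrow> \<bar>\<phi> y - (\<Sum>s\<le>S. k s * y ^ s)\<bar> \<le> \<delta>"
  shows "\<bar>gg_defect x n f l \<phi>\<bar> \<le> K * gg_error x + 4 * real n * \<delta>"
proof -
  let ?\<psi> = "\<lambda>y. \<Sum>s\<le>S. k s * y ^ s"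
  have "gg_defect x n f l \<phi> = gg_defect x n f l ?\<psi> + gg_defect x n f l (\<lambda>y. \<phi> y - ?\<psi> y)"
    by (simp flip: gg_defect_add)
  also have "\<bar>\<dots>\<bar> \<le> K * gg_error x + 4 * real n * \<delta>"
    by (intro order_trans[OF abs_triangle_ineq] add_mono abs_gg_defect_polynomial_le abs_gg_defect_le l f x k \<delta>)
  finally show ?thesis .
qed

end

subsection \<open>Separated replicas\<close>

definition ramp :: "real \<Rightarrow> real \<Rightarrow> real \<Rightarrow> real" where
  "ramp e d y = max 0 (min 1 ((y + e) / d))"

lemma ramp_nonneg: "0 \<le> ramp e d y" and ramp_le_1: "ramp e d y \<le> 1"
  by (auto simp: ramp_def)

lemma ramp_eq_0: "d > 0 \<Longrightarrow> y \<le> - e \<Longrightarrow> ramp e d y = 0"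
  using divide_nonpos_pos[of "y + e" d] by (simp add: ramp_def)

lemma ramp_eq_1: "d > 0 \<Longrightarrow> y \<ge> - (e - d) \<Longrightarrow> ramp e d y = 1"
  by (simp add: ramp_def max_def min_def le_divide_eq)

lemma continuous_on_ramp: "d > 0 \<Longrightarrow> continuous_on A (ramp e d)"
  unfolding ramp_def[abs_def] by (intro continuous_intros) auto

context perturbed
begin

definition separated :: "nat \<Rightarrow> real \<Rightarrow> (nat \<Rightarrow> 'o) \<Rightarrow> bool" where
  "separated n e \<tau> \<longleftrightarrow> (\<forall>l<n. \<forall>l'<n. l \<noteq> l' \<longrightarrow> ovl (\<tau> l) (\<tau> l') \<le> - e)"

definition separation_prob :: "(nat \<Rightarrow> nat) \<Rightarrow> nat \<Rightarrow> real \<Rightarrow> real" where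
  "separation_prob x n e = (\<integral>g. multi_avg x g n (\<lambda>\<tau>. of_bool (separated n e \<tau>)) \<partial>iid_gauss)"

definition negative_overlap_prob :: "real \<Rightarrow> (nat \<Rightarrow> nat) \<Rightarrow> real" where
  "negative_overlap_prob e = mean_overlap_avg (\<lambda>y. of_bool (y \<le> - e))"

lemma integrable_separation: "integrable iid_gauss (\<lambda>g. multi_avg x g n (\<lambda>\<tau>. of_bool (separated n e \<tau>)))"
  by (rule integrable_multi_avg) simp

lemma integrable_separation_ramp:
  "integrable iid_gauss (\<lambda>g. multi_avg x g n (\<lambda>\<tau>. of_bool (separated n e \<tau>) * avg x g (\<lambda>\<omega>. \<phi> (ovl (\<tau> l) \<omega>))))"
  by (intro integrable_multi_avg integrable_mult_right integrable_avg) simp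

lemma separation_prob_nonneg: "0 \<le> separation_prob x n e"
  unfolding separation_prob_def by (intro Bochner_Integration.integral_nonneg gibbs_avg_nonneg) simp

lemma negative_overlap_prob_nonneg: "0 \<le> negative_overlap_prob e x"
  unfolding negative_overlap_prob_def mean_overlap_avg_def
  by (intro Bochner_Integration.integral_nonneg gibbs_avg_nonneg) simp

lemma negative_overlap_prob_le_1: "negative_overlap_prob e x \<le> 1"
  unfolding negative_overlap_prob_def
  using abs_mean_overlap_avg_le[of "\<lambda>y. of_bool (y \<le> - e)" 1 x] by simp

text \<open>\<^term>\<open>n\<close> vectors of norm \<open>1\<close> with pairwise inner products at most \<open>- e\<close> satisfy
  \<open>0 \<le> \<parallel>\<Sum> v\<parallel>\<^sup>2 \<le> n - n (n - 1) e\<close>.\<close>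
lemma not_separated:
  assumes \<tau>: "\<tau> \<in> {..<n} \<rightarrow>\<^sub>E \<Omega>" and e: "e * (real n - 1) > 1" and n: "n \<ge> 1"
  shows "\<not> separated n e \<tau>"
proof
  assume sep: "separated n e \<tau>"
  have "0 \<le> (\<Sum>i<M. (\<Sum>l<n. spins (\<tau> l) i)\<^sup>2)" by (intro sum_nonneg) auto
  also have "\<dots> = (\<Sum>i<M. \<Sum>l<n. \<Sum>l'<n. spins (\<tau> l) i * spins (\<tau> l') i)"
    by (simp add: power2_eq_square sum_product)
  also have "\<dots> = (\<Sum>l<n. \<Sum>l'<n. \<Sum>i<M. spins (\<tau> l) i * spins (\<tau> l') i)"
    by (subst sum.swap) (intro sum.cong refl sum.swap)
  also have "\<dots> = real M * (\<Sum>l<n. \<Sum>l'<n. ovl (\<tau> l) (\<tau> l'))"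
    using M by (simp add: ovl_def overlap_def flip: sum_divide_distrib)
  finally have "0 \<le> (\<Sum>l<n. \<Sum>l'<n. ovl (\<tau> l) (\<tau> l'))" using M by (simp add: zero_le_mult_iff)
  also have "\<dots> \<le> (\<Sum>l<n. \<Sum>l'<n. (if l' = l then 1 + e else 0) - e)"
    using sep \<tau> by (intro sum_mono) (auto simp: separated_def ovl_self PiE_iff)
  also have "\<dots> = real n * (1 - e * (real n - 1))"
    by (simp add: sum_subtractf sum.delta algebra_simps)
  also have "\<dots> < 0" using n e by (simp add: mult_less_0_iff)
  finally show False by simp
qed

lemma sum_ramp_separated:
  assumes \<tau>: "\<tau> \<in> {..<n} \<rightarrow>\<^sub>E \<Omega>" and sep: "separated n e \<tau>" and l: "l < n" and d: "0 < d" "d < e"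
  shows "(\<Sum>l'<n. ramp e d (ovl (\<tau> l) (\<tau> l'))) = 1"
proof -
  have "ramp e d (ovl (\<tau> l) (\<tau> l')) = (if l' = l then 1 else 0)" if "l' < n" for l'
    using sep \<tau> l d that by (auto simp: separated_def ovl_self PiE_iff ramp_eq_0 ramp_eq_1)
  then have "(\<Sum>l'<n. ramp e d (ovl (\<tau> l) (\<tau> l'))) = (\<Sum>l'<n. if l' = l then 1 else 0)"
    by (intro sum.cong) auto
  then show ?thesis using l by (simp add: sum.delta)
qed

lemma mean_overlap_avg_ramp_le:
  assumes "0 < d" "e \<le> e'"
  shows "mean_overlap_avg (ramp e d) x \<le> 1 - negative_overlap_prob e' x"
proof -
  have ramp_le: "ramp e d y \<le> 1 - of_bool (y \<le> - e')" for y
    using ramp_eq_0[OF assms(1), of y e] ramp_le_1[of e d y] assms(2) by auto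
  have "mean_overlap_avg (ramp e d) x \<le> mean_overlap_avg (\<lambda>y. 1 - of_bool (y \<le> - e')) x"
    unfolding mean_overlap_avg_def by (intro integral_mono integrable_overlap_avg gibbs_avg_mono ramp_le)
  also have "\<dots> = 1 - negative_overlap_prob e' x"
    unfolding negative_overlap_prob_def mean_overlap_avg_def
      gibbs_avg_diff gibbs_avg_const[OF finite_\<Omega> \<Omega>_nonempty]
    using integrable_overlap_avg[of x "\<lambda>y. of_bool (y \<le> - e')"] by simp
  finally show ?thesis .
qed

lemma separated_upd_ge:
  assumes d: "0 < d"
  shows "of_bool (separated n e \<tau>) - (\<Sum>l<n. of_bool (separated n e \<tau>) * ramp e d (ovl (\<tau> l) \<omega>))
    \<le> of_bool (separated (Suc n) (e - d) (\<tau>(n := \<omega>)))"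
proof (cases "separated n e \<tau>")
  case True
  show ?thesis
  proof (cases "\<exists>l<n. - (e - d) \<le> ovl (\<tau> l) \<omega>")
    case True
    then obtain l where l: "l < n" "- (e - d) \<le> ovl (\<tau> l) \<omega>" by blast
    have "1 = ramp e d (ovl (\<tau> l) \<omega>)" by (rule ramp_eq_1[OF d l(2), symmetric])
    also have "\<dots> \<le> (\<Sum>l<n. ramp e d (ovl (\<tau> l) \<omega>))"
      using l(1) by (intro member_le_sum) (auto simp: ramp_nonneg)
    finally show ?thesis using \<open>separated n e \<tau>\<close> by simp
  next
    case False
    have "ovl (\<tau> l) (\<tau> l') \<le> - (e - d)" if "l < n" "l' < n" "l \<noteq> l'" for l l'
    proof -
      have "ovl (\<tau> l) (\<tau> l') \<le> - e" using \<open>separated n e \<tau>\<close> that by (auto simp: separated_def)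
      then show ?thesis using d by simp
    qed
    moreover have "ovl (\<tau> l) \<omega> \<le> - (e - d)" "ovl \<omega> (\<tau> l) \<le> - (e - d)" if "l < n" for l
      using False that ovl_commute[of \<omega> "\<tau> l"] by (auto simp: not_le intro: less_imp_le)
    ultimately have "separated (Suc n) (e - d) (\<tau>(n := \<omega>))"
      by (auto simp: separated_def less_Suc_eq)
    then show ?thesis using True by (simp add: sum_nonneg ramp_nonneg)
  qed
qed simp

lemma expected_separated_ramp_le:
  assumes l: "l < n" and x: "\<And>s. s \<in> {1..S} \<Longrightarrow> x s \<ge> 1"
    and k: "\<And>s. \<bar>k s\<bar> \<le> K" and d: "0 < d" "d < e" and e': "e \<le> e'"
    and \<delta>: "\<And>y. \<bar>y\<bar> \<le> 1 \<Longrightarrow> \<bar>ramp e d y - (\<Sum>s\<le>S. k s * y ^ s)\<bar> \<le> \<delta>"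
  shows "real n * (\<integral>g. multi_avg x g n (\<lambda>\<tau>. of_bool (separated n e \<tau>) * avg x g (\<lambda>\<omega>. ramp e d (ovl (\<tau> l) \<omega>))) \<partial>iid_gauss)
    \<le> separation_prob x n e * (1 - negative_overlap_prob e' x) + (K * gg_error x + 4 * real n * \<delta>)"
    (is "real n * (\<integral>g. ?T g \<partial>iid_gauss) \<le> ?E * (1 - _) + ?err")
proof -
  let ?f = "\<lambda>\<tau>. of_bool (separated n e \<tau>) :: real"
  have "?f \<tau> * overlap_excess x g n l (ramp e d) \<tau> = ?f \<tau> - real n * (?f \<tau> * avg x g (\<lambda>\<omega>. ramp e d (ovl (\<tau> l) \<omega>)))"
    if "\<tau> \<in> {..<n} \<rightarrow>\<^sub>E \<Omega>" for g \<tau>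
    using sum_ramp_separated[OF that, of e l d] l d by (cases "separated n e \<tau>") (simp_all add: overlap_excess_def)
  then have "multi_avg x g n (\<lambda>\<tau>. ?f \<tau> * overlap_excess x g n l (ramp e d) \<tau>) =
      multi_avg x g n (\<lambda>\<tau>. ?f \<tau> - real n * (?f \<tau> * avg x g (\<lambda>\<omega>. ramp e d (ovl (\<tau> l) \<omega>))))" for g
    by (rule gibbs_avg_cong)
  then have "multi_avg x g n (\<lambda>\<tau>. ?f \<tau> * overlap_excess x g n l (ramp e d) \<tau>) = multi_avg x g n ?f - real n * ?T g" for g
    by (simp only: gibbs_avg_diff gibbs_avg_cmult)
  then have "(\<integral>g. multi_avg x g n (\<lambda>\<tau>. ?f \<tau> * overlap_excess x g n l (ramp e d) \<tau>) \<partial>iid_gauss) =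
      ?E - real n * (\<integral>g. ?T g \<partial>iid_gauss)"
    unfolding separation_prob_def
    using integrable_separation integrable_separation_ramp by simp
  moreover have "ramp e d 1 = 1" using d by (intro ramp_eq_1) auto
  ultimately have "gg_defect x n ?f l (ramp e d) =
      ?E - real n * (\<integral>g. ?T g \<partial>iid_gauss) - ?E * (1 - mean_overlap_avg (ramp e d) x)"
    by (simp add: gg_defect_def separation_prob_def)
  moreover have "\<bar>gg_defect x n ?f l (ramp e d)\<bar> \<le> ?err"
    by (rule abs_gg_defect_approx_le[OF l _ x k \<delta>]) auto
  moreover have "?E * mean_overlap_avg (ramp e d) x \<le> ?E * (1 - negative_overlap_prob e' x)"
    by (intro mult_left_mono mean_overlap_avg_ramp_le separation_prob_nonneg d e')
  ultimately show ?thesis unfolding right_diff_distrib mult_1_right by linarith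
qed

lemma separation_prob_Suc:
  assumes n: "n \<ge> 1" and x: "\<And>s. s \<in> {1..S} \<Longrightarrow> x s \<ge> 1"
    and k: "\<And>s. \<bar>k s\<bar> \<le> K" and d: "0 < d" "d < e" and e': "e \<le> e'"
    and \<delta>: "\<And>y. \<bar>y\<bar> \<le> 1 \<Longrightarrow> \<bar>ramp e d y - (\<Sum>s\<le>S. k s * y ^ s)\<bar> \<le> \<delta>"
  shows "separation_prob x n e * negative_overlap_prob e' x - (K * gg_error x + 4 * real n * \<delta>)
    \<le> separation_prob x (Suc n) (e - d)"
proof -
  let ?f = "\<lambda>\<tau>. of_bool (separated n e \<tau>) :: real"
  let ?T = "\<lambda>l g. multi_avg x g n (\<lambda>\<tau>. ?f \<tau> * avg x g (\<lambda>\<omega>. ramp e d (ovl (\<tau> l) \<omega>)))"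
  let ?b = "separation_prob x n e * (1 - negative_overlap_prob e' x) + (K * gg_error x + 4 * real n * \<delta>)"
  have "real n * (\<Sum>l<n. \<integral>g. ?T l g \<partial>iid_gauss) \<le> (\<Sum>l<n. ?b)"
    unfolding sum_distrib_left
    by (intro sum_mono expected_separated_ramp_le[OF _ x k d e' \<delta>]) auto
  then have "(\<Sum>l<n. \<integral>g. ?T l g \<partial>iid_gauss) \<le> ?b" using n by simp
  moreover have "separation_prob x n e - (\<Sum>l<n. \<integral>g. ?T l g \<partial>iid_gauss) =
      (\<integral>g. multi_avg x g n ?f - (\<Sum>l<n. ?T l g) \<partial>iid_gauss)"
    unfolding separation_prob_def
    using integrable_separation integrable_separation_ramp by (simp add: Bochner_Integration.integral_sum)
  moreover have "\<dots> \<le> separation_prob x (Suc n) (e - d)"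
    unfolding separation_prob_def
  proof (rule integral_mono)
    fix g
    have "multi_avg x g n ?f - (\<Sum>l<n. ?T l g) =
        multi_avg x g n (\<lambda>\<tau>. avg x g (\<lambda>\<omega>. ?f \<tau> - (\<Sum>l<n. ?f \<tau> * ramp e d (ovl (\<tau> l) \<omega>))))"
      by (simp only: gibbs_avg_diff gibbs_avg_const[OF finite_\<Omega> \<Omega>_nonempty] gibbs_avg_sum gibbs_avg_cmult)
    also have "\<dots> \<le> multi_avg x g n (\<lambda>\<tau>. avg x g (\<lambda>\<omega>. of_bool (separated (Suc n) (e - d) (\<tau>(n := \<omega>)))))"
      by (intro gibbs_avg_mono separated_upd_ge d)
    also have "\<dots> = multi_avg x g (Suc n) (\<lambda>\<tau>. of_bool (separated (Suc n) (e - d) \<tau>))"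
      by (rule replica_avg_Suc[OF finite_\<Omega> \<Omega>_nonempty, symmetric])
    finally show "multi_avg x g n ?f - (\<Sum>l<n. ?T l g) \<le> multi_avg x g (Suc n) (\<lambda>\<tau>. of_bool (separated (Suc n) (e - d) \<tau>))" .
  qed (intro Bochner_Integration.integrable_diff Bochner_Integration.integrable_sum
      integrable_separation integrable_separation_ramp)+
  ultimately show ?thesis unfolding right_diff_distrib by simp
qed

lemma negative_overlap_prob_power_le:
  assumes m: "m \<ge> 1" and e: "e > 0" "e / 2 * (real m - 1) > 1"
    and x: "\<And>s. s \<in> {1..S} \<Longrightarrow> x s \<ge> 1" and \<delta>: "\<delta> \<ge> 0"
    and approx: "\<And>n. n < m \<Longrightarrow> \<exists>k. (\<forall>s. \<bar>k s\<bar> \<le> K) \<and>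
      (\<forall>y. \<bar>y\<bar> \<le> 1 \<longrightarrow> \<bar>ramp (e * (1 - real n / (2 * real m))) (e / (2 * real m)) y - (\<Sum>s\<le>S. k s * y ^ s)\<bar> \<le> \<delta>)"
  shows "negative_overlap_prob e x ^ (m - 1) \<le> real m * (K * gg_error x + 4 * real m * \<delta>)"
proof -
  let ?q = "negative_overlap_prob e x" and ?err = "K * gg_error x + 4 * real m * \<delta>"
  let ?e = "\<lambda>n. e * (1 - real n / (2 * real m))" and ?d = "e / (2 * real m)"
  let ?E = "\<lambda>n. separation_prob x n (?e n)"
  have "K \<ge> 0" using approx[of 0] m by (auto intro: order_trans[OF abs_ge_zero])
  then have err: "0 \<le> ?err" using gg_error_nonneg \<delta> by simp
  have step: "?E n * ?q - ?err \<le> ?E (Suc n)" if n: "1 \<le> n" "n < m" for n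
  proof -
    obtain k where k: "\<And>s. \<bar>k s\<bar> \<le> K" "\<And>y. \<bar>y\<bar> \<le> 1 \<Longrightarrow> \<bar>ramp (?e n) ?d y - (\<Sum>s\<le>S. k s * y ^ s)\<bar> \<le> \<delta>"
      using approx[OF n(2)] by blast
    have shift: "?e n - ?d = ?e (Suc n)" by (simp add: algebra_simps add_divide_distrib)
    have "real (Suc n) / (2 * real m) < 1" using n by simp
    then have "0 < ?e (Suc n)" using e by simp
    then have d: "0 < ?d" "?d < ?e n" using e m shift by auto
    have le: "?e n \<le> e" using e by (simp add: mult_le_cancel_left1)
    have "?E n * ?q - (K * gg_error x + 4 * real n * \<delta>) \<le> ?E (Suc n)"
      unfolding shift[symmetric] by (rule separation_prob_Suc[OF n(1) x k(1) d le k(2)])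
    moreover have "4 * real n * \<delta> \<le> 4 * real m * \<delta>" using n \<delta> by (intro mult_right_mono) auto
    ultimately show ?thesis by linarith
  qed
  have "separated 1 e \<tau>" for e \<tau> by (simp add: separated_def)
  then have "?E 1 = 1"
    by (simp add: separation_prob_def gibbs_avg_const finite_replicas replicas_nonempty finite_\<Omega> \<Omega>_nonempty)
  then have "?q ^ (m - 1) - real m * ?err \<le> ?E m"
    using step m
    by (intro power_lower_bound_of_recurrence[where m = m] negative_overlap_prob_nonneg negative_overlap_prob_le_1 err) auto
  also have "?E m = 0"
  proof -
    have "?e m = e / 2" using m by simp
    then have "multi_avg x g m (\<lambda>\<tau>. of_bool (separated m (?e m) \<tau>)) = multi_avg x g m (\<lambda>_. 0)" for g
      using not_separated[OF _ _ m] e by (intro gibbs_avg_cong) auto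
    then show ?thesis
      by (simp add: separation_prob_def gibbs_avg_const finite_replicas replicas_nonempty finite_\<Omega> \<Omega>_nonempty)
  qed
  finally show ?thesis by simp
qed

end

lemma negative_overlap_prob_le:
  assumes \<epsilon>: "\<epsilon> > 0" and \<rho>: "\<rho> > 0"
  shows "\<exists>S K. K \<ge> 0 \<and> (\<forall>(\<Omega> :: 'o set) c spins M \<eta> x. perturbed \<Omega> spins M \<eta> \<longrightarrow> (\<forall>s\<in>{1..S}. x s \<ge> 1) \<longrightarrow>
    perturbed.negative_overlap_prob \<Omega> c spins M S \<eta> \<epsilon> x \<le> \<rho> + K * perturbed.gg_error \<Omega> c spins M S \<eta> x)"
proof -
  obtain r :: nat where r: "2 / \<epsilon> < real r" using reals_Archimedean2 by blast
  define m where "m = r + 1"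
  have m: "m \<ge> 1" "\<epsilon> / 2 * (real m - 1) > 1" using r \<epsilon> by (simp_all add: m_def field_simps)
  define B where "B = real m / (\<rho> / 2) ^ (m - 1)"
  have B: "B > 0" using \<rho> m by (simp add: B_def)
  define \<delta> where "\<delta> = \<rho> / 2 / (B * (4 * real m))"
  have \<delta>: "\<delta> > 0" "B * (4 * real m * \<delta>) = \<rho> / 2" using \<rho> B m by (simp_all add: \<delta>_def)
  have "continuous_on {-1..1} (ramp (\<epsilon> * (1 - real n / (2 * real m))) (\<epsilon> / (2 * real m)))" for n
    using \<epsilon> m by (intro continuous_on_ramp) simp
  from simultaneous_polynomial_approximation[where m = m and h = "\<lambda>n. ramp (\<epsilon> * (1 - real n / (2 * real m))) (\<epsilon> / (2 * real m))",
      OF this \<delta>(1)]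
  obtain S K where K: "K \<ge> 0" and approx: "\<forall>n<m. \<exists>k. (\<forall>s. \<bar>k s\<bar> \<le> K) \<and>
      (\<forall>y. \<bar>y\<bar> \<le> 1 \<longrightarrow> \<bar>ramp (\<epsilon> * (1 - real n / (2 * real m))) (\<epsilon> / (2 * real m)) y - (\<Sum>s\<le>S. k s * y ^ s)\<bar> \<le> \<delta>)"
    by (elim exE conjE that)
  have "perturbed.negative_overlap_prob \<Omega> c spins M S \<eta> \<epsilon> x \<le> \<rho> + B * K * perturbed.gg_error \<Omega> c spins M S \<eta> x"
    if pert: "perturbed \<Omega> spins M \<eta>" and x: "\<forall>s\<in>{1..S}. x s \<ge> 1"
    for \<Omega> :: "'o set" and c spins M \<eta> x
  proof -
    interpret perturbed \<Omega> c spins M S \<eta> by (rule pert)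
    let ?q = "negative_overlap_prob \<epsilon> x"
    show ?thesis
    proof (cases "?q \<le> \<rho> / 2")
      case True
      have "0 \<le> B * K * gg_error x" using B K gg_error_nonneg by simp
      then show ?thesis using True \<rho> by linarith
    next
      case False
      have "(\<rho> / 2) ^ (m - 1) \<le> ?q ^ (m - 1)" using False \<rho> by (intro power_mono) auto
      also have "\<dots> \<le> real m * (K * gg_error x + 4 * real m * \<delta>)"
        using x \<delta>(1) by (intro negative_overlap_prob_power_le m \<epsilon> approx[rule_format]) auto
      finally have "1 \<le> B * (K * gg_error x + 4 * real m * \<delta>)" using \<rho> by (simp add: B_def field_simps)
      also have "\<dots> = B * K * gg_error x + \<rho> / 2" unfolding distrib_left \<delta>(2) by simp
      finally show ?thesis using negative_overlap_prob_le_1[of \<epsilon> x] \<rho> by linarith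
    qed
  qed
  moreover have "B * K \<ge> 0" using B K by simp
  ultimately show ?thesis by blast
qed

subsection \<open>Averaging over the perturbation strengths\<close>

definition strength_grid :: "nat \<Rightarrow> nat \<Rightarrow> (nat \<Rightarrow> nat) set" where
  "strength_grid S m = {1..S} \<rightarrow>\<^sub>E {m<..2 * m}"

lemma strength_gridD:
  assumes "x \<in> strength_grid S m" "s \<in> {1..S}"
  shows "m < x s" and "x s \<le> 2 * m"
  using PiE_mem[OF assms[unfolded strength_grid_def]] by auto

definition grid_error :: "nat \<Rightarrow> nat \<Rightarrow> real \<Rightarrow> nat \<Rightarrow> real" where
  "grid_error S M \<eta> m = (ln 2 + 24 * sqrt (real S * ((real (2 * m + 1))\<^sup>2 * \<eta>\<^sup>2 * real M))) / (\<eta>\<^sup>2 * real M) + 10"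

context perturbed
begin

lemma sum_spin_energy_deviation_le:
  assumes s: "s \<in> {1..S}" and m: "m \<ge> 1" and x: "\<And>s. s \<in> {1..S} \<Longrightarrow> x s \<le> 2 * m"
  shows "(\<Sum>y\<in>{m<..2 * m}. spin_energy_deviation s (x(s := y))) \<le>
    real m * (ln 2 + 24 * sqrt (real S * ((real (2 * m + 1))\<^sup>2 * \<eta>\<^sup>2 * real M)) + 10 * (\<eta>\<^sup>2 * real M))"
proof -
  let ?e = "\<lambda>y. mean_spin_energy s (x(s := y))"
  let ?k = "ln 2 + 24 * sqrt (real S * ((real (2 * m + 1))\<^sup>2 * \<eta>\<^sup>2 * real M))"
  have "(\<Sum>y\<in>{m<..2 * m}. spin_energy_deviation s (x(s := y))) \<le> (\<Sum>y\<in>{m<..2 * m}. ?k + (?e (y + 1) - ?e (y - 1)))"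
  proof (rule sum_mono)
    fix y assume y: "y \<in> {m<..2 * m}"
    have "(x(s := y)) s' + 1 \<le> 2 * m + 1" if "s' \<in> {1..S}" for s'
      using x[OF that] y by auto
    then show "spin_energy_deviation s (x(s := y)) \<le> ?k + (?e (y + 1) - ?e (y - 1))"
      using spin_energy_deviation_le[OF s, of "x(s := y)" "2 * m + 1"] y by simp
  qed
  also have "\<dots> = real m * ?k + (?e (2 * m + 1) + ?e (2 * m) - ?e (m + 1) - ?e m)"
    by (simp only: sum.distrib sum_central_differences[OF m, of ?e]) (simp add: distrib_left)
  also have "\<dots> \<le> real m * ?k + real m * (10 * (\<eta>\<^sup>2 * real M))"
  proof -
    have upper: "?e y \<le> 2 * real y * (\<eta>\<^sup>2 * real M)" for y
      using mean_spin_energy_bounds(2)[OF s, of "x(s := y)"] by (simp add: mult_ac)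
    have "2 * real (2 * m + 1) * (\<eta>\<^sup>2 * real M) + 2 * real (2 * m) * (\<eta>\<^sup>2 * real M) = (8 * real m + 2) * (\<eta>\<^sup>2 * real M)"
      by (simp add: algebra_simps)
    also have "\<dots> \<le> (10 * real m) * (\<eta>\<^sup>2 * real M)" using m by (intro mult_right_mono) auto
    also have "\<dots> = real m * (10 * (\<eta>\<^sup>2 * real M))" by simp
    finally show ?thesis
      using upper[of "2 * m + 1"] upper[of "2 * m"] mean_spin_energy_bounds(1)[OF s, of "x(s := m + 1)"]
        mean_spin_energy_bounds(1)[OF s, of "x(s := m)"] by linarith
  qed
  finally show ?thesis by (simp add: algebra_simps)
qed

lemma sum_spin_energy_deviation_divide_le:
  assumes s: "s \<in> {1..S}" and m: "m \<ge> 1" and x: "\<And>s. s \<in> {1..S} \<Longrightarrow> x s \<le> 2 * m"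
  shows "(\<Sum>y\<in>{m<..2 * m}. spin_energy_deviation s (x(s := y)) / (\<eta>\<^sup>2 * real y * real M)) \<le> grid_error S M \<eta> m"
proof -
  have pos: "0 < \<eta>\<^sup>2 * real M * real m" using \<eta> M m by simp
  have "(\<Sum>y\<in>{m<..2 * m}. spin_energy_deviation s (x(s := y)) / (\<eta>\<^sup>2 * real y * real M)) \<le>
      (\<Sum>y\<in>{m<..2 * m}. spin_energy_deviation s (x(s := y)) / (\<eta>\<^sup>2 * real M * real m))"
  proof (intro sum_mono divide_left_mono spin_energy_deviation_nonneg)
    fix y assume y: "y \<in> {m<..2 * m}"
    show "\<eta>\<^sup>2 * real M * real m \<le> \<eta>\<^sup>2 * real y * real M"
      using y mult_left_mono[of "real m" "real y" "\<eta>\<^sup>2 * real M"] by (simp add: mult_ac)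
    show "0 < \<eta>\<^sup>2 * real y * real M * (\<eta>\<^sup>2 * real M * real m)" using \<eta> M m y by simp
  qed
  also have "\<dots> \<le> real m * (ln 2 + 24 * sqrt (real S * ((real (2 * m + 1))\<^sup>2 * \<eta>\<^sup>2 * real M)) + 10 * (\<eta>\<^sup>2 * real M)) /
      (\<eta>\<^sup>2 * real M * real m)"
    unfolding sum_divide_distrib[symmetric] using pos
    by (intro divide_right_mono sum_spin_energy_deviation_le s m x) auto
  also have "\<dots> = grid_error S M \<eta> m"
  proof -
    have "j * (k + 10 * q) / (q * j) = k / q + 10" if "q > 0" "j > 0" for j k q :: real
      using that by (simp add: field_simps)
    then show ?thesis unfolding grid_error_def using \<eta> M m by simp
  qed
  finally show ?thesis .
qed

lemma sum_gg_error_le: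
  assumes m: "m \<ge> 1"
  shows "real m * (\<Sum>x\<in>strength_grid S m. gg_error x) \<le> real (card (strength_grid S m)) * (real S * grid_error S M \<eta> m)"
proof -
  let ?X = "strength_grid S m" and ?f = "\<lambda>s x. spin_energy_deviation s x / (\<eta>\<^sup>2 * real (x s) * real M)"
  have each_spin_order: "real m * (\<Sum>x\<in>?X. ?f s x) \<le> real (card ?X) * grid_error S M \<eta> m" if s: "s \<in> {1..S}" for s
  proof -
    have "real m * (\<Sum>x\<in>?X. ?f s x) = (\<Sum>x\<in>?X. \<Sum>y\<in>{m<..2 * m}. ?f s (x(s := y)))"
      unfolding strength_grid_def using sum_PiE_resample[OF s, of "?f s" "{m<..2 * m}"] by simp
    also have "\<dots> \<le> (\<Sum>x\<in>?X. grid_error S M \<eta> m)"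
    proof (rule sum_mono)
      fix x assume "x \<in> ?X"
      from sum_spin_energy_deviation_divide_le[OF s m strength_gridD(2)[OF this]]
      show "(\<Sum>y\<in>{m<..2 * m}. ?f s (x(s := y))) \<le> grid_error S M \<eta> m" by simp
    qed
    finally show ?thesis by simp
  qed
  have "real m * (\<Sum>x\<in>?X. gg_error x) = (\<Sum>s=1..S. real m * (\<Sum>x\<in>?X. ?f s x))"
    unfolding gg_error_def by (subst sum.swap) (simp add: sum_distrib_left)
  also have "\<dots> \<le> (\<Sum>s=1..S. real (card ?X) * grid_error S M \<eta> m)" by (intro sum_mono each_spin_order)
  finally show ?thesis by (simp add: mult_ac)
qed

end

lemma eventually_grid_error_le:
  assumes "\<eta> > 0"
  shows "\<forall>\<^sub>F M in sequentially. grid_error S M \<eta> m \<le> 11"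
proof -
  define A where "A = sqrt (real S * ((real (2 * m + 1))\<^sup>2 * \<eta>\<^sup>2))"
  have "(\<lambda>M. (ln 2 + 24 * (A * sqrt (real M))) / (\<eta>\<^sup>2 * real M)) \<longlonglongrightarrow> 0"
    using assms by real_asymp
  then have "\<forall>\<^sub>F M in sequentially. (ln 2 + 24 * (A * sqrt (real M))) / (\<eta>\<^sup>2 * real M) < 1"
    by (rule order_tendstoD) simp
  then show ?thesis
  proof (rule eventually_mono)
    fix M assume "(ln 2 + 24 * (A * sqrt (real M))) / (\<eta>\<^sup>2 * real M) < 1"
    then show "grid_error S M \<eta> m \<le> 11"
      by (simp add: grid_error_def A_def mult.assoc flip: real_sqrt_mult)
  qed
qed

theorem talagrand_positivity:
  assumes \<epsilon>: "\<epsilon> > 0" and \<rho>: "\<rho> > 0"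
  shows "\<exists>S m. m \<ge> 1 \<and> (\<forall>\<eta>>0. \<forall>\<^sub>F M in sequentially. \<forall>(\<Omega> :: 'o set) c spins. perturbed \<Omega> spins M \<eta> \<longrightarrow>
    (\<Sum>x\<in>strength_grid S m. perturbed.negative_overlap_prob \<Omega> c spins M S \<eta> \<epsilon> x) \<le> \<rho> * real (card (strength_grid S m)))"
proof -
  obtain S K where K: "K \<ge> 0" and q_le: "\<And>(\<Omega> :: 'o set) c spins M \<eta> x. perturbed \<Omega> spins M \<eta> \<Longrightarrow> \<forall>s\<in>{1..S}. x s \<ge> 1 \<Longrightarrow>
      perturbed.negative_overlap_prob \<Omega> c spins M S \<eta> \<epsilon> x \<le> \<rho> / 2 + K * perturbed.gg_error \<Omega> c spins M S \<eta> x"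
    using negative_overlap_prob_le[OF \<epsilon> half_gt_zero[OF \<rho>]] by blast
  obtain r :: nat where r: "22 * K * real S / \<rho> < real r" using reals_Archimedean2 by blast
  define m where "m = r + 1"
  have m: "m \<ge> 1" "K * (real S * 11) / real m \<le> \<rho> / 2" using r \<rho> by (simp_all add: m_def field_simps)
  let ?X = "strength_grid S m"
  have "\<forall>\<^sub>F M in sequentially. \<forall>(\<Omega> :: 'o set) c spins. perturbed \<Omega> spins M \<eta> \<longrightarrow>
      (\<Sum>x\<in>?X. perturbed.negative_overlap_prob \<Omega> c spins M S \<eta> \<epsilon> x) \<le> \<rho> * real (card ?X)" if "\<eta> > 0" for \<eta>
    using eventually_grid_error_le[OF that, of S m]
  proof eventually_elim
    case (elim M)
    show ?case
    proof (intro allI impI)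
      fix \<Omega> :: "'o set" and c spins assume pert: "perturbed \<Omega> spins M \<eta>"
      interpret perturbed \<Omega> c spins M S \<eta> by (rule pert)
      have "(\<Sum>x\<in>?X. gg_error x) \<le> real (card ?X) * (real S * grid_error S M \<eta> m) / real m"
        using sum_gg_error_le[OF m(1)] m(1) by (simp add: pos_le_divide_eq mult.commute)
      also have "\<dots> \<le> real (card ?X) * (real S * 11) / real m"
        by (intro divide_right_mono mult_left_mono elim) auto
      finally have error: "(\<Sum>x\<in>?X. gg_error x) \<le> real (card ?X) * (real S * 11) / real m" .
      have "(\<Sum>x\<in>?X. negative_overlap_prob \<epsilon> x) \<le> (\<Sum>x\<in>?X. \<rho> / 2 + K * gg_error x)"
        by (intro sum_mono q_le pert ballI) (auto dest: strength_gridD)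
      also have "\<dots> = \<rho> / 2 * real (card ?X) + K * (\<Sum>x\<in>?X. gg_error x)"
        by (simp add: sum.distrib sum_distrib_left)
      also have "\<dots> \<le> \<rho> / 2 * real (card ?X) + K * (real (card ?X) * (real S * 11) / real m)"
        by (intro add_left_mono mult_left_mono error K)
      also have "\<dots> = (\<rho> / 2 + K * (real S * 11) / real m) * real (card ?X)"
        by (simp add: algebra_simps)
      also have "\<dots> \<le> \<rho> * real (card ?X)"
        using m(2) by (intro mult_right_mono) auto
      finally show "(\<Sum>x\<in>?X. negative_overlap_prob \<epsilon> x) \<le> \<rho> * real (card ?X)" .
    qed
  qed
  then show ?thesis using m(1) by blast
qed

section \<open>Existence of the limiting free energy\<close>

subsection \<open>Interpolation between one system and independent blocks\<close>

datatype coupling = Global "nat list" | Block nat "nat list" | Perturbation nat "nat list"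

definition mean_free_energy :: "nat \<Rightarrow> real \<Rightarrow> nat \<Rightarrow> real" where
  "mean_free_energy p k N = (\<integral>g. log_sum_exp (Sigma N) (\<lambda>\<sigma>. k * H p N g \<sigma>) \<partial>iid_gauss)"

lemma integrable_log_sum_exp_H:
  assumes "N \<ge> 1" "p \<ge> 1"
  shows "integrable iid_gauss (\<lambda>g. log_sum_exp (Sigma N) (\<lambda>\<sigma>. k * H p N g \<sigma>))"
  using subgaussian_imp_integrable[OF subgaussian_log_sum_exp_H[OF assms order_refl, of k "\<lambda>_. 0"]] by simp

text \<open>\<open>N = m * M + r\<close> spins: \<open>m\<close> blocks of \<open>M\<close> spins and \<open>r\<close> spins frozen to \<open>1\<close>.\<close>
locale blocks =
  fixes p M m r S :: nat and \<eta> :: real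
  assumes p: "p \<ge> 1" and M: "M \<ge> 1" and m: "m \<ge> 1" and \<eta>: "\<eta> > 0"
begin

definition N :: nat where
  "N = m * M + r"

definition \<Omega> :: "(nat \<Rightarrow> nat \<Rightarrow> real) set" where
  "\<Omega> = {..<m} \<rightarrow>\<^sub>E Sigma M"

definition glue :: "(nat \<Rightarrow> nat \<Rightarrow> real) \<Rightarrow> nat \<Rightarrow> real" where
  "glue \<omega> = (\<lambda>i\<in>{..<N}. if i < m * M then \<omega> (i div M) (i mod M) else 1)"

definition glued_overlap :: "(nat \<Rightarrow> nat \<Rightarrow> real) \<Rightarrow> (nat \<Rightarrow> nat \<Rightarrow> real) \<Rightarrow> real" where
  "glued_overlap \<omega> \<omega>' = overlap N (glue \<omega>) (glue \<omega>')"

definition block_overlap :: "nat \<Rightarrow> (nat \<Rightarrow> nat \<Rightarrow> real) \<Rightarrow> (nat \<Rightarrow> nat \<Rightarrow> real) \<Rightarrow> real" where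
  "block_overlap j \<omega> \<omega>' = overlap M (\<omega> j) (\<omega>' j)"

definition couplings :: "coupling set" where
  "couplings = Global ` idx p N \<union> case_prod Block ` ({..<m} \<times> idx p M) \<union>
     case_prod Perturbation ` (SIGMA j:{..<m}. \<Union>s\<in>{1..S}. idx s M)"

primrec interp_coeff ::
    "real \<Rightarrow> real \<Rightarrow> (nat \<Rightarrow> nat \<Rightarrow> real) \<Rightarrow> coupling \<Rightarrow> (nat \<Rightarrow> nat \<Rightarrow> real) \<Rightarrow> real" where
  "interp_coeff A B x (Global xs) \<omega> = A * coupling_coeff p N xs (glue \<omega>)"
| "interp_coeff A B x (Block j xs) \<omega> = B * coupling_coeff p M xs (\<omega> j)"
| "interp_coeff A B x (Perturbation j xs) \<omega> = \<eta> * x j (length xs) * coupling_coeff (length xs) M xs (\<omega> j)"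

definition interp_energy ::
    "real \<Rightarrow> real \<Rightarrow> (nat \<Rightarrow> nat \<Rightarrow> real) \<Rightarrow> (coupling \<Rightarrow> real) \<Rightarrow> (nat \<Rightarrow> nat \<Rightarrow> real) \<Rightarrow> real" where
  "interp_energy A B x = affine_energy couplings (interp_coeff A B x) (\<lambda>_. 0)"

definition interp_free_energy :: "real \<Rightarrow> real \<Rightarrow> (nat \<Rightarrow> nat \<Rightarrow> real) \<Rightarrow> real" where
  "interp_free_energy A B x = (\<integral>g. log_sum_exp \<Omega> (interp_energy A B x g) \<partial>iid_gauss)"

definition mean_pair_avg ::
    "real \<Rightarrow> real \<Rightarrow> (nat \<Rightarrow> nat \<Rightarrow> real) \<Rightarrow> ((nat \<Rightarrow> nat \<Rightarrow> real) \<Rightarrow> (nat \<Rightarrow> nat \<Rightarrow> real) \<Rightarrow> real) \<Rightarrow> real" where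
  "mean_pair_avg A B x f = (\<integral>g. pair_avg \<Omega> (interp_energy A B x g) f \<partial>iid_gauss)"

lemma N_ge_1: "N \<ge> 1"
  using M m by (simp add: N_def Suc_le_eq)

lemma blocks_le_N: "m * M \<le> N"
  by (simp add: N_def)

lemma real_blocks_le_N: "real m * real M \<le> real N"
  using blocks_le_N by (metis of_nat_le_iff of_nat_mult)

lemma finite_\<Omega> [simp]: "finite \<Omega>"
  unfolding \<Omega>_def by (intro finite_PiE) auto

lemma \<Omega>_nonempty [simp]: "\<Omega> \<noteq> {}"
  unfolding \<Omega>_def by (simp add: PiE_eq_empty_iff)

lemma block_in_Sigma: "\<omega> \<in> \<Omega> \<Longrightarrow> j < m \<Longrightarrow> \<omega> j \<in> Sigma M"
  unfolding \<Omega>_def by (auto simp: PiE_iff)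

lemma glue_in_Sigma:
  assumes "\<omega> \<in> \<Omega>"
  shows "glue \<omega> \<in> Sigma N"
  unfolding Sigma_def
proof (rule PiE_I)
  fix i assume i: "i \<in> {..<N}"
  show "glue \<omega> i \<in> {-1, 1}"
  proof (cases "i < m * M")
    case True
    then have "i div M < m" "i mod M < M" using M by (auto simp: less_mult_imp_div_less)
    then have "\<omega> (i div M) (i mod M) \<in> {-1, 1}"
      using block_in_Sigma[OF assms, of "i div M"] unfolding Sigma_def by (auto simp: PiE_iff)
    then show ?thesis using True i by (simp add: glue_def)
  qed (use i in \<open>simp add: glue_def\<close>)
qed (simp add: glue_def)

lemma glue_block:
  assumes "j < m" "i < M"
  shows "glue \<omega> (j * M + i) = \<omega> j i"
proof -
  have "j * M + i < (j + 1) * M" using assms by simp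
  also have "\<dots> \<le> m * M" using assms by (intro mult_le_mono1) auto
  finally show ?thesis using assms blocks_le_N by (simp add: glue_def)
qed

lemma inj_on_glue: "inj_on glue \<Omega>"
proof (rule inj_onI)
  fix \<omega> \<omega>' assume \<omega>: "\<omega> \<in> \<Omega>" "\<omega>' \<in> \<Omega>" and eq: "glue \<omega> = glue \<omega>'"
  have "\<omega> j = \<omega>' j" if j: "j < m" for j
  proof (rule PiE_ext)
    show "\<omega> j \<in> {..<M} \<rightarrow>\<^sub>E {-1, 1}" "\<omega>' j \<in> {..<M} \<rightarrow>\<^sub>E {-1, 1}"
      using block_in_Sigma[OF _ j] \<omega> by (auto simp: Sigma_def)
    show "\<omega> j i = \<omega>' j i" if "i \<in> {..<M}" for i
      using glue_block[OF j, of i] that eq by (metis lessThan_iff)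
  qed
  then show "\<omega> = \<omega>'" using \<omega> unfolding \<Omega>_def by (intro PiE_ext[of \<omega> "{..<m}" "\<lambda>_. Sigma M" \<omega>']) auto
qed

lemma sum_blocks: "(\<Sum>i<m * M. f (i div M) (i mod M)) = (\<Sum>j<m. \<Sum>i<M. f j i)" for f :: "nat \<Rightarrow> nat \<Rightarrow> real"
proof -
  have "(\<Sum>i\<in>{j * M..<j * M + M}. f (i div M) (i mod M)) = (\<Sum>i<M. f j i)" for j
  proof -
    have "(\<Sum>i\<in>{j * M..<j * M + M}. f (i div M) (i mod M)) = (\<Sum>i\<in>{0..<M}. f ((i + j * M) div M) ((i + j * M) mod M))"
      using sum.shift_bounds_nat_ivl[of "\<lambda>i. f (i div M) (i mod M)" 0 "j * M" M] by (simp add: add.commute)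
    also have "\<dots> = (\<Sum>i<M. f j i)" by (rule sum.cong) auto
    finally show ?thesis .
  qed
  then show ?thesis by (simp flip: sum.nat_group)
qed

lemma glued_overlap_eq_weighted_sum:
  "glued_overlap \<omega> \<omega>' = (\<Sum>j<m. real M / real N * block_overlap j \<omega> \<omega>') + real r / real N"
proof -
  have "(\<Sum>i<N. glue \<omega> i * glue \<omega>' i) = (\<Sum>i<m * M. glue \<omega> i * glue \<omega>' i) + (\<Sum>i\<in>{m * M..<N}. glue \<omega> i * glue \<omega>' i)"
    using blocks_le_N by (simp add: lessThan_atLeast0 sum.atLeastLessThan_concat)
  also have "(\<Sum>i<m * M. glue \<omega> i * glue \<omega>' i) = (\<Sum>i<m * M. \<omega> (i div M) (i mod M) * \<omega>' (i div M) (i mod M))"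
    using blocks_le_N by (intro sum.cong) (auto simp: glue_def)
  also have "(\<Sum>i\<in>{m * M..<N}. glue \<omega> i * glue \<omega>' i) = real r"
    by (simp add: glue_def N_def)
  finally have sum: "(\<Sum>i<N. glue \<omega> i * glue \<omega>' i) = (\<Sum>j<m. \<Sum>i<M. \<omega> j i * \<omega>' j i) + real r"
    by (simp add: sum_blocks[of "\<lambda>j i. \<omega> j i * \<omega>' j i"])
  have "real M / real N * (y / real M) = y / real N" for y using M by simp
  then show ?thesis
    unfolding glued_overlap_def block_overlap_def overlap_def sum
    by (simp only: add_divide_distrib sum_divide_distrib[of "\<lambda>j. \<Sum>i<M. \<omega> j i * \<omega>' j i"])
qed

lemma abs_block_overlap_le_1: "\<omega> \<in> \<Omega> \<Longrightarrow> \<omega>' \<in> \<Omega> \<Longrightarrow> j < m \<Longrightarrow> \<bar>block_overlap j \<omega> \<omega>'\<bar> \<le> 1"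
  unfolding block_overlap_def by (intro abs_overlap_le_1 block_in_Sigma)

lemma block_overlap_self: "\<omega> \<in> \<Omega> \<Longrightarrow> j < m \<Longrightarrow> block_overlap j \<omega> \<omega> = 1"
  unfolding block_overlap_def by (intro overlap_self M block_in_Sigma)

lemma glued_overlap_self: "\<omega> \<in> \<Omega> \<Longrightarrow> glued_overlap \<omega> \<omega> = 1"
  unfolding glued_overlap_def by (intro overlap_self N_ge_1 glue_in_Sigma)

lemma finite_couplings [simp]: "finite couplings"
  by (simp add: couplings_def)

lemma sum_couplings:
  fixes f :: "coupling \<Rightarrow> real"
  shows "(\<Sum>i\<in>couplings. f i) = (\<Sum>xs\<in>idx p N. f (Global xs)) + (\<Sum>j<m. \<Sum>xs\<in>idx p M. f (Block j xs)) +
    (\<Sum>j<m. \<Sum>s=1..S. \<Sum>xs\<in>idx s M. f (Perturbation j xs))"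
proof -
  let ?G = "Global ` idx p N" and ?B = "case_prod Block ` ({..<m} \<times> idx p M)"
  let ?P = "case_prod Perturbation ` (SIGMA j:{..<m}. \<Union>s\<in>{1..S}. idx s M)"
  have "?G \<inter> ?B = {}" "(?G \<union> ?B) \<inter> ?P = {}" by auto
  then have "(\<Sum>i\<in>couplings. f i) = sum f ?G + sum f ?B + sum f ?P"
    unfolding couplings_def by (simp add: sum.union_disjoint)
  also have "sum f ?G = (\<Sum>xs\<in>idx p N. f (Global xs))"
    by (subst sum.reindex) (auto simp: inj_on_def)
  also have "sum f ?B = (\<Sum>j<m. \<Sum>xs\<in>idx p M. f (Block j xs))"
    by (subst sum.reindex) (auto simp: inj_on_def sum.cartesian_product split_beta')
  also have "sum f ?P = (\<Sum>j<m. \<Sum>xs\<in>(\<Union>s\<in>{1..S}. idx s M). f (Perturbation j xs))"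
    by (subst sum.reindex) (auto simp: inj_on_def sum.Sigma split_beta')
  also have "\<dots> = (\<Sum>j<m. \<Sum>s=1..S. \<Sum>xs\<in>idx s M. f (Perturbation j xs))"
    by (intro sum.cong refl sum.UNION_disjoint) (auto dest: length_idx)
  finally show ?thesis .
qed

lemma interp_energy_eq:
  "interp_energy A B x g \<omega> = A * H p N (\<lambda>xs. g (Global xs)) (glue \<omega>) + (\<Sum>j<m. B * H p M (\<lambda>xs. g (Block j xs)) (\<omega> j)) +
     (\<Sum>j<m. \<Sum>s=1..S. \<eta> * x j s * H s M (\<lambda>xs. g (Perturbation j xs)) (\<omega> j))"
proof -
  have "(\<Sum>xs\<in>idx s M. interp_coeff A B x (Perturbation j xs) \<omega> * g (Perturbation j xs)) =
     \<eta> * x j s * H s M (\<lambda>xs. g (Perturbation j xs)) (\<omega> j)" for j s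
    unfolding H_eq_sum_coupling_coeff sum_distrib_left by (intro sum.cong refl) (simp add: length_idx)
  then show ?thesis
    unfolding interp_energy_def affine_energy_def sum_couplings
    by (simp add: H_eq_sum_coupling_coeff[of p] sum_distrib_left mult.assoc del: interp_coeff.simps(3))
qed

definition interp_cov ::
    "real \<Rightarrow> real \<Rightarrow> (nat \<Rightarrow> nat \<Rightarrow> real) \<Rightarrow> (nat \<Rightarrow> nat \<Rightarrow> real) \<Rightarrow> (nat \<Rightarrow> nat \<Rightarrow> real) \<Rightarrow> real" where
  "interp_cov a b y \<omega> \<omega>' = a * (real N * glued_overlap \<omega> \<omega>' ^ p) + b * (\<Sum>j<m. real M * block_overlap j \<omega> \<omega>' ^ p) +
     (\<Sum>j<m. \<Sum>s=1..S. \<eta>\<^sup>2 * y j s * (real M * block_overlap j \<omega> \<omega>' ^ s))"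

definition interp_variance :: "real \<Rightarrow> real \<Rightarrow> (nat \<Rightarrow> nat \<Rightarrow> real) \<Rightarrow> real" where
  "interp_variance a b y = a * real N + b * (real m * real M) + (\<Sum>j<m. \<Sum>s=1..S. \<eta>\<^sup>2 * y j s * real M)"

lemma interp_cov_self: "\<omega> \<in> \<Omega> \<Longrightarrow> interp_cov a b y \<omega> \<omega> = interp_variance a b y"
  by (simp add: interp_cov_def interp_variance_def glued_overlap_self block_overlap_self)

lemma sum_interp_coeff_mult:
  "(\<Sum>i\<in>couplings. interp_coeff A' B' x' i \<omega> * interp_coeff A B x i \<omega>') =
    interp_cov (A' * A) (B' * B) (\<lambda>j s. x' j s * x j s) \<omega> \<omega>'"
proof -
  have global: "(\<Sum>xs\<in>idx p N. interp_coeff A' B' x' (Global xs) \<omega> * interp_coeff A B x (Global xs) \<omega>') =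
      A' * A * (real N * glued_overlap \<omega> \<omega>' ^ p)"
    unfolding glued_overlap_def sum_coupling_coeff_mult[OF N_ge_1 p, symmetric] sum_distrib_left
    by (intro sum.cong refl) simp
  have block: "(\<Sum>xs\<in>idx p M. interp_coeff A' B' x' (Block j xs) \<omega> * interp_coeff A B x (Block j xs) \<omega>') =
      B' * B * (real M * block_overlap j \<omega> \<omega>' ^ p)" for j
    unfolding block_overlap_def sum_coupling_coeff_mult[OF M p, symmetric] sum_distrib_left
    by (intro sum.cong refl) simp
  have perturbation:
    "(\<Sum>xs\<in>idx s M. interp_coeff A' B' x' (Perturbation j xs) \<omega> * interp_coeff A B x (Perturbation j xs) \<omega>') =
      \<eta>\<^sup>2 * (x' j s * x j s) * (real M * block_overlap j \<omega> \<omega>' ^ s)" if "s \<in> {1..S}" for j s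
  proof -
    have "s \<ge> 1" using that by simp
    then show ?thesis
      unfolding block_overlap_def sum_coupling_coeff_mult[OF M \<open>s \<ge> 1\<close>, symmetric] sum_distrib_left
      by (intro sum.cong refl) (auto simp: length_idx power2_eq_square)
  qed
  show ?thesis
    unfolding sum_couplings global block interp_cov_def using perturbation by (simp add: sum_distrib_left)
qed

lemma measurable_interp_energy [measurable]: "(\<lambda>g. interp_energy A B x g \<omega>) \<in> borel_measurable iid_gauss"
  unfolding interp_energy_def by measurable

lemma integrable_log_sum_exp_interp_energy: "integrable iid_gauss (\<lambda>g. log_sum_exp \<Omega> (interp_energy A B x g))"
  unfolding interp_energy_def by (rule integrable_log_sum_exp_affine_energy) auto

lemma integrable_interp_pair_avg: "integrable iid_gauss (\<lambda>g. pair_avg \<Omega> (interp_energy A B x g) f)"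
  by (rule iid_gauss.integrable_pair_avg) auto

lemma mean_pair_avg_mono:
  assumes "\<And>\<omega> \<omega>'. \<omega> \<in> \<Omega> \<Longrightarrow> \<omega>' \<in> \<Omega> \<Longrightarrow> f \<omega> \<omega>' \<le> h \<omega> \<omega>'"
  shows "mean_pair_avg A B x f \<le> mean_pair_avg A B x h"
  unfolding mean_pair_avg_def by (intro integral_mono integrable_interp_pair_avg gibbs_avg_mono assms)

lemma mean_pair_avg_const: "mean_pair_avg A B x (\<lambda>_ _. k) = k"
  by (simp add: mean_pair_avg_def gibbs_avg_const)

lemma mean_pair_avg_add:
  "mean_pair_avg A B x (\<lambda>\<omega> \<omega>'. f \<omega> \<omega>' + h \<omega> \<omega>') = mean_pair_avg A B x f + mean_pair_avg A B x h"
  unfolding mean_pair_avg_def gibbs_avg_add using integrable_interp_pair_avg by simp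

lemma mean_pair_avg_cmult: "mean_pair_avg A B x (\<lambda>\<omega> \<omega>'. k * f \<omega> \<omega>') = k * mean_pair_avg A B x f"
  unfolding mean_pair_avg_def gibbs_avg_cmult by simp

lemma mean_pair_avg_sum:
  "mean_pair_avg A B x (\<lambda>\<omega> \<omega>'. \<Sum>i\<in>I. f i \<omega> \<omega>') = (\<Sum>i\<in>I. mean_pair_avg A B x (f i))"
  unfolding mean_pair_avg_def gibbs_avg_sum
  using integrable_interp_pair_avg by (simp add: Bochner_Integration.integral_sum)

lemma abs_mean_pair_avg_le:
  assumes "\<And>\<omega> \<omega>'. \<omega> \<in> \<Omega> \<Longrightarrow> \<omega>' \<in> \<Omega> \<Longrightarrow> \<bar>f \<omega> \<omega>'\<bar> \<le> k"
  shows "\<bar>mean_pair_avg A B x f\<bar> \<le> k"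
  using mean_pair_avg_mono[of f "\<lambda>_ _. k" A B x] mean_pair_avg_mono[of "\<lambda>_ _. - k" f A B x] assms
  by (fastforce simp: mean_pair_avg_const abs_le_iff)

lemma interp_free_energy_increment:
  "interp_free_energy A B x +
      (interp_variance ((A' - A) * A) ((B' - B) * B) (\<lambda>j s. (x' j s - x j s) * x j s) -
       mean_pair_avg A B x (interp_cov ((A' - A) * A) ((B' - B) * B) (\<lambda>j s. (x' j s - x j s) * x j s)))
    \<le> interp_free_energy A' B' x'"
proof -
  have diff: "interp_coeff A' B' x' i \<omega> - interp_coeff A B x i \<omega> =
      interp_coeff (A' - A) (B' - B) (\<lambda>j s. x' j s - x j s) i \<omega>" for i \<omega>
    by (cases i) (simp_all add: algebra_simps)
  show ?thesis
    unfolding interp_free_energy_def mean_pair_avg_def interp_energy_def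
    by (rule expected_log_sum_exp_increment) (simp_all add: diff sum_interp_coeff_mult interp_cov_self)
qed

subsection \<open>The two ends of the interpolation\<close>

lemma interp_free_energy_perturbation_ge: "interp_free_energy A B (\<lambda>_ _. 0) \<le> interp_free_energy A B x"
proof -
  have "interp_cov 0 0 (\<lambda>_ _. 0) = (\<lambda>_ _. 0)" by (auto simp: interp_cov_def fun_eq_iff)
  then show ?thesis
    using interp_free_energy_increment[of A B "\<lambda>_ _. 0" A B x] by (simp add: interp_variance_def mean_pair_avg_const)
qed

lemma interp_free_energy_perturbation_le:
  assumes x: "\<And>j s. j < m \<Longrightarrow> s \<in> {1..S} \<Longrightarrow> \<bar>x j s\<bar> \<le> D"
  shows "interp_free_energy A B x \<le> interp_free_energy A B (\<lambda>_ _. 0) + 2 * (real S * (\<eta>\<^sup>2 * D\<^sup>2)) * real N"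
proof -
  let ?y = "\<lambda>j s. (0 - x j s) * x j s" and ?k = "real m * (real S * (\<eta>\<^sup>2 * D\<^sup>2 * real M))"
  have y: "\<bar>?y j s\<bar> \<le> D\<^sup>2" if "j < m" "s \<in> {1..S}" for j s
    using power_mono[OF x[OF that] abs_ge_zero, of 2] by (simp add: abs_mult power2_eq_square)
  have cov: "\<bar>interp_cov 0 0 ?y \<omega> \<omega>'\<bar> \<le> ?k" if \<omega>: "\<omega> \<in> \<Omega>" "\<omega>' \<in> \<Omega>" for \<omega> \<omega>'
  proof -
    have "\<bar>\<eta>\<^sup>2 * ?y j s * (real M * block_overlap j \<omega> \<omega>' ^ s)\<bar> \<le> \<eta>\<^sup>2 * D\<^sup>2 * real M" if "j < m" "s \<in> {1..S}" for j s
    proof -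
      have "\<bar>?y j s\<bar> * \<bar>block_overlap j \<omega> \<omega>' ^ s\<bar> \<le> D\<^sup>2 * 1"
        using y[OF that] abs_power_le_1[OF abs_block_overlap_le_1[OF \<omega> that(1)]] by (intro mult_mono) auto
      then have "\<eta>\<^sup>2 * real M * (\<bar>?y j s\<bar> * \<bar>block_overlap j \<omega> \<omega>' ^ s\<bar>) \<le> \<eta>\<^sup>2 * real M * (D\<^sup>2 * 1)"
        by (rule mult_left_mono) simp
      then show ?thesis by (simp add: abs_mult mult_ac)
    qed
    then have "(\<Sum>j<m. \<Sum>s=1..S. \<bar>\<eta>\<^sup>2 * ?y j s * (real M * block_overlap j \<omega> \<omega>' ^ s)\<bar>) \<le> (\<Sum>j<m. \<Sum>s=1..S. \<eta>\<^sup>2 * D\<^sup>2 * real M)"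
      by (intro sum_mono) auto
    moreover have "\<bar>\<Sum>j<m. \<Sum>s=1..S. \<eta>\<^sup>2 * ?y j s * (real M * block_overlap j \<omega> \<omega>' ^ s)\<bar> \<le>
        (\<Sum>j<m. \<Sum>s=1..S. \<bar>\<eta>\<^sup>2 * ?y j s * (real M * block_overlap j \<omega> \<omega>' ^ s)\<bar>)"
      by (intro order_trans[OF sum_abs] sum_mono sum_abs)
    ultimately show ?thesis by (simp add: interp_cov_def)
  qed
  obtain \<omega> where \<omega>: "\<omega> \<in> \<Omega>" using \<Omega>_nonempty by blast
  have "\<bar>mean_pair_avg A B x (interp_cov 0 0 ?y)\<bar> \<le> ?k" by (rule abs_mean_pair_avg_le[OF cov])
  moreover have "\<bar>interp_variance 0 0 ?y\<bar> \<le> ?k" using cov[OF \<omega> \<omega>] by (simp add: interp_cov_self[OF \<omega>])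
  moreover have "interp_free_energy A B x + (interp_variance 0 0 ?y - mean_pair_avg A B x (interp_cov 0 0 ?y))
      \<le> interp_free_energy A B (\<lambda>_ _. 0)"
    using interp_free_energy_increment[of A B x A B "\<lambda>_ _. 0"] by simp
  moreover have "(real S * (\<eta>\<^sup>2 * D\<^sup>2)) * (real m * real M) \<le> (real S * (\<eta>\<^sup>2 * D\<^sup>2)) * real N"
    by (intro mult_left_mono real_blocks_le_N) auto
  then have "?k \<le> (real S * (\<eta>\<^sup>2 * D\<^sup>2)) * real N" by (simp add: mult_ac)
  ultimately show ?thesis by linarith
qed

lemma interp_free_energy_global: "interp_free_energy A 0 (\<lambda>_ _. 0) \<le> mean_free_energy p A N"
proof -
  let ?L = "\<lambda>g. log_sum_exp (Sigma N) (\<lambda>\<sigma>. A * H p N g \<sigma>)"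
  have inj: "inj Global" by (simp add: inj_def)
  have int: "integrable iid_gauss ?L" by (rule integrable_log_sum_exp_H[OF N_ge_1 p])
  have "log_sum_exp \<Omega> (interp_energy A 0 (\<lambda>_ _. 0) g) \<le> ?L (\<lambda>xs. g (Global xs))" for g
  proof -
    have "log_sum_exp \<Omega> (interp_energy A 0 (\<lambda>_ _. 0) g) = log_sum_exp (glue ` \<Omega>) (\<lambda>\<sigma>. A * H p N (\<lambda>xs. g (Global xs)) \<sigma>)"
      by (simp add: log_sum_exp_reindex[OF inj_on_glue] interp_energy_eq[abs_def])
    also have "\<dots> \<le> ?L (\<lambda>xs. g (Global xs))"
      by (rule log_sum_exp_mono_set) (auto simp: glue_in_Sigma)
    finally show ?thesis .
  qed
  then have "interp_free_energy A 0 (\<lambda>_ _. 0) \<le> (\<integral>g. ?L (\<lambda>xs. g (Global xs)) \<partial>iid_gauss)"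
    unfolding interp_free_energy_def
    by (intro integral_mono integrable_log_sum_exp_interp_energy integrable_reindex[OF inj int])
  also have "\<dots> = mean_free_energy p A N"
    unfolding mean_free_energy_def by (rule integral_reindex[OF inj borel_measurable_integrable[OF int]])
  finally show ?thesis .
qed

lemma interp_free_energy_local: "interp_free_energy 0 B (\<lambda>_ _. 0) = real m * mean_free_energy p B M"
proof -
  let ?L = "\<lambda>g. log_sum_exp (Sigma M) (\<lambda>\<sigma>. B * H p M g \<sigma>)"
  have inj: "inj (Block j)" for j by (simp add: inj_def)
  have int: "integrable iid_gauss ?L" by (rule integrable_log_sum_exp_H[OF M p])
  have "log_sum_exp \<Omega> (interp_energy 0 B (\<lambda>_ _. 0) g) = (\<Sum>j<m. ?L (\<lambda>xs. g (Block j xs)))" for g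
    using log_sum_exp_PiE[where I = "{..<m}" and A = "\<lambda>_. Sigma M" and X = "\<lambda>j \<sigma>. B * H p M (\<lambda>xs. g (Block j xs)) \<sigma>"]
    by (simp add: \<Omega>_def interp_energy_eq[abs_def])
  then have "interp_free_energy 0 B (\<lambda>_ _. 0) = (\<Sum>j<m. \<integral>g. ?L (\<lambda>xs. g (Block j xs)) \<partial>iid_gauss)"
    unfolding interp_free_energy_def
    by (simp add: Bochner_Integration.integral_sum integrable_reindex[OF inj int])
  also have "\<dots> = (\<Sum>j<m. mean_free_energy p B M)"
    unfolding mean_free_energy_def
    by (intro sum.cong refl integral_reindex[OF inj borel_measurable_integrable[OF int]])
  finally show ?thesis by simp
qed

subsection \<open>Negative block overlaps\<close>

definition negative_block_overlap :: "real \<Rightarrow> real \<Rightarrow> (nat \<Rightarrow> nat \<Rightarrow> real) \<Rightarrow> real \<Rightarrow> nat \<Rightarrow> real" where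
  "negative_block_overlap A B x \<epsilon> j = mean_pair_avg A B x (\<lambda>\<omega> \<omega>'. of_bool (block_overlap j \<omega> \<omega>' \<le> - \<epsilon>))"

lemma perturbed_block: "j < m \<Longrightarrow> perturbed \<Omega> (\<lambda>\<omega>. \<omega> j) M \<eta>"
  by unfold_locales (use block_in_Sigma M \<eta> in auto)

text \<open>Conditionally on all other couplings, the perturbation of block \<open>j\<close> acts on a deterministic reference weight.\<close>
lemma interp_energy_condition:
  assumes j: "j < m"
  shows "interp_energy A B (x(j := \<lambda>s. real (y s))) (\<lambda>i. if i \<in> range (Perturbation j) then g' i else g i) =
    perturbed.perturbed_energy (interp_energy A B (x(j := \<lambda>_. 0)) g) (\<lambda>\<omega>. \<omega> j) M S \<eta> y (\<lambda>xs. g' (Perturbation j xs))"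
    (is "?L = _")
proof
  fix \<omega>
  interpret block: perturbed \<Omega> "interp_energy A B (x(j := \<lambda>_. 0)) g" "\<lambda>\<omega>. \<omega> j" M S \<eta>
    by (rule perturbed_block[OF j])
  let ?P = "\<Sum>s=1..S. real (y s) * (\<eta> * H s M (\<lambda>xs. g' (Perturbation j xs)) (\<omega> j))"
  have "(\<Sum>s=1..S. \<eta> * (x(j := \<lambda>s. real (y s))) i s *
        H s M (\<lambda>xs. if Perturbation i xs \<in> range (Perturbation j) then g' (Perturbation i xs) else g (Perturbation i xs)) (\<omega> i)) =
      (\<Sum>s=1..S. \<eta> * (x(j := \<lambda>_. 0)) i s * H s M (\<lambda>xs. g (Perturbation i xs)) (\<omega> i)) + (if i = j then ?P else 0)" for i
    by (cases "i = j") (auto simp: image_iff mult_ac intro!: sum.cong)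
  then have "?L \<omega> = A * H p N (\<lambda>xs. g (Global xs)) (glue \<omega>) + (\<Sum>i<m. B * H p M (\<lambda>xs. g (Block i xs)) (\<omega> i)) +
      (\<Sum>i<m. (\<Sum>s=1..S. \<eta> * (x(j := \<lambda>_. 0)) i s * H s M (\<lambda>xs. g (Perturbation i xs)) (\<omega> i)) + (if i = j then ?P else 0))"
    unfolding interp_energy_eq by (simp add: image_iff)
  also have "\<dots> = interp_energy A B (x(j := \<lambda>_. 0)) g \<omega> + ?P"
    using j by (simp add: interp_energy_eq sum.distrib sum.delta)
  finally show "?L \<omega> = block.perturbed_energy y (\<lambda>xs. g' (Perturbation j xs)) \<omega>"
    by (simp add: block.perturbed_energy_eq_sum block.spin_energy_def)
qed

lemma sum_negative_block_overlap_le: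
  assumes j: "j < m"
    and pos: "\<And>c. (\<Sum>y\<in>X. perturbed.negative_overlap_prob \<Omega> c (\<lambda>\<omega>. \<omega> j) M S \<eta> \<epsilon> y) \<le> b"
  shows "(\<Sum>y\<in>X. negative_block_overlap A B (x(j := \<lambda>s. real (y s))) \<epsilon> j) \<le> b"
proof -
  let ?f = "\<lambda>y g. pair_avg \<Omega> (interp_energy A B (x(j := \<lambda>s. real (y s))) g) (\<lambda>\<omega> \<omega>'. of_bool (block_overlap j \<omega> \<omega>' \<le> - \<epsilon>))"
  let ?c = "interp_energy A B (x(j := \<lambda>_. 0))"
  let ?merge = "\<lambda>g' g i. if i \<in> range (Perturbation j) then g' i else g i"
  have inj: "inj (Perturbation j)" by (simp add: inj_def)
  have conditional: "(\<integral>g'. ?f y (?merge g' g) \<partial>iid_gauss) =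
      perturbed.negative_overlap_prob \<Omega> (?c g) (\<lambda>\<omega>. \<omega> j) M S \<eta> \<epsilon> y" for y and g :: "coupling \<Rightarrow> real"
  proof -
    interpret block: perturbed \<Omega> "?c g" "\<lambda>\<omega>. \<omega> j" M S \<eta> by (rule perturbed_block[OF j])
    let ?h = "\<lambda>g. pair_avg \<Omega> (block.perturbed_energy y g) (\<lambda>\<omega> \<omega>'. of_bool (block.ovl \<omega> \<omega>' \<le> - \<epsilon>))"
    have "(\<integral>g'. ?f y (?merge g' g) \<partial>iid_gauss) = (\<integral>g'. ?h (\<lambda>xs. g' (Perturbation j xs)) \<partial>iid_gauss)"
      unfolding interp_energy_condition[OF j] block_overlap_def block.ovl_def ..
    also have "\<dots> = (\<integral>g'. ?h g' \<partial>iid_gauss)"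
      by (rule integral_reindex[OF inj borel_measurable_integrable[OF block.integrable_overlap_avg]])
    finally show ?thesis
      by (simp add: block.negative_overlap_prob_def block.mean_overlap_avg_def)
  qed
  have int: "integrable iid_gauss (?f y)" for y
    by (rule integrable_interp_pair_avg)
  have "(\<Sum>y\<in>X. negative_block_overlap A B (x(j := \<lambda>s. real (y s))) \<epsilon> j) =
      (\<Sum>y\<in>X. \<integral>g. (\<integral>g'. ?f y (?merge g' g) \<partial>iid_gauss) \<partial>iid_gauss)"
    unfolding negative_block_overlap_def mean_pair_avg_def by (intro sum.cong refl integral_merge int)
  also have "\<dots> = (\<integral>g. (\<Sum>y\<in>X. \<integral>g'. ?f y (?merge g' g) \<partial>iid_gauss) \<partial>iid_gauss)"
    by (intro Bochner_Integration.integral_sum[symmetric] integrable_merge int)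
  also have "\<dots> \<le> (\<integral>g. b \<partial>(iid_gauss :: (coupling \<Rightarrow> real) measure))"
  proof (rule integral_mono)
    show "integrable iid_gauss (\<lambda>g. \<Sum>y\<in>X. \<integral>g'. ?f y (?merge g' g) \<partial>iid_gauss)"
      by (intro Bochner_Integration.integrable_sum integrable_merge int)
    show "(\<Sum>y\<in>X. \<integral>g'. ?f y (?merge g' g) \<partial>iid_gauss) \<le> b" for g
      unfolding conditional by (rule pos)
  qed simp
  finally show ?thesis by simp
qed

definition interp_error :: "real \<Rightarrow> (nat \<Rightarrow> real) \<Rightarrow> real" where
  "interp_error \<epsilon> q = real N * ((real p + 1) * (\<epsilon> + (\<Sum>j<m. real M / real N * q j))) + real p * real r"

lemma mean_glued_overlap_power_le:
  assumes \<epsilon>: "\<epsilon> \<ge> 0"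
  shows "real N * mean_pair_avg A B x (\<lambda>\<omega> \<omega>'. glued_overlap \<omega> \<omega>' ^ p) \<le>
    (\<Sum>j<m. real M * mean_pair_avg A B x (\<lambda>\<omega> \<omega>'. block_overlap j \<omega> \<omega>' ^ p)) +
    interp_error \<epsilon> (negative_block_overlap A B x \<epsilon>)"
proof -
  let ?E = "mean_pair_avg A B x" and ?w = "real M / real N" and ?t = "real r / real N"
  have N: "real N > 0" using N_ge_1 by simp
  have weights: "(\<Sum>j<m. ?w) + ?t = 1" using N by (simp add: add_divide_distrib[symmetric] N_def)
  have "?E (\<lambda>\<omega> \<omega>'. glued_overlap \<omega> \<omega>' ^ p) \<le> ?E (\<lambda>\<omega> \<omega>'. (\<Sum>j<m. ?w * block_overlap j \<omega> \<omega>' ^ p) +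
     (real p + 1) * (\<epsilon> + (\<Sum>j<m. ?w * of_bool (block_overlap j \<omega> \<omega>' \<le> - \<epsilon>))) + real p * ?t)"
    unfolding glued_overlap_eq_weighted_sum
    by (intro mean_pair_avg_mono power_mean_le_mean_power abs_block_overlap_le_1 weights p \<epsilon>) auto
  also have "\<dots> = (\<Sum>j<m. ?w * ?E (\<lambda>\<omega> \<omega>'. block_overlap j \<omega> \<omega>' ^ p)) +
     (real p + 1) * (\<epsilon> + (\<Sum>j<m. ?w * negative_block_overlap A B x \<epsilon> j)) + real p * ?t"
    by (simp only: mean_pair_avg_add mean_pair_avg_cmult mean_pair_avg_sum mean_pair_avg_const negative_block_overlap_def)
  finally have "real N * ?E (\<lambda>\<omega> \<omega>'. glued_overlap \<omega> \<omega>' ^ p) \<le> real N * \<dots>"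
    using N by (intro mult_left_mono) auto
  also have "\<dots> = (\<Sum>j<m. real M * ?E (\<lambda>\<omega> \<omega>'. block_overlap j \<omega> \<omega>' ^ p)) +
      interp_error \<epsilon> (negative_block_overlap A B x \<epsilon>)"
    using N by (simp add: interp_error_def distrib_left sum_distrib_left)
  finally show ?thesis .
qed

end

subsection \<open>Almost superadditivity\<close>

lemma rotation_increment:
  assumes \<theta>: "0 \<le> \<theta>" "\<theta> \<le> \<theta>'" "\<theta>' \<le> pi / 2"
  defines "u \<equiv> (sin \<theta>' - sin \<theta>) * sin \<theta>" and "v \<equiv> (cos \<theta>' - cos \<theta>) * cos \<theta>"
  shows "0 \<le> u" and "u \<le> \<theta>' - \<theta>" and "- (\<theta>' - \<theta>)\<^sup>2 / 2 \<le> u + v"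
proof -
  have sin: "0 \<le> sin \<theta>" "sin \<theta> \<le> 1" "sin \<theta> \<le> sin \<theta>'"
    using \<theta> by (auto intro!: sin_ge_zero sin_monotone_2pi_le)
  have lipschitz: "sin \<theta>' - sin \<theta> \<le> \<theta>' - \<theta>"
  proof -
    have "sin \<theta>' - sin \<theta> = 2 * sin ((\<theta>' - \<theta>) / 2) * cos ((\<theta>' + \<theta>) / 2)" by (rule sin_diff_sin)
    also have "\<dots> \<le> 2 * ((\<theta>' - \<theta>) / 2) * 1"
    proof (intro mult_mono mult_left_mono)
      show "sin ((\<theta>' - \<theta>) / 2) \<le> (\<theta>' - \<theta>) / 2" using \<theta> by (intro sin_x_le_x) simp
      show "0 \<le> cos ((\<theta>' + \<theta>) / 2)" using \<theta> by (intro cos_ge_zero) auto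
    qed (use \<theta> pi_gt_zero in \<open>auto intro!: sin_ge_zero\<close>)
    finally show ?thesis by simp
  qed
  show "0 \<le> u" unfolding u_def using sin by simp
  have "u \<le> (\<theta>' - \<theta>) * 1" unfolding u_def using sin lipschitz \<theta> by (intro mult_mono) auto
  then show "u \<le> \<theta>' - \<theta>" by simp
  define h where "h = (\<theta>' - \<theta>) / 2"
  have h: "\<theta>' - \<theta> = 2 * h" by (simp add: h_def)
  have "u + v = cos (\<theta>' - \<theta>) - ((sin \<theta>)\<^sup>2 + (cos \<theta>)\<^sup>2)"
    unfolding u_def v_def by (simp add: cos_diff power2_eq_square algebra_simps)
  also have "\<dots> = - 2 * (sin h)\<^sup>2"
    unfolding h cos_double_sin by simp
  finally have "u + v = - 2 * (sin h)\<^sup>2" .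
  moreover have "(sin h)\<^sup>2 \<le> h\<^sup>2"
    using abs_sin_x_le_abs_x[of h] by (simp only: abs_le_square_iff)
  ultimately show "- (\<theta>' - \<theta>)\<^sup>2 / 2 \<le> u + v" by (simp add: h power_mult_distrib)
qed

context blocks
begin

lemma interp_error_nonneg:
  assumes "\<epsilon> \<ge> 0" "\<And>j. 0 \<le> q j"
  shows "0 \<le> interp_error \<epsilon> q"
  unfolding interp_error_def using assms by (intro add_nonneg_nonneg mult_nonneg_nonneg sum_nonneg) auto

lemma negative_block_overlap_nonneg: "0 \<le> negative_block_overlap A B x \<epsilon> j"
  unfolding negative_block_overlap_def mean_pair_avg_def
  by (intro Bochner_Integration.integral_nonneg gibbs_avg_nonneg) simp

lemma interp_free_energy_step:
  fixes k x
  assumes \<theta>: "0 \<le> \<theta>" "\<theta> \<le> \<theta>'" "\<theta>' \<le> pi / 2" and \<epsilon>: "\<epsilon> \<ge> 0"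
  defines "W \<equiv> interp_error \<epsilon> (negative_block_overlap (k * sin \<theta>) (k * cos \<theta>) x \<epsilon>)"
  shows "interp_free_energy (k * sin \<theta>) (k * cos \<theta>) x - k\<^sup>2 * ((\<theta>' - \<theta>) * W + (\<theta>' - \<theta>)\<^sup>2 * real N)
    \<le> interp_free_energy (k * sin \<theta>') (k * cos \<theta>') x"
proof -
  define A B where "A = k * sin \<theta>" and "B = k * cos \<theta>"
  define u v where "u = (sin \<theta>' - sin \<theta>) * sin \<theta>" and "v = (cos \<theta>' - cos \<theta>) * cos \<theta>"
  let ?E = "mean_pair_avg A B x"
  define G where "G = real N - real N * ?E (\<lambda>\<omega> \<omega>'. glued_overlap \<omega> \<omega>' ^ p)"
  define L where "L = real m * real M - (\<Sum>j<m. real M * ?E (\<lambda>\<omega> \<omega>'. block_overlap j \<omega> \<omega>' ^ p))"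
  have AB: "(k * sin \<theta>' - A) * A = k\<^sup>2 * u" "(k * cos \<theta>' - B) * B = k\<^sup>2 * v"
    by (simp_all add: A_def B_def u_def v_def power2_eq_square algebra_simps)
  have cov: "interp_cov a b (\<lambda>_ _. 0) =
      (\<lambda>\<omega> \<omega>'. (a * real N) * glued_overlap \<omega> \<omega>' ^ p + (\<Sum>j<m. (b * real M) * block_overlap j \<omega> \<omega>' ^ p))" for a b
    by (auto simp: interp_cov_def fun_eq_iff sum_distrib_left mult_ac)
  have "interp_free_energy A B x + k\<^sup>2 * (u * G + v * L) \<le> interp_free_energy (k * sin \<theta>') (k * cos \<theta>') x"
    using interp_free_energy_increment[of A B x "k * sin \<theta>'" "k * cos \<theta>'" x]
    unfolding AB diff_self mult_zero_left cov mean_pair_avg_add mean_pair_avg_sum mean_pair_avg_cmult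
      interp_variance_def G_def L_def
    by (simp add: algebra_simps sum_distrib_left)
  moreover have "- ((\<theta>' - \<theta>) * W + (\<theta>' - \<theta>)\<^sup>2 * real N) \<le> u * G + v * L"
  proof -
    have "\<bar>\<Sum>j<m. real M * ?E (\<lambda>\<omega> \<omega>'. block_overlap j \<omega> \<omega>' ^ p)\<bar> \<le> (\<Sum>j<m. real M * 1)"
      by (intro order_trans[OF sum_abs] sum_mono)
         (auto simp: abs_mult intro!: mult_left_le abs_mean_pair_avg_le abs_power_le_1 abs_block_overlap_le_1)
    then have L: "0 \<le> L" "L \<le> 2 * real N" using real_blocks_le_N by (auto simp: L_def abs_le_iff)
    have "- W \<le> G - L"
      using mean_glued_overlap_power_le[OF \<epsilon>, of A B x] real_blocks_le_N
      by (simp add: W_def G_def L_def A_def B_def)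
    moreover have u: "0 \<le> u" "u \<le> \<theta>' - \<theta>" and uv: "- (\<theta>' - \<theta>)\<^sup>2 / 2 \<le> u + v"
      unfolding u_def v_def by (rule rotation_increment[OF \<theta>])+
    ultimately have "u * (- W) \<le> u * (G - L)" by (intro mult_left_mono)
    moreover have "u * W \<le> (\<theta>' - \<theta>) * W"
      unfolding W_def by (intro mult_right_mono u interp_error_nonneg \<epsilon> negative_block_overlap_nonneg)
    moreover have "- (\<theta>' - \<theta>)\<^sup>2 / 2 * L \<le> (u + v) * L" using uv L by (intro mult_right_mono)
    moreover have "(\<theta>' - \<theta>)\<^sup>2 / 2 * L \<le> (\<theta>' - \<theta>)\<^sup>2 / 2 * (2 * real N)" using L by (intro mult_left_mono) auto
    ultimately show ?thesis by (simp add: algebra_simps)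
  qed
  then have "k\<^sup>2 * (- ((\<theta>' - \<theta>) * W + (\<theta>' - \<theta>)\<^sup>2 * real N)) \<le> k\<^sup>2 * (u * G + v * L)"
    by (intro mult_left_mono) auto
  ultimately show ?thesis unfolding A_def[symmetric] B_def[symmetric] by linarith
qed

context
  fixes X :: "(nat \<Rightarrow> nat) set" and \<epsilon> \<rho> :: real
  assumes X: "finite X" "X \<noteq> {}" and \<epsilon>: "\<epsilon> \<ge> 0" and \<rho>: "\<rho> \<ge> 0"
    and pos: "\<And>c j. j < m \<Longrightarrow> (\<Sum>y\<in>X. perturbed.negative_overlap_prob \<Omega> c (\<lambda>\<omega>. \<omega> j) M S \<eta> \<epsilon> y) \<le> \<rho> * real (card X)"
begin

lemma sum_negative_block_overlap_PiE_le:
  assumes j: "j < m"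
  shows "(\<Sum>x\<in>{..<m} \<rightarrow>\<^sub>E X. negative_block_overlap A B (\<lambda>j s. real (x j s)) \<epsilon> j) \<le> \<rho> * real (card ({..<m} \<rightarrow>\<^sub>E X))"
proof -
  let ?q = "\<lambda>x. negative_block_overlap A B (\<lambda>j s. real (x j s :: nat)) \<epsilon> j"
  have "real (card X) * (\<Sum>x\<in>{..<m} \<rightarrow>\<^sub>E X. ?q x) = (\<Sum>x\<in>{..<m} \<rightarrow>\<^sub>E X. \<Sum>y\<in>X. ?q (x(j := y)))"
    by (rule sum_PiE_resample[symmetric]) (use j in simp)
  also have "\<dots> \<le> (\<Sum>x\<in>{..<m} \<rightarrow>\<^sub>E X. \<rho> * real (card X))"
  proof (rule sum_mono)
    fix x :: "nat \<Rightarrow> nat \<Rightarrow> nat"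
    have "(\<lambda>i s. real ((x(j := y)) i s)) = (\<lambda>i s. real (x i s))(j := \<lambda>s. real (y s))" for y
      by (auto simp: fun_eq_iff)
    then show "(\<Sum>y\<in>X. ?q (x(j := y))) \<le> \<rho> * real (card X)"
      using sum_negative_block_overlap_le[OF j pos[OF j]] by simp
  qed
  finally have "real (card X) * (\<Sum>x\<in>{..<m} \<rightarrow>\<^sub>E X. ?q x) \<le> real (card X) * (\<rho> * real (card ({..<m} \<rightarrow>\<^sub>E X)))"
    by (simp add: mult_ac)
  moreover have "real (card X) > 0" using X by (simp add: card_gt_0_iff)
  ultimately show ?thesis by simp
qed

lemma sum_interp_error_le:
  "(\<Sum>x\<in>{..<m} \<rightarrow>\<^sub>E X. interp_error \<epsilon> (negative_block_overlap A B (\<lambda>j s. real (x j s)) \<epsilon>)) \<le>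
    real (card ({..<m} \<rightarrow>\<^sub>E X)) * interp_error (\<epsilon> + \<rho>) (\<lambda>_. 0)"
proof -
  let ?X = "{..<m} \<rightarrow>\<^sub>E X" and ?q = "\<lambda>x. negative_block_overlap A B (\<lambda>j s. real (x j s :: nat)) \<epsilon>"
  let ?n = "real (card ?X)"
  have "(\<Sum>x\<in>?X. \<Sum>j<m. real M / real N * ?q x j) = (\<Sum>j<m. real M / real N * (\<Sum>x\<in>?X. ?q x j))"
    by (subst sum.swap) (simp add: sum_distrib_left)
  also have "\<dots> \<le> (\<Sum>j<m. real M / real N * (\<rho> * ?n))"
    using sum_negative_block_overlap_PiE_le by (intro sum_mono mult_left_mono) auto
  also have "\<dots> = (real m * real M / real N) * (\<rho> * ?n)" by simp
  also have "\<dots> \<le> 1 * (\<rho> * ?n)"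
    using real_blocks_le_N N_ge_1 \<rho> by (intro mult_right_mono) auto
  finally have overlap: "(\<Sum>x\<in>?X. \<Sum>j<m. real M / real N * ?q x j) \<le> ?n * \<rho>" by (simp add: mult.commute)
  have "(\<Sum>x\<in>?X. interp_error \<epsilon> (?q x)) =
      real N * ((real p + 1) * (?n * \<epsilon> + (\<Sum>x\<in>?X. \<Sum>j<m. real M / real N * ?q x j))) + ?n * (real p * real r)"
    unfolding interp_error_def
    by (simp only: sum.distrib sum_distrib_left[symmetric] sum_constant mult.left_commute[of "real p"])
  also have "\<dots> \<le> real N * ((real p + 1) * (?n * \<epsilon> + ?n * \<rho>)) + ?n * (real p * real r)"
    by (intro add_right_mono mult_left_mono add_left_mono overlap) auto
  also have "\<dots> = ?n * interp_error (\<epsilon> + \<rho>) (\<lambda>_. 0)" by (simp add: interp_error_def algebra_simps)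
  finally show ?thesis .
qed

lemma sum_interp_free_energy_step:
  assumes \<theta>: "0 \<le> \<theta>" "\<theta> \<le> \<theta>'" "\<theta>' \<le> pi / 2"
  shows "(\<Sum>x\<in>{..<m} \<rightarrow>\<^sub>E X. interp_free_energy (k * sin \<theta>) (k * cos \<theta>) (\<lambda>j s. real (x j s))) -
      real (card ({..<m} \<rightarrow>\<^sub>E X)) * (k\<^sup>2 * ((\<theta>' - \<theta>) * interp_error (\<epsilon> + \<rho>) (\<lambda>_. 0) + (\<theta>' - \<theta>)\<^sup>2 * real N))
    \<le> (\<Sum>x\<in>{..<m} \<rightarrow>\<^sub>E X. interp_free_energy (k * sin \<theta>') (k * cos \<theta>') (\<lambda>j s. real (x j s)))"
proof -
  let ?X = "{..<m} \<rightarrow>\<^sub>E X" and ?x = "\<lambda>x j s. real (x j s :: nat)"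
  let ?I = "\<lambda>\<theta> x. interp_free_energy (k * sin \<theta>) (k * cos \<theta>) (?x x)"
  let ?e = "\<lambda>x. interp_error \<epsilon> (negative_block_overlap (k * sin \<theta>) (k * cos \<theta>) (?x x) \<epsilon>)"
  have "k\<^sup>2 * ((\<theta>' - \<theta>) * (\<Sum>x\<in>?X. ?e x)) \<le> k\<^sup>2 * ((\<theta>' - \<theta>) * (real (card ?X) * interp_error (\<epsilon> + \<rho>) (\<lambda>_. 0)))"
    using \<theta> by (intro mult_left_mono sum_interp_error_le) auto
  moreover have "(\<Sum>x\<in>?X. ?I \<theta> x - k\<^sup>2 * ((\<theta>' - \<theta>) * ?e x + (\<theta>' - \<theta>)\<^sup>2 * real N)) \<le> (\<Sum>x\<in>?X. ?I \<theta>' x)"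
    by (intro sum_mono interp_free_energy_step \<theta> \<epsilon>)
  then have "(\<Sum>x\<in>?X. ?I \<theta> x) - k\<^sup>2 * ((\<theta>' - \<theta>) * (\<Sum>x\<in>?X. ?e x) + real (card ?X) * ((\<theta>' - \<theta>)\<^sup>2 * real N)) \<le> (\<Sum>x\<in>?X. ?I \<theta>' x)"
    by (simp add: sum_subtractf sum_distrib_left[symmetric] sum.distrib)
  ultimately show ?thesis by (simp add: algebra_simps)
qed

text \<open>Interpolate along \<^term>\<open>(sin \<theta>, cos \<theta>)\<close> with the perturbation of every block kept fixed, averaging over
  the strengths of the perturbations.\<close>
lemma mean_free_energy_superadditive:
  assumes D: "\<And>y s. y \<in> X \<Longrightarrow> s \<in> {1..S} \<Longrightarrow> real (y s) \<le> D"
  shows "real m * mean_free_energy p k M - 2 * k\<^sup>2 * interp_error (\<epsilon> + \<rho>) (\<lambda>_. 0) -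
     2 * (real S * (\<eta>\<^sup>2 * D\<^sup>2)) * real N \<le> mean_free_energy p k N"
proof -
  let ?X = "{..<m} \<rightarrow>\<^sub>E X" and ?W = "interp_error (\<epsilon> + \<rho>) (\<lambda>_. 0)" and ?x = "\<lambda>x j s. real (x j s :: nat)"
  let ?n = "real (card ?X)"
  have "?X \<noteq> {}" "finite ?X" using X by (auto intro!: finite_PiE simp: PiE_eq_empty_iff)
  then have n: "?n > 0" by (simp add: card_gt_0_iff)
  define \<Psi> where "\<Psi> \<theta> = (\<Sum>x\<in>?X. interp_free_energy (k * sin \<theta>) (k * cos \<theta>) (?x x))" for \<theta>
  have "- \<Psi> (pi / 2) - (- \<Psi> 0) \<le> (?n * k\<^sup>2 * ?W) * (pi / 2 - 0)"
  proof (rule diff_le_of_quadratic_increments[where C = "?n * k\<^sup>2 * real N"])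
    show "- \<Psi> \<theta>' - - \<Psi> \<theta> \<le> (?n * k\<^sup>2 * ?W) * (\<theta>' - \<theta>) + ?n * k\<^sup>2 * real N * (\<theta>' - \<theta>)\<^sup>2"
      if "0 \<le> \<theta>" "\<theta> \<le> \<theta>'" "\<theta>' \<le> pi / 2" for \<theta> \<theta>'
      using sum_interp_free_energy_step[OF that, of k] by (simp add: \<Psi>_def algebra_simps)
  qed simp
  moreover have "0 \<le> ?W" using \<epsilon> \<rho> by (intro interp_error_nonneg) auto
  then have "(?n * k\<^sup>2 * ?W) * (pi / 2) \<le> (?n * k\<^sup>2 * ?W) * 2"
    using pi_less_4 by (intro mult_left_mono) auto
  moreover have "\<Psi> (pi / 2) \<le> (\<Sum>x\<in>?X. mean_free_energy p k N + 2 * (real S * (\<eta>\<^sup>2 * D\<^sup>2)) * real N)"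
    unfolding \<Psi>_def
  proof (rule sum_mono)
    fix x assume x: "x \<in> ?X"
    have "interp_free_energy k 0 (?x x) \<le> interp_free_energy k 0 (\<lambda>_ _. 0) + 2 * (real S * (\<eta>\<^sup>2 * D\<^sup>2)) * real N"
      by (rule interp_free_energy_perturbation_le) (use D x in \<open>auto simp: PiE_iff\<close>)
    then show "interp_free_energy (k * sin (pi / 2)) (k * cos (pi / 2)) (?x x) \<le>
        mean_free_energy p k N + 2 * (real S * (\<eta>\<^sup>2 * D\<^sup>2)) * real N"
      using interp_free_energy_global[of k] by simp
  qed
  moreover have "(\<Sum>x\<in>?X. real m * mean_free_energy p k M) \<le> \<Psi> 0"
    unfolding \<Psi>_def interp_free_energy_local[symmetric]
    by (rule sum_mono) (simp add: interp_free_energy_perturbation_ge)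
  ultimately have "?n * (real m * mean_free_energy p k M) \<le>
      ?n * (mean_free_energy p k N + 2 * (real S * (\<eta>\<^sup>2 * D\<^sup>2)) * real N + 2 * k\<^sup>2 * ?W)"
    by (simp add: algebra_simps)
  then show ?thesis using n by (simp only: mult_le_cancel_left_pos)
qed

lemma mean_free_energy_superadditive_small_error:
  assumes D: "\<And>y s. y \<in> X \<Longrightarrow> s \<in> {1..S} \<Longrightarrow> real (y s) \<le> D"
    and small: "2 * k\<^sup>2 * (real p + 1) * (\<epsilon> + \<rho>) \<le> \<delta> / 2" "2 * (real S * (\<eta>\<^sup>2 * D\<^sup>2)) \<le> \<delta> / 2"
  shows "real m * mean_free_energy p k M - \<delta> * real N - 2 * k\<^sup>2 * real p * real r \<le> mean_free_energy p k N"
proof -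
  have "2 * k\<^sup>2 * interp_error (\<epsilon> + \<rho>) (\<lambda>_. 0) =
      2 * k\<^sup>2 * (real p + 1) * (\<epsilon> + \<rho>) * real N + 2 * k\<^sup>2 * real p * real r"
    by (simp add: interp_error_def algebra_simps)
  also have "\<dots> \<le> \<delta> / 2 * real N + 2 * k\<^sup>2 * real p * real r"
    by (intro add_right_mono mult_right_mono small) simp
  moreover have "2 * (real S * (\<eta>\<^sup>2 * D\<^sup>2)) * real N \<le> \<delta> / 2 * real N"
    by (intro mult_right_mono small) simp
  moreover have "real m * mean_free_energy p k M - 2 * k\<^sup>2 * interp_error (\<epsilon> + \<rho>) (\<lambda>_. 0) -
      2 * (real S * (\<eta>\<^sup>2 * D\<^sup>2)) * real N \<le> mean_free_energy p k N"
    by (rule mean_free_energy_superadditive) (rule D)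
  ultimately show ?thesis by simp
qed

end

end

theorem mean_free_energy_almost_superadditive:
  assumes p: "p \<ge> 1" and \<delta>: "\<delta> > 0"
  shows "\<forall>\<^sub>F M in sequentially. \<forall>m\<ge>1. \<forall>r.
    real m * mean_free_energy p k M - \<delta> * real (m * M + r) - 2 * k\<^sup>2 * real p * real r \<le> mean_free_energy p k (m * M + r)"
proof -
  have "0 \<le> 4 * k\<^sup>2 * (real p + 1)" by simp
  then obtain \<epsilon> where \<epsilon>: "\<epsilon> > 0" "4 * k\<^sup>2 * (real p + 1) * \<epsilon> \<le> \<delta> / 2"
    using obtain_pos_mult_le half_gt_zero[OF \<delta>] by metis
  obtain S n where n: "n \<ge> 1" and pos: "\<And>\<eta>. \<eta> > 0 \<Longrightarrow> \<forall>\<^sub>F M in sequentially.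
      \<forall>(\<Omega> :: (nat \<Rightarrow> nat \<Rightarrow> real) set) c spins. perturbed \<Omega> spins M \<eta> \<longrightarrow>
      (\<Sum>x\<in>strength_grid S n. perturbed.negative_overlap_prob \<Omega> c spins M S \<eta> \<epsilon> x) \<le> \<epsilon> * real (card (strength_grid S n))"
    using talagrand_positivity[OF \<epsilon>(1) \<epsilon>(1), where 'o = "nat \<Rightarrow> nat \<Rightarrow> real"] by blast
  let ?D = "real (2 * n)"
  have "0 \<le> 2 * real S * ?D\<^sup>2" by simp
  then obtain v where v: "v > 0" "2 * real S * ?D\<^sup>2 * v \<le> \<delta> / 2"
    using obtain_pos_mult_le half_gt_zero[OF \<delta>] by metis
  define \<eta> where "\<eta> = sqrt v"
  have \<eta>: "\<eta> > 0" and strength: "2 * (real S * (\<eta>\<^sup>2 * ?D\<^sup>2)) \<le> \<delta> / 2" using v by (simp_all add: \<eta>_def mult_ac)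
  show ?thesis
    using pos[OF \<eta>] eventually_ge_at_top[of 1]
  proof eventually_elim
    case (elim M)
    show ?case
    proof (intro allI impI)
      fix m r :: nat assume m: "1 \<le> m"
      interpret blocks p M m r S \<eta> by unfold_locales (use p elim(2) m \<eta> in auto)
      show "real m * mean_free_energy p k M - \<delta> * real (m * M + r) - 2 * k\<^sup>2 * real p * real r \<le>
          mean_free_energy p k (m * M + r)"
        unfolding N_def[symmetric]
      proof (rule mean_free_energy_superadditive_small_error)
        show "finite (strength_grid S n)" "strength_grid S n \<noteq> {}"
          using n by (auto simp: strength_grid_def PiE_eq_empty_iff intro!: finite_PiE)
        show "(\<Sum>y\<in>strength_grid S n. perturbed.negative_overlap_prob \<Omega> c (\<lambda>\<omega>. \<omega> j) M S \<eta> \<epsilon> y) \<le>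
            \<epsilon> * real (card (strength_grid S n))" if "j < m" for c j
          using elim(1) perturbed_block[OF that] by blast
        show "real (y s) \<le> ?D" if "y \<in> strength_grid S n" "s \<in> {1..S}" for y s
          using strength_gridD(2)[OF that] by simp
      qed (use \<epsilon> strength in auto)
    qed
  qed
qed

subsection \<open>Convergence\<close>

lemma integral_H: "(\<integral>g. H p N g \<sigma> \<partial>iid_gauss) = 0"
proof -
  have "(\<integral>g. g i \<partial>iid_gauss) = 0" for i :: "nat list"
    using iid_gauss_integration_by_parts[of "\<lambda>_. 1" "\<lambda>_. 0" i 1] by simp
  then show ?thesis
    by (simp add: H_eq_sum_coupling_coeff Bochner_Integration.integral_sum integrable_coordinate)
qed

lemma mean_free_energy_nonneg:
  assumes "N \<ge> 1" "p \<ge> 1"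
  shows "0 \<le> mean_free_energy p k N"
proof -
  have "(\<integral>g. k * H p N g (ones N) \<partial>iid_gauss) \<le> mean_free_energy p k N"
    unfolding mean_free_energy_def
    by (intro integral_mono integrable_log_sum_exp_H assms log_sum_exp_ge) (auto simp: integrable_H)
  then show ?thesis by (simp add: integral_H)
qed

lemma log_ratio_eq_log_sum_exp_H:
  "log_ratio p N \<beta> g = log_sum_exp (Sigma N) (\<lambda>\<sigma>. \<beta> / sqrt 2 * H p N g \<sigma>) - (\<beta>\<^sup>2 / 4 + ln 2) * real N"
  unfolding log_ratio_def normalized_energy_def[abs_def] log_sum_exp_add_const[OF finite_Sigma Sigma_nonempty] by simp

lemma mean_log_ratio_eq_mean_free_energy:
  assumes "N \<ge> 1" "p \<ge> 1"
  shows "mean_log_ratio p N \<beta> = mean_free_energy p (\<beta> / sqrt 2) N - (\<beta>\<^sup>2 / 4 + ln 2) * real N"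
  unfolding mean_log_ratio_def log_ratio_eq_log_sum_exp_H mean_free_energy_def
  using integrable_log_sum_exp_H[OF assms, of "\<beta> / sqrt 2"] by simp

lemma mean_log_ratio_nonpos:
  assumes N: "N \<ge> 1" "p \<ge> 1" and \<beta>: "0 \<le> \<beta>"
  shows "mean_log_ratio p N \<beta> \<le> 0"
proof -
  have "ennreal (exp (mean_log_ratio p N \<beta>)) \<le> (\<integral>\<^sup>+g. ennreal (exp (log_ratio p N \<beta> g)) \<partial>iid_gauss)"
    unfolding mean_log_ratio_def
    by (rule iid_gauss.exp_expectation_le_nn_integral[OF subgaussian_imp_integrable[OF subgaussian_log_ratio[OF N \<beta> order_refl]]])
  also have "\<dots> = 1"
    using nn_integral_eq_integral[OF integrable_exp_log_ratio[OF N]] integral_exp_log_ratio[OF N] by simp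
  finally show ?thesis by (simp flip: ennreal_1)
qed

theorem mean_log_ratio_convergent:
  assumes p: "p \<ge> 1" and \<beta>: "0 \<le> \<beta>"
  shows "convergent (\<lambda>N. mean_log_ratio p N \<beta> / real N)"
proof -
  let ?k = "\<beta> / sqrt 2"
  have "convergent (\<lambda>N. mean_free_energy p ?k N / real N)"
  proof (rule convergent_if_almost_superadditive[where C = "\<beta>\<^sup>2 / 4 + ln 2" and D = "2 * ?k\<^sup>2 * real p"])
    show "0 \<le> mean_free_energy p ?k N" if "N \<ge> 1" for N
      by (rule mean_free_energy_nonneg[OF that p])
    show "mean_free_energy p ?k N \<le> (\<beta>\<^sup>2 / 4 + ln 2) * real N" if "N \<ge> 1" for N
      using mean_log_ratio_nonpos[OF that p \<beta>] mean_log_ratio_eq_mean_free_energy[OF that p, of \<beta>] by simp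
  qed (use mean_free_energy_almost_superadditive[OF p] in auto)
  then have "convergent (\<lambda>N. mean_free_energy p ?k N / real N - (\<beta>\<^sup>2 / 4 + ln 2))"
    by (intro convergent_diff convergent_const)
  moreover have "\<forall>\<^sub>F N in sequentially.
      mean_free_energy p ?k N / real N - (\<beta>\<^sup>2 / 4 + ln 2) = mean_log_ratio p N \<beta> / real N"
    using eventually_ge_at_top[of 1]
    by eventually_elim (simp add: mean_log_ratio_eq_mean_free_energy[OF _ p] diff_divide_distrib)
  ultimately show ?thesis by (simp cong: convergent_cong)
qed

section \<open>The replica symmetric phase\<close>

subsection \<open>The overlap of uniform configurations\<close>

lemma sum_cosh_overlap:
  assumes \<sigma>: "\<sigma> \<in> Sigma N"
  shows "(\<Sum>\<tau>\<in>Sigma N. cosh (l * (\<Sum>i<N. \<sigma> i * \<tau> i))) = (2 * cosh l) ^ N"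
proof -
  have exp: "(\<Sum>\<tau>\<in>Sigma N. exp (k * (\<Sum>i<N. \<sigma> i * \<tau> i))) = (2 * cosh k) ^ N" for k
  proof -
    have "(\<Sum>\<tau>\<in>Sigma N. exp (k * (\<Sum>i<N. \<sigma> i * \<tau> i))) = (\<Sum>\<tau>\<in>{..<N} \<rightarrow>\<^sub>E {-1, 1}. \<Prod>i<N. exp (k * (\<sigma> i * \<tau> i)))"
      by (simp add: Sigma_def sum_distrib_left exp_sum)
    also have "\<dots> = (\<Prod>i<N. \<Sum>t\<in>{-1, 1}. exp (k * (\<sigma> i * t)))"
      by (subst prod_sum_PiE) auto
    also have "\<dots> = (\<Prod>i<N. 2 * cosh k)"
    proof (rule prod.cong[OF refl])
      fix i assume "i \<in> {..<N}"
      then show "(\<Sum>t\<in>{-1, 1}. exp (k * (\<sigma> i * t))) = 2 * cosh k"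
        using \<sigma> by (auto elim!: Sigma_cases[of \<sigma> N i] simp: cosh_field_def)
    qed
    finally show ?thesis by simp
  qed
  have "(\<Sum>\<tau>\<in>Sigma N. cosh (l * (\<Sum>i<N. \<sigma> i * \<tau> i))) =
      ((\<Sum>\<tau>\<in>Sigma N. exp (l * (\<Sum>i<N. \<sigma> i * \<tau> i))) + (\<Sum>\<tau>\<in>Sigma N. exp (- l * (\<Sum>i<N. \<sigma> i * \<tau> i)))) / 2"
    by (simp add: cosh_field_def sum.distrib flip: sum_divide_distrib)
  then show ?thesis unfolding exp by simp
qed

lemma sum_overlap_tail_le:
  assumes \<sigma>: "\<sigma> \<in> Sigma N" and N: "N \<ge> 1" and v: "v \<ge> 0"
  shows "(\<Sum>\<tau>\<in>Sigma N. of_bool (v \<le> \<bar>overlap N \<sigma> \<tau>\<bar>)) \<le> 2 ^ N * (2 * exp (- (v\<^sup>2 / 2) * real N))"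
proof -
  let ?T = "\<lambda>\<tau>. \<Sum>i<N. \<sigma> i * \<tau> i"
  have markov: "of_bool (v \<le> \<bar>overlap N \<sigma> \<tau>\<bar>) \<le> 2 * exp (- v\<^sup>2 * real N) * cosh (v * ?T \<tau>)" for \<tau>
  proof (cases "v \<le> \<bar>overlap N \<sigma> \<tau>\<bar>")
    case True
    then have "v * real N \<le> \<bar>?T \<tau>\<bar>" using N by (simp add: overlap_def field_simps)
    then have "v * (v * real N) \<le> v * \<bar>?T \<tau>\<bar>" using v by (intro mult_left_mono)
    then have "exp (v\<^sup>2 * real N) \<le> exp \<bar>v * ?T \<tau>\<bar>" using v by (simp add: abs_mult power2_eq_square)
    also have "\<dots> \<le> 2 * cosh (v * ?T \<tau>)" by (auto simp: cosh_field_def abs_if)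
    finally have "exp (- v\<^sup>2 * real N) * exp (v\<^sup>2 * real N) \<le> exp (- v\<^sup>2 * real N) * (2 * cosh (v * ?T \<tau>))"
      by (rule mult_left_mono) simp
    then show ?thesis using True by (simp flip: exp_add)
  qed simp
  have "(\<Sum>\<tau>\<in>Sigma N. of_bool (v \<le> \<bar>overlap N \<sigma> \<tau>\<bar>)) \<le> (\<Sum>\<tau>\<in>Sigma N. 2 * exp (- v\<^sup>2 * real N) * cosh (v * ?T \<tau>))"
    by (intro sum_mono markov)
  also have "\<dots> = 2 * exp (- v\<^sup>2 * real N) * (2 * cosh v) ^ N"
    by (simp only: sum_distrib_left[symmetric] sum_cosh_overlap[OF \<sigma>])
  also have "\<dots> \<le> 2 * exp (- v\<^sup>2 * real N) * (2 * exp (v\<^sup>2 / 2)) ^ N"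
    using cosh_le_exp[of v] by (intro mult_left_mono power_mono) auto
  also have "\<dots> = 2 ^ N * (2 * (exp (- v\<^sup>2 * real N) * exp (v\<^sup>2 / 2 * real N)))"
    by (simp add: power_mult_distrib exp_of_nat_mult[symmetric] mult.commute)
  also have "exp (- v\<^sup>2 * real N) * exp (v\<^sup>2 / 2 * real N) = exp (- (v\<^sup>2 / 2) * real N)"
    by (simp flip: exp_add add: field_simps)
  finally show ?thesis .
qed

lemma abs_overlap_eq_divide:
  assumes "\<sigma> \<in> Sigma N" "\<tau> \<in> Sigma N" "N \<ge> 1"
  obtains k where "k \<le> N" "\<bar>overlap N \<sigma> \<tau>\<bar> = real k / real N"
proof -
  have "\<sigma> i * \<tau> i \<in> \<int>" if "i < N" for i
    using Sigma_cases[OF assms(1) that] Sigma_cases[OF assms(2) that]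
    by (metis Ints_1 Ints_minus Ints_mult)
  then have "(\<Sum>i<N. \<sigma> i * \<tau> i) \<in> \<int>" by (intro Ints_sum) auto
  then obtain z where "(\<Sum>i<N. \<sigma> i * \<tau> i) = of_int z" by (auto elim: Ints_cases)
  then have overlap: "\<bar>overlap N \<sigma> \<tau>\<bar> = real (nat \<bar>z\<bar>) / real N" by (simp add: overlap_def)
  then have "real (nat \<bar>z\<bar>) \<le> real N"
    using abs_overlap_le_1[OF assms(1,2)] assms(3) by (simp add: divide_le_eq)
  then show ?thesis using overlap by (intro that[of "nat \<bar>z\<bar>"]) auto
qed

lemma sum_exp_overlap_power_le:
  assumes N: "N \<ge> 1" and p: "p \<ge> 2" and \<sigma>: "\<sigma> \<in> Sigma N"
  shows "(\<Sum>\<tau>\<in>Sigma N. exp (1 / 2 * real N * overlap N \<sigma> \<tau> ^ p)) \<le> 2 ^ N * (2 * (real N + 1))"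
proof -
  let ?e = "\<lambda>k. exp ((real k / real N)\<^sup>2 / 2 * real N)"
  let ?b = "\<lambda>k \<tau>. of_bool (real k / real N \<le> \<bar>overlap N \<sigma> \<tau>\<bar>) :: real"
  have "exp (1 / 2 * real N * overlap N \<sigma> \<tau> ^ p) \<le> (\<Sum>k\<le>N. ?e k * ?b k \<tau>)" if \<tau>: "\<tau> \<in> Sigma N" for \<tau>
  proof -
    obtain k where k: "k \<le> N" "\<bar>overlap N \<sigma> \<tau>\<bar> = real k / real N"
      using abs_overlap_eq_divide[OF \<sigma> \<tau> N] by blast
    have "overlap N \<sigma> \<tau> ^ p \<le> \<bar>overlap N \<sigma> \<tau>\<bar> ^ p" by (simp flip: power_abs)
    also have "\<dots> \<le> \<bar>overlap N \<sigma> \<tau>\<bar> ^ 2" using abs_overlap_le_1[OF \<sigma> \<tau>] p by (intro power_decreasing) auto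
    finally have "exp (1 / 2 * real N * overlap N \<sigma> \<tau> ^ p) \<le> ?e k * ?b k \<tau>"
      unfolding k(2) using mult_left_mono[of "overlap N \<sigma> \<tau> ^ p" "(real k / real N)\<^sup>2" "real N / 2"] by (simp add: mult_ac)
    also have "\<dots> \<le> (\<Sum>k\<le>N. ?e k * ?b k \<tau>)"
      using k(1) by (intro member_le_sum[where f = "\<lambda>k. ?e k * ?b k \<tau>"]) auto
    finally show ?thesis .
  qed
  then have "(\<Sum>\<tau>\<in>Sigma N. exp (1 / 2 * real N * overlap N \<sigma> \<tau> ^ p)) \<le> (\<Sum>\<tau>\<in>Sigma N. \<Sum>k\<le>N. ?e k * ?b k \<tau>)"
    by (rule sum_mono)
  also have "\<dots> = (\<Sum>k\<le>N. ?e k * (\<Sum>\<tau>\<in>Sigma N. ?b k \<tau>))"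
    unfolding sum_distrib_left by (rule sum.swap)
  also have "\<dots> \<le> (\<Sum>k\<le>N. ?e k * (2 ^ N * (2 * exp (- ((real k / real N)\<^sup>2 / 2) * real N))))"
    by (intro sum_mono mult_left_mono sum_overlap_tail_le[OF \<sigma> N]) auto
  also have "\<dots> = (\<Sum>k\<le>N. 2 ^ N * 2)"
  proof (rule sum.cong[OF refl])
    fix k
    have "?e k * exp (- ((real k / real N)\<^sup>2 / 2) * real N) = 1" by (simp flip: exp_add)
    then show "?e k * (2 ^ N * (2 * exp (- ((real k / real N)\<^sup>2 / 2) * real N))) = 2 ^ N * 2"
      by (simp only: mult.left_commute mult_1_right)
  qed
  finally show ?thesis by (simp add: algebra_simps)
qed

subsection \<open>The second moment of the partition function\<close>

lemma
  assumes N: "N \<ge> 1" "p \<ge> 1" and Sigma: "\<sigma> \<in> Sigma N" "\<tau> \<in> Sigma N"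
  shows integrable_exp_normalized_energy_pair:
      "integrable iid_gauss (\<lambda>g. exp (normalized_energy p N \<beta> g \<sigma> + normalized_energy p N \<beta> g \<tau>))"
    and integral_exp_normalized_energy_pair:
      "(\<integral>g. exp (normalized_energy p N \<beta> g \<sigma> + normalized_energy p N \<beta> g \<tau>) \<partial>iid_gauss) =
        exp (\<beta>\<^sup>2 / 2 * real N * overlap N \<sigma> \<tau> ^ p) / 4 ^ N"
proof -
  let ?E = "\<lambda>g. normalized_energy p N \<beta> g \<sigma> + normalized_energy p N \<beta> g \<tau>"
  let ?c = "coupling_coeff p N" and ?q = "overlap N \<sigma> \<tau> ^ p"
  let ?b = "\<lambda>xs. \<beta> / sqrt 2 * (?c xs \<sigma> + ?c xs \<tau>)"
  have square: "(?b xs)\<^sup>2 = \<beta>\<^sup>2 / 2 * (?c xs \<sigma> * ?c xs \<sigma>) + \<beta>\<^sup>2 / 2 * (?c xs \<tau> * ?c xs \<tau>) + \<beta>\<^sup>2 * (?c xs \<sigma> * ?c xs \<tau>)" for xs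
    by (simp add: power_mult_distrib power_divide power2_eq_square algebra_simps)
  have "(\<Sum>xs\<in>idx p N. (?b xs)\<^sup>2) = \<beta>\<^sup>2 / 2 * (\<Sum>xs\<in>idx p N. ?c xs \<sigma> * ?c xs \<sigma>) +
      \<beta>\<^sup>2 / 2 * (\<Sum>xs\<in>idx p N. ?c xs \<tau> * ?c xs \<tau>) + \<beta>\<^sup>2 * (\<Sum>xs\<in>idx p N. ?c xs \<sigma> * ?c xs \<tau>)"
    by (simp only: square sum.distrib sum_distrib_left)
  also have "\<dots> = \<beta>\<^sup>2 * real N * (1 + ?q)"
    by (simp add: sum_coupling_coeff_mult[OF N] overlap_self[OF N(1)] Sigma algebra_simps)
  finally have mgf: "(\<integral>\<^sup>+g. ennreal (exp (\<Sum>xs\<in>idx p N. ?b xs * g xs)) \<partial>iid_gauss) = ennreal (exp (\<beta>\<^sup>2 / 2 * real N * (1 + ?q)))"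
    by (subst nn_integral_exp_linear) simp_all
  have energy: "?E g = - ((\<beta>\<^sup>2 / 2 + 2 * ln 2) * real N) + (\<Sum>xs\<in>idx p N. ?b xs * g xs)" for g
    by (simp add: normalized_energy_def H_eq_sum_coupling_coeff sum_distrib_left sum.distrib algebra_simps)
  have "exp (real N * (2 * ln 2)) = (4 :: real) ^ N"
    unfolding exp_of_nat_mult by (simp add: exp_double)
  moreover have "- ((\<beta>\<^sup>2 / 2 + 2 * ln 2) * real N) + \<beta>\<^sup>2 / 2 * real N * (1 + ?q) =
      \<beta>\<^sup>2 / 2 * real N * ?q - real N * (2 * ln 2)"
    by (simp add: algebra_simps)
  ultimately have prefactor: "exp (- ((\<beta>\<^sup>2 / 2 + 2 * ln 2) * real N)) * exp (\<beta>\<^sup>2 / 2 * real N * (1 + ?q)) =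
      exp (\<beta>\<^sup>2 / 2 * real N * ?q) / 4 ^ N"
    by (simp only: exp_add[symmetric] exp_diff)
  have "(\<integral>\<^sup>+g. ennreal (exp (?E g)) \<partial>iid_gauss) = (\<integral>\<^sup>+g. ennreal (exp (- ((\<beta>\<^sup>2 / 2 + 2 * ln 2) * real N))) *
      ennreal (exp (\<Sum>xs\<in>idx p N. ?b xs * g xs)) \<partial>iid_gauss)"
    unfolding energy exp_add by (simp add: ennreal_mult)
  also have "\<dots> = ennreal (exp (\<beta>\<^sup>2 / 2 * real N * ?q) / 4 ^ N)"
    unfolding prefactor[symmetric] by (subst nn_integral_cmult, measurable) (simp only: mgf ennreal_mult exp_ge_zero)
  finally have "integrable iid_gauss (\<lambda>g. exp (?E g)) \<and> (\<integral>g. exp (?E g) \<partial>iid_gauss) = exp (\<beta>\<^sup>2 / 2 * real N * ?q) / 4 ^ N"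
    by (subst (asm) nn_integral_eq_integrable) auto
  then show "integrable iid_gauss (\<lambda>g. exp (?E g))" "(\<integral>g. exp (?E g) \<partial>iid_gauss) = exp (\<beta>\<^sup>2 / 2 * real N * ?q) / 4 ^ N"
    by blast+
qed

lemma
  assumes N: "N \<ge> 1" "p \<ge> 1"
  shows integrable_sum_pairs: "integrable iid_gauss
      (\<lambda>g. \<Sum>\<sigma>\<in>Sigma N. \<Sum>\<tau>\<in>Sigma N. exp (normalized_energy p N \<beta> g \<sigma> + normalized_energy p N \<beta> g \<tau>) * c \<sigma> \<tau>)"
    and integral_sum_pairs:
      "(\<integral>g. (\<Sum>\<sigma>\<in>Sigma N. \<Sum>\<tau>\<in>Sigma N. exp (normalized_energy p N \<beta> g \<sigma> + normalized_energy p N \<beta> g \<tau>) * c \<sigma> \<tau>) \<partial>iid_gauss) =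
        (\<Sum>\<sigma>\<in>Sigma N. \<Sum>\<tau>\<in>Sigma N. exp (\<beta>\<^sup>2 / 2 * real N * overlap N \<sigma> \<tau> ^ p) / 4 ^ N * c \<sigma> \<tau>)"
proof -
  note integrable_exp_normalized_energy_pair[OF N, simp] integral_exp_normalized_energy_pair[OF N, simp]
  show "integrable iid_gauss
      (\<lambda>g. \<Sum>\<sigma>\<in>Sigma N. \<Sum>\<tau>\<in>Sigma N. exp (normalized_energy p N \<beta> g \<sigma> + normalized_energy p N \<beta> g \<tau>) * c \<sigma> \<tau>)"
    by (intro Bochner_Integration.integrable_sum integrable_mult_left) simp
  show "(\<integral>g. (\<Sum>\<sigma>\<in>Sigma N. \<Sum>\<tau>\<in>Sigma N. exp (normalized_energy p N \<beta> g \<sigma> + normalized_energy p N \<beta> g \<tau>) * c \<sigma> \<tau>) \<partial>iid_gauss) =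
      (\<Sum>\<sigma>\<in>Sigma N. \<Sum>\<tau>\<in>Sigma N. exp (\<beta>\<^sup>2 / 2 * real N * overlap N \<sigma> \<tau> ^ p) / 4 ^ N * c \<sigma> \<tau>)"
    by (simp add: Bochner_Integration.integral_sum)
qed

lemma
  assumes N: "N \<ge> 1" and p: "p \<ge> 2"
  shows integrable_exp_log_ratio_square: "integrable iid_gauss (\<lambda>g. (exp (log_ratio p N 1 g))\<^sup>2)"
    and integral_exp_log_ratio_square_le: "(\<integral>g. (exp (log_ratio p N 1 g))\<^sup>2 \<partial>iid_gauss) \<le> 2 * (real N + 1)"
proof -
  have p1: "p \<ge> 1" using p by simp
  have square: "(exp (log_ratio p N 1 g))\<^sup>2 =
      (\<Sum>\<sigma>\<in>Sigma N. \<Sum>\<tau>\<in>Sigma N. exp (normalized_energy p N 1 g \<sigma> + normalized_energy p N 1 g \<tau>) * 1)" for g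
    by (simp add: exp_log_ratio power2_eq_square sum_product exp_add)
  show "integrable iid_gauss (\<lambda>g. (exp (log_ratio p N 1 g))\<^sup>2)"
    unfolding square by (rule integrable_sum_pairs[OF N p1])
  have "(\<integral>g. (exp (log_ratio p N 1 g))\<^sup>2 \<partial>iid_gauss) =
      (\<Sum>\<sigma>\<in>Sigma N. (\<Sum>\<tau>\<in>Sigma N. exp (1 / 2 * real N * overlap N \<sigma> \<tau> ^ p)) / 4 ^ N)"
    unfolding square integral_sum_pairs[OF N p1] by (simp add: sum_divide_distrib)
  also have "\<dots> \<le> (\<Sum>\<sigma>\<in>Sigma N. 2 ^ N * (2 * (real N + 1)) / 4 ^ N)"
    by (intro sum_mono divide_right_mono sum_exp_overlap_power_le N p) auto
  also have "\<dots> = (2 ^ N * 2 ^ N / 4 ^ N) * (2 * (real N + 1))" by (simp add: card_Sigma)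
  also have "(2 ^ N * 2 ^ N / 4 ^ N :: real) = 1" by (simp flip: power_mult_distrib)
  finally show "(\<integral>g. (exp (log_ratio p N 1 g))\<^sup>2 \<partial>iid_gauss) \<le> 2 * (real N + 1)" by simp
qed

lemma prob_log_ratio_ge:
  assumes N: "N \<ge> 1" and p: "p \<ge> 2"
  shows "1 \<le> 8 * (real N + 1) * iid_gauss.prob {g. - ln 2 \<le> log_ratio p N 1 g}"
proof -
  let ?X = "\<lambda>g. exp (log_ratio p N 1 g)"
  have p1: "p \<ge> 1" using p by simp
  have "1 / 2 \<le> ?X g \<longleftrightarrow> - ln 2 \<le> log_ratio p N 1 g" for g
    using exp_le_cancel_iff[of "- ln 2" "log_ratio p N 1 g"] by (simp add: exp_minus inverse_eq_divide)
  then have "((\<integral>g. ?X g \<partial>iid_gauss) - 1 / 2)\<^sup>2 \<le>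
      (\<integral>g. (?X g)\<^sup>2 \<partial>iid_gauss) * iid_gauss.prob {g. - ln 2 \<le> log_ratio p N 1 g}"
    using iid_gauss.paley_zygmund[OF integrable_exp_log_ratio[OF N p1] integrable_exp_log_ratio_square[OF N p], of "1 / 2"]
    by (simp add: integral_exp_log_ratio[OF N p1])
  also have "\<dots> \<le> (2 * (real N + 1)) * iid_gauss.prob {g. - ln 2 \<le> log_ratio p N 1 g}"
    by (intro mult_right_mono integral_exp_log_ratio_square_le N p) simp
  finally show ?thesis by (simp add: integral_exp_log_ratio[OF N p1] power2_eq_square algebra_simps)
qed

lemma mean_log_ratio_1_ge:
  assumes p: "p \<ge> 2" and \<eta>: "\<eta> > 0"
  shows "\<forall>\<^sub>F N in sequentially. - \<eta> * real N \<le> mean_log_ratio p N 1"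
proof -
  define c where "c = (\<eta> / 2)\<^sup>2 / (2 * 1\<^sup>2)"
  have c: "c > 0" using \<eta> by (simp add: c_def)
  have "(\<lambda>N. 8 * (real N + 1) * exp (- c * real N)) \<longlonglongrightarrow> 0"
    using c by real_asymp
  then have small: "\<forall>\<^sub>F N in sequentially. 8 * (real N + 1) * exp (- c * real N) < 1"
    by (rule order_tendstoD) simp
  have "filterlim (\<lambda>N. \<eta> / 2 * real N) at_top sequentially"
    using \<eta> by real_asymp
  then have large: "\<forall>\<^sub>F N in sequentially. ln 2 \<le> \<eta> / 2 * real N"
    by (simp add: filterlim_at_top)
  show ?thesis
    using small large eventually_ge_at_top[of 1]
  proof eventually_elim
    case (elim N)
    show ?case
    proof (rule ccontr)
      assume contr: "\<not> - \<eta> * real N \<le> mean_log_ratio p N 1"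
      have "iid_gauss.prob {g. - ln 2 \<le> log_ratio p N 1 g} \<le>
          iid_gauss.prob {g. (\<integral>g. log_ratio p N 1 g \<partial>iid_gauss) + \<eta> / 2 * real N \<le> log_ratio p N 1 g}"
        using contr elim(2) by (intro iid_gauss.finite_measure_mono) (auto simp: mean_log_ratio_def)
      also have "\<dots> \<le> exp (- c * real N)"
        using iid_gauss.subgaussian_linear_tails(1)[OF subgaussian_log_ratio[of N p 1 1], of "\<eta> / 2"] elim(3) p \<eta>
        by (simp add: c_def)
      finally have "8 * (real N + 1) * iid_gauss.prob {g. - ln 2 \<le> log_ratio p N 1 g} \<le> 8 * (real N + 1) * exp (- c * real N)"
        by (rule mult_left_mono) simp
      then show False using prob_log_ratio_ge[OF elim(3) p] elim(1) by linarith
    qed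
  qed
qed

subsection \<open>The limiting free energy\<close>

lemma prob_log_ratio_deviation_le:
  assumes N: "N \<ge> 1" and p: "p \<ge> 1" and \<beta>: "\<beta> > 0" and e: "e > 0"
  shows "iid_gauss.prob {g. e \<le> \<bar>(log_ratio p N \<beta> g - mean_log_ratio p N \<beta>) / real N\<bar>} \<le> 2 * exp (- (e\<^sup>2 / (2 * \<beta>\<^sup>2)) * real N)"
proof -
  let ?W = "log_ratio p N \<beta>" and ?m = "\<integral>g. log_ratio p N \<beta> g \<partial>iid_gauss"
  have W: "subgaussian iid_gauss ?W (\<beta>\<^sup>2 / 2 * real N)"
    using \<beta> by (intro subgaussian_log_ratio N p) auto
  have event: "{g. e \<le> \<bar>(?W g - mean_log_ratio p N \<beta>) / real N\<bar>} = {g. ?m + e * real N \<le> ?W g} \<union> {g. ?W g \<le> ?m - e * real N}"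
    using N by (auto simp: mean_log_ratio_def abs_divide pos_le_divide_eq)
  have "iid_gauss.prob {g. e \<le> \<bar>(?W g - mean_log_ratio p N \<beta>) / real N\<bar>} \<le>
      iid_gauss.prob {g. ?m + e * real N \<le> ?W g} + iid_gauss.prob {g. ?W g \<le> ?m - e * real N}"
    unfolding event by (rule measure_Un_le) measurable
  also have "\<dots> \<le> exp (- (e\<^sup>2 / (2 * \<beta>\<^sup>2)) * real N) + exp (- (e\<^sup>2 / (2 * \<beta>\<^sup>2)) * real N)"
    using iid_gauss.subgaussian_linear_tails[OF W \<beta> _ e] N by (intro add_mono) auto
  finally show ?thesis by simp
qed

lemma log_ratio_AE_concentrated:
  assumes p: "p \<ge> 1" and \<beta>: "\<beta> > 0"
  shows "AE g in iid_gauss. (\<lambda>N. (log_ratio p N \<beta> g - mean_log_ratio p N \<beta>) / real N) \<longlonglongrightarrow> 0"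
proof (rule iid_gauss.AE_tendsto_0_if_summable_tails)
  fix e :: real assume e: "e > 0"
  let ?c = "e\<^sup>2 / (2 * \<beta>\<^sup>2)"
  show "summable (\<lambda>N. iid_gauss.prob {g\<in>space iid_gauss. e \<le> \<bar>(log_ratio p N \<beta> g - mean_log_ratio p N \<beta>) / real N\<bar>})"
  proof (rule summable_comparison_test'[where N = 1])
    show "summable (\<lambda>N. 2 * exp (- ?c) ^ N)"
      using e \<beta> by (intro summable_mult summable_geometric) auto
    show "norm (iid_gauss.prob {g\<in>space iid_gauss. e \<le> \<bar>(log_ratio p N \<beta> g - mean_log_ratio p N \<beta>) / real N\<bar>}) \<le> 2 * exp (- ?c) ^ N"
      if "N \<ge> 1" for N
      using prob_log_ratio_deviation_le[OF that p \<beta> e] by (simp add: exp_of_nat2_mult[symmetric])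
  qed
qed measurable

lemma FN_eq_log_ratio:
  assumes "N \<ge> 1"
  shows "FN p N g \<beta> = log_ratio p N \<beta> g / real N + \<beta>\<^sup>2 / 4"
proof -
  have "FN p N g \<beta> = log_sum_exp (Sigma N) (\<lambda>\<sigma>. \<beta> / sqrt 2 * H p N g \<sigma> + (- real N * ln 2)) / real N"
    unfolding FN_def log_sum_exp_def weight_def exp_add by (simp add: powr_def mult.commute)
  also have "\<dots> = (log_sum_exp (Sigma N) (\<lambda>\<sigma>. \<beta> / sqrt 2 * H p N g \<sigma>) - real N * ln 2) / real N"
    by (subst log_sum_exp_add_const) auto
  also have "\<dots> = log_ratio p N \<beta> g / real N + \<beta>\<^sup>2 / 4"
    unfolding log_ratio_eq_log_sum_exp_H using assms by (simp add: field_simps)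
  finally show ?thesis .
qed

lemma disorder_eq_iid_gauss: "disorder = iid_gauss"
  by (simp add: disorder_def iid_gauss_def)

lemma F_eq_lim_mean_log_ratio:
  assumes p: "p \<ge> 1" and \<beta>: "\<beta> > 0" and L: "(\<lambda>N. mean_log_ratio p N \<beta> / real N) \<longlonglongrightarrow> L"
  shows "F p \<beta> = L + \<beta>\<^sup>2 / 4"
proof -
  have AE: "AE g in iid_gauss. (\<lambda>N. FN p N g \<beta>) \<longlonglongrightarrow> L + \<beta>\<^sup>2 / 4"
    using log_ratio_AE_concentrated[OF p \<beta>]
  proof (rule AE_mp, intro AE_I2 impI)
    fix g assume "(\<lambda>N. (log_ratio p N \<beta> g - mean_log_ratio p N \<beta>) / real N) \<longlonglongrightarrow> 0"
    from tendsto_add[OF tendsto_add[OF this L] tendsto_const[of "\<beta>\<^sup>2 / 4"]]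
    have "(\<lambda>N. log_ratio p N \<beta> g / real N + \<beta>\<^sup>2 / 4) \<longlonglongrightarrow> L + \<beta>\<^sup>2 / 4" by (simp add: diff_divide_distrib)
    moreover have "\<forall>\<^sub>F N in sequentially. log_ratio p N \<beta> g / real N + \<beta>\<^sup>2 / 4 = FN p N g \<beta>"
      using eventually_ge_at_top[of 1] by (rule eventually_mono) (simp add: FN_eq_log_ratio)
    ultimately show "(\<lambda>N. FN p N g \<beta>) \<longlonglongrightarrow> L + \<beta>\<^sup>2 / 4" by (rule Lim_transform_eventually)
  qed
  show ?thesis
    unfolding F_def disorder_eq_iid_gauss
  proof (rule the_equality)
    show "AE g in iid_gauss. (\<lambda>N. FN p N g \<beta>) \<longlonglongrightarrow> L + \<beta>\<^sup>2 / 4" by (rule AE)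
    fix c assume "AE g in iid_gauss. (\<lambda>N. FN p N g \<beta>) \<longlonglongrightarrow> c"
    with AE have "AE g in (iid_gauss :: (nat list \<Rightarrow> real) measure). c = L + \<beta>\<^sup>2 / 4"
      by eventually_elim (rule LIMSEQ_unique)
    then show "c = L + \<beta>\<^sup>2 / 4" by simp
  qed
qed

lemma replica_sym_iff:
  assumes p: "p \<ge> 1" and \<beta>: "\<beta> > 0"
  shows "\<beta> \<in> replica_sym p \<longleftrightarrow> (\<lambda>N. mean_log_ratio p N \<beta> / real N) \<longlonglongrightarrow> 0"
proof -
  obtain L where L: "(\<lambda>N. mean_log_ratio p N \<beta> / real N) \<longlonglongrightarrow> L"
    using mean_log_ratio_convergent[OF p less_imp_le[OF \<beta>]] by (auto simp: convergent_def)
  then have "\<beta> \<in> replica_sym p \<longleftrightarrow> L = 0"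
    using F_eq_lim_mean_log_ratio[OF p \<beta> L] \<beta> by (simp add: replica_sym_def)
  then show ?thesis using L LIMSEQ_unique by blast
qed

lemma one_in_replica_sym:
  assumes p: "p \<ge> 2"
  shows "1 \<in> replica_sym p"
proof -
  have p1: "p \<ge> 1" using p by simp
  have "(\<lambda>N. mean_log_ratio p N 1 / real N) \<longlonglongrightarrow> 0"
  proof (rule tendstoI)
    fix e :: real assume e: "e > 0"
    show "\<forall>\<^sub>F N in sequentially. dist (mean_log_ratio p N 1 / real N) 0 < e"
      using mean_log_ratio_1_ge[OF p half_gt_zero[OF e]] eventually_ge_at_top[of 1]
    proof eventually_elim
      case (elim N)
      have "0 < e * real N" using elim(2) e by simp
      then have "- (e * real N) < mean_log_ratio p N 1" using elim(1) by simp
      moreover have "mean_log_ratio p N 1 \<le> 0" using elim(2) p1 by (intro mean_log_ratio_nonpos) auto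
      ultimately have "- e < mean_log_ratio p N 1 / real N" "mean_log_ratio p N 1 / real N \<le> 0"
        using elim(2) by (simp_all add: pos_less_divide_eq divide_nonpos_nonneg)
      then show ?case using e unfolding dist_real_def by linarith
    qed
  qed
  then show ?thesis by (simp add: replica_sym_iff[OF p1])
qed

lemma replica_symmetric_at_if_less_beta_c:
  assumes p: "p \<ge> 2" and b: "b < beta_c p"
  obtains b' where "b < b'" "replica_symmetric_at p b'"
proof -
  obtain b' where b': "b' \<in> replica_sym p" "b < b'"
    using b less_cSupE[of b "replica_sym p"] one_in_replica_sym[OF p] unfolding beta_c_def by blast
  have p1: "p \<ge> 1" using p by simp
  have pos: "b' > 0" using b'(1) by (simp add: replica_sym_def)
  have "\<forall>\<^sub>F N in sequentially. - \<eta> * real N \<le> mean_log_ratio p N b'" if "\<eta> > 0" for \<eta>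
  proof -
    have "\<forall>\<^sub>F N in sequentially. - \<eta> < mean_log_ratio p N b' / real N"
      using b'(1) that by (intro order_tendstoD(1)[of _ 0]) (simp_all add: replica_sym_iff[OF p1 pos])
    then show ?thesis
      using eventually_ge_at_top[of 1] by eventually_elim (simp add: pos_less_divide_eq)
  qed
  then have "replica_symmetric_at p b'" by (rule replica_symmetric_at.intro[OF p1 pos])
  then show ?thesis by (rule that[OF b'(2)])
qed

subsection \<open>The overlap under the Gibbs measure\<close>

lemma overlap_tail_eq_pair_avg:
  "overlap_tail p N \<beta> \<epsilon> g =
    pair_avg (Sigma N) (normalized_energy p N \<beta> g) (\<lambda>\<sigma> \<tau>. of_bool (\<epsilon> \<le> \<bar>overlap N \<sigma> \<tau>\<bar>))"
proof -
  have "gibbs p N \<beta> g \<sigma> = softmax (Sigma N) (normalized_energy p N \<beta> g) \<sigma>" for \<sigma>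
  proof -
    have "exp (normalized_energy p N \<beta> g \<tau>) = weight p N \<beta> g \<tau> * exp (- ((\<beta>\<^sup>2 / 4 + ln 2) * real N))" for \<tau>
      unfolding normalized_energy_def weight_def exp_add ..
    then show ?thesis
      by (simp add: softmax_eq_divide[OF finite_Sigma Sigma_nonempty] gibbs_def flip: sum_distrib_right)
  qed
  then show ?thesis
    by (simp add: overlap_tail_def gibbs_avg_def sum_distrib_left of_bool_def mult_ac)
qed

lemma expected_overlap_tail_le_1: "(\<integral>g. overlap_tail p N \<beta> \<epsilon> g \<partial>iid_gauss) \<le> 1"
proof -
  have "overlap_tail p N \<beta> \<epsilon> g \<le> 1" for g
    unfolding overlap_tail_eq_pair_avg by (intro gibbs_avg_le) auto
  then have "(\<integral>g. overlap_tail p N \<beta> \<epsilon> g \<partial>iid_gauss) \<le> (\<integral>g. 1 \<partial>(iid_gauss :: (nat list \<Rightarrow> real) measure))"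
    unfolding overlap_tail_eq_pair_avg by (intro integral_mono iid_gauss.integrable_pair_avg) auto
  then show ?thesis by simp
qed

text \<open>For even \<^term>\<open>p\<close> the event \<^term>\<open>x ^ p \<le> 0\<close> is trivial; for odd \<^term>\<open>p\<close> it covers the negative overlaps.\<close>
definition negative_overlap_mass :: "nat \<Rightarrow> nat \<Rightarrow> real \<Rightarrow> real \<Rightarrow> (nat list \<Rightarrow> real) \<Rightarrow> real" where
  "negative_overlap_mass p N \<beta> \<epsilon> g = pair_avg (Sigma N) (normalized_energy p N \<beta> g)
     (\<lambda>\<sigma> \<tau>. of_bool (\<epsilon> \<le> \<bar>overlap N \<sigma> \<tau>\<bar> \<and> overlap N \<sigma> \<tau> ^ p \<le> 0))"

lemma integrable_negative_overlap_mass: "integrable iid_gauss (negative_overlap_mass p N \<beta> \<epsilon>)"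
  unfolding negative_overlap_mass_def[abs_def] by (rule iid_gauss.integrable_pair_avg) auto

lemma overlap_tail_le:
  assumes "\<epsilon> \<ge> 0"
  shows "overlap_tail p N \<beta> \<epsilon> g \<le> pair_overlap_mass p N \<beta> (\<epsilon> ^ p) g + negative_overlap_mass p N \<beta> \<epsilon> g"
proof -
  have "\<epsilon> ^ p \<le> x ^ p \<or> x ^ p \<le> 0" if "\<epsilon> \<le> \<bar>x\<bar>" for x :: real
    using power_mono[OF that assms, of p] unfolding power_abs[symmetric] by linarith
  then have "of_bool (\<epsilon> \<le> \<bar>x\<bar>) \<le> (of_bool (\<epsilon> ^ p \<le> x ^ p) + of_bool (\<epsilon> \<le> \<bar>x\<bar> \<and> x ^ p \<le> 0) :: real)" for x :: real
    by auto
  then show ?thesis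
    unfolding overlap_tail_eq_pair_avg pair_overlap_mass_def negative_overlap_mass_def gibbs_avg_add[symmetric]
    by (intro gibbs_avg_mono)
qed

lemma negative_overlap_mass_le:
  "negative_overlap_mass p N \<beta> \<epsilon> g \<le> of_bool (log_ratio p N \<beta> g \<le> - y) +
    exp (2 * y) * (\<Sum>\<sigma>\<in>Sigma N. \<Sum>\<tau>\<in>Sigma N. exp (normalized_energy p N \<beta> g \<sigma> + normalized_energy p N \<beta> g \<tau>) *
      of_bool (\<epsilon> \<le> \<bar>overlap N \<sigma> \<tau>\<bar> \<and> overlap N \<sigma> \<tau> ^ p \<le> 0))" (is "_ \<le> _ + _ * ?Z")
proof -
  have Z: "0 \<le> ?Z" by (intro sum_nonneg) auto
  show ?thesis
  proof (cases "log_ratio p N \<beta> g \<le> - y")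
    case True
    have "negative_overlap_mass p N \<beta> \<epsilon> g \<le> 1"
      unfolding negative_overlap_mass_def by (intro gibbs_avg_le) auto
    then show ?thesis using True Z by (simp add: add_increasing2)
  next
    case False
    have "negative_overlap_mass p N \<beta> \<epsilon> g = exp (- 2 * log_ratio p N \<beta> g) * ?Z"
      unfolding negative_overlap_mass_def gibbs_avg_def softmax_def log_ratio_def[symmetric] sum_distrib_left
      by (intro sum.cong refl) (simp add: exp_add[symmetric] mult.assoc[symmetric])
    also have "\<dots> \<le> exp (2 * y) * ?Z" using False Z by (intro mult_right_mono) auto
    finally show ?thesis using False by simp
  qed
qed

lemma annealed_negative_overlap_le:
  assumes N: "N \<ge> 1" and \<epsilon>: "\<epsilon> \<ge> 0"
  shows "(\<Sum>\<sigma>\<in>Sigma N. \<Sum>\<tau>\<in>Sigma N. exp (\<beta>\<^sup>2 / 2 * real N * overlap N \<sigma> \<tau> ^ p) / 4 ^ N *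
      of_bool (\<epsilon> \<le> \<bar>overlap N \<sigma> \<tau>\<bar> \<and> overlap N \<sigma> \<tau> ^ p \<le> 0)) \<le> 2 * exp (- (\<epsilon>\<^sup>2 / 2) * real N)"
proof -
  have "exp (\<beta>\<^sup>2 / 2 * real N * overlap N \<sigma> \<tau> ^ p) / 4 ^ N * of_bool (\<epsilon> \<le> \<bar>overlap N \<sigma> \<tau>\<bar> \<and> overlap N \<sigma> \<tau> ^ p \<le> 0) \<le>
      1 / 4 ^ N * of_bool (\<epsilon> \<le> \<bar>overlap N \<sigma> \<tau>\<bar>)" for \<sigma> \<tau>
    by (auto intro!: divide_right_mono mult_nonneg_nonpos)
  then have "(\<Sum>\<sigma>\<in>Sigma N. \<Sum>\<tau>\<in>Sigma N. exp (\<beta>\<^sup>2 / 2 * real N * overlap N \<sigma> \<tau> ^ p) / 4 ^ N *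
      of_bool (\<epsilon> \<le> \<bar>overlap N \<sigma> \<tau>\<bar> \<and> overlap N \<sigma> \<tau> ^ p \<le> 0)) \<le>
      (\<Sum>\<sigma>\<in>Sigma N. 1 / 4 ^ N * (\<Sum>\<tau>\<in>Sigma N. of_bool (\<epsilon> \<le> \<bar>overlap N \<sigma> \<tau>\<bar>)))"
    unfolding sum_distrib_left by (intro sum_mono)
  also have "\<dots> \<le> (\<Sum>\<sigma>\<in>Sigma N. 1 / 4 ^ N * (2 ^ N * (2 * exp (- (\<epsilon>\<^sup>2 / 2) * real N))))"
    by (intro sum_mono mult_left_mono sum_overlap_tail_le N \<epsilon>) auto
  also have "\<dots> = (2 ^ N * 2 ^ N / 4 ^ N) * (2 * exp (- (\<epsilon>\<^sup>2 / 2) * real N))" by (simp add: card_Sigma)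
  also have "(2 ^ N * 2 ^ N / 4 ^ N :: real) = 1" by (simp flip: power_mult_distrib)
  finally show ?thesis by simp
qed

lemma expected_negative_overlap_mass_le:
  assumes N: "N \<ge> 1" and p: "p \<ge> 1" and \<epsilon>: "\<epsilon> \<ge> 0"
  shows "(\<integral>g. negative_overlap_mass p N \<beta> \<epsilon> g \<partial>iid_gauss) \<le>
    iid_gauss.prob {g. log_ratio p N \<beta> g \<le> - y} + exp (2 * y) * (2 * exp (- (\<epsilon>\<^sup>2 / 2) * real N))"
proof -
  let ?Z = "\<lambda>g. \<Sum>\<sigma>\<in>Sigma N. \<Sum>\<tau>\<in>Sigma N. exp (normalized_energy p N \<beta> g \<sigma> + normalized_energy p N \<beta> g \<tau>) *
    of_bool (\<epsilon> \<le> \<bar>overlap N \<sigma> \<tau>\<bar> \<and> overlap N \<sigma> \<tau> ^ p \<le> 0)"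
  have Z: "integrable iid_gauss ?Z" by (rule integrable_sum_pairs[OF N p])
  have "(\<integral>g. negative_overlap_mass p N \<beta> \<epsilon> g \<partial>iid_gauss) \<le>
      (\<integral>g. of_bool (log_ratio p N \<beta> g \<le> - y) + exp (2 * y) * ?Z g \<partial>iid_gauss)"
    by (intro integral_mono integrable_negative_overlap_mass negative_overlap_mass_le
        Bochner_Integration.integrable_add iid_gauss.integrable_of_bool integrable_mult_right Z) auto
  also have "\<dots> = (\<integral>g. of_bool (log_ratio p N \<beta> g \<le> - y) \<partial>iid_gauss) + (\<integral>g. exp (2 * y) * ?Z g \<partial>iid_gauss)"
    by (intro Bochner_Integration.integral_add iid_gauss.integrable_of_bool integrable_mult_right Z) auto
  also have "\<dots> = iid_gauss.prob {g. log_ratio p N \<beta> g \<le> - y} + exp (2 * y) * (\<integral>g. ?Z g \<partial>iid_gauss)"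
    by (simp only: integral_of_bool integral_mult_right_zero space_iid_gauss UNIV_I simp_thms)
  also have "(\<integral>g. ?Z g \<partial>iid_gauss) \<le> 2 * exp (- (\<epsilon>\<^sup>2 / 2) * real N)"
    unfolding integral_sum_pairs[OF N p] by (rule annealed_negative_overlap_le[OF N \<epsilon>])
  finally show ?thesis by (simp add: mult_left_mono)
qed

theorem (in replica_symmetric_at) overlap_tail_exponentially_small:
  assumes range: "0 < a" "a \<le> b'" "b' < b" and \<epsilon>: "\<epsilon> > 0"
  shows "\<exists>c>0. \<forall>\<^sub>F N in sequentially. \<forall>\<beta>\<in>{a..b'}. (\<integral>g. overlap_tail p N \<beta> \<epsilon> g \<partial>iid_gauss) \<le> 4 * exp (- c * real N)"
proof -
  obtain \<gamma> where \<gamma>: "\<gamma> > 0"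
      "\<forall>\<^sub>F N in sequentially. \<forall>\<beta>\<in>{a..b'}. mean_pair_overlap_mass p N \<beta> (\<epsilon> ^ p) \<le> exp (- \<gamma> * real N)"
    using mean_pair_overlap_mass_exponentially_small[OF range, of "\<epsilon> ^ p"] \<epsilon> by auto
  define \<eta> where "\<eta> = \<epsilon>\<^sup>2 / 8"
  have \<eta>: "\<eta> > 0" using \<epsilon> by (simp add: \<eta>_def)
  define c where "c = min \<gamma> (min (\<eta>\<^sup>2 / (8 * b\<^sup>2)) (\<epsilon>\<^sup>2 / 4))"
  have c: "c > 0" "c \<le> \<gamma>" "c \<le> \<eta>\<^sup>2 / (8 * b\<^sup>2)" "c \<le> \<epsilon>\<^sup>2 / 4"
    using \<gamma>(1) \<eta> b \<epsilon> by (auto simp: c_def)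
  have "\<forall>\<^sub>F N in sequentially. \<forall>\<beta>\<in>{a..b'}. (\<integral>g. overlap_tail p N \<beta> \<epsilon> g \<partial>iid_gauss) \<le> 4 * exp (- c * real N)"
    using \<gamma>(2) log_ratio_lower_tail[OF \<eta>] eventually_ge_at_top[of 1]
  proof eventually_elim
    case (elim N)
    have decay: "exp (- x * real N) \<le> exp (- c * real N)" if "c \<le> x" for x
      using mult_right_mono[OF that, of "real N"] by simp
    show ?case
    proof
      fix \<beta> assume \<beta>: "\<beta> \<in> {a..b'}"
      have "(\<integral>g. overlap_tail p N \<beta> \<epsilon> g \<partial>iid_gauss) \<le>
          (\<integral>g. pair_overlap_mass p N \<beta> (\<epsilon> ^ p) g + negative_overlap_mass p N \<beta> \<epsilon> g \<partial>iid_gauss)"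
        using \<epsilon> unfolding overlap_tail_eq_pair_avg
        by (intro integral_mono iid_gauss.integrable_pair_avg Bochner_Integration.integrable_add
            integrable_pair_overlap_mass integrable_negative_overlap_mass overlap_tail_le[unfolded overlap_tail_eq_pair_avg]) auto
      also have "\<dots> = mean_pair_overlap_mass p N \<beta> (\<epsilon> ^ p) + (\<integral>g. negative_overlap_mass p N \<beta> \<epsilon> g \<partial>iid_gauss)"
        unfolding mean_pair_overlap_mass_def
        by (rule Bochner_Integration.integral_add[OF integrable_pair_overlap_mass integrable_negative_overlap_mass])
      also have "\<dots> \<le> exp (- \<gamma> * real N) + (exp (- (\<eta>\<^sup>2 / (8 * b\<^sup>2)) * real N) +
          exp (2 * (\<eta> * real N)) * (2 * exp (- (\<epsilon>\<^sup>2 / 2) * real N)))"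
        using elim(1,2) \<beta> range \<epsilon>
        by (intro add_mono order_trans[OF expected_negative_overlap_mass_le[OF elim(3) p, of \<epsilon> _ "\<eta> * real N"]]) auto
      also have "exp (2 * (\<eta> * real N)) * (2 * exp (- (\<epsilon>\<^sup>2 / 2) * real N)) = 2 * exp (- (\<epsilon>\<^sup>2 / 4) * real N)"
        by (simp add: \<eta>_def field_simps flip: exp_add)
      also have "exp (- \<gamma> * real N) + (exp (- (\<eta>\<^sup>2 / (8 * b\<^sup>2)) * real N) + 2 * exp (- (\<epsilon>\<^sup>2 / 4) * real N)) \<le>
          exp (- c * real N) + (exp (- c * real N) + 2 * exp (- c * real N))"
        by (intro add_mono mult_left_mono decay c) auto
      finally show "(\<integral>g. overlap_tail p N \<beta> \<epsilon> g \<partial>iid_gauss) \<le> 4 * exp (- c * real N)" by simp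
    qed
  qed
  then show ?thesis using c(1) by blast
qed

theorem mainTheorem8:
  fixes p :: nat and a b \<epsilon> :: real
  assumes "p \<ge> 2" and "0 < a" and "a < b" and "b < beta_c p" and "\<epsilon> > 0"
  shows "\<exists>K>0. \<forall>\<beta>\<in>{a..b}. \<forall>N::nat. N \<ge> 1 \<longrightarrow>
           (\<integral>g. overlap_tail p N \<beta> \<epsilon> g \<partial>disorder) \<le> K * exp (- real N / K)"
proof -
  obtain b' where "b < b'" and "replica_symmetric_at p b'"
    using replica_symmetric_at_if_less_beta_c[OF assms(1,4)] .
  then obtain c where "c > 0" and "\<forall>\<^sub>F N in sequentially. \<forall>\<beta>\<in>{a..b}.
      (\<integral>g. overlap_tail p N \<beta> \<epsilon> g \<partial>iid_gauss) \<le> 4 * exp (- c * real N)"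
    using replica_symmetric_at.overlap_tail_exponentially_small[of p b' a b \<epsilon>] assms by auto
  then have "\<exists>K>0. \<forall>\<beta>\<in>{a..b}. \<forall>N. (\<integral>g. overlap_tail p N \<beta> \<epsilon> g \<partial>iid_gauss) \<le> K * exp (- real N / K)"
    by (intro uniform_exponential_bound expected_overlap_tail_le_1)
  then show ?thesis by (simp add: disorder_eq_iid_gauss) blast
qed

end
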